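(* Fix $b>0$. There exists a constant $D>0$, not depending on $s$, such that for every $s\in\mathbb{C}$ the following holds. The operator $$L=-\frac{d^2}{dx^2}+x^2+s\,[\delta(x-b)-\delta(x+b)]$$ in $L^2(\mathbb{R})$ has a discrete spectrum $\sigma(L)$. With $$N^*=\bigl(D\,|s|\,\log(e|s|)\bigr)^2,$$ all eigenvalues $\lambda_n=\lambda_n(L)$ in the half-plane $\{z\in\mathbb{C}:\operatorname{Re} z>N^*\}$ are simple, and $$\lambda_n=(2n+1)+s^2\,\frac{\kappa(n)}{n}+\widetilde\rho(n),\qquad |\widetilde\rho(n)|\le C\,\frac{\log n}{n^{3/2}},$$ where $$\kappa(n)=\frac{1}{2\pi}\left[(-1)^{n+1}\sin\bigl(2b\sqrt{2n}\bigr)-\frac12\sin\bigl(4b\sqrt{2n}\bigr)\right]$$ and $C$ is a constant independent of $n$.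
   Context: The operator $L$ is the closed operator in $L^2(\mathbb{R})$ associated (by the quadratic-form method) with the form $\int_{\mathbb{R}}(|f'|^2+x^2|f|^2)\,dx+s\,(|f(b)|^2-|f(-b)|^2)$ on $\{f\in H^1(\mathbb{R}): xf\in L^2(\mathbb{R})\}$. The numbering of eigenvalues is that of the unperturbed oscillator: $\lambda_n$ is the eigenvalue of $L$ in the strip $\{z:|\operatorname{Re}z-(2n+1)|\le 1\}$ (for large $n$ there is exactly one). For $s=0$ the expression $|s|\log(e|s|)$ is read as $0$. The estimate of $\widetilde\rho(n)$ is for $n\ge 2$. *)

theory Defs
  imports "HOL-Analysis.Analysis"
begin

section \<open>The space \<open>L\<^sup>2(\<real>)\<close>\<close>

text \<open>
  Elements of \<open>L\<^sup>2(\<real>)\<close> are represented by functions, equality in \<open>L\<^sup>2(\<real>)\<close> being equality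
  almost everywhere.
\<close>

definition L2 :: "(real \<Rightarrow> complex) set" where
  "L2 = {f \<in> borel_measurable lborel. integrable lborel (\<lambda>x. (cmod (f x))\<^sup>2)}"

definition L2_inner :: "(real \<Rightarrow> complex) \<Rightarrow> (real \<Rightarrow> complex) \<Rightarrow> complex" where
  "L2_inner f g = (LINT x|lborel. f x * cnj (g x))"

definition L2_norm :: "(real \<Rightarrow> complex) \<Rightarrow> real" where
  "L2_norm f = sqrt (LINT x|lborel. (cmod (f x))\<^sup>2)"

definition L2_eq :: "(real \<Rightarrow> complex) \<Rightarrow> (real \<Rightarrow> complex) \<Rightarrow> bool" where
  "L2_eq f g \<longleftrightarrow> (AE x in lborel. f x = g x)"

text \<open>
  \<open>has_L2_dim V m\<close>: the linear subspace \<open>V\<close> of \<open>L\<^sup>2(\<real>)\<close> has a basis \<open>e 0, \<dots>, e (m - 1)\<close>,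
  where independence and spanning are understood modulo null functions.
\<close>

definition has_L2_dim :: "(real \<Rightarrow> complex) set \<Rightarrow> nat \<Rightarrow> bool" where
  "has_L2_dim V m \<longleftrightarrow>
     (\<exists>e :: nat \<Rightarrow> real \<Rightarrow> complex.
        (\<forall>i<m. e i \<in> V) \<and>
        (\<forall>c :: nat \<Rightarrow> complex. L2_eq (\<lambda>x. \<Sum>i<m. c i * e i x) (\<lambda>x. 0) \<longrightarrow> (\<forall>i<m. c i = 0)) \<and>
        (\<forall>u\<in>V. \<exists>c :: nat \<Rightarrow> complex. L2_eq u (\<lambda>x. \<Sum>i<m. c i * e i x)))"

section \<open>Unbounded operators in \<open>L\<^sup>2(\<real>)\<close> and their spectra\<close>

text \<open>
  An operator is given by its graph: \<open>(u, w) \<in> T\<close> means that \<open>u\<close> is in the domain and \<open>T u = w\<close>.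
  Graphs contain all representatives of the classes of \<open>u\<close> and \<open>w\<close>.
\<close>

type_synonym L2_operator = "((real \<Rightarrow> complex) \<times> (real \<Rightarrow> complex)) set"

definition resolvent_set :: "L2_operator \<Rightarrow> complex set" where
  "resolvent_set T =
     {z. (\<forall>f\<in>L2. \<exists>(u, w)\<in>T. L2_eq (\<lambda>x. w x - z * u x) f) \<and>
         (\<exists>K. \<forall>(u, w)\<in>T. L2_norm u \<le> K * L2_norm (\<lambda>x. w x - z * u x))}"

definition spectrum :: "L2_operator \<Rightarrow> complex set" where
  "spectrum T = - resolvent_set T"

definition eigenvalue :: "L2_operator \<Rightarrow> complex \<Rightarrow> bool" where
  "eigenvalue T z \<longleftrightarrow> (\<exists>(u, w)\<in>T. \<not> L2_eq u (\<lambda>x. 0) \<and> L2_eq w (\<lambda>x. z * u x))"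

text \<open>\<open>ker_pow T z k\<close> is the kernel of \<open>(T - z)\<^sup>k\<close>, with the domain of the power taken into account.\<close>

primrec ker_pow :: "L2_operator \<Rightarrow> complex \<Rightarrow> nat \<Rightarrow> (real \<Rightarrow> complex) set" where
  "ker_pow T z 0 = {u \<in> L2. L2_eq u (\<lambda>x. 0)}"
| "ker_pow T z (Suc k) = {u. \<exists>w. (u, w) \<in> T \<and> (\<lambda>x. w x - z * u x) \<in> ker_pow T z k}"

definition root_space :: "L2_operator \<Rightarrow> complex \<Rightarrow> (real \<Rightarrow> complex) set" where
  "root_space T z = (\<Union>k. ker_pow T z k)"

text \<open>Simplicity refers to the algebraic multiplicity, the dimension of the root space.\<close>

definition simple_eigenvalue :: "L2_operator \<Rightarrow> complex \<Rightarrow> bool" where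
  "simple_eigenvalue T z \<longleftrightarrow> eigenvalue T z \<and> has_L2_dim (root_space T z) 1"

definition discrete_spectrum :: "L2_operator \<Rightarrow> bool" where
  "discrete_spectrum T \<longleftrightarrow>
     (\<forall>z \<in> spectrum T.
        z isolated_in spectrum T \<and> eigenvalue T z \<and> (\<exists>m. has_L2_dim (root_space T z) m))"

section \<open>The form and the operator\<close>

text \<open>
  Weak derivative, tested against \<open>C\<^sup>1\<close> functions with compact support.
\<close>

definition has_weak_deriv :: "(real \<Rightarrow> complex) \<Rightarrow> (real \<Rightarrow> complex) \<Rightarrow> bool" where
  "has_weak_deriv f g \<longleftrightarrow>
     (\<forall>\<phi> \<phi>' :: real \<Rightarrow> complex.
        (\<forall>x. (\<phi> has_vector_derivative \<phi>' x) (at x)) \<longrightarrow> continuous_on UNIV \<phi>' \<longrightarrow>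
        (\<exists>R. \<forall>x. \<bar>x\<bar> > R \<longrightarrow> \<phi> x = 0) \<longrightarrow>
        (LINT x|lborel. f x * \<phi>' x) = - (LINT x|lborel. g x * \<phi> x))"

text \<open>
  \<open>H\<^sup>1(\<real>)\<close>. Each class of functions in this space has exactly one continuous representative, and
  it is this representative that we take, so that the point values \<open>f b\<close> and \<open>f (-b)\<close> make sense.
\<close>

definition H1 :: "(real \<Rightarrow> complex) set" where
  "H1 = {f \<in> L2. continuous_on UNIV f \<and> (\<exists>g\<in>L2. has_weak_deriv f g)}"

text \<open>For \<open>f \<in> H1\<close> this is determined up to a null set.\<close>

definition weak_deriv :: "(real \<Rightarrow> complex) \<Rightarrow> real \<Rightarrow> complex" where
  "weak_deriv f = (SOME g. g \<in> L2 \<and> has_weak_deriv f g)"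

definition form_domain :: "(real \<Rightarrow> complex) set" where
  "form_domain = {f \<in> H1. (\<lambda>x. of_real x * f x) \<in> L2}"

text \<open>
  The sesquilinear form (linear in the first argument) whose diagonal is the quadratic form
  \<open>\<integral> (\<bar>f'\<bar>\<^sup>2 + x\<^sup>2 \<bar>f\<bar>\<^sup>2) dx + s (\<bar>f b\<bar>\<^sup>2 - \<bar>f (-b)\<bar>\<^sup>2)\<close>.
\<close>

definition osc_form :: "real \<Rightarrow> complex \<Rightarrow> (real \<Rightarrow> complex) \<Rightarrow> (real \<Rightarrow> complex) \<Rightarrow> complex" where
  "osc_form b s f g =
     (LINT x|lborel. weak_deriv f x * cnj (weak_deriv g x) + of_real (x\<^sup>2) * (f x * cnj (g x)))
     + s * (f b * cnj (g b) - f (- b) * cnj (g (- b)))"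

text \<open>
  The operator associated with the form by the first representation theorem: \<open>u\<close> is in its domain
  and is mapped to \<open>w\<close> iff \<open>u\<close> is in the form domain and \<open>osc_form b s u v = \<langle>w, v\<rangle>\<close> for all \<open>v\<close> in
  the form domain.
\<close>

definition osc_op :: "real \<Rightarrow> complex \<Rightarrow> L2_operator" where
  "osc_op b s =
     {(u, w). u \<in> L2 \<and> w \<in> L2 \<and>
        (\<exists>u0\<in>form_domain. L2_eq u u0 \<and> (\<forall>v\<in>form_domain. osc_form b s u0 v = L2_inner w v))}"

section \<open>Quantities in the eigenvalue asymptotics\<close>

text \<open>Since \<open>ln 0 = 0\<close>, the value at \<open>s = 0\<close> is \<open>0\<close>, as it should be.\<close>

definition Nstar :: "real \<Rightarrow> complex \<Rightarrow> real" where
  "Nstar D s = (D * cmod s * ln (exp 1 * cmod s))\<^sup>2"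

definition kappa :: "real \<Rightarrow> nat \<Rightarrow> real" where
  "kappa b n = 1 / (2 * pi) *
     ((- 1) ^ (n + 1) * sin (2 * b * sqrt (2 * real n)) - 1 / 2 * sin (4 * b * sqrt (2 * real n)))"

text \<open>
  \<open>eigenvalue_at T n z\<close>: \<open>z\<close> is an eigenvalue carrying the number \<open>n\<close>, that is, lying in the closed
  strip of half-width \<open>1\<close> around the unperturbed eigenvalue \<open>2 n + 1\<close>.
\<close>

definition eigenvalue_at :: "L2_operator \<Rightarrow> nat \<Rightarrow> complex \<Rightarrow> bool" where
  "eigenvalue_at T n z \<longleftrightarrow> eigenvalue T z \<and> \<bar>Re z - (2 * real n + 1)\<bar> \<le> 1"

end

(* In the basis of the Hermite functions h_k, the perturbation has rank two and couples even to odd k.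
   For z near 2n+1 one eliminates all coefficients except the n-th; by Cramer's rule, z is an eigenvalue iff a
   holomorphic function chr s n vanishes at z, and the order of this zero bounds the length of Jordan chains.
   Put w = 2n+1 - z. Then chr s n z = w - 4 s^2 O(z) (w E(z) + h_n(b)^2), where O(z) and E(z)
   are the sums of h_k(b)^2 / (2k+1-z) over the k <> n of parity opposite and equal to that of n, respectively.
   As h_k(b)^2 = O(k^(-1/2)), both sums are O(log n / sqrt n). If |s| log n / sqrt n is small,
   the strip around 2n+1 contains exactly one zero, it is simple, and it is 2n+1 - 4 s^2 h_n(b)^2 O(2n+1) up to
   O((log n)^4 / n^2).

   The condition Re z > N* implies that smallness only if log(e|s|) is bounded away from 0. For |s| <= 3/8 all
   eigenvalues are shown to be simple: by Mehler's formula, (1 -+ exp(i pi (z-1)/2)) times the sum over even/odd k is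
   an integral over a half period of the propagator, bounded uniformly in b and z, as is its derivative; so the
   equation for the eigenvalues differs from exp(i pi (z-1)) = 1 by a term too small to create multiple roots.

   The term h_n(b)^2 O(2n+1) is computed by replacing h_n on [-b,b] by a trigonometric function with error
   O(n^(-3/4)), and the Green function with value O(2n+1) at b by a function that is trigonometric in [-b,b] and a
   multiple of h_n outside. The amplitude of h_n comes from Wallis' product. *)
theory Submission
  imports Defs "HOL-Probability.Probability" "HOL-Complex_Analysis.Complex_Analysis"
begin

section \<open>Hermite functions\<close>

text \<open>The obstacle is that \<open>Nstar D s\<close> vanishes at |s| = 1/e whatever
  \<open>D\<close> is. For such s every eigenvalue with positive real part must be simple, although
  |s| is of order one and b is arbitrary; no asymptotic argument reaches these eigenvalues. The
  estimate for small couplings therefore has to hold with absolute constants up to some threshold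
  above 1/e = 0.367..., and 3/8 is such a threshold. It requires 4 |s|^2 J^2 < 2/3, where J bounds
  the integral of (sin 2t)^(-1/2) over (0, pi/2) divided by sqrt (2 pi). This quotient is about
  1.046, so even the exact value admits only |s| < 0.39; hence the careful majorant. The n-th
  coefficient is kept as an unknown because the determinant 1 - 4 s^2 E O formed with the full sums
  can have a pole at 2n+1 and, if h_n(b) = 0, does not see the eigenvalue 2n+1 with eigenfunction
  h_n. The function \<open>chr\<close> is holomorphic at 2n+1 and covers both situations.\<close>

fun hf :: "nat \<Rightarrow> real \<Rightarrow> real" where
  "hf 0 x = exp (- x\<^sup>2 / 2) / sqrt (sqrt pi)"
| "hf (Suc 0) x = sqrt 2 * x * hf 0 x"
| "hf (Suc (Suc n)) x =
     (sqrt 2 * x * hf (Suc n) x - sqrt (real (n + 1)) * hf n x) / sqrt (real (n + 2))"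

declare hf.simps [simp del]

text \<open>At \<open>n = 0\<close> the truncated difference \<open>n - 1\<close> is harmless
  because the factor \<open>sqrt (real n)\<close> vanishes. The same device is used in
  \<open>hfd\<close> and in all ladder relations.\<close>

lemma hf_rec: "sqrt (real (n + 1)) * hf (n + 1) x = sqrt 2 * x * hf n x - sqrt (real n) * hf (n - 1) x"
  by (cases n) (auto simp: hf.simps)

lemma sqrt_2_mult: "sqrt (2 * x) = sqrt 2 * sqrt x"
  by (rule real_sqrt_mult)

text \<open>The lowering relation of the ladder operators, solved for the derivative of
  \<open>hf n\<close>.\<close>

definition hfd :: "nat \<Rightarrow> real \<Rightarrow> real" where
  "hfd n x = sqrt (2 * real n) * hf (n - 1) x - x * hf n x"

text \<open>Half the difference of lowering and raising; together with \<open>x_hf\<close>, half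
  their sum, it turns d/dx and multiplication by x into shifts of the index.\<close>

lemma hfd_alt: "hfd n x = (sqrt (2 * real n) * hf (n - 1) x - sqrt (2 * real (n + 1)) * hf (n + 1) x) / 2"
proof -
  have "sqrt 2 * (sqrt (real (n + 1)) * hf (n + 1) x) = 2 * x * hf n x - sqrt 2 * sqrt (real n) * hf (n - 1) x"
    unfolding hf_rec by (simp add: algebra_simps)
  then show ?thesis
    unfolding hfd_def sqrt_2_mult by (simp add: algebra_simps del: of_nat_add of_nat_Suc)
qed

lemma x_hf: "x * hf n x = (sqrt (2 * real n) * hf (n - 1) x + sqrt (2 * real (n + 1)) * hf (n + 1) x) / 2"
proof -
  have "y = (p + q) / 2" if "p - y = (p - q) / 2" for p q y :: real
    using that by (simp add: field_simps)
  then show ?thesis using hfd_alt[of n x] unfolding hfd_def by blast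
qed

lemma hf_0_deriv: "(hf 0 has_real_derivative - x * hf 0 x) (at x)"
proof -
  have "((\<lambda>x. exp (- x\<^sup>2 / 2) / sqrt (sqrt pi)) has_real_derivative - x * (exp (- x\<^sup>2 / 2) / sqrt (sqrt pi))) (at x)"
    by (auto intro!: derivative_eq_intros simp: field_simps)
  then show ?thesis unfolding hf.simps(1)[abs_def] .
qed

lemma hf_1_deriv: "(hf (Suc 0) has_real_derivative hfd 1 x) (at x)"
proof -
  have "((\<lambda>x. sqrt 2 * x * hf 0 x) has_real_derivative sqrt 2 * hf 0 x + sqrt 2 * x * (- x * hf 0 x)) (at x)"
    by (auto intro!: derivative_eq_intros hf_0_deriv)
  then show ?thesis unfolding hf.simps(2)[abs_def]
    by (simp add: hfd_def hf.simps(2) algebra_simps)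
qed

lemma hf_deriv: "(hf n has_real_derivative hfd n x) (at x)"
proof (induction n rule: induct_nat_012)
  case 0
  show ?case using hf_0_deriv[of x] by (simp add: hfd_def)
next
  case 1
  show ?case using hf_1_deriv by simp
next
  case (ge2 n)
  have "(hf (Suc (Suc n)) has_real_derivative
      (sqrt 2 * hf (Suc n) x + sqrt 2 * x * hfd (Suc n) x - sqrt (real (n + 1)) * hfd n x)
        / sqrt (real (n + 2))) (at x)"
    unfolding hf.simps(3)[abs_def]
    by (rule DERIV_cdivide) (auto intro!: derivative_eq_intros ge2)
  moreover have "(sqrt 2 * hf (Suc n) x + sqrt 2 * x * hfd (Suc n) x - sqrt (real (n + 1)) * hfd n x)
        = sqrt (real (n + 2)) * hfd (Suc (Suc n)) x"
  proof -
    have r1: "sqrt (real (n + 2)) * hf (Suc (Suc n)) x = sqrt 2 * x * hf (Suc n) x - sqrt (real (n + 1)) * hf n x"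
      using hf_rec[of "Suc n" x] by simp
    have r0: "sqrt (real (n + 1)) * hf (Suc n) x = sqrt 2 * x * hf n x - sqrt (real n) * hf (n - 1) x"
      using hf_rec[of n x] by simp
    have "sqrt (real (n + 1)) * (sqrt (real (n + 1)) * hf (Suc n) x)
        = sqrt (real (n + 1)) * (sqrt 2 * x * hf n x - sqrt (real n) * hf (n - 1) x)"
      using r0 by simp
    then have r0': "real (n + 1) * hf (Suc n) x
        = sqrt (real (n + 1)) * (sqrt 2 * x * hf n x - sqrt (real n) * hf (n - 1) x)"
      by (simp add: mult.assoc[symmetric] del: mult.assoc)
    have "sqrt (real (n + 2)) * hfd (Suc (Suc n)) x
       = sqrt (real (n + 2)) * sqrt (real (n + 2)) * sqrt 2 * hf (Suc n) x - x * (sqrt (real (n + 2)) * hf (Suc (Suc n)) x)"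
      unfolding hfd_def sqrt_2_mult by (simp add: algebra_simps)
    also have "\<dots> = real (n + 2) * sqrt 2 * hf (Suc n) x - x * (sqrt 2 * x * hf (Suc n) x - sqrt (real (n + 1)) * hf n x)"
      unfolding r1 by simp
    also have "\<dots> = sqrt 2 * hf (Suc n) x + sqrt 2 * (real (n + 1) * hf (Suc n) x) 
        - x * (sqrt 2 * x * hf (Suc n) x - sqrt (real (n + 1)) * hf n x)"
      by (simp add: algebra_simps)
    also have "\<dots> = sqrt 2 * hf (Suc n) x + sqrt 2 * x * hfd (Suc n) x - sqrt (real (n + 1)) * hfd n x"
      unfolding r0' hfd_def sqrt_2_mult by (simp add: algebra_simps)
    finally show ?thesis by simp
  qed
  ultimately show ?case by simp
qed

text \<open>Lowering twice and eliminating the lowest index by the recursion gives the oscillator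
  equation. All energy and Wronskian arguments start from it.\<close>

lemma hfd_deriv: "(hfd n has_real_derivative (x\<^sup>2 - (2 * real n + 1)) * hf n x) (at x)"
proof -
  have "(hfd n has_real_derivative sqrt (2 * real n) * hfd (n - 1) x - (hf n x + x * hfd n x)) (at x)"
    unfolding hfd_def[abs_def]
    by (auto intro!: derivative_eq_intros hf_deriv simp: hfd_def)
  moreover have "sqrt (2 * real n) * hfd (n - 1) x - (hf n x + x * hfd n x) = (x\<^sup>2 - (2 * real n + 1)) * hf n x"
  proof (cases n)
    case 0
    then show ?thesis by (simp add: hfd_def power2_eq_square algebra_simps)
  next
    case (Suc m)
    have r: "sqrt (real n) * hf n x = sqrt 2 * x * hf m x - sqrt (real m) * hf (m - 1) x"
      using hf_rec[of m x] Suc by simp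
    have "sqrt (2 * real n) * (sqrt (2 * real m) * hf (m - 1) x - 2 * x * hf m x)
      = - 2 * sqrt (real n) * (sqrt 2 * x * hf m x - sqrt (real m) * hf (m - 1) x)"
      by (simp add: real_sqrt_mult algebra_simps)
    also have "\<dots> = - 2 * real n * hf n x"
      unfolding r[symmetric] by (simp add: algebra_simps)
    finally have "sqrt (2 * real n) * (sqrt (2 * real m) * hf (m - 1) x - 2 * x * hf m x) = - 2 * real n * hf n x" .
    then show ?thesis
      using Suc by (simp add: hfd_def algebra_simps power2_eq_square)
  qed
  ultimately show ?thesis by simp
qed

lemma hf_minus: "hf n (- x) = (- 1) ^ n * hf n x"
  by (induction n rule: induct_nat_012) (auto simp: hf.simps field_simps)

lemma hfd_minus: "hfd n (- x) = - ((- 1) ^ n * hfd n x)"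
  unfolding hfd_def hf_minus by (cases n) (auto simp: algebra_simps)

lemma continuous_on_hf [continuous_intros]: "continuous_on A f \<Longrightarrow> continuous_on A (\<lambda>x. hf n (f x))"
  by (rule continuous_on_compose2[of UNIV "hf n"])
     (auto intro!: continuous_at_imp_continuous_on DERIV_isCont hf_deriv)

lemma continuous_on_hfd [continuous_intros]: "continuous_on A f \<Longrightarrow> continuous_on A (\<lambda>x. hfd n (f x))"
  by (rule continuous_on_compose2[of UNIV "hfd n"])
     (auto intro!: continuous_at_imp_continuous_on DERIV_isCont hfd_deriv)

lemma hf_measurable [measurable]: "hf n \<in> borel_measurable borel"
  by (intro borel_measurable_continuous_onI continuous_intros)

lemma hfd_measurable [measurable]: "hfd n \<in> borel_measurable borel"
  by (intro borel_measurable_continuous_onI continuous_intros)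

section \<open>Gaussian decay and orthonormality\<close>

lemma bounded_power_exp: "\<exists>C. \<forall>x::real. \<bar>x\<bar> ^ m * exp (- x\<^sup>2 / 4) \<le> C"
proof -
  have "((\<lambda>x::real. x ^ m * exp (- x\<^sup>2 / 4)) \<longlongrightarrow> 0) at_top"
    by real_asymp
  then have "eventually (\<lambda>x::real. x ^ m * exp (- x\<^sup>2 / 4) < 1) at_top"
    by (rule order_tendstoD) simp
  then obtain R where R: "\<And>x::real. x \<ge> R \<Longrightarrow> x ^ m * exp (- x\<^sup>2 / 4) < 1"
    unfolding eventually_at_top_linorder by blast
  have "compact ((\<lambda>x::real. x ^ m * exp (- x\<^sup>2 / 4)) ` {0..max R 0})"
    by (intro compact_continuous_image continuous_intros) auto
  then obtain B where B: "\<And>x. x \<in> {0..max R 0} \<Longrightarrow> norm (x ^ m * exp (- x\<^sup>2 / 4)) \<le> B"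
    by (metis (no_types, lifting) bounded_iff compact_imp_bounded imageI)
  have "\<bar>x\<bar> ^ m * exp (- x\<^sup>2 / 4) \<le> max 1 B" for x :: real
  proof (cases "\<bar>x\<bar> \<ge> R")
    case True
    show ?thesis using R[OF True] by simp
  next
    case False
    then show ?thesis using B[of "\<bar>x\<bar>"] by auto
  qed
  then show ?thesis by blast
qed

text \<open>The polynomial factor is carried along because the recursion multiplies by \<open>x\<close>.\<close>

lemma power_hf_decay: "\<exists>C. \<forall>x. \<bar>x ^ m * hf n x\<bar> \<le> C * exp (- x\<^sup>2 / 4)"
proof (induction n arbitrary: m rule: induct_nat_012)
  case 0
  obtain C where C: "\<And>x::real. \<bar>x\<bar> ^ m * exp (- x\<^sup>2 / 4) \<le> C" using bounded_power_exp by blast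
  have "\<bar>x ^ m * hf 0 x\<bar> \<le> C / sqrt (sqrt pi) * exp (- x\<^sup>2 / 4)" for x
  proof -
    have "exp (- x\<^sup>2 / 2) = exp (- x\<^sup>2 / 4) * exp (- x\<^sup>2 / 4)"
      by (simp flip: exp_add)
    then show ?thesis
      using mult_right_mono[OF C[of x], of "exp (- x\<^sup>2 / 4)"]
      by (simp add: hf.simps abs_mult power_abs field_simps)
  qed
  then show ?case by blast
next
  case 1
  obtain C where C: "\<And>x::real. \<bar>x\<bar> ^ (Suc m) * exp (- x\<^sup>2 / 4) \<le> C" using bounded_power_exp by blast
  have "\<bar>x ^ m * hf 1 x\<bar> \<le> sqrt 2 * C / sqrt (sqrt pi) * exp (- x\<^sup>2 / 4)" for x
  proof -
    have "exp (- x\<^sup>2 / 2) = exp (- x\<^sup>2 / 4) * exp (- x\<^sup>2 / 4)"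
      by (simp flip: exp_add)
    then show ?thesis
      using mult_right_mono[OF C[of x], of "exp (- x\<^sup>2 / 4)"]
      by (simp add: hf.simps abs_mult power_abs field_simps)
  qed
  then show ?case by (metis One_nat_def)
next
  case (ge2 n)
  obtain C1 where C1: "\<And>x. \<bar>x ^ Suc m * hf (Suc n) x\<bar> \<le> C1 * exp (- x\<^sup>2 / 4)" using ge2 by blast
  obtain C0 where C0: "\<And>x. \<bar>x ^ m * hf n x\<bar> \<le> C0 * exp (- x\<^sup>2 / 4)" using ge2 by blast
  have "\<bar>x ^ m * hf (Suc (Suc n)) x\<bar> \<le> (sqrt 2 * C1 + sqrt (real (n + 1)) * C0) * exp (- x\<^sup>2 / 4)" for x
  proof -
    have "\<bar>x ^ m * hf (Suc (Suc n)) x\<bar> 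
      = \<bar>sqrt 2 * (x ^ Suc m * hf (Suc n) x) - sqrt (real (n + 1)) * (x ^ m * hf n x)\<bar> / sqrt (real (n + 2))"
      by (simp add: hf.simps abs_mult field_simps)
    also have "\<dots> \<le> \<bar>sqrt 2 * (x ^ Suc m * hf (Suc n) x) - sqrt (real (n + 1)) * (x ^ m * hf n x)\<bar>"
      using divide_left_mono[of 1 "sqrt (real (n + 2))" "\<bar>sqrt 2 * (x ^ Suc m * hf (Suc n) x) - sqrt (real (n + 1)) * (x ^ m * hf n x)\<bar>"]
      by simp
    also have "\<dots> \<le> sqrt 2 * \<bar>x ^ Suc m * hf (Suc n) x\<bar> + sqrt (real (n + 1)) * \<bar>x ^ m * hf n x\<bar>"
      by (rule order_trans[OF abs_triangle_ineq4]) (simp add: abs_mult)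
    also have "\<dots> \<le> sqrt 2 * (C1 * exp (- x\<^sup>2 / 4)) + sqrt (real (n + 1)) * (C0 * exp (- x\<^sup>2 / 4))"
      by (intro add_mono mult_left_mono C1 C0) auto
    finally show ?thesis by (simp add: algebra_simps)
  qed
  then show ?case by blast
qed

lemma power_hfd_decay: "\<exists>C. \<forall>x. \<bar>x ^ m * hfd n x\<bar> \<le> C * exp (- x\<^sup>2 / 4)"
proof -
  obtain C1 where C1: "\<And>x. \<bar>x ^ Suc m * hf n x\<bar> \<le> C1 * exp (- x\<^sup>2 / 4)" using power_hf_decay by blast
  obtain C0 where C0: "\<And>x. \<bar>x ^ m * hf (n - 1) x\<bar> \<le> C0 * exp (- x\<^sup>2 / 4)" using power_hf_decay by blast
  have "\<bar>x ^ m * hfd n x\<bar> \<le> (sqrt (2 * real n) * C0 + C1) * exp (- x\<^sup>2 / 4)" for x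
  proof -
    have "\<bar>x ^ m * hfd n x\<bar> = \<bar>sqrt (2 * real n) * (x ^ m * hf (n - 1) x) - x ^ Suc m * hf n x\<bar>"
      by (simp add: hfd_def algebra_simps)
    also have "\<dots> \<le> sqrt (2 * real n) * \<bar>x ^ m * hf (n - 1) x\<bar> + \<bar>x ^ Suc m * hf n x\<bar>"
      by (rule order_trans[OF abs_triangle_ineq4]) (simp add: abs_mult)
    also have "\<dots> \<le> sqrt (2 * real n) * (C0 * exp (- x\<^sup>2 / 4)) + C1 * exp (- x\<^sup>2 / 4)"
      by (intro add_mono mult_left_mono C1 C0) auto
    finally show ?thesis by (simp add: algebra_simps)
  qed
  then show ?thesis by blast
qed

lemma integrable_gauss: "c > 0 \<Longrightarrow> integrable lborel (\<lambda>x::real. exp (- x\<^sup>2 * c))"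
proof -
  assume c: "c > 0"
  have "integrable lborel (\<lambda>x. sqrt (2 * pi * (1 / (2 * c))) * normal_density 0 (sqrt (1 / (2 * c))) x)"
    using c by (intro integrable_mult_right integrable_normal_density) auto
  also have "(\<lambda>x. sqrt (2 * pi * (1 / (2 * c))) * normal_density 0 (sqrt (1 / (2 * c))) x) = (\<lambda>x::real. exp (- x\<^sup>2 * c))"
    using c by (auto simp: normal_density_def real_sqrt_mult real_sqrt_divide field_simps)
  finally show ?thesis .
qed

lemma integrable_gauss_decay:
  fixes g :: "real \<Rightarrow> real"
  assumes [measurable]: "g \<in> borel_measurable borel" and "\<And>x. \<bar>g x\<bar> \<le> C * exp (- x\<^sup>2 / 4)"
  shows "integrable lborel g"
proof (rule Bochner_Integration.integrable_bound)
  show "integrable lborel (\<lambda>x::real. C * exp (- x\<^sup>2 * (1/4)))"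
    by (intro integrable_mult_right integrable_gauss) auto
  show "AE x in lborel. norm (g x) \<le> norm (C * exp (- x\<^sup>2 * (1/4)))"
    using assms(2) by (auto intro!: AE_I2 intro: order_trans[OF _ abs_ge_self])
qed auto

text \<open>Only one of the two Gaussian factors is kept, so that products stay in the same class
  and the lemma can be iterated.\<close>

lemma gauss_decay_mult:
  fixes f g :: "real \<Rightarrow> real"
  assumes f: "\<exists>C. \<forall>x. \<bar>f x\<bar> \<le> C * exp (- x\<^sup>2 / 4)" and g: "\<exists>C. \<forall>x. \<bar>g x\<bar> \<le> C * exp (- x\<^sup>2 / 4)"
  shows "\<exists>C. \<forall>x. \<bar>f x * g x\<bar> \<le> C * exp (- x\<^sup>2 / 4)"
proof -
  obtain C D where C: "\<And>x. \<bar>f x\<bar> \<le> C * exp (- x\<^sup>2 / 4)" and D: "\<And>x. \<bar>g x\<bar> \<le> D * exp (- x\<^sup>2 / 4)"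
    using f g by blast
  have "\<bar>f x * g x\<bar> \<le> (C * D) * exp (- x\<^sup>2 / 4)" for x
  proof -
    have D0: "0 \<le> D" using D[of 0] by simp
    have "\<bar>g x\<bar> \<le> D"
      by (rule order_trans[OF D]) (use D0 in \<open>simp add: mult_left_le\<close>)
    then have "\<bar>f x\<bar> * \<bar>g x\<bar> \<le> (C * exp (- x\<^sup>2 / 4)) * D"
      by (intro mult_mono C) (use C[of x] in auto)
    then show ?thesis by (simp add: abs_mult algebra_simps)
  qed
  then show ?thesis by blast
qed

lemma hf_decay: "\<exists>C. \<forall>x. \<bar>hf n x\<bar> \<le> C * exp (- x\<^sup>2 / 4)"
  using power_hf_decay[of 0 n] by simp

lemma hfd_decay: "\<exists>C. \<forall>x. \<bar>hfd n x\<bar> \<le> C * exp (- x\<^sup>2 / 4)"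
  using power_hfd_decay[of 0 n] by simp

lemma integrable_gauss_decay':
  fixes g :: "real \<Rightarrow> real"
  assumes "g \<in> borel_measurable borel" and "\<exists>C. \<forall>x. \<bar>g x\<bar> \<le> C * exp (- x\<^sup>2 / 4)"
  shows "integrable lborel g"
  using assms integrable_gauss_decay by blast

lemma integrable_hf_hf: "integrable lborel (\<lambda>x. hf m x * hf n x)"
  by (intro integrable_gauss_decay' gauss_decay_mult hf_decay) auto

lemma integrable_hfd_hf: "integrable lborel (\<lambda>x. hfd m x * hf n x)"
  by (intro integrable_gauss_decay' gauss_decay_mult hf_decay hfd_decay) auto

lemma gauss_decay_tendsto:
  fixes g :: "real \<Rightarrow> real"
  assumes "\<exists>C. \<forall>x. \<bar>g x\<bar> \<le> C * exp (- x\<^sup>2 / 4)"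
  shows "(g \<longlongrightarrow> 0) at_top" "(g \<longlongrightarrow> 0) at_bot"
proof -
  obtain C where C: "\<And>x. norm (g x) \<le> C * exp (- x\<^sup>2 / 4)" using assms by auto
  have "((\<lambda>x::real. C * exp (- x\<^sup>2 / 4)) \<longlongrightarrow> 0) at_top" by real_asymp
  then show "(g \<longlongrightarrow> 0) at_top" by (rule Lim_null_comparison[OF always_eventually, rotated]) (use C in blast)
  have "((\<lambda>x::real. C * exp (- x\<^sup>2 / 4)) \<longlongrightarrow> 0) at_bot" by real_asymp
  then show "(g \<longlongrightarrow> 0) at_bot" by (rule Lim_null_comparison[OF always_eventually, rotated]) (use C in blast)
qed

lemma integral_deriv_UNIV:
  fixes F f :: "real \<Rightarrow> real"
  assumes "\<And>x. (F has_real_derivative f x) (at x)" "continuous_on UNIV f" "integrable lborel f"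
    and "(F \<longlongrightarrow> A) at_bot" "(F \<longlongrightarrow> B) at_top"
  shows "(LINT x|lborel. f x) = B - A"
proof -
  have "(LBINT x=-\<infinity>..\<infinity>. f x) = B - A"
    by (rule interval_integral_FTC_integrable[where F = F])
       (use assms in \<open>auto simp: ereal_tendsto_simps set_integrable_def continuous_on_eq_continuous_at
          simp flip: has_real_derivative_iff_has_vector_derivative\<close>)
  then show ?thesis by (simp add: interval_lebesgue_integral_def set_lebesgue_integral_def)
qed

text \<open>The integral of (h_m h_n)' vanishes. Lowering is used for h_m and raising for h_n, so
  that the terms x h_m h_n cancel and two shifted inner products remain.\<close>

lemma hf_orthonormal_step:
  "sqrt (real (n + 1)) * (LINT x|lborel. hf m x * hf (n + 1) x)
     = sqrt (real m) * (LINT x|lborel. hf (m - 1) x * hf n x)"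
proof -
  let ?I = "\<lambda>m n. (LINT x|lborel. hf m x * hf n x)"
  have "(LINT x|lborel. hfd m x * hf n x + hf m x * hfd n x) = 0 - 0"
  proof (rule integral_deriv_UNIV[where F = "\<lambda>x. hf m x * hf n x"])
    show "((\<lambda>x. hf m x * hf n x) has_real_derivative hfd m x * hf n x + hf m x * hfd n x) (at x)" for x
      by (auto intro!: derivative_eq_intros hf_deriv)
    show "integrable lborel (\<lambda>x. hfd m x * hf n x + hf m x * hfd n x)"
      using integrable_hfd_hf[of m n] integrable_hfd_hf[of n m] by (simp add: mult.commute)
  qed (auto intro!: gauss_decay_tendsto gauss_decay_mult hf_decay continuous_intros)
  moreover have "hfd m x * hf n x + hf m x * hfd n x
      = sqrt (2 * real m) * (hf (m - 1) x * hf n x) - sqrt (2 * real (n + 1)) * (hf m x * hf (n + 1) x)" for x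
  proof -
    have "hfd n x = x * hf n x - sqrt (2 * real (n + 1)) * hf (n + 1) x"
      using hfd_alt[of n x] x_hf[of x n] by (simp add: field_simps)
    then have "hf m x * hfd n x = hf m x * (x * hf n x - sqrt (2 * real (n + 1)) * hf (n + 1) x)" by simp
    then show ?thesis by (simp add: hfd_def[of m] algebra_simps)
  qed
  ultimately have "sqrt (2 * real m) * ?I (m - 1) n - sqrt (2 * real (n + 1)) * ?I m (n + 1) = 0"
    using integrable_hf_hf by simp
  then have "sqrt 2 * (sqrt (real m) * ?I (m - 1) n - sqrt (real (n + 1)) * ?I m (n + 1)) = 0"
    unfolding sqrt_2_mult by (simp add: algebra_simps del: of_nat_add of_nat_Suc)
  then show ?thesis by simp
qed

text \<open>The step lowers both indices at once, down to n = 0. There the factor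
  \<open>sqrt 0\<close> kills the inner products with higher indices, and the norm of h_0 is the
  total mass of a normal density of variance 1/2.\<close>

lemma hf_orthonormal: "(LINT x|lborel. hf m x * hf n x) = (if m = n then 1 else 0)"
proof (induction n arbitrary: m)
  case 0
  show ?case
  proof (cases m)
    case 0
    have "(LINT x|lborel. hf 0 x * hf 0 x) = (LINT x|lborel. normal_density 0 (sqrt (1 / 2)) x)"
    proof (intro Bochner_Integration.integral_cong refl)
      fix x :: real
      have "exp (- x\<^sup>2 / 2) * exp (- x\<^sup>2 / 2) = exp (- x\<^sup>2)" by (simp flip: exp_add)
      then show "hf 0 x * hf 0 x = normal_density 0 (sqrt (1 / 2)) x"
        by (simp add: normal_density_def hf.simps)
    qed
    then show ?thesis using 0 by simp
  next
    case (Suc k)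
    have "sqrt (real (k + 1)) * (LINT x|lborel. hf 0 x * hf (k + 1) x) = 0"
      using hf_orthonormal_step[of k 0] by simp
    then have "(LINT x|lborel. hf 0 x * hf (k + 1) x) = 0" by simp
    then show ?thesis using Suc by (simp add: mult.commute)
  qed
next
  case (Suc n)
  have *: "sqrt (real (n + 1)) * (LINT x|lborel. hf m x * hf (n + 1) x)
     = sqrt (real m) * (LINT x|lborel. hf (m - 1) x * hf n x)"
    by (rule hf_orthonormal_step)
  show ?case
  proof (cases m)
    case 0
    then show ?thesis using * by (simp)
  next
    case (Suc k)
    then show ?thesis using * Suc.IH[of k] by (auto split: if_splits)
  qed
qed

section \<open>The Hermite expansion in \<open>L\<^sup>2(\<real>)\<close>\<close>

definition N2 :: "(real \<Rightarrow> complex) \<Rightarrow> real" where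
  "N2 f = (LINT x|lborel. (cmod (f x))\<^sup>2)"

lemma N2_nonneg [simp]: "N2 f \<ge> 0"
  unfolding N2_def by simp

lemma L2_norm_N2: "L2_norm f = sqrt (N2 f)"
  unfolding L2_norm_def N2_def ..

section \<open>Calculus with square integrable functions\<close>

lemma L2_measurable [measurable_dest]: "f \<in> L2 \<Longrightarrow> f \<in> borel_measurable borel"
  unfolding L2_def by simp

lemma L2_integrable_sq: "f \<in> L2 \<Longrightarrow> integrable lborel (\<lambda>x. (cmod (f x))\<^sup>2)"
  unfolding L2_def by simp

lemma L2I: "f \<in> borel_measurable borel \<Longrightarrow> integrable lborel (\<lambda>x. (cmod (f x))\<^sup>2) \<Longrightarrow> f \<in> L2"
  unfolding L2_def by simp

lemma L2_integrable_mult: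
  assumes f: "f \<in> L2" and g: "g \<in> L2"
  shows "integrable lborel (\<lambda>x. f x * g x)"
proof (rule Bochner_Integration.integrable_bound)
  show "integrable lborel (\<lambda>x. (cmod (f x))\<^sup>2 + (cmod (g x))\<^sup>2)"
    using f g by (intro Bochner_Integration.integrable_add L2_integrable_sq)
  show "(\<lambda>x. f x * g x) \<in> borel_measurable lborel" using f g by measurable
  have "cmod (f x * g x) \<le> (cmod (f x))\<^sup>2 + (cmod (g x))\<^sup>2" for x
  proof -
    have "0 \<le> (cmod (f x) - cmod (g x))\<^sup>2" "0 \<le> cmod (f x) * cmod (g x)" by auto
    then show ?thesis unfolding norm_mult power2_diff by linarith
  qed
  then show "AE x in lborel. norm (f x * g x) \<le> norm ((cmod (f x))\<^sup>2 + (cmod (g x))\<^sup>2)"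
    by (auto intro!: AE_I2)
qed

lemma cnj_measurable [measurable]: "cnj \<in> borel_measurable borel"
  by (intro borel_measurable_continuous_onI continuous_intros)

lemma L2_cnj: "f \<in> L2 \<Longrightarrow> (\<lambda>x. cnj (f x)) \<in> L2"
  by (intro L2I) (auto dest: L2_measurable L2_integrable_sq)

lemma L2_integrable_inner:
  assumes f: "f \<in> L2" and g: "g \<in> L2"
  shows "integrable lborel (\<lambda>x. f x * cnj (g x))"
  by (rule L2_integrable_mult[OF f L2_cnj[OF g]])

lemma L2_cmult: "f \<in> L2 \<Longrightarrow> (\<lambda>x. c * f x) \<in> L2"
  by (auto intro!: L2I simp: norm_mult power_mult_distrib dest: L2_measurable L2_integrable_sq)

lemma L2_add:
  assumes f: "f \<in> L2" and g: "g \<in> L2"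
  shows "(\<lambda>x. f x + g x) \<in> L2"
proof (rule L2I)
  show "(\<lambda>x. f x + g x) \<in> borel_measurable borel" using f g by measurable
  show "integrable lborel (\<lambda>x. (cmod (f x + g x))\<^sup>2)"
  proof (rule Bochner_Integration.integrable_bound)
    show "integrable lborel (\<lambda>x. 2 * (cmod (f x))\<^sup>2 + 2 * (cmod (g x))\<^sup>2)"
      using f g by (intro Bochner_Integration.integrable_add integrable_mult_right L2_integrable_sq)
    show "(\<lambda>x. (cmod (f x + g x))\<^sup>2) \<in> borel_measurable lborel" using f g by measurable
    have "(cmod (f x + g x))\<^sup>2 \<le> 2 * (cmod (f x))\<^sup>2 + 2 * (cmod (g x))\<^sup>2" for x
    proof -
      have "(cmod (f x + g x))\<^sup>2 \<le> (cmod (f x) + cmod (g x))\<^sup>2"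
        by (intro power_mono norm_triangle_ineq) auto
      moreover have "0 \<le> (cmod (f x) - cmod (g x))\<^sup>2" by simp
      ultimately show ?thesis unfolding power2_diff power2_sum by linarith
    qed
    then show "AE x in lborel. norm ((cmod (f x + g x))\<^sup>2) \<le> norm (2 * (cmod (f x))\<^sup>2 + 2 * (cmod (g x))\<^sup>2)"
      by (auto intro!: AE_I2)
  qed
qed

lemma L2_minus: "f \<in> L2 \<Longrightarrow> (\<lambda>x. - f x) \<in> L2"
  using L2_cmult[of f "- 1"] by simp

lemma L2_diff: "f \<in> L2 \<Longrightarrow> g \<in> L2 \<Longrightarrow> (\<lambda>x. f x - g x) \<in> L2"
  using L2_add[OF _ L2_minus, of f g] by simp

lemma L2_zero: "(\<lambda>x. 0) \<in> L2"
  by (auto intro: L2I)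

lemma L2_sum: "(\<And>i. i \<in> I \<Longrightarrow> f i \<in> L2) \<Longrightarrow> (\<lambda>x. \<Sum>i\<in>I. f i x) \<in> L2"
  by (induction I rule: infinite_finite_induct) (auto intro: L2_zero L2_add)

lemma L2_gauss_decay:
  fixes g :: "real \<Rightarrow> real"
  assumes [measurable]: "g \<in> borel_measurable borel" and "\<exists>C. \<forall>x. \<bar>g x\<bar> \<le> C * exp (- x\<^sup>2 / 4)"
  shows "(\<lambda>x. complex_of_real (g x)) \<in> L2"
proof (rule L2I)
  have "integrable lborel (\<lambda>x. g x * g x)"
    by (intro integrable_gauss_decay' gauss_decay_mult assms) auto
  then show "integrable lborel (\<lambda>x. (cmod (complex_of_real (g x)))\<^sup>2)"
    by (simp add: power2_eq_square)
qed auto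

lemma L2_hf: "(\<lambda>x. complex_of_real (hf k x)) \<in> L2"
  by (intro L2_gauss_decay hf_decay) auto

lemma L2_hfd: "(\<lambda>x. complex_of_real (hfd k x)) \<in> L2"
  by (intro L2_gauss_decay hfd_decay) auto

lemma L2_x_hf: "(\<lambda>x. complex_of_real (x * hf k x)) \<in> L2"
  using power_hf_decay[of 1 k] by (intro L2_gauss_decay) auto

text \<open>The weighted arithmetic-geometric mean gives (t N2 f + N2 g / t) / 2 for every t > 0;
  the optimal t is the quotient of the norms.\<close>

lemma L2_Cauchy_Schwarz:
  assumes f: "f \<in> L2" and g: "g \<in> L2"
  shows "(LINT x|lborel. cmod (f x * g x)) \<le> sqrt (N2 f) * sqrt (N2 g)"
proof -
  let ?I = "LINT x|lborel. cmod (f x * g x)"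
  have le: "?I \<le> (t * N2 f + N2 g / t) / 2" if t: "t > 0" for t
  proof -
    have "?I \<le> (LINT x|lborel. (t * (cmod (f x))\<^sup>2 + (cmod (g x))\<^sup>2 / t) / 2)"
    proof (rule integral_mono)
      show "integrable lborel (\<lambda>x. cmod (f x * g x))"
        using L2_integrable_mult[OF f g] by (rule integrable_norm)
      show "integrable lborel (\<lambda>x. (t * (cmod (f x))\<^sup>2 + (cmod (g x))\<^sup>2 / t) / 2)"
        using f g by (intro integrable_divide Bochner_Integration.integrable_add integrable_mult_right L2_integrable_sq)
      fix x
      have "0 \<le> (t * cmod (f x) - cmod (g x))\<^sup>2" by simp
      then have "2 * t * (cmod (f x) * cmod (g x)) \<le> t\<^sup>2 * (cmod (f x))\<^sup>2 + (cmod (g x))\<^sup>2"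
        unfolding power2_diff power_mult_distrib by linarith
      then show "cmod (f x * g x) \<le> (t * (cmod (f x))\<^sup>2 + (cmod (g x))\<^sup>2 / t) / 2"
        using t unfolding norm_mult by (simp add: field_simps power2_eq_square)
    qed
    also have "\<dots> = (t * N2 f + N2 g / t) / 2"
      using f g unfolding N2_def by (subst integral_divide_zero, subst Bochner_Integration.integral_add)
        (auto intro!: integrable_divide integrable_mult_right dest: L2_integrable_sq)
    finally show ?thesis .
  qed
  \<comment> \<open>Adding \<open>e\<close> to both squared norms keeps the optimal weight defined
    when one of them vanishes.\<close>
  have ev: "?I \<le> sqrt (N2 f + e) * sqrt (N2 g + e)" if e: "e > 0" for e
  proof -
    define A where "A = sqrt (N2 f + e)"
    define B where "B = sqrt (N2 g + e)"
    have AB: "A > 0" "B > 0" "A\<^sup>2 = N2 f + e" "B\<^sup>2 = N2 g + e"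
      using e unfolding A_def B_def by (auto simp: add_nonneg_pos)
    have "?I \<le> (B / A * N2 f + N2 g / (B / A)) / 2" using AB by (intro le) auto
    also have "\<dots> \<le> (B / A * A\<^sup>2 + B\<^sup>2 / (B / A)) / 2"
      using AB e by (intro divide_right_mono add_mono mult_left_mono) auto
    also have "\<dots> = A * B" using AB(1,2) by (simp add: field_simps power2_eq_square)
    finally show ?thesis unfolding A_def B_def .
  qed
  have "((\<lambda>e. sqrt (N2 f + e) * sqrt (N2 g + e)) \<longlongrightarrow> sqrt (N2 f + 0) * sqrt (N2 g + 0)) (at_right 0)"
    by (intro tendsto_intros)
  moreover have "eventually (\<lambda>e. ?I \<le> sqrt (N2 f + e) * sqrt (N2 g + e)) (at_right 0)"
    using eventually_at_right_less[of 0] by eventually_elim (rule ev)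
  ultimately have "?I \<le> sqrt (N2 f + 0) * sqrt (N2 g + 0)"
    by (rule tendsto_lowerbound) simp
  then show ?thesis by simp
qed

lemma L2_Cauchy_Schwarz_integral:
  assumes f: "f \<in> L2" and g: "g \<in> L2"
  shows "cmod (LINT x|lborel. f x * g x) \<le> sqrt (N2 f) * sqrt (N2 g)"
  using L2_Cauchy_Schwarz[OF f g] by (rule order_trans[OF integral_norm_bound])

lemma N2_cong: 
  assumes "L2_eq f g" "f \<in> borel_measurable borel" "g \<in> borel_measurable borel"
  shows "N2 f = N2 g"
  unfolding N2_def by (rule integral_cong_AE) (use assms in \<open>auto simp: L2_eq_def\<close>)

lemma N2_eq_0_iff: "f \<in> L2 \<Longrightarrow> N2 f = 0 \<longleftrightarrow> L2_eq f (\<lambda>x. 0)"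
  unfolding N2_def L2_eq_def
  by (subst integral_nonneg_eq_0_iff_AE) (auto dest: L2_integrable_sq)

section \<open>Coefficients, partial sums and Bessel's inequality\<close>

definition cf :: "(real \<Rightarrow> complex) \<Rightarrow> nat \<Rightarrow> complex" where
  "cf f k = (LINT x|lborel. f x * complex_of_real (hf k x))"

lemma cf_add: "f \<in> L2 \<Longrightarrow> g \<in> L2 \<Longrightarrow> cf (\<lambda>x. f x + g x) k = cf f k + cf g k"
  unfolding cf_def by (simp add: distrib_right L2_integrable_mult L2_hf)

lemma cf_diff: "f \<in> L2 \<Longrightarrow> g \<in> L2 \<Longrightarrow> cf (\<lambda>x. f x - g x) k = cf f k - cf g k"
  unfolding cf_def by (simp add: left_diff_distrib L2_integrable_mult L2_hf)

lemma cf_cmult: "cf (\<lambda>x. c * f x) k = c * cf f k"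
  unfolding cf_def by (simp add: mult.assoc)

lemma cf_0 [simp]: "cf (\<lambda>x. 0) k = 0"
  unfolding cf_def by simp

lemma cf_sum: "(\<And>i. i \<in> I \<Longrightarrow> f i \<in> L2) \<Longrightarrow> cf (\<lambda>x. \<Sum>i\<in>I. f i x) k = (\<Sum>i\<in>I. cf (f i) k)"
  by (induction I rule: infinite_finite_induct) (auto simp: cf_add L2_sum)

lemma cf_hf: "cf (\<lambda>x. complex_of_real (hf j x)) k = (if j = k then 1 else 0)"
  unfolding cf_def using hf_orthonormal[of j k]
  by (simp flip: of_real_mult)

lemma cf_cnj: "cf (\<lambda>x. cnj (f x)) k = cnj (cf f k)"
proof -
  have "cf (\<lambda>x. cnj (f x)) k = (LINT x|lborel. cnj (f x * complex_of_real (hf k x)))"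
    unfolding cf_def by simp
  also have "\<dots> = cnj (cf f k)"
    unfolding cf_def by (rule Bochner_Integration.integral_cnj)
  finally show ?thesis .
qed

lemma cf_cong: "L2_eq f g \<Longrightarrow> f \<in> borel_measurable borel \<Longrightarrow> g \<in> borel_measurable borel \<Longrightarrow> cf f k = cf g k"
  unfolding cf_def by (rule integral_cong_AE) (auto simp: L2_eq_def)

definition psum :: "(nat \<Rightarrow> complex) \<Rightarrow> nat \<Rightarrow> real \<Rightarrow> complex" where
  "psum c N x = (\<Sum>k<N. c k * complex_of_real (hf k x))"

lemma psum_L2: "psum c N \<in> L2"
  unfolding psum_def[abs_def] by (intro L2_sum L2_cmult L2_hf)

lemma cf_psum: "cf (psum c N) k = (if k < N then c k else 0)"
proof -
  have "cf (psum c N) k = (\<Sum>i<N. c i * (if i = k then 1 else 0))"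
    unfolding psum_def[abs_def] by (simp add: cf_sum L2_cmult L2_hf cf_cmult cf_hf)
  also have "\<dots> = (\<Sum>i<N. if i = k then c i else 0)"
    by (intro sum.cong) auto
  also have "\<dots> = (if k < N then c k else 0)"
    by (simp add: sum.delta)
  finally show ?thesis .
qed

lemma N2_minus_hf:
  assumes f: "f \<in> L2"
  shows "N2 (\<lambda>x. f x - c * complex_of_real (hf k x)) = N2 f - (cmod (cf f k))\<^sup>2 + (cmod (cf f k - c))\<^sup>2"
proof -
  let ?h = "\<lambda>x. complex_of_real (hf k x)"
  have e: "(cmod (z - c * w))\<^sup>2 = (cmod z)\<^sup>2 - 2 * Re (z * w * cnj c) + (cmod c)\<^sup>2 * (cmod w)\<^sup>2"
    if "Im w = 0" for z w :: complex
    using that unfolding cmod_power2 by (simp add: power2_eq_square algebra_simps)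
  have i1: "integrable lborel (\<lambda>x. f x * ?h x * cnj c)"
    by (intro integrable_mult_left L2_integrable_mult f L2_hf)
  have i2: "integrable lborel (\<lambda>x. (cmod c)\<^sup>2 * (cmod (?h x))\<^sup>2)"
    by (intro integrable_mult_right L2_integrable_sq L2_hf)
  have "N2 (\<lambda>x. f x - c * ?h x) = (LINT x|lborel. (cmod (f x))\<^sup>2 - 2 * Re (f x * ?h x * cnj c) + (cmod c)\<^sup>2 * (cmod (?h x))\<^sup>2)"
    unfolding N2_def by (intro Bochner_Integration.integral_cong refl e) simp
  also have "\<dots> = (LINT x|lborel. (cmod (f x))\<^sup>2 - 2 * Re (f x * ?h x * cnj c)) + (LINT x|lborel. (cmod c)\<^sup>2 * (cmod (?h x))\<^sup>2)"
    by (intro Bochner_Integration.integral_add Bochner_Integration.integrable_diff integrable_mult_right integrable_Re i1 i2 L2_integrable_sq f)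
  also have "(LINT x|lborel. (cmod (f x))\<^sup>2 - 2 * Re (f x * ?h x * cnj c)) = N2 f - (LINT x|lborel. 2 * Re (f x * ?h x * cnj c))"
    unfolding N2_def by (intro Bochner_Integration.integral_diff integrable_mult_right integrable_Re i1 L2_integrable_sq f)
  also have "(LINT x|lborel. 2 * Re (f x * ?h x * cnj c)) = 2 * Re (LINT x|lborel. f x * ?h x * cnj c)"
    by (simp only: integral_mult_right_zero integral_Re[OF i1])
  also have "(LINT x|lborel. f x * ?h x * cnj c) = cf f k * cnj c"
    unfolding cf_def by simp
  also have "(LINT x|lborel. (cmod c)\<^sup>2 * (cmod (?h x))\<^sup>2) = (cmod c)\<^sup>2"
    using hf_orthonormal[of k k] by (simp add: power2_eq_square)
  also have "N2 f - 2 * Re (cf f k * cnj c) + (cmod c)\<^sup>2 = N2 f - (cmod (cf f k))\<^sup>2 + (cmod (cf f k - c))\<^sup>2"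
    unfolding cmod_power2 by (simp add: power2_eq_square algebra_simps)
  finally show ?thesis .
qed

text \<open>Orthonormality decouples the terms, so an induction step is \<open>N2_minus_hf\<close>
  applied to the remainder. With \<open>c = cf f\<close> this yields Bessel's inequality, with
  \<open>f = 0\<close> the norm of a partial sum.\<close>

lemma N2_minus_psum:
  assumes f: "f \<in> L2"
  shows "N2 (\<lambda>x. f x - psum c N x) = N2 f - (\<Sum>k<N. (cmod (cf f k))\<^sup>2) + (\<Sum>k<N. (cmod (cf f k - c k))\<^sup>2)"
proof (induction N)
  case 0
  then show ?case by (simp add: psum_def)
next
  case (Suc N)
  have "N2 (\<lambda>x. f x - psum c (Suc N) x) = N2 (\<lambda>x. (f x - psum c N x) - c N * complex_of_real (hf N x))"
    by (simp add: psum_def algebra_simps)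
  also have "\<dots> = N2 (\<lambda>x. f x - psum c N x) - (cmod (cf (\<lambda>x. f x - psum c N x) N))\<^sup>2
      + (cmod (cf (\<lambda>x. f x - psum c N x) N - c N))\<^sup>2"
    by (intro N2_minus_hf L2_diff f psum_L2)
  also have "cf (\<lambda>x. f x - psum c N x) N = cf f N"
    by (simp add: cf_diff f psum_L2 cf_psum)
  finally show ?case using Suc by simp
qed

lemma N2_uminus: "N2 (\<lambda>x. - f x) = N2 f" by (simp add: N2_def)

lemma N2_psum: "N2 (psum c N) = (\<Sum>k<N. (cmod (c k))\<^sup>2)"
  using N2_minus_psum[OF L2_zero, of c N] N2_uminus[of "psum c N"]
  by (simp add: N2_def)

lemma Bessel:
  assumes "f \<in> L2"
  shows "(\<Sum>k<N. (cmod (cf f k))\<^sup>2) \<le> N2 f" "summable (\<lambda>k. (cmod (cf f k))\<^sup>2)"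
proof -
  show *: "(\<Sum>k<N. (cmod (cf f k))\<^sup>2) \<le> N2 f" for N
    using N2_minus_psum[OF assms, of "cf f" N] N2_nonneg[of "\<lambda>x. f x - psum (cf f) N x"] by simp
  show "summable (\<lambda>k. (cmod (cf f k))\<^sup>2)"
    by (rule summableI_nonneg_bounded[of _ "N2 f"]) (use * in auto)
qed

section \<open>Fatou's lemma and the Riesz-Fischer theorem\<close>

lemma N2_nn_integral: "f \<in> L2 \<Longrightarrow> (\<integral>\<^sup>+x. ennreal ((cmod (f x))\<^sup>2) \<partial>lborel) = ennreal (N2 f)"
  unfolding N2_def by (rule nn_integral_eq_integral) (auto dest: L2_integrable_sq)

lemma fatou_L2:
  assumes f: "\<And>j. f j \<in> L2" and g [measurable]: "g \<in> borel_measurable borel"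
    and lim: "AE x in lborel. (\<lambda>j. f j x) \<longlonglongrightarrow> g x"
    and bd: "eventually (\<lambda>j. N2 (f j) \<le> B) sequentially"
  shows "g \<in> L2" "N2 g \<le> B"
proof -
  have [measurable]: "f j \<in> borel_measurable borel" for j using f by measurable
  have B0: "B \<ge> 0" using bd N2_nonneg by (metis (mono_tags, lifting) eventually_happens order_trans sequentially_bot)
  have "(\<integral>\<^sup>+x. ennreal ((cmod (g x))\<^sup>2) \<partial>lborel) = (\<integral>\<^sup>+x. liminf (\<lambda>j. ennreal ((cmod (f j x))\<^sup>2)) \<partial>lborel)"
  proof (rule nn_integral_cong_AE)
    show "AE x in lborel. ennreal ((cmod (g x))\<^sup>2) = liminf (\<lambda>j. ennreal ((cmod (f j x))\<^sup>2))"
      using lim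
    proof eventually_elim
      case (elim x)
      have "(\<lambda>j. ennreal ((cmod (f j x))\<^sup>2)) \<longlonglongrightarrow> ennreal ((cmod (g x))\<^sup>2)"
        by (intro tendsto_ennrealI tendsto_power tendsto_norm elim)
      then show ?case by (intro lim_imp_Liminf[symmetric]) auto
    qed
  qed
  also have "\<dots> \<le> liminf (\<lambda>j. \<integral>\<^sup>+x. ennreal ((cmod (f j x))\<^sup>2) \<partial>lborel)"
    by (rule nn_integral_liminf) measurable
  also have "\<dots> \<le> ennreal B"
  proof (rule Liminf_le)
    show "\<forall>\<^sub>F j in sequentially. (\<integral>\<^sup>+x. ennreal ((cmod (f j x))\<^sup>2) \<partial>lborel) \<le> ennreal B"
      using bd by eventually_elim (simp add: N2_nn_integral f ennreal_leI)
  qed simp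
  finally have *: "(\<integral>\<^sup>+x. ennreal ((cmod (g x))\<^sup>2) \<partial>lborel) \<le> ennreal B" .
  show "g \<in> L2"
  proof (rule L2I[OF g], rule integrableI_bounded)
    show "(\<integral>\<^sup>+ x. ennreal (norm ((cmod (g x))\<^sup>2)) \<partial>lborel) < \<infinity>"
      using * by (simp add: order_le_less_trans)
  qed measurable
  then show "N2 g \<le> B" using * B0 by (simp add: N2_nn_integral)
qed

lemma psum_diff: "N \<le> M \<Longrightarrow> psum c M x - psum c N x = psum (\<lambda>k. if k < N then 0 else c k) M x"
proof -
  assume "N \<le> M"
  then have "(\<Sum>k<M. c k * complex_of_real (hf k x)) = (\<Sum>k<N. c k * complex_of_real (hf k x)) + (\<Sum>k\<in>{N..<M}. c k * complex_of_real (hf k x))"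
    by (subst sum.union_disjoint[symmetric]) (auto intro!: sum.cong)
  moreover have "psum (\<lambda>k. if k < N then 0 else c k) M x = (\<Sum>k\<in>{N..<M}. c k * complex_of_real (hf k x))"
    unfolding psum_def by (rule sum.mono_neutral_cong_right) auto
  ultimately show ?thesis unfolding psum_def by simp
qed

lemma N2_psum_diff: "N \<le> M \<Longrightarrow> N2 (\<lambda>x. psum c M x - psum c N x) = (\<Sum>k\<in>{N..<M}. (cmod (c k))\<^sup>2)"
proof -
  assume NM: "N \<le> M"
  have "N2 (\<lambda>x. psum c M x - psum c N x) = N2 (psum (\<lambda>k. if k < N then 0 else c k) M)"
    using psum_diff[OF NM] by (simp add: fun_eq_iff)
  also have "\<dots> = (\<Sum>k\<in>{N..<M}. (cmod (c k))\<^sup>2)"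
    unfolding N2_psum by (rule sum.mono_neutral_cong_right) auto
  finally show ?thesis .
qed

lemma N2_psum_diff_le:
  assumes c: "summable (\<lambda>k. (cmod (c k))\<^sup>2)" and NM: "N \<le> M"
  shows "N2 (\<lambda>x. psum c M x - psum c N x) \<le> (\<Sum>k. (cmod (c k))\<^sup>2) - (\<Sum>k<N. (cmod (c k))\<^sup>2)"
proof -
  have "(\<Sum>k<M. (cmod (c k))\<^sup>2) = (\<Sum>k<N. (cmod (c k))\<^sup>2) + (\<Sum>k\<in>{N..<M}. (cmod (c k))\<^sup>2)"
    using NM by (subst sum.union_disjoint[symmetric]) (auto intro!: sum.cong)
  moreover have "(\<Sum>k<M. (cmod (c k))\<^sup>2) \<le> (\<Sum>k. (cmod (c k))\<^sup>2)"
    by (rule sum_le_suminf[OF c]) auto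
  ultimately show ?thesis unfolding N2_psum_diff[OF NM] by simp
qed

text \<open>The differences \<open>psum c (\<nu> j) - psum c N\<close> have squared norms bounded by
  the tail of the series, and Fatou's lemma passes this bound to the limit. A sparse
  \<open>\<nu>\<close> serves \<open>riesz_fischer\<close>; for the pointwise series
  \<open>synth\<close> it is the identity.\<close>

lemma psum_limit:
  assumes c: "summable (\<lambda>k. (cmod (c k))\<^sup>2)" and F [measurable]: "F \<in> borel_measurable borel"
    and \<nu>: "filterlim \<nu> at_top sequentially"
    and lim: "AE x in lborel. (\<lambda>j. psum c (\<nu> j) x) \<longlonglongrightarrow> F x"
  shows "F \<in> L2" "cf F k = c k"
    "N2 (\<lambda>x. F x - psum c N x) \<le> (\<Sum>k. (cmod (c k))\<^sup>2) - (\<Sum>k<N. (cmod (c k))\<^sup>2)"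
proof -
  have le: "N2 (\<lambda>x. F x - psum c N x) \<le> (\<Sum>k. (cmod (c k))\<^sup>2) - (\<Sum>k<N. (cmod (c k))\<^sup>2) \<and> (\<lambda>x. F x - psum c N x) \<in> L2" for N
  proof -
    have [measurable]: "psum c N \<in> borel_measurable borel" using psum_L2 by measurable
    have "eventually (\<lambda>j. \<nu> j \<ge> N) sequentially"
      using \<nu> by (simp add: filterlim_at_top)
    then have "eventually (\<lambda>j. N2 (\<lambda>x. psum c (\<nu> j) x - psum c N x) \<le> (\<Sum>k. (cmod (c k))\<^sup>2) - (\<Sum>k<N. (cmod (c k))\<^sup>2)) sequentially"
      by eventually_elim (rule N2_psum_diff_le[OF c])
    moreover have "AE x in lborel. (\<lambda>j. psum c (\<nu> j) x - psum c N x) \<longlonglongrightarrow> F x - psum c N x"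
      using lim by eventually_elim (intro tendsto_diff tendsto_const)
    moreover have "(\<lambda>x. F x - psum c N x) \<in> borel_measurable borel" by measurable
    ultimately show ?thesis
      using fatou_L2[of "\<lambda>j x. psum c (\<nu> j) x - psum c N x" "\<lambda>x. F x - psum c N x"]
      by (auto intro: L2_diff psum_L2)
  qed
  then show "N2 (\<lambda>x. F x - psum c N x) \<le> (\<Sum>k. (cmod (c k))\<^sup>2) - (\<Sum>k<N. (cmod (c k))\<^sup>2)" by blast
  show F2: "F \<in> L2" using le[of 0] by (simp add: psum_def)
  have "(\<lambda>N. sqrt ((\<Sum>k. (cmod (c k))\<^sup>2) - (\<Sum>k<N. (cmod (c k))\<^sup>2)) * sqrt (N2 (\<lambda>x. complex_of_real (hf k x))))
     \<longlonglongrightarrow> sqrt ((\<Sum>k. (cmod (c k))\<^sup>2) - (\<Sum>k. (cmod (c k))\<^sup>2)) * sqrt (N2 (\<lambda>x. complex_of_real (hf k x)))"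
    by (intro tendsto_intros summable_LIMSEQ c)
  moreover have "eventually (\<lambda>N. cmod (cf F k - c k) \<le> sqrt ((\<Sum>k. (cmod (c k))\<^sup>2) - (\<Sum>k<N. (cmod (c k))\<^sup>2)) * sqrt (N2 (\<lambda>x. complex_of_real (hf k x)))) sequentially"
    using eventually_gt_at_top[of k]
  proof eventually_elim
    case (elim N)
    have "cf F k - c k = cf (\<lambda>x. F x - psum c N x) k"
      using elim by (simp add: cf_diff F2 psum_L2 cf_psum)
    then have "cmod (cf F k - c k) \<le> sqrt (N2 (\<lambda>x. F x - psum c N x)) * sqrt (N2 (\<lambda>x. complex_of_real (hf k x)))"
      unfolding cf_def using L2_Cauchy_Schwarz_integral[OF L2_diff[OF F2 psum_L2] L2_hf] by simp
    also have "\<dots> \<le> sqrt ((\<Sum>k. (cmod (c k))\<^sup>2) - (\<Sum>k<N. (cmod (c k))\<^sup>2)) * sqrt (N2 (\<lambda>x. complex_of_real (hf k x)))"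
      using le[of N] by (intro mult_right_mono) auto
    finally show ?case .
  qed
  ultimately have "cmod (cf F k - c k) \<le> sqrt ((\<Sum>k. (cmod (c k))\<^sup>2) - (\<Sum>k. (cmod (c k))\<^sup>2)) * sqrt (N2 (\<lambda>x. complex_of_real (hf k x)))"
    by (intro tendsto_lowerbound) auto
  then show "cf F k = c k" by simp
qed

lemma riesz_fischer:
  assumes c: "summable (\<lambda>k. (cmod (c k))\<^sup>2)"
  obtains F where "F \<in> L2" "\<And>k. cf F k = c k"
    "\<And>N. N2 (\<lambda>x. F x - psum c N x) \<le> (\<Sum>k. (cmod (c k))\<^sup>2) - (\<Sum>k<N. (cmod (c k))\<^sup>2)"
proof -
  have "\<exists>N. \<forall>m\<ge>N. \<forall>n. norm (\<Sum>k\<in>{m..<n}. (cmod (c k))\<^sup>2) < (1/4) ^ j" for j :: nat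
    using c unfolding summable_Cauchy by simp
  then obtain M where M: "\<And>j m n. m \<ge> M j \<Longrightarrow> norm (\<Sum>k\<in>{m..<n}. (cmod (c k))\<^sup>2) < (1/4) ^ j"
    by metis
  \<comment> \<open>The sum exceeds \<open>M j\<close> and makes the sequence increasing; the
    summand \<open>j\<close> makes it tend to infinity.\<close>
  define \<nu> where "\<nu> j = j + (\<Sum>i\<le>j. M i)" for j
  have \<nu>M: "\<nu> j \<ge> M j" for j
    using member_le_sum[of j "{..j}" M] unfolding \<nu>_def by auto
  have \<nu>mono: "\<nu> j \<le> \<nu> (Suc j)" for j unfolding \<nu>_def by simp
  have \<nu>lim: "filterlim \<nu> at_top sequentially"
    by (rule filterlim_at_top_mono[OF filterlim_ident]) (auto simp: \<nu>_def)
  \<comment> \<open>A positive weight in L2: by Cauchy-Schwarz against \<open>g\<close> the summable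
    L2 norms of the increments become summable weighted L1 norms, which gives convergence almost
    everywhere.\<close>
  define g where "g x = complex_of_real (exp (- x\<^sup>2 / 4))" for x :: real
  have g: "g \<in> L2" unfolding g_def
    by (rule L2_gauss_decay) (auto intro!: exI[of _ 1])
  define Dj where "Dj j x = psum c (\<nu> (Suc j)) x - psum c (\<nu> j) x" for j x
  have Dj: "Dj j \<in> L2" for j unfolding Dj_def[abs_def] by (intro L2_diff psum_L2)
  note [measurable] = L2_measurable[OF Dj] L2_measurable[OF g] L2_measurable[OF psum_L2]
  have Dj_N2: "N2 (Dj j) \<le> (1/4) ^ j" for j
    using M[OF \<nu>M, of j "\<nu> (Suc j)"] unfolding Dj_def[abs_def] N2_psum_diff[OF \<nu>mono] by simp
  have int_le: "(\<integral>\<^sup>+x. ennreal (cmod (Dj j x * g x)) \<partial>lborel) \<le> ennreal ((1/2) ^ j * sqrt (N2 g))" for j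
  proof -
    have "(\<integral>\<^sup>+x. ennreal (cmod (Dj j x * g x)) \<partial>lborel) = ennreal (LINT x|lborel. cmod (Dj j x * g x))"
      by (intro nn_integral_eq_integral integrable_norm L2_integrable_mult Dj g) auto
    also have "(LINT x|lborel. cmod (Dj j x * g x)) \<le> sqrt (N2 (Dj j)) * sqrt (N2 g)"
      by (rule L2_Cauchy_Schwarz[OF Dj g])
    also have "sqrt (N2 (Dj j)) \<le> sqrt ((1/4) ^ j)" using Dj_N2 by simp
    also have "sqrt ((1/4) ^ j) = (1/2) ^ j" 
      by (simp add: real_sqrt_power real_sqrt_divide)
    finally show ?thesis by (simp add: ennreal_leI mult_right_mono)
  qed
  have "(\<integral>\<^sup>+x. (\<Sum>j. ennreal (cmod (Dj j x * g x))) \<partial>lborel) = (\<Sum>j. \<integral>\<^sup>+x. ennreal (cmod (Dj j x * g x)) \<partial>lborel)"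
    by (rule nn_integral_suminf) measurable
  also have "\<dots> \<le> (\<Sum>j. ennreal ((1/2) ^ j * sqrt (N2 g)))"
    by (intro suminf_le int_le) auto
  also have "\<dots> = ennreal (\<Sum>j. (1/2) ^ j * sqrt (N2 g))"
    by (intro suminf_ennreal2 summable_mult2 summable_geometric) auto
  finally have "(\<integral>\<^sup>+x. (\<Sum>j. ennreal (cmod (Dj j x * g x))) \<partial>lborel) \<noteq> \<infinity>"
    by (metis ennreal_less_top infinity_ennreal_def order_le_less_trans order_less_irrefl)
  then have AE: "AE x in lborel. (\<Sum>j. ennreal (cmod (Dj j x * g x))) \<noteq> \<infinity>"
    by (intro nn_integral_noteq_infinite) measurable
  have conv: "AE x in lborel. convergent (\<lambda>j. psum c (\<nu> j) x)"
    using AE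
  proof eventually_elim
    case (elim x)
    have "summable (\<lambda>j. cmod (Dj j x * g x))"
      using elim by (intro summable_suminf_not_top) auto
    then have "summable (\<lambda>j. cmod (Dj j x) * exp (- x\<^sup>2 / 4))"
      by (simp add: g_def norm_mult)
    then have "summable (\<lambda>j. cmod (Dj j x) * exp (- x\<^sup>2 / 4) * inverse (exp (- x\<^sup>2 / 4)))"
      by (rule summable_mult2)
    then have "summable (\<lambda>j. cmod (Dj j x))"
      by (simp add: mult.assoc)
    then have "summable (\<lambda>j. Dj j x)" by (rule summable_norm_cancel)
    then have "convergent (\<lambda>n. \<Sum>j<n. Dj j x)" by (simp add: summable_iff_convergent)
    also have "(\<lambda>n. \<Sum>j<n. Dj j x) = (\<lambda>n. psum c (\<nu> n) x - psum c (\<nu> 0) x)"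
      unfolding Dj_def by (rule ext) (rule sum_lessThan_telescope)
    finally have "convergent (\<lambda>n. (psum c (\<nu> n) x - psum c (\<nu> 0) x) + psum c (\<nu> 0) x)"
      by (intro convergent_add convergent_const)
    then show ?case by simp
  qed
  define F where "F x = lim (\<lambda>j. psum c (\<nu> j) x)" for x
  have F [measurable]: "F \<in> borel_measurable borel" unfolding F_def[abs_def] by measurable
  have lim: "AE x in lborel. (\<lambda>j. psum c (\<nu> j) x) \<longlonglongrightarrow> F x"
    using conv by eventually_elim (simp add: F_def convergent_LIMSEQ_iff)
  show thesis
    by (rule that[of F]) (use psum_limit[OF c F \<nu>lim lim] in auto)
qed

section \<open>Completeness of the Hermite functions\<close>

lemma abs_mult_le_gauss: "t * \<bar>x\<bar> \<le> x\<^sup>2 / 4 + t\<^sup>2" for t x :: real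
proof -
  have "0 \<le> (\<bar>x\<bar> / 2 - t)\<^sup>2" by simp
  then show ?thesis by (simp add: power2_eq_square algebra_simps)
qed

text \<open>By \<open>x_hf\<close> a factor x only shifts the index, so induction on
  \<open>m\<close> reduces the moments to the coefficients themselves.\<close>

lemma real_integral_x_power_hf:
  fixes r :: "real \<Rightarrow> real"
  assumes r [measurable]: "r \<in> borel_measurable borel" and r2: "(\<lambda>x. complex_of_real (r x)) \<in> L2"
    and z: "\<And>k. (LINT x|lborel. r x * hf k x) = 0"
  shows "integrable lborel (\<lambda>x. r x * (x ^ m * hf k x)) \<and> (LINT x|lborel. r x * (x ^ m * hf k x)) = 0"
proof (induction m arbitrary: k)
  case (0 k)
  have "integrable lborel (\<lambda>x. Re (complex_of_real (r x) * complex_of_real (hf k x)))"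
    by (intro integrable_Re L2_integrable_mult r2 L2_hf)
  then show ?case using z by simp
next
  case (Suc m k)
  have e: "r x * (x ^ Suc m * hf k x) = (sqrt (2 * real k) / 2) * (r x * (x ^ m * hf (k - 1) x))
     + (sqrt (2 * real (k + 1)) / 2) * (r x * (x ^ m * hf (k + 1) x))" for x
  proof -
    have "r x * (x ^ Suc m * hf k x) = r x * x ^ m * (x * hf k x)" by simp
    also have "\<dots> = r x * x ^ m * ((sqrt (2 * real k) * hf (k - 1) x + sqrt (2 * real (k + 1)) * hf (k + 1) x) / 2)"
      unfolding x_hf ..
    finally show ?thesis by (simp add: algebra_simps add_divide_distrib)
  qed
  show ?case unfolding e using Suc[of "k - 1"] Suc[of "k + 1"] by simp
qed

text \<open>Uniform in \<open>N\<close>, as dominated convergence of the exponential series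
  requires.\<close>

lemma iexp_partial_sum_bound:
  "cmod (\<Sum>k<N. (\<i> * complex_of_real y) ^ k / of_nat (fact k)) \<le> exp \<bar>y\<bar>"
proof -
  have "cmod (\<Sum>k<N. (\<i> * complex_of_real y) ^ k / of_nat (fact k)) \<le> (\<Sum>k<N. \<bar>y\<bar> ^ k / fact k)"
    by (intro sum_norm_le) (simp add: norm_divide norm_power norm_mult)
  also have "\<dots> \<le> (\<Sum>k. \<bar>y\<bar> ^ k / fact k)"
    using summable_exp[of "\<bar>y\<bar>"] by (intro sum_le_suminf) (auto simp: field_simps)
  also have "\<dots> = exp \<bar>y\<bar>"
    unfolding exp_def by (simp add: field_simps scaleR_conv_of_real)
  finally show ?thesis .
qed

text \<open>The Fourier transform of \<open>r h\<^sub>0\<close> vanishes, because its Taylor coefficients are moments of \<open>r h\<^sub>0\<close>;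
  injectivity of the characteristic function then gives \<open>r = 0\<close>.\<close>

lemma hermite_complete_real:
  fixes r :: "real \<Rightarrow> real"
  assumes r [measurable]: "r \<in> borel_measurable borel" and r2: "(\<lambda>x. complex_of_real (r x)) \<in> L2"
    and z: "\<And>k. (LINT x|lborel. r x * hf k x) = 0"
  shows "AE x in lborel. r x = 0"
proof -
  define \<phi> where "\<phi> x = r x * hf 0 x" for x
  have \<phi>m [measurable]: "\<phi> \<in> borel_measurable borel" unfolding \<phi>_def by measurable
  have \<phi>i: "integrable lborel \<phi>" 
    using real_integral_x_power_hf[OF r r2 z, of 0 0] by (simp add: \<phi>_def[abs_def])
  have ft: "(LINT x|lborel. complex_of_real (\<phi> x) * iexp (t * x)) = 0" for t
  proof -
    define s where "s N x = complex_of_real (\<phi> x) * (\<Sum>k<N. (\<i> * complex_of_real (t * x)) ^ k / of_nat (fact k))" for N x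
    \<comment> \<open>The majorant: exp |t x| is at most exp (x^2/4 + t^2), which uses up half of
      the exponent of h_0. The other half leaves a square integrable function to pair with
      \<open>r\<close>.\<close>
    define W where "W x = cmod (complex_of_real (r x) * complex_of_real (exp (t\<^sup>2) / sqrt (sqrt pi) * exp (- x\<^sup>2 / 4)))" for x
    have Wi: "integrable lborel W"
      unfolding W_def
      by (intro integrable_norm L2_integrable_mult r2 L2_gauss_decay)
         (auto intro!: exI[of _ "exp (t\<^sup>2) / sqrt (sqrt pi)"])
    have s0: "(LINT x|lborel. s N x) = 0" for N
    proof -
      have i: "integrable lborel (\<lambda>x. (\<i> * complex_of_real t) ^ k / of_nat (fact k) * complex_of_real (r x * (x ^ k * hf 0 x)))" for k
        using real_integral_x_power_hf[OF r r2 z, of k 0] by (intro integrable_mult_right integrable_of_real) auto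
      have "s N = (\<lambda>x. \<Sum>k<N. (\<i> * complex_of_real t) ^ k / of_nat (fact k) * complex_of_real (r x * (x ^ k * hf 0 x)))"
        unfolding s_def \<phi>_def by (auto simp: sum_distrib_left power_mult_distrib fun_eq_iff intro!: sum.cong)
      then have "(LINT x|lborel. s N x) = (\<Sum>k<N. (LINT x|lborel. (\<i> * complex_of_real t) ^ k / of_nat (fact k) * complex_of_real (r x * (x ^ k * hf 0 x))))"
        using i by simp
      also have "\<dots> = 0"
      proof (rule sum.neutral, rule ballI)
        fix k
        have "(LINT x|lborel. (\<i> * complex_of_real t) ^ k / of_nat (fact k) * complex_of_real (r x * (x ^ k * hf 0 x)))
          = (\<i> * complex_of_real t) ^ k / of_nat (fact k) * complex_of_real (LINT x|lborel. r x * (x ^ k * hf 0 x))"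
          by (simp only: integral_mult_right_zero integral_complex_of_real)
        then show "(LINT x|lborel. (\<i> * complex_of_real t) ^ k / of_nat (fact k) * complex_of_real (r x * (x ^ k * hf 0 x))) = 0"
          using real_integral_x_power_hf[OF r r2 z, of k 0] by simp
      qed
      finally show ?thesis .
    qed
    have "(\<lambda>N. LINT x|lborel. s N x) \<longlonglongrightarrow> (LINT x|lborel. complex_of_real (\<phi> x) * iexp (t * x))"
    proof (rule integral_dominated_convergence[OF _ _ Wi])
      show "(\<lambda>x. complex_of_real (\<phi> x) * iexp (t * x)) \<in> borel_measurable lborel" by measurable
      show "s N \<in> borel_measurable lborel" for N unfolding s_def by measurable
      have "(\<lambda>N. s N x) \<longlonglongrightarrow> complex_of_real (\<phi> x) * iexp (t * x)" for x
      proof -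
        have "(\<lambda>k. (\<i> * complex_of_real (t * x)) ^ k / of_nat (fact k)) sums exp (\<i> * complex_of_real (t * x))"
          using exp_converges[of "\<i> * complex_of_real (t * x)"] by (simp add: scaleR_conv_of_real field_simps)
        then show ?thesis unfolding s_def sums_def by (intro tendsto_intros)
      qed
      then show "AE x in lborel. (\<lambda>N. s N x) \<longlonglongrightarrow> complex_of_real (\<phi> x) * iexp (t * x)" by simp
      have "cmod (s N x) \<le> W x" for N x
      proof -
        have "cmod (s N x) \<le> cmod (complex_of_real (\<phi> x)) * exp \<bar>t * x\<bar>"
          unfolding s_def norm_mult by (intro mult_left_mono iexp_partial_sum_bound) auto
        also have "\<dots> = \<bar>r x\<bar> / sqrt (sqrt pi) * exp (- x\<^sup>2 / 2 + \<bar>t\<bar> * \<bar>x\<bar>)"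
          unfolding norm_of_real \<phi>_def hf.simps exp_add abs_mult by (simp add: abs_mult)
        also have "\<dots> \<le> \<bar>r x\<bar> / sqrt (sqrt pi) * exp (- x\<^sup>2 / 4 + t\<^sup>2)"
          using abs_mult_le_gauss[of "\<bar>t\<bar>" x] by (intro mult_left_mono) auto
        also have "\<dots> = W x" unfolding W_def norm_mult norm_of_real exp_add by (simp add: abs_mult)
        finally show ?thesis .
      qed
      then show "AE x in lborel. norm (s N x) \<le> W x" for N by simp
    qed
    then show ?thesis unfolding s0 using LIMSEQ_unique tendsto_const by blast
  qed
  \<comment> \<open>Characteristic functions determine probability measures, hence the split into
    positive and negative parts. They have equal mass by the transform at t = 0, so both can be
    normalised by the same \<open>A\<close>.\<close>
  define p where "p x = max (\<phi> x) 0" for x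
  define m where "m x = max (- \<phi> x) 0" for x
  have [measurable]: "p \<in> borel_measurable borel" "m \<in> borel_measurable borel"
    unfolding p_def m_def by measurable
  have pi: "integrable lborel p" and mi: "integrable lborel m"
    unfolding p_def m_def using \<phi>i by auto
  have pm: "\<phi> x = p x - m x" and p0: "p x \<ge> 0" and m0: "m x \<ge> 0" for x unfolding p_def m_def by auto
  have pt: "integrable lborel (\<lambda>x. complex_of_real (p x) * iexp (t * x))"
    and mt: "integrable lborel (\<lambda>x. complex_of_real (m x) * iexp (t * x))" for t
    by (rule Bochner_Integration.integrable_bound[OF pi], measurable, simp add: norm_mult)
       (rule Bochner_Integration.integrable_bound[OF mi], measurable, simp add: norm_mult)
  have eq: "(LINT x|lborel. complex_of_real (p x) * iexp (t * x)) = (LINT x|lborel. complex_of_real (m x) * iexp (t * x))" for t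
    using ft[of t] unfolding pm by (simp only: of_real_diff left_diff_distrib Bochner_Integration.integral_diff[OF pt mt]) simp
  define A where "A = (LINT x|lborel. p x)"
  have Am: "A = (LINT x|lborel. m x)"
    using eq[of 0] by (simp add: A_def)
  have A0: "A \<ge> 0" unfolding A_def using p0 by simp
  have "AE x in lborel. p x = m x"
  proof (cases "A = 0")
    case True
    then have "AE x in lborel. p x = 0" "AE x in lborel. m x = 0"
      using integral_nonneg_eq_0_iff_AE[OF pi] integral_nonneg_eq_0_iff_AE[OF mi] Am p0 m0 unfolding A_def by auto
    then show ?thesis by eventually_elim simp
  next
    case False
    then have Apos: "A > 0" using A0 by simp
    define P where "P q = density lborel (\<lambda>x. ennreal (q x / A))" for q :: "real \<Rightarrow> real"
    have rd: "real_distribution (P q)" if [measurable]: "q \<in> borel_measurable borel" and q: "integrable lborel q" "\<And>x. q x \<ge> 0" "(LINT x|lborel. q x) = A" for q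
    proof -
      have "emeasure (P q) (space (P q)) = (\<integral>\<^sup>+x. ennreal (q x / A) \<partial>lborel)"
        unfolding P_def by (simp add: emeasure_density)
      also have "\<dots> = ennreal (LINT x|lborel. q x / A)"
        using q Apos by (intro nn_integral_eq_integral) auto
      also have "\<dots> = 1" using q Apos by simp
      finally have "prob_space (P q)" by (rule prob_spaceI)
      then show ?thesis
        by (auto simp: real_distribution_def real_distribution_axioms_def P_def)
    qed
    have ch: "char (P q) t = (LINT x|lborel. complex_of_real (q x) * iexp (t * x)) / complex_of_real A"
      if [measurable]: "q \<in> borel_measurable borel" and q: "\<And>x. q x \<ge> 0" for q t
    proof -
      have "char (P q) t = (LINT x|lborel. (q x / A) *\<^sub>R iexp (t * x))"
        unfolding char_def P_def using q Apos by (intro integral_density) auto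
      also have "\<dots> = (LINT x|lborel. (complex_of_real (q x) * iexp (t * x)) / complex_of_real A)"
        by (intro Bochner_Integration.integral_cong) (auto simp: scaleR_conv_of_real)
      finally show ?thesis by simp
    qed
    have "P p = P m"
    proof (rule Levy_uniqueness)
      show "real_distribution (P p)" by (rule rd) (auto simp: pi p0 A_def)
      show "real_distribution (P m)" by (rule rd) (auto simp: mi m0 Am)
      show "char (P p) = char (P m)"
        by (rule ext, subst ch, measurable, rule p0, subst ch, measurable, rule m0, simp only: eq)
    qed
    then have "density lborel (\<lambda>x. ennreal (p x / A)) = density lborel (\<lambda>x. ennreal (m x / A))" unfolding P_def .
    then have "AE x in lborel. ennreal (p x / A) = ennreal (m x / A)"
      by (subst (asm) sigma_finite_measure.density_unique_iff[OF sigma_finite_lborel]) auto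
    then show ?thesis using Apos p0 m0 by (auto simp: divide_nonneg_pos)
  qed
  then show ?thesis
  proof eventually_elim
    case (elim x)
    then have "r x * hf 0 x = 0" using pm[of x] by (simp add: \<phi>_def)
    then show ?case by (simp add: hf.simps)
  qed
qed

lemma hermite_complete:
  assumes f: "f \<in> L2" and z: "\<And>k. cf f k = 0"
  shows "L2_eq f (\<lambda>x. 0)"
proof -
  note [measurable] = L2_measurable[OF f]
  have i: "integrable lborel (\<lambda>x. f x * complex_of_real (hf k x))" for k
    by (rule L2_integrable_mult[OF f L2_hf])
  have "AE x in lborel. Re (f x) = 0"
  proof (rule hermite_complete_real)
    show "(\<lambda>x. complex_of_real (Re (f x))) \<in> L2"
      by (rule L2I, measurable, rule Bochner_Integration.integrable_bound[OF L2_integrable_sq[OF f]])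
         (auto intro!: AE_I2 simp: cmod_power2)
    show "(LINT x|lborel. Re (f x) * hf k x) = 0" for k
      using integral_Re[OF i[of k]] z[of k] by (simp add: cf_def)
  qed measurable
  moreover have "AE x in lborel. Im (f x) = 0"
  proof (rule hermite_complete_real)
    show "(\<lambda>x. complex_of_real (Im (f x))) \<in> L2"
      by (rule L2I, measurable, rule Bochner_Integration.integrable_bound[OF L2_integrable_sq[OF f]])
         (auto intro!: AE_I2 simp: cmod_power2)
    show "(LINT x|lborel. Im (f x) * hf k x) = 0" for k
      using integral_Im[OF i[of k]] z[of k] by (simp add: cf_def)
  qed measurable
  ultimately show ?thesis unfolding L2_eq_def by eventually_elim (simp add: complex_eq_iff)
qed

section \<open>Uniqueness of coefficients and Parseval's identity\<close>

lemma hermite_unique: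
  assumes f: "f \<in> L2" and g: "g \<in> L2" and "\<And>k. cf f k = cf g k"
  shows "L2_eq f g"
  using hermite_complete[OF L2_diff[OF f g]] assms by (simp add: cf_diff L2_eq_def)

text \<open>The Riesz-Fischer function with the same coefficients comes with an estimate of the
  remainder, and by completeness it is \<open>f\<close> itself.\<close>

lemma psum_tendsto:
  assumes f: "f \<in> L2"
  shows "(\<lambda>N. N2 (\<lambda>x. f x - psum (cf f) N x)) \<longlonglongrightarrow> 0"
proof -
  have c: "summable (\<lambda>k. (cmod (cf f k))\<^sup>2)" by (rule Bessel[OF f])
  obtain F where F: "F \<in> L2" "\<And>k. cf F k = cf f k"
    "\<And>N. N2 (\<lambda>x. F x - psum (cf f) N x) \<le> (\<Sum>k. (cmod (cf f k))\<^sup>2) - (\<Sum>k<N. (cmod (cf f k))\<^sup>2)"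
    using riesz_fischer[OF c] by blast
  have "L2_eq f F" by (rule hermite_unique) (use f F in auto)
  then have "N2 (\<lambda>x. f x - psum (cf f) N x) = N2 (\<lambda>x. F x - psum (cf f) N x)" for N
    by (intro N2_cong) (use L2_measurable[OF f] L2_measurable[OF F(1)] L2_measurable[OF psum_L2] in \<open>auto simp: L2_eq_def\<close>)
  then have le: "N2 (\<lambda>x. f x - psum (cf f) N x) \<le> (\<Sum>k. (cmod (cf f k))\<^sup>2) - (\<Sum>k<N. (cmod (cf f k))\<^sup>2)" for N
    using F(3) by simp
  have "(\<lambda>N. (\<Sum>k. (cmod (cf f k))\<^sup>2) - (\<Sum>k<N. (cmod (cf f k))\<^sup>2)) \<longlonglongrightarrow> (\<Sum>k. (cmod (cf f k))\<^sup>2) - (\<Sum>k. (cmod (cf f k))\<^sup>2)"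
    by (intro tendsto_intros summable_LIMSEQ c)
  then have "(\<lambda>N. (\<Sum>k. (cmod (cf f k))\<^sup>2) - (\<Sum>k<N. (cmod (cf f k))\<^sup>2)) \<longlonglongrightarrow> 0" by simp
  then show ?thesis
    by (rule tendsto_sandwich[OF _ _ tendsto_const, rotated 2]) (use le in auto)
qed

lemma Parseval:
  assumes f: "f \<in> L2" and g: "g \<in> L2"
  shows "(\<lambda>k. cf f k * cnj (cf g k)) sums L2_inner f g"
proof -
  have "(\<lambda>N. sqrt (N2 (\<lambda>x. f x - psum (cf f) N x)) * sqrt (N2 (\<lambda>x. cnj (g x)))) \<longlonglongrightarrow> sqrt 0 * sqrt (N2 (\<lambda>x. cnj (g x)))"
    by (intro tendsto_intros psum_tendsto f)
  then have lim: "(\<lambda>N. sqrt (N2 (\<lambda>x. f x - psum (cf f) N x)) * sqrt (N2 (\<lambda>x. cnj (g x)))) \<longlonglongrightarrow> 0" by simp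
  have "cmod (L2_inner f g - (\<Sum>k<N. cf f k * cnj (cf g k))) \<le> sqrt (N2 (\<lambda>x. f x - psum (cf f) N x)) * sqrt (N2 (\<lambda>x. cnj (g x)))" for N
  proof -
    have "(LINT x|lborel. psum (cf f) N x * cnj (g x)) = (\<Sum>k<N. cf f k * cf (\<lambda>x. cnj (g x)) k)"
    proof -
      have "(LINT x|lborel. psum (cf f) N x * cnj (g x)) = (LINT x|lborel. (\<Sum>k<N. cf f k * (cnj (g x) * complex_of_real (hf k x))))"
        unfolding psum_def by (intro Bochner_Integration.integral_cong refl) (simp add: sum_distrib_left mult_ac)
      also have "\<dots> = (\<Sum>k<N. (LINT x|lborel. cf f k * (cnj (g x) * complex_of_real (hf k x))))"
        by (intro Bochner_Integration.integral_sum integrable_mult_right L2_integrable_mult L2_cnj g L2_hf)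
      finally show ?thesis unfolding cf_def by simp
    qed
    then have "L2_inner f g - (\<Sum>k<N. cf f k * cnj (cf g k)) = (LINT x|lborel. (f x - psum (cf f) N x) * cnj (g x))"
      unfolding L2_inner_def left_diff_distrib
      by (subst Bochner_Integration.integral_diff) (auto intro!: L2_integrable_inner f g psum_L2 simp: cf_cnj)
    then show ?thesis
      using L2_Cauchy_Schwarz_integral[OF L2_diff[OF f psum_L2] L2_cnj[OF g]] by simp
  qed
  then have "(\<lambda>N. L2_inner f g - (\<Sum>k<N. cf f k * cnj (cf g k))) \<longlonglongrightarrow> 0"
    by (intro Lim_null_comparison[OF always_eventually lim]) auto
  then have "(\<lambda>N. L2_inner f g - (L2_inner f g - (\<Sum>k<N. cf f k * cnj (cf g k)))) \<longlonglongrightarrow> L2_inner f g - 0"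
    by (intro tendsto_intros)
  then show ?thesis unfolding sums_def by simp
qed

lemma Parseval_norm:
  assumes f: "f \<in> L2"
  shows "(\<lambda>k. (cmod (cf f k))\<^sup>2) sums N2 f"
proof -
  have "(\<lambda>k. Re (cf f k * cnj (cf f k))) sums Re (L2_inner f f)"
    by (intro sums_Re Parseval f)
  moreover have "Re (z * cnj z) = (cmod z)\<^sup>2" for z
    unfolding complex_norm_square[symmetric] by (rule Re_complex_of_real)
  moreover have "Re (L2_inner f f) = N2 f"
    unfolding L2_inner_def N2_def integral_Re[OF L2_integrable_inner[OF f f], symmetric]
    unfolding complex_norm_square[symmetric] by simp
  ultimately show ?thesis by simp
qed

section \<open>Local bounds for Hermite functions\<close>

lemma hf_zero_Suc_Suc: "(hf (Suc (Suc n)) 0)\<^sup>2 = real (n + 1) / real (n + 2) * (hf n 0)\<^sup>2"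
  by (simp add: hf.simps power_divide power_mult_distrib)

text \<open>The recursion at 0 multiplies the square by (n+1)/(n+2), and sqrt ((n+1)(n+3)) \<le> n+2
  makes the bound stable under this.\<close>

lemma hf_zero_bound: "(hf n 0)\<^sup>2 \<le> 1 / sqrt (real (n + 1))"
proof (induction n rule: induct_nat_012)
  case 0
  have "1 \<le> sqrt pi" using pi_gt3 by simp
  then show ?case by (simp add: hf.simps power_divide)
next
  case 1
  show ?case by (simp add: hf.simps)
next
  case (ge2 n)
  have "sqrt (real (n + 1)) * sqrt (real (n + 3)) \<le> real (n + 2)"
    unfolding real_sqrt_mult[symmetric] by (intro real_le_lsqrt) (auto simp: power2_eq_square algebra_simps)
  then have *: "sqrt (real (n + 1)) / real (n + 2) \<le> 1 / sqrt (real (n + 3))"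
    by (simp add: field_simps)
  have "(hf (Suc (Suc n)) 0)\<^sup>2 \<le> real (n + 1) / real (n + 2) * (1 / sqrt (real (n + 1)))"
    unfolding hf_zero_Suc_Suc by (intro mult_left_mono ge2) auto
  also have "\<dots> = (real (n + 1) / sqrt (real (n + 1))) / real (n + 2)" by simp
  also have "\<dots> = sqrt (real (n + 1)) / real (n + 2)"
    by (subst real_div_sqrt) auto
  also have "\<dots> \<le> 1 / sqrt (real (n + 3))" by (rule *)
  finally show ?case by (simp add: numeral_eq_Suc)
qed

text \<open>By the oscillator equation this energy has the derivative -2 x h_n(x)^2.\<close>

lemma hf_energy:
  assumes "x \<ge> 0"
  shows "(hfd n x)\<^sup>2 + (2 * real n + 1 - x\<^sup>2) * (hf n x)\<^sup>2 \<le> (hfd n 0)\<^sup>2 + (2 * real n + 1) * (hf n 0)\<^sup>2"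
proof -
  let ?E = "\<lambda>x. (hfd n x)\<^sup>2 + (2 * real n + 1 - x\<^sup>2) * (hf n x)\<^sup>2"
  have "?E x \<le> ?E 0"
  proof (rule DERIV_nonpos_imp_nonincreasing[OF assms], intro exI conjI)
    fix y :: real assume "0 \<le> y" "y \<le> x"
    show "(?E has_real_derivative - 2 * y * (hf n y)\<^sup>2) (at y)"
      by (auto intro!: derivative_eq_intros hf_deriv hfd_deriv simp: power2_eq_square algebra_simps)
    show "- 2 * y * (hf n y)\<^sup>2 \<le> 0" using \<open>0 \<le> y\<close> by simp
  qed
  then show ?thesis by simp
qed

text \<open>On the interval the coefficient 2n+1-x^2 is at least half of 2n+1, so the energy at 0,
  of order sqrt n, controls h_n^2. The constant is 6 = 2 (2 + 1), from the bounds for h_n'(0)^2 and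
  h_n(0)^2.\<close>

lemma hf_local_bound_large:
  assumes x: "\<bar>x\<bar> \<le> R" and n: "2 * R\<^sup>2 \<le> 2 * real n + 1"
  shows "(hf n x)\<^sup>2 \<le> 6 / sqrt (real (n + 1))"
proof -
  define y where "y = \<bar>x\<bar>"
  have hy: "(hf n x)\<^sup>2 = (hf n y)\<^sup>2"
    using hf_minus[of n x] unfolding y_def by (cases "x \<ge> 0") (auto simp: minus_one_power_iff)
  have y0: "y \<ge> 0" "y \<le> R" unfolding y_def using x by auto
  have "y\<^sup>2 \<le> R\<^sup>2" using y0 by (intro power_mono) auto
  then have h: "(2 * real n + 1) / 2 \<le> 2 * real n + 1 - y\<^sup>2" using n by (simp add: field_simps)
  have "(2 * real n + 1) / 2 * (hf n y)\<^sup>2 \<le> (2 * real n + 1 - y\<^sup>2) * (hf n y)\<^sup>2"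
    by (intro mult_right_mono h) auto
  also have "\<dots> \<le> (hfd n 0)\<^sup>2 + (2 * real n + 1) * (hf n 0)\<^sup>2"
    using hf_energy[OF y0(1), of n] zero_le_power2[of "hfd n y"] by linarith
  also have "(hfd n 0)\<^sup>2 \<le> (2 * real n + 1) * (2 / sqrt (real (n + 1)))"
  proof (cases n)
    case 0 then show ?thesis by (simp add: hfd_def)
  next
    case (Suc m)
    have "(hfd n 0)\<^sup>2 = 2 * real n * (hf m 0)\<^sup>2" using Suc by (simp add: hfd_def power_mult_distrib)
    also have "\<dots> \<le> (2 * real n + 1) * (2 / sqrt (real (n + 1)))"
    proof (intro mult_mono)
      have "sqrt (real (n + 1)) \<le> sqrt (4 * real n)" using Suc by (intro real_sqrt_le_mono) auto
      then have "sqrt (real (n + 1)) \<le> 2 * sqrt (real n)" by (simp add: real_sqrt_mult)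
      then have "1 / sqrt (real n) \<le> 2 / sqrt (real (n + 1))" using Suc by (simp add: field_simps)
      moreover have "(hf m 0)\<^sup>2 \<le> 1 / sqrt (real n)" using hf_zero_bound[of m] Suc by simp
      ultimately show "(hf m 0)\<^sup>2 \<le> 2 / sqrt (real (n + 1))" by linarith
    qed auto
    finally show ?thesis .
  qed
  also have "(2 * real n + 1) * (hf n 0)\<^sup>2 \<le> (2 * real n + 1) * (1 / sqrt (real (n + 1)))"
    by (intro mult_left_mono hf_zero_bound) auto
  finally have fin: "(2 * real n + 1) / 2 * (hf n y)\<^sup>2
    \<le> (2 * real n + 1) * (2 / sqrt (real (n + 1))) + (2 * real n + 1) * (1 / sqrt (real (n + 1)))"
    by simp
  have *: "X * h \<le> X * (6 / r)" if "X / 2 * h \<le> X * (2 / r) + X * (1 / r)" for X h r :: real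
  proof -
    have "X * (2 / r) + X * (1 / r) = X * (3 / r)" by (simp add: algebra_simps flip: add_divide_distrib)
    then show ?thesis using that by (simp add: mult.commute)
  qed
  have "(2 * real n + 1) * (hf n y)\<^sup>2 \<le> (2 * real n + 1) * (6 / sqrt (real (n + 1)))"
    by (rule *[OF fin])
  then show ?thesis unfolding hy by (subst (asm) mult_le_cancel_left_pos) auto
qed

text \<open>The finitely many small \<open>n\<close> are covered by compactness and enter the
  constant through a sum. The decay in \<open>n\<close> is what makes point evaluation continuous on
  the form domain.\<close>

lemma hf_local_bound: "\<exists>A>0. \<forall>n x. \<bar>x\<bar> \<le> R \<longrightarrow> (hf n x)\<^sup>2 \<le> A / sqrt (real (n + 1))"
proof -
  have "\<exists>B. \<forall>x\<in>{-R..R}. (hf n x)\<^sup>2 \<le> B" for n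
  proof -
    have "compact ((\<lambda>x. (hf n x)\<^sup>2) ` {-R..R})"
      by (intro compact_continuous_image continuous_intros) auto
    then have "bounded ((\<lambda>x. (hf n x)\<^sup>2) ` {-R..R})" by (rule compact_imp_bounded)
    then show ?thesis unfolding bounded_iff by auto
  qed
  then obtain B where B: "\<And>n x. x \<in> {-R..R} \<Longrightarrow> (hf n x)\<^sup>2 \<le> B n" by metis
  define N where "N = nat \<lceil>2 * R\<^sup>2\<rceil>"
  define A where "A = 6 + (\<Sum>n<N. \<bar>B n\<bar> * sqrt (real (n + 1)))"
  have A6: "A \<ge> 6" unfolding A_def by (auto intro!: sum_nonneg)
  have "(hf n x)\<^sup>2 \<le> A / sqrt (real (n + 1))" if x: "\<bar>x\<bar> \<le> R" for n x
  proof (cases "n < N")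
    case True
    have "\<bar>B n\<bar> * sqrt (real (n + 1)) \<le> (\<Sum>n<N. \<bar>B n\<bar> * sqrt (real (n + 1)))"
      using True by (intro member_le_sum) auto
    then have "\<bar>B n\<bar> \<le> A / sqrt (real (n + 1))" unfolding A_def by (simp add: field_simps)
    then show ?thesis using B[of x n] x by (auto simp: abs_le_iff)
  next
    case False
    then have "2 * R\<^sup>2 \<le> 2 * real n + 1" unfolding N_def by linarith
    from hf_local_bound_large[OF x this] have "(hf n x)\<^sup>2 \<le> 6 / sqrt (real (n + 1))" .
    also have "\<dots> \<le> A / sqrt (real (n + 1))" using A6 by (intro divide_right_mono) auto
    finally show ?thesis .
  qed
  then show ?thesis using A6 by (intro exI[of _ A]) auto
qed

section \<open>The form domain and the operator in Hermite coefficients\<close>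

text \<open>The form of the unperturbed oscillator is the sum of (2k+1) |c_k|^2, so this is the form
  domain in terms of coefficients.\<close>

definition fdom :: "(nat \<Rightarrow> complex) \<Rightarrow> bool" where
  "fdom c \<longleftrightarrow> summable (\<lambda>k. real (k + 1) * (cmod (c k))\<^sup>2)"

text \<open>The sum is pointwise and so produces the continuous representative.\<close>

definition synth :: "(nat \<Rightarrow> complex) \<Rightarrow> real \<Rightarrow> complex" where
  "synth c x = (\<Sum>k. c k * complex_of_real (hf k x))"

section \<open>Pointwise convergence of expansions\<close>

lemma fdom_summable: "fdom c \<Longrightarrow> summable (\<lambda>k. (cmod (c k))\<^sup>2)"
  unfolding fdom_def by (rule summable_comparison_test'[where N = 0]) (auto simp: mult_le_cancel_right1 zero_less_power2)

lemma summable_inverse_3_2: "summable (\<lambda>k. 1 / (real (k + 1) * sqrt (real (k + 1))))"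
proof -
  have "summable (\<lambda>k. real (k + 1) powr (- 3/2))"
    using summable_real_powr_iff[of "- 3/2"] by (subst summable_iff_shift) auto
  moreover have "real (k + 1) powr (- 3/2) = 1 / (real (k + 1) * sqrt (real (k + 1)))" for k
  proof -
    have "real (k + 1) powr (- 3/2) = 1 / (real (k + 1) powr (1 + 1/2))"
      by (simp add: powr_minus_divide)
    also have "real (k + 1) powr (1 + 1/2) = real (k + 1) * sqrt (real (k + 1))"
      unfolding powr_add by (simp add: powr_half_sqrt)
    finally show ?thesis .
  qed
  ultimately show ?thesis by simp
qed

lemma mult_le_half_weighted:
  fixes a b t :: real
  assumes "t > 0"
  shows "a * b \<le> (t * a\<^sup>2 + b\<^sup>2 / t) / 2"
proof -
  have "0 \<le> (t * a - b)\<^sup>2" by simp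
  then have "2 * t * (a * b) \<le> t\<^sup>2 * a\<^sup>2 + b\<^sup>2"
    unfolding power2_diff power_mult_distrib by linarith
  then show ?thesis using assms by (simp add: field_simps power2_eq_square)
qed

text \<open>With weight k+1 in the arithmetic-geometric mean, a term is dominated by (k+1) |c_k|^2
  and h_k^2/(k+1); the latter is O(k^(-3/2)) on compact sets.\<close>

lemma synth_uniform:
  assumes c: "fdom c"
  shows "summable (\<lambda>k. cmod (c k * complex_of_real (hf k x)))"
    and "uniform_limit {-R..R} (\<lambda>n x. psum c n x) (synth c) sequentially"
proof -
  have *: "\<exists>M. summable M \<and> (\<forall>k. \<forall>x\<in>{-R..R}. cmod (c k * complex_of_real (hf k x)) \<le> M k)" for R
  proof -
    obtain A where A: "A > 0" "\<And>n x. \<bar>x\<bar> \<le> R \<Longrightarrow> (hf n x)\<^sup>2 \<le> A / sqrt (real (n + 1))"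
      using hf_local_bound[of R] by blast
    define M where "M k = (real (k + 1) * (cmod (c k))\<^sup>2 + A * (1 / (real (k + 1) * sqrt (real (k + 1))))) / 2" for k
    have "summable M"
      unfolding M_def using c unfolding fdom_def
      by (intro summable_divide summable_add summable_mult summable_inverse_3_2)
    moreover have "cmod (c k * complex_of_real (hf k x)) \<le> M k" if "x \<in> {-R..R}" for k x
    proof -
      have "cmod (c k * complex_of_real (hf k x)) = cmod (c k) * \<bar>hf k x\<bar>" by (simp add: norm_mult)
      also have "\<dots> \<le> (real (k + 1) * (cmod (c k))\<^sup>2 + \<bar>hf k x\<bar>\<^sup>2 / real (k + 1)) / 2"
        by (rule mult_le_half_weighted) simp
      also have "\<bar>hf k x\<bar>\<^sup>2 / real (k + 1) \<le> A / sqrt (real (k + 1)) / real (k + 1)"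
        using A(2)[of x k] that by (intro divide_right_mono) auto
      finally show ?thesis unfolding M_def by (simp add: mult.commute)
    qed
    ultimately show ?thesis by blast
  qed
  obtain M where M: "summable M" "\<And>k y. y \<in> {-\<bar>x\<bar>..\<bar>x\<bar>} \<Longrightarrow> cmod (c k * complex_of_real (hf k y)) \<le> M k"
    using *[of "\<bar>x\<bar>"] by blast
  show "summable (\<lambda>k. cmod (c k * complex_of_real (hf k x)))"
    by (rule summable_comparison_test'[OF M(1), of 0]) (use M(2)[of x] in \<open>auto simp: abs_if split: if_splits\<close>)
  obtain M where M: "summable M" "\<And>k y. y \<in> {-R..R} \<Longrightarrow> cmod (c k * complex_of_real (hf k y)) \<le> M k"
    using *[of R] by blast
  show "uniform_limit {-R..R} (\<lambda>n x. psum c n x) (synth c) sequentially"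
    unfolding psum_def[abs_def] synth_def[abs_def]
    by (rule Weierstrass_m_test[OF M(2) M(1)])
qed

lemma synth_sums: "fdom c \<Longrightarrow> (\<lambda>k. c k * complex_of_real (hf k x)) sums synth c x"
  unfolding synth_def by (rule summable_sums, rule summable_norm_cancel, rule synth_uniform(1))

lemma synth_continuous:
  assumes "fdom c"
  shows "continuous_on UNIV (synth c)"
proof -
  have p: "continuous_on {-R..R} (psum c n)" for R n
    unfolding psum_def[abs_def] by (intro continuous_intros)
  have *: "continuous_on {-R..R} (synth c)" for R
    by (rule uniform_limit_theorem[OF always_eventually[OF allI[OF p]] synth_uniform(2)[OF assms]]) simp
  have "isCont (synth c) x" for x
    by (rule continuous_on_interior[OF *[of "\<bar>x\<bar> + 1"]]) (auto simp: abs_if)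
  then show ?thesis by (simp add: continuous_on_eq_continuous_at)
qed

lemma synth_L2:
  assumes "fdom c"
  shows "synth c \<in> L2" "cf (synth c) k = c k"
proof -
  have m: "synth c \<in> borel_measurable borel"
    by (intro borel_measurable_continuous_onI synth_continuous assms)
  have lim: "AE x in lborel. (\<lambda>j. psum c j x) \<longlonglongrightarrow> synth c x"
    using synth_sums[OF assms] unfolding sums_def psum_def by (intro AE_I2)
  show "synth c \<in> L2" "cf (synth c) k = c k"
    using psum_limit[OF fdom_summable[OF assms] m filterlim_ident lim] by auto
qed

text \<open>Continuous functions that differ at a point differ on an interval, which has positive
  measure. This identifies the representative in \<open>form_domain\<close> with the pointwise
  series.\<close>

lemma AE_eq_continuous:
  fixes f g :: "real \<Rightarrow> complex"
  assumes f: "continuous_on UNIV f" and g: "continuous_on UNIV g" and eq: "L2_eq f g"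
  shows "f x = g x"
proof (rule ccontr)
  assume neq: "f x \<noteq> g x"
  have op: "open {y. f y \<noteq> g y}"
    by (intro open_Collect_neq f g)
  then obtain e where e: "e > 0" "ball x e \<subseteq> {y. f y \<noteq> g y}"
    using neq by (auto simp: open_contains_ball)
  then have sub: "{x<..<x + e} \<subseteq> {y. f y \<noteq> g y}" 
  proof -
    have "{x<..<x + e} \<subseteq> ball x e" by (auto simp: dist_real_def)
    then show ?thesis using e(2) by blast
  qed
  have "emeasure lborel {y. f y \<noteq> g y} = 0"
    using eq op unfolding L2_eq_def by (subst (asm) AE_iff_measurable[where N = "{y. f y \<noteq> g y}"]) auto
  moreover have "emeasure lborel {x<..<x + e} \<le> emeasure lborel {y. f y \<noteq> g y}"
    using sub op by (intro emeasure_mono) auto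
  ultimately show False using e(1) by simp
qed

lemma synth_cf:
  assumes f: "f \<in> L2" "continuous_on UNIV f" and d: "fdom (cf f)"
  shows "f x = synth (cf f) x"
proof -
  have "L2_eq f (synth (cf f))"
    by (rule hermite_unique[OF f(1) synth_L2(1)[OF d]]) (simp add: synth_L2(2)[OF d])
  then show ?thesis by (rule AE_eq_continuous[OF f(2) synth_continuous[OF d]])
qed

lemma integral_vderiv_UNIV:
  fixes F f :: "real \<Rightarrow> complex"
  assumes "\<And>x. (F has_vector_derivative f x) (at x)" "continuous_on UNIV f" "integrable lborel f"
    and "(F \<longlongrightarrow> A) at_bot" "(F \<longlongrightarrow> B) at_top"
  shows "(LINT x|lborel. f x) = B - A"
proof -
  have "(LBINT x=-\<infinity>..\<infinity>. f x) = B - A"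
    by (rule interval_integral_FTC_integrable[where F = F])
       (use assms in \<open>auto simp: ereal_tendsto_simps set_integrable_def continuous_on_eq_continuous_at\<close>)
  then show ?thesis by (simp add: interval_lebesgue_integral_def set_lebesgue_integral_def)
qed

section \<open>Cut-off functions\<close>

lemma integrable_compact_support:
  fixes f :: "real \<Rightarrow> 'a :: {banach, second_countable_topology}"
  assumes f: "continuous_on UNIV f" and R: "\<And>x. \<bar>x\<bar> > R \<Longrightarrow> f x = 0"
  shows "integrable lborel f"
proof -
  have "integrable lborel (\<lambda>x. indicator {-R..R} x *\<^sub>R f x)"
    by (rule borel_integrable_compact) (auto intro: continuous_on_subset[OF f])
  also have "(\<lambda>x. indicator {-R..R} x *\<^sub>R f x) = f"
    using R by (auto simp: fun_eq_iff indicator_def abs_if split: if_splits)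
  finally show ?thesis .
qed

lemma L2_compact_support:
  assumes f: "continuous_on UNIV f" and R: "\<And>x. \<bar>x\<bar> > R \<Longrightarrow> f x = 0"
  shows "f \<in> L2"
proof (rule L2I)
  show "f \<in> borel_measurable borel" by (rule borel_measurable_continuous_onI[OF f])
  show "integrable lborel (\<lambda>x. (cmod (f x))\<^sup>2)"
    by (rule integrable_compact_support[where R = R]) (auto intro!: continuous_intros f simp: R)
qed

lemma square_pos_part_deriv: "((\<lambda>y::real. (max 0 y)\<^sup>2) has_real_derivative 2 * max 0 y) (at y)"
proof -
  consider "y < 0" | "y > 0" | "y = 0" by linarith
  then show ?thesis
  proof cases
    case 1
    have "eventually (\<lambda>z. z \<in> {..<0}) (nhds y)" using 1 by (intro eventually_nhds_in_open) auto
    then have "eventually (\<lambda>z. (max 0 z)\<^sup>2 = 0) (nhds y)" by eventually_elim (simp add: max_def)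
    then have "((\<lambda>y. (max 0 y)\<^sup>2) has_real_derivative 0) (at y) \<longleftrightarrow> ((\<lambda>y. 0) has_real_derivative 0) (at y)"
      by (intro DERIV_cong_ev refl)
    then show ?thesis using 1 by (simp add: max_def)
  next
    case 2
    have "eventually (\<lambda>z. (max 0 z)\<^sup>2 = z\<^sup>2) (nhds y)"
    proof -
      have "eventually (\<lambda>z. z \<in> {0<..}) (nhds y)" using 2 by (intro eventually_nhds_in_open) auto
      then show ?thesis by eventually_elim (simp add: max_def)
    qed
    then have "((\<lambda>y. (max 0 y)\<^sup>2) has_real_derivative 2 * y) (at y) \<longleftrightarrow> ((\<lambda>y. y\<^sup>2) has_real_derivative 2 * y) (at y)"
      by (intro DERIV_cong_ev refl)
    then show ?thesis using 2 by (auto intro!: derivative_eq_intros simp: max_def)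
  next
    case 3
    have "((\<lambda>h. ((max 0 (y + h))\<^sup>2 - (max 0 y)\<^sup>2) / h) \<longlongrightarrow> 0) (at 0)"
    proof (rule Lim_null_comparison)
      show "((\<lambda>h::real. \<bar>h\<bar>) \<longlongrightarrow> 0) (at 0)" by (rule tendsto_rabs_zero) (rule tendsto_ident_at)
      show "\<forall>\<^sub>F h in at 0. norm (((max 0 (y + h))\<^sup>2 - (max 0 y)\<^sup>2) / h) \<le> \<bar>h\<bar>"
        using 3 by (intro always_eventually) (auto simp: max_def power2_eq_square)
    qed
    then show ?thesis using 3 by (simp add: DERIV_def)
  qed
qed

text \<open>The truncated parabola is squared to make it continuously differentiable, as the test
  functions of \<open>has_weak_deriv\<close> must be.\<close>

definition cutf :: "nat \<Rightarrow> real \<Rightarrow> real" where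
  "cutf m x = (max 0 (1 - (x / real (Suc m))\<^sup>2))\<^sup>2"

definition cutd :: "nat \<Rightarrow> real \<Rightarrow> real" where
  "cutd m x = - 4 * x / (real (Suc m))\<^sup>2 * max 0 (1 - (x / real (Suc m))\<^sup>2)"

lemma cut_deriv: "(cutf m has_real_derivative cutd m x) (at x)"
proof -
  have "((\<lambda>x. 1 - (x / real (Suc m))\<^sup>2) has_real_derivative - (2 * x / (real (Suc m))\<^sup>2)) (at x)"
    by (auto intro!: derivative_eq_intros simp: power2_eq_square)
  from DERIV_chain2[OF square_pos_part_deriv this]
  show ?thesis unfolding cutf_def[abs_def] cutd_def by (simp add: algebra_simps)
qed

lemma cut_bound: "0 \<le> cutf m x" "cutf m x \<le> 1"
  unfolding cutf_def by (auto intro!: power_le_one)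

lemma cutd_bound: "\<bar>cutd m x\<bar> \<le> 4 * \<bar>x\<bar> / (real (Suc m))\<^sup>2"
proof -
  have "\<bar>max 0 (1 - (x / real (Suc m))\<^sup>2)\<bar> \<le> 1" by auto
  then have "4 * \<bar>x\<bar> / (real (Suc m))\<^sup>2 * \<bar>max 0 (1 - (x / real (Suc m))\<^sup>2)\<bar> \<le> 4 * \<bar>x\<bar> / (real (Suc m))\<^sup>2 * 1"
    by (intro mult_left_mono) auto
  then show ?thesis unfolding cutd_def by (simp add: abs_mult)
qed

lemma cut_tendsto: "(\<lambda>m. cutf m x) \<longlonglongrightarrow> 1"
proof -
  have "(\<lambda>m. x / real (Suc m)) \<longlonglongrightarrow> 0"
    using LIMSEQ_Suc[OF lim_const_over_n[of x]] by simp
  then have "(\<lambda>m. (max 0 (1 - (x / real (Suc m))\<^sup>2))\<^sup>2) \<longlonglongrightarrow> (max 0 (1 - 0\<^sup>2))\<^sup>2"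
    by (intro tendsto_intros)
  then show ?thesis unfolding cutf_def by simp
qed

lemma cutd_tendsto: "(\<lambda>m. cutd m x) \<longlonglongrightarrow> 0"
proof (rule Lim_null_comparison)
  show "\<forall>\<^sub>F m in sequentially. norm (cutd m x) \<le> 4 * \<bar>x\<bar> / (real (Suc m))\<^sup>2"
    using cutd_bound by simp
  show "(\<lambda>m. 4 * \<bar>x\<bar> / (real (Suc m))\<^sup>2) \<longlonglongrightarrow> 0" by real_asymp
qed

lemma cut_outside: "\<bar>x\<bar> > real (Suc m) \<Longrightarrow> cutf m x = 0"
proof -
  assume "\<bar>x\<bar> > real (Suc m)"
  then have "1 \<le> \<bar>x / real (Suc m)\<bar>" by (simp add: field_simps)
  then have "1 \<le> \<bar>x / real (Suc m)\<bar>\<^sup>2" by (rule one_le_power)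
  then have "1 \<le> (x / real (Suc m))\<^sup>2" unfolding power2_abs .
  then show ?thesis unfolding cutf_def by (simp add: max_def)
qed

lemma continuous_on_cut [continuous_intros]: "continuous_on A (cutf m)"
  unfolding cutf_def[abs_def] by (intro continuous_intros) auto

lemma continuous_on_cutd [continuous_intros]: "continuous_on A (cutd m)"
  unfolding cutd_def[abs_def] by (intro continuous_intros) auto

lemma cut_measurable [measurable]: "cutf m \<in> borel_measurable borel" "cutd m \<in> borel_measurable borel"
  by (intro borel_measurable_continuous_onI continuous_intros)+

section \<open>Weak derivatives and ladder operators\<close>

lemma has_weak_derivD:
  assumes "has_weak_deriv f g" "\<And>x. (\<phi> has_vector_derivative \<phi>' x) (at x)" "continuous_on UNIV \<phi>'"
    "\<And>x. \<bar>x\<bar> > R \<Longrightarrow> \<phi> x = 0"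
  shows "(LINT x|lborel. f x * \<phi>' x) = - (LINT x|lborel. g x * \<phi> x)"
proof -
  have "\<exists>R. \<forall>x. \<bar>x\<bar> > R \<longrightarrow> \<phi> x = 0" using assms(4) by blast
  with assms(1)[unfolded has_weak_deriv_def, THEN spec[of _ \<phi>], THEN spec[of _ \<phi>']] assms(2,3)
  show ?thesis by simp
qed

lemma hf_cutf_deriv: "((\<lambda>x. hf k x * cutf m x) has_real_derivative hfd k x * cutf m x + hf k x * cutd m x) (at x)"
  using DERIV_mult[OF hf_deriv[of k x] cut_deriv[of m x]] by (simp add: algebra_simps)

text \<open>A majorant independent of \<open>m\<close>, for the removal of the cut-off by dominated
  convergence.\<close>

lemma hf_cutf_deriv_bound: "\<bar>hfd k x * cutf m x + hf k x * cutd m x\<bar> \<le> \<bar>hfd k x\<bar> + 4 * \<bar>x * hf k x\<bar>"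
proof -
  have c: "\<bar>cutd m x\<bar> \<le> 4 * \<bar>x\<bar>"
  proof (rule order_trans[OF cutd_bound])
    have "1 \<le> (real (Suc m))\<^sup>2" by simp
    then show "4 * \<bar>x\<bar> / (real (Suc m))\<^sup>2 \<le> 4 * \<bar>x\<bar>"
      using divide_left_mono[of 1 "(real (Suc m))\<^sup>2" "4 * \<bar>x\<bar>"] by simp
  qed
  have "\<bar>hfd k x * cutf m x + hf k x * cutd m x\<bar> \<le> \<bar>hfd k x * cutf m x\<bar> + \<bar>hf k x * cutd m x\<bar>"
    by (rule abs_triangle_ineq)
  also have "\<dots> = \<bar>hfd k x\<bar> * cutf m x + \<bar>hf k x\<bar> * \<bar>cutd m x\<bar>"
    using cut_bound(1)[of m x] by (simp only: abs_mult abs_of_nonneg)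
  also have "\<dots> \<le> \<bar>hfd k x\<bar> * 1 + \<bar>hf k x\<bar> * (4 * \<bar>x\<bar>)"
    by (intro add_mono mult_left_mono cut_bound c abs_ge_zero)
  also have "\<dots> = \<bar>hfd k x\<bar> + 4 * \<bar>x * hf k x\<bar>" by (simp add: abs_mult)
  finally show ?thesis .
qed

text \<open>The weak derivative may be tested against \<open>h\<^sub>k\<close>, by truncation.\<close>

lemma cf_weak_deriv:
  assumes f: "f \<in> L2" and g: "g \<in> L2" and w: "has_weak_deriv f g"
  shows "cf g k = - (LINT x|lborel. f x * complex_of_real (hfd k x))"
proof -
  note [measurable] = L2_measurable[OF f] L2_measurable[OF g]
  define d where "d m x = hfd k x * cutf m x + hf k x * cutd m x" for m x
  define p where "p m x = hf k x * cutf m x" for m x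
  have d_cont: "continuous_on UNIV (d m)" for m
    unfolding d_def[abs_def] by (intro continuous_intros)
  have [measurable]: "d m \<in> borel_measurable borel" "p m \<in> borel_measurable borel" for m
    unfolding d_def[abs_def] p_def[abs_def] by measurable
  have eq: "(LINT x|lborel. f x * complex_of_real (d m x)) = - (LINT x|lborel. g x * complex_of_real (p m x))" for m
  proof (rule has_weak_derivD[OF w, where R = "real (Suc m)"])
    show "((\<lambda>x. complex_of_real (p m x)) has_vector_derivative complex_of_real (d m x)) (at x)" for x
      unfolding p_def d_def by (rule has_vector_derivative_of_real[OF hf_cutf_deriv])
    show "continuous_on UNIV (\<lambda>x. complex_of_real (d m x))"
      by (rule continuous_on_of_real[OF d_cont])
    show "complex_of_real (p m x) = 0" if "\<bar>x\<bar> > real (Suc m)" for x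
      unfolding p_def using cut_outside[OF that] by simp
  qed
  have dl: "(\<lambda>m. d m x) \<longlonglongrightarrow> hfd k x" for x
  proof -
    have "(\<lambda>m. d m x) \<longlonglongrightarrow> hfd k x * 1 + hf k x * 0"
      unfolding d_def by (intro tendsto_intros cut_tendsto cutd_tendsto)
    then show ?thesis by simp
  qed
  have pl: "(\<lambda>m. p m x) \<longlonglongrightarrow> hf k x" for x
  proof -
    have "(\<lambda>m. p m x) \<longlonglongrightarrow> hf k x * 1"
      unfolding p_def by (intro tendsto_intros cut_tendsto)
    then show ?thesis by simp
  qed
  have l1: "(\<lambda>m. LINT x|lborel. f x * complex_of_real (d m x)) \<longlonglongrightarrow> (LINT x|lborel. f x * complex_of_real (hfd k x))"
  proof (rule integral_dominated_convergence)
    show "integrable lborel (\<lambda>x. cmod (f x * complex_of_real (hfd k x)) + 4 * cmod (f x * complex_of_real (x * hf k x)))"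
      by (intro Bochner_Integration.integrable_add integrable_mult_right integrable_norm L2_integrable_mult f L2_hfd L2_x_hf)
    show "AE x in lborel. (\<lambda>m. f x * complex_of_real (d m x)) \<longlonglongrightarrow> f x * complex_of_real (hfd k x)"
      by (intro AE_I2 tendsto_mult tendsto_const tendsto_of_real dl)
    have "cmod (f x * complex_of_real (d m x)) \<le> cmod (f x * complex_of_real (hfd k x)) + 4 * cmod (f x * complex_of_real (x * hf k x))" for m x
    proof -
      have "cmod (f x) * \<bar>d m x\<bar> \<le> cmod (f x) * (\<bar>hfd k x\<bar> + 4 * \<bar>x * hf k x\<bar>)"
        unfolding d_def by (intro mult_left_mono hf_cutf_deriv_bound norm_ge_zero)
      then show ?thesis unfolding norm_mult norm_of_real by (simp only: distrib_left mult.left_commute)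
    qed
    then show "AE x in lborel. norm (f x * complex_of_real (d m x)) \<le> cmod (f x * complex_of_real (hfd k x)) + 4 * cmod (f x * complex_of_real (x * hf k x))" for m
      by (intro AE_I2)
    show "(\<lambda>x. f x * complex_of_real (hfd k x)) \<in> borel_measurable lborel" by measurable
    show "(\<lambda>x. f x * complex_of_real (d m x)) \<in> borel_measurable lborel" for m by measurable
  qed
  have l2: "(\<lambda>m. LINT x|lborel. g x * complex_of_real (p m x)) \<longlonglongrightarrow> (LINT x|lborel. g x * complex_of_real (hf k x))"
  proof (rule integral_dominated_convergence)
    show "integrable lborel (\<lambda>x. cmod (g x * complex_of_real (hf k x)))"
      by (intro integrable_norm L2_integrable_mult g L2_hf)
    show "AE x in lborel. (\<lambda>m. g x * complex_of_real (p m x)) \<longlonglongrightarrow> g x * complex_of_real (hf k x)"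
      by (intro AE_I2 tendsto_mult tendsto_const tendsto_of_real pl)
    have "cmod (g x * complex_of_real (p m x)) \<le> cmod (g x * complex_of_real (hf k x))" for m x
    proof -
      have "\<bar>p m x\<bar> = \<bar>hf k x\<bar> * cutf m x"
        using cut_bound(1)[of m x] unfolding p_def by (simp only: abs_mult abs_of_nonneg)
      also have "\<dots> \<le> \<bar>hf k x\<bar> * 1"
        by (intro mult_left_mono cut_bound abs_ge_zero)
      finally show ?thesis unfolding norm_mult norm_of_real by (intro mult_left_mono) auto
    qed
    then show "AE x in lborel. norm (g x * complex_of_real (p m x)) \<le> cmod (g x * complex_of_real (hf k x))" for m
      by (intro AE_I2)
    show "(\<lambda>x. g x * complex_of_real (hf k x)) \<in> borel_measurable lborel" by measurable
    show "(\<lambda>x. g x * complex_of_real (p m x)) \<in> borel_measurable lborel" for m by measurable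
  qed
  have "(LINT x|lborel. f x * complex_of_real (hfd k x)) = - cf g k"
    using LIMSEQ_unique[OF l1[unfolded eq] tendsto_minus[OF l2]] unfolding cf_def .
  then show ?thesis by simp
qed

lemma integral_hfd:
  assumes f: "f \<in> L2"
  shows "(LINT x|lborel. f x * complex_of_real (hfd k x))
    = (complex_of_real (sqrt (2 * real k)) * cf f (k - 1) - complex_of_real (sqrt (2 * real (k + 1))) * cf f (k + 1)) / 2"
proof -
  have i: "integrable lborel (\<lambda>x. f x * complex_of_real (hf j x))" for j
    by (rule L2_integrable_mult[OF f L2_hf])
  have "(LINT x|lborel. f x * complex_of_real (hfd k x)) = (LINT x|lborel. (complex_of_real (sqrt (2 * real k)) * (f x * complex_of_real (hf (k - 1) x)) - complex_of_real (sqrt (2 * real (k + 1))) * (f x * complex_of_real (hf (k + 1) x))) / 2)"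
    unfolding hfd_alt by (intro Bochner_Integration.integral_cong refl) (simp add: algebra_simps)
  also have "\<dots> = ((LINT x|lborel. complex_of_real (sqrt (2 * real k)) * (f x * complex_of_real (hf (k - 1) x))) - (LINT x|lborel. complex_of_real (sqrt (2 * real (k + 1))) * (f x * complex_of_real (hf (k + 1) x)))) / 2"
    by (subst integral_divide_zero, subst Bochner_Integration.integral_diff) (intro integrable_mult_right i refl)+
  finally show ?thesis unfolding cf_def by (simp only: integral_mult_right_zero)
qed

lemma cf_x_mult:
  assumes f: "f \<in> L2"
  shows "cf (\<lambda>x. complex_of_real x * f x) k
    = (complex_of_real (sqrt (2 * real k)) * cf f (k - 1) + complex_of_real (sqrt (2 * real (k + 1))) * cf f (k + 1)) / 2"
proof -
  have i: "integrable lborel (\<lambda>x. f x * complex_of_real (hf j x))" for j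
    by (rule L2_integrable_mult[OF f L2_hf])
  have e: "complex_of_real x * f x * complex_of_real (hf k x) = f x * complex_of_real (x * hf k x)" for x by simp
  have "cf (\<lambda>x. complex_of_real x * f x) k = (LINT x|lborel. (complex_of_real (sqrt (2 * real k)) * (f x * complex_of_real (hf (k - 1) x)) + complex_of_real (sqrt (2 * real (k + 1))) * (f x * complex_of_real (hf (k + 1) x))) / 2)"
    unfolding cf_def e x_hf by (intro Bochner_Integration.integral_cong refl) (simp add: algebra_simps)
  also have "\<dots> = ((LINT x|lborel. complex_of_real (sqrt (2 * real k)) * (f x * complex_of_real (hf (k - 1) x))) + (LINT x|lborel. complex_of_real (sqrt (2 * real (k + 1))) * (f x * complex_of_real (hf (k + 1) x)))) / 2"
    by (subst integral_divide_zero, subst Bochner_Integration.integral_add) (intro integrable_mult_right i refl)+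
  finally show ?thesis unfolding cf_def by (simp only: integral_mult_right_zero)
qed

text \<open>The operators d/dx + x and d/dx - x shift the index with a single weight, whereas d/dx
  and x separately mix two neighbours.\<close>

lemma cf_ladder:
  assumes f: "f \<in> L2" and xf: "(\<lambda>x. complex_of_real x * f x) \<in> L2" and g: "g \<in> L2" and w: "has_weak_deriv f g"
  shows "cf (\<lambda>x. g x + complex_of_real x * f x) k = complex_of_real (sqrt (2 * real (k + 1))) * cf f (k + 1)"
    and "cf (\<lambda>x. g x - complex_of_real x * f x) k = - (complex_of_real (sqrt (2 * real k)) * cf f (k - 1))"
  unfolding cf_add[OF g xf] cf_diff[OF g xf] cf_x_mult[OF f] cf_weak_deriv[OF f g w] integral_hfd[OF f]
  by (simp_all add: field_simps)

lemma form_domainD: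
  assumes "f \<in> form_domain"
  shows "f \<in> L2" "continuous_on UNIV f" "(\<lambda>x. complex_of_real x * f x) \<in> L2"
    "weak_deriv f \<in> L2" "has_weak_deriv f (weak_deriv f)"
proof -
  show "f \<in> L2" "continuous_on UNIV f" "(\<lambda>x. complex_of_real x * f x) \<in> L2"
    using assms unfolding form_domain_def H1_def by auto
  have "\<exists>g. g \<in> L2 \<and> has_weak_deriv f g" using assms unfolding form_domain_def H1_def by auto
  then have "weak_deriv f \<in> L2 \<and> has_weak_deriv f (weak_deriv f)"
    unfolding weak_deriv_def by (rule someI_ex)
  then show "weak_deriv f \<in> L2" "has_weak_deriv f (weak_deriv f)" by auto
qed

lemma of_real_sqrt_mult_self: "y \<ge> 0 \<Longrightarrow> complex_of_real (sqrt y) * complex_of_real (sqrt y) = complex_of_real y"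
  by (metis of_real_mult real_sqrt_mult_self abs_of_nonneg)

text \<open>Bessel's inequality for f' + x f, whose k-th coefficient is sqrt (2(k+1)) times the next
  coefficient of f.\<close>

lemma form_domain_fdom:
  assumes f: "f \<in> form_domain"
  shows "fdom (cf f)"
proof -
  note d = form_domainD[OF f]
  have "summable (\<lambda>k. (cmod (cf (\<lambda>x. weak_deriv f x + complex_of_real x * f x) k))\<^sup>2)"
    by (intro Bessel L2_add d)
  also have "(\<lambda>k. (cmod (cf (\<lambda>x. weak_deriv f x + complex_of_real x * f x) k))\<^sup>2)
     = (\<lambda>k. 2 * real (k + 1) * (cmod (cf f (k + 1)))\<^sup>2)"
    unfolding cf_ladder(1)[OF d(1,3,4,5)] norm_mult power_mult_distrib norm_of_real power2_abs
    by (simp add: fun_eq_iff)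
  finally have "summable (\<lambda>k. 2 * real (k + 1) * (cmod (cf f (k + 1)))\<^sup>2)" .
  then have "summable (\<lambda>k. real (Suc k + 1) * (cmod (cf f (Suc k)))\<^sup>2)"
    by (rule summable_comparison_test'[where N = 0]) (simp add: mult_right_mono)
  then show ?thesis unfolding fdom_def by (subst (asm) summable_Suc_iff)
qed

text \<open>A polarised parallelogram identity: twice the integrand is the sum of the products
  formed with f' + x f and with f' - x f. Their weights 2k and 2(k+1) average to 2k+1.\<close>

lemma form_sums:
  assumes f: "f \<in> form_domain" and v: "v \<in> form_domain"
  shows "(\<lambda>k. of_nat (2 * k + 1) * cf f k * cnj (cf v k)) sums
    (LINT x|lborel. weak_deriv f x * cnj (weak_deriv v x) + complex_of_real (x\<^sup>2) * (f x * cnj (v x)))"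
proof -
  note d = form_domainD[OF f] and e = form_domainD[OF v]
  let ?p = "\<lambda>f x. weak_deriv f x + complex_of_real x * f x" and ?m = "\<lambda>f x. weak_deriv f x - complex_of_real x * f x"
  have L: "?p f \<in> L2" "?m f \<in> L2" "?p v \<in> L2" "?m v \<in> L2"
    by (intro L2_add L2_diff d e)+
  define a where "a k = complex_of_real (2 * real k) * cf f k * cnj (cf v k)" for k
  define c where "c k = complex_of_real (2 * real (k + 1)) * cf f k * cnj (cf v k)" for k
  have "(\<lambda>k. cf (?p f) k * cnj (cf (?p v) k)) sums L2_inner (?p f) (?p v)"
    by (rule Parseval[OF L(1,3)])
  also have "(\<lambda>k. cf (?p f) k * cnj (cf (?p v) k)) = (\<lambda>k. a (Suc k))"
  proof
    fix k
    have "cf (?p f) k * cnj (cf (?p v) k) = (complex_of_real (sqrt (2 * real (k + 1))) * complex_of_real (sqrt (2 * real (k + 1)))) * cf f (k + 1) * cnj (cf v (k + 1))"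
      unfolding cf_ladder(1)[OF d(1,3,4,5)] cf_ladder(1)[OF e(1,3,4,5)] by simp
    then show "cf (?p f) k * cnj (cf (?p v) k) = a (Suc k)"
      unfolding a_def by (subst (asm) of_real_sqrt_mult_self) auto
  qed
  \<comment> \<open>The shift by one costs nothing because the term at 0 carries the factor
    0.\<close>
  finally have A: "a sums L2_inner (?p f) (?p v)"
    by (subst (asm) sums_Suc_iff) (simp add: a_def)
  have "(\<lambda>k. cf (?m f) k * cnj (cf (?m v) k)) sums L2_inner (?m f) (?m v)"
    by (rule Parseval[OF L(2,4)])
  moreover have mm: "cf (?m f) k * cnj (cf (?m v) k) = complex_of_real (2 * real k) * cf f (k - 1) * cnj (cf v (k - 1))" for k
  proof -
    have "cf (?m f) k * cnj (cf (?m v) k) = (complex_of_real (sqrt (2 * real k)) * complex_of_real (sqrt (2 * real k))) * cf f (k - 1) * cnj (cf v (k - 1))"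
      unfolding cf_ladder(2)[OF d(1,3,4,5)] cf_ladder(2)[OF e(1,3,4,5)] by simp
    then show ?thesis by (subst (asm) of_real_sqrt_mult_self) auto
  qed
  ultimately have "(\<lambda>k. complex_of_real (2 * real k) * cf f (k - 1) * cnj (cf v (k - 1))) sums L2_inner (?m f) (?m v)"
    by simp
  then have "(\<lambda>k. complex_of_real (2 * real (Suc k)) * cf f (Suc k - 1) * cnj (cf v (Suc k - 1))) sums L2_inner (?m f) (?m v)"
    by (subst sums_Suc_iff) simp
  then have C: "c sums L2_inner (?m f) (?m v)"
    unfolding c_def[abs_def] by simp
  have S: "(\<lambda>k. (a k + c k) / 2) sums ((L2_inner (?p f) (?p v) + L2_inner (?m f) (?m v)) / 2)"
    by (intro sums_divide sums_add A C)
  have "L2_inner (?p f) (?p v) + L2_inner (?m f) (?m v)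
     = (LINT x|lborel. ?p f x * cnj (?p v x) + ?m f x * cnj (?m v x))"
    unfolding L2_inner_def by (intro Bochner_Integration.integral_add[symmetric] L2_integrable_inner L)
  also have "\<dots> = (LINT x|lborel. 2 * (weak_deriv f x * cnj (weak_deriv v x) + complex_of_real (x\<^sup>2) * (f x * cnj (v x))))"
    by (intro Bochner_Integration.integral_cong refl) (simp add: algebra_simps power2_eq_square)
  also have "\<dots> = 2 * (LINT x|lborel. weak_deriv f x * cnj (weak_deriv v x) + complex_of_real (x\<^sup>2) * (f x * cnj (v x)))"
    by (rule integral_mult_right_zero)
  finally have "(L2_inner (?p f) (?p v) + L2_inner (?m f) (?m v)) / 2
     = (LINT x|lborel. weak_deriv f x * cnj (weak_deriv v x) + complex_of_real (x\<^sup>2) * (f x * cnj (v x)))"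
    by simp
  moreover have "(a k + c k) / 2 = of_nat (2 * k + 1) * cf f k * cnj (cf v k)" for k
    unfolding a_def c_def by (simp add: algebra_simps add_divide_distrib)
  ultimately show ?thesis using S by simp
qed

section \<open>From coefficients back to the form domain\<close>

lemma summable_real_shift_pred:
  assumes "summable (g :: nat \<Rightarrow> real)"
  shows "summable (\<lambda>k. if k = 0 then 0 else g (k - 1))"
  using assms by (subst summable_Suc_iff[symmetric]) simp

lemma norm_ladder_sq_le:
  fixes y z :: complex
  shows "(cmod ((complex_of_real (sqrt (2 * real k)) * y + complex_of_real (sqrt (2 * real (k + 1))) * z) / 2))\<^sup>2
     \<le> real k * (cmod y)\<^sup>2 + real (k + 1) * (cmod z)\<^sup>2"
proof -
  define p where "p = sqrt (2 * real k) * cmod y"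
  define q where "q = sqrt (2 * real (k + 1)) * cmod z"
  have "cmod (complex_of_real (sqrt (2 * real k)) * y + complex_of_real (sqrt (2 * real (k + 1))) * z) \<le> p + q"
    unfolding p_def q_def by (rule order_trans[OF norm_triangle_ineq]) (simp add: norm_mult)
  then have "(cmod ((complex_of_real (sqrt (2 * real k)) * y + complex_of_real (sqrt (2 * real (k + 1))) * z) / 2))\<^sup>2 \<le> ((p + q) / 2)\<^sup>2"
    by (intro power_mono) (simp_all add: norm_divide)
  also have "\<dots> \<le> (p\<^sup>2 + q\<^sup>2) / 2"
    using zero_le_power2[of "p - q"] by (simp add: power2_eq_square field_simps)
  also have "\<dots> = real k * (cmod y)\<^sup>2 + real (k + 1) * (cmod z)\<^sup>2"
    unfolding p_def q_def power_mult_distrib by (simp add: algebra_simps)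
  finally show ?thesis .
qed

lemma ladder_summable:
  assumes c: "fdom c"
  shows "summable (\<lambda>k. real k * (cmod (c (k - 1)))\<^sup>2 + real (k + 1) * (cmod (c (k + 1)))\<^sup>2)"
proof (intro summable_add)
  have "summable (\<lambda>k. if k = 0 then 0 else (\<lambda>k. real (k + 1) * (cmod (c k))\<^sup>2) (k - 1))"
    using c unfolding fdom_def by (rule summable_real_shift_pred)
  also have "(\<lambda>k. if k = 0 then 0 else (\<lambda>k. real (k + 1) * (cmod (c k))\<^sup>2) (k - 1)) = (\<lambda>k. real k * (cmod (c (k - 1)))\<^sup>2)"
    by (auto simp: fun_eq_iff)
  finally show "summable (\<lambda>k. real k * (cmod (c (k - 1)))\<^sup>2)" .
  have "summable (\<lambda>k. real (Suc k + 1) * (cmod (c (Suc k)))\<^sup>2)"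
    using c unfolding fdom_def by (subst summable_Suc_iff)
  then show "summable (\<lambda>k. real (k + 1) * (cmod (c (k + 1)))\<^sup>2)"
    by (rule summable_comparison_test'[where N = 0]) (simp add: mult_right_mono)
qed

text \<open>The partial sums multiplied by x have squared norms below the series of
  \<open>ladder_summable\<close>; Fatou's lemma gives the limit.\<close>

lemma x_synth_L2:
  assumes c: "fdom c"
  shows "(\<lambda>x. complex_of_real x * synth c x) \<in> L2"
proof -
  define B where "B = (\<Sum>k. real k * (cmod (c (k - 1)))\<^sup>2 + real (k + 1) * (cmod (c (k + 1)))\<^sup>2)"
  note sm = ladder_summable[OF c]
  have xp: "(\<lambda>x. complex_of_real x * psum c N x) \<in> L2" for N
  proof -
    have "(\<lambda>x. complex_of_real x * psum c N x) = (\<lambda>x. \<Sum>k<N. c k * complex_of_real (x * hf k x))"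
      unfolding psum_def by (simp add: fun_eq_iff sum_distrib_left mult_ac)
    then show ?thesis by (simp only:) (intro L2_sum L2_cmult L2_x_hf)
  qed
  have bd: "N2 (\<lambda>x. complex_of_real x * psum c N x) \<le> B" for N
  proof (rule sums_le[OF _ Parseval_norm[OF xp] summable_sums[OF sm, folded B_def]])
    fix k
    have "(cmod (cf (\<lambda>x. complex_of_real x * psum c N x) k))\<^sup>2
      \<le> real k * (cmod (cf (psum c N) (k - 1)))\<^sup>2 + real (k + 1) * (cmod (cf (psum c N) (k + 1)))\<^sup>2"
      unfolding cf_x_mult[OF psum_L2] by (rule norm_ladder_sq_le)
    also have "\<dots> \<le> real k * (cmod (c (k - 1)))\<^sup>2 + real (k + 1) * (cmod (c (k + 1)))\<^sup>2"
      unfolding cf_psum by (intro add_mono mult_left_mono) auto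
    finally show "(cmod (cf (\<lambda>x. complex_of_real x * psum c N x) k))\<^sup>2 \<le> real k * (cmod (c (k - 1)))\<^sup>2 + real (k + 1) * (cmod (c (k + 1)))\<^sup>2" .
  qed
  show ?thesis
  proof (rule fatou_L2(1)[where f = "\<lambda>N x. complex_of_real x * psum c N x" and B = B])
    show "(\<lambda>x. complex_of_real x * synth c x) \<in> borel_measurable borel"
      by (intro borel_measurable_continuous_onI continuous_on_mult continuous_on_of_real continuous_on_id synth_continuous c)
    have "(\<lambda>j. psum c j x) \<longlonglongrightarrow> synth c x" for x
      using synth_sums[OF c] unfolding sums_def psum_def .
    then show "AE x in lborel. (\<lambda>j. complex_of_real x * psum c j x) \<longlonglongrightarrow> complex_of_real x * synth c x"
      by (intro AE_I2 tendsto_mult tendsto_const)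
    show "\<forall>\<^sub>F N in sequentially. N2 (\<lambda>x. complex_of_real x * psum c N x) \<le> B"
      using bd by simp
  qed (rule xp)
qed

lemma cf_deriv_compact_support:
  assumes \<phi>: "\<And>x. (\<phi> has_vector_derivative \<phi>' x) (at x)" and c': "continuous_on UNIV \<phi>'"
    and R: "\<And>x. \<bar>x\<bar> > R \<Longrightarrow> \<phi> x = 0"
  shows "\<phi> \<in> L2" "\<phi>' \<in> L2" "cf \<phi>' k = - (LINT x|lborel. \<phi> x * complex_of_real (hfd k x))"
proof -
  have c: "continuous_on UNIV \<phi>"
    using \<phi> by (intro continuous_at_imp_continuous_on ballI has_vector_derivative_continuous)
  have R': "\<phi>' x = 0" if "\<bar>x\<bar> > R" for x
  proof -
    have "open {x. \<bar>x\<bar> > R}" by (intro open_Collect_less continuous_intros)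
    then have ev: "eventually (\<lambda>y. y \<in> {x. \<bar>x\<bar> > R}) (nhds x)" using that by (intro eventually_nhds_in_open) auto
    have "(\<phi> has_vector_derivative 0) (at x)"
    proof (rule has_vector_derivative_transform_within_open[OF _ \<open>open {x. \<bar>x\<bar> > R}\<close>])
      show "((\<lambda>x. 0) has_vector_derivative 0) (at x)" by simp
    qed (use that R in auto)
    then show ?thesis using \<phi>[of x] by (rule vector_derivative_unique_at[rotated])
  qed
  show \<phi>2: "\<phi> \<in> L2" by (rule L2_compact_support[OF c R])
  show \<phi>2': "\<phi>' \<in> L2" by (rule L2_compact_support[OF c' R'])
  have i1: "integrable lborel (\<lambda>x. \<phi>' x * complex_of_real (hf k x))" by (rule L2_integrable_mult[OF \<phi>2' L2_hf])
  have i2: "integrable lborel (\<lambda>x. \<phi> x * complex_of_real (hfd k x))" by (rule L2_integrable_mult[OF \<phi>2 L2_hfd])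
  have "(LINT x|lborel. \<phi>' x * complex_of_real (hf k x) + \<phi> x * complex_of_real (hfd k x)) = 0 - 0"
  proof (rule integral_vderiv_UNIV[where F = "\<lambda>x. \<phi> x * complex_of_real (hf k x)"])
    show "((\<lambda>x. \<phi> x * complex_of_real (hf k x)) has_vector_derivative \<phi>' x * complex_of_real (hf k x) + \<phi> x * complex_of_real (hfd k x)) (at x)" for x
      using has_vector_derivative_mult[OF \<phi>[of x] has_vector_derivative_of_real[OF hf_deriv[of k x]]]
      by (simp add: add.commute)
    show "continuous_on UNIV (\<lambda>x. \<phi>' x * complex_of_real (hf k x) + \<phi> x * complex_of_real (hfd k x))"
      by (intro continuous_on_add continuous_on_mult continuous_on_of_real continuous_on_hf continuous_on_hfd c c' continuous_on_id)
    show "integrable lborel (\<lambda>x. \<phi>' x * complex_of_real (hf k x) + \<phi> x * complex_of_real (hfd k x))"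
      by (rule Bochner_Integration.integrable_add[OF i1 i2])
    show "((\<lambda>x. \<phi> x * complex_of_real (hf k x)) \<longlongrightarrow> 0) at_top"
      by (rule tendsto_eventually, rule eventually_mono[OF eventually_gt_at_top[of "\<bar>R\<bar>"]]) (use R in auto)
    show "((\<lambda>x. \<phi> x * complex_of_real (hf k x)) \<longlongrightarrow> 0) at_bot"
      by (rule tendsto_eventually, rule eventually_mono[OF eventually_gt_at_bot[of "- \<bar>R\<bar>"]]) (use R in auto)
  qed
  then show "cf \<phi>' k = - (LINT x|lborel. \<phi> x * complex_of_real (hfd k x))"
    unfolding cf_def by (simp add: Bochner_Integration.integral_add[OF i1 i2] add_eq_0_iff2)
qed

text \<open>The weak derivative is built from the coefficients that the ladder relations force. Its
  defining identity then compares two Parseval series whose joint partial sums telescope to a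
  boundary term.\<close>

lemma synth_form_domain:
  assumes c: "fdom c"
  shows "synth c \<in> form_domain"
proof -
  define d where "d k = - ((complex_of_real (sqrt (2 * real k)) * c (k - 1) - complex_of_real (sqrt (2 * real (k + 1))) * c (k + 1)) / 2)" for k
  have "summable (\<lambda>k. (cmod (d k))\<^sup>2)"
  proof (rule summable_comparison_test'[OF ladder_summable[OF c], where N = 0])
    show "norm ((cmod (d k))\<^sup>2) \<le> real k * (cmod (c (k - 1)))\<^sup>2 + real (k + 1) * (cmod (c (k + 1)))\<^sup>2" for k
      using norm_ladder_sq_le[of k "c (k - 1)" "- c (k + 1)"] unfolding d_def norm_minus_cancel by simp
  qed
  then obtain G where G: "G \<in> L2" "\<And>k. cf G k = d k"
    by (rule riesz_fischer) (rule that)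
  have "has_weak_deriv (synth c) G"
    unfolding has_weak_deriv_def
  proof (intro allI impI)
    fix \<phi> \<phi>' :: "real \<Rightarrow> complex"
    assume \<phi>: "\<forall>x. (\<phi> has_vector_derivative \<phi>' x) (at x)" "continuous_on UNIV \<phi>'" "\<exists>R. \<forall>x. \<bar>x\<bar> > R \<longrightarrow> \<phi> x = 0"
    then obtain R where R: "\<And>x. \<bar>x\<bar> > R \<Longrightarrow> \<phi> x = 0" by blast
    have \<phi>x: "\<And>x. (\<phi> has_vector_derivative \<phi>' x) (at x)" using \<phi> by blast
    have \<phi>2: "\<phi> \<in> L2" "\<phi>' \<in> L2" "cf \<phi>' k = - (LINT x|lborel. \<phi> x * complex_of_real (hfd k x))" for k
      by (rule cf_deriv_compact_support[where R = R, OF \<phi>x \<phi>(2)], erule R)+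
    have P1: "(\<lambda>k. c k * cf \<phi>' k) sums (LINT x|lborel. synth c x * \<phi>' x)"
      using Parseval[OF synth_L2(1)[OF c] L2_cnj[OF \<phi>2(2)]] unfolding cf_cnj L2_inner_def
      by (simp add: synth_L2(2)[OF c])
    have P2: "(\<lambda>k. d k * cf \<phi> k) sums (LINT x|lborel. G x * \<phi> x)"
      using Parseval[OF G(1) L2_cnj[OF \<phi>2(1)]] unfolding cf_cnj L2_inner_def
      by (simp add: G(2))
    define a where "a k = complex_of_real (sqrt (2 * real (k + 1))) * c k * cf \<phi> (k + 1)" for k
    define e where "e k = complex_of_real (sqrt (2 * real (k + 1))) * c (k + 1) * cf \<phi> k" for k
    have cfd: "cf \<phi>' k = - ((complex_of_real (sqrt (2 * real k)) * cf \<phi> (k - 1) - complex_of_real (sqrt (2 * real (k + 1))) * cf \<phi> (k + 1)) / 2)" for k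
      using \<phi>2(3)[of k] integral_hfd[OF \<phi>2(1), of k] by simp
    have tele: "(\<Sum>k<N. c k * cf \<phi>' k + d k * cf \<phi> k) = (if N = 0 then 0 else (a (N - 1) + e (N - 1)) / 2)" for N
    proof (induction N)
      case (Suc N)
      have "c N * cf \<phi>' N + d N * cf \<phi> N = (a N + e N) / 2 - (if N = 0 then 0 else (a (N - 1) + e (N - 1)) / 2)"
        unfolding cfd[of N] d_def a_def e_def by (cases N) (simp_all add: field_simps)
      then show ?case using Suc by simp
    qed simp
    \<comment> \<open>The boundary term is dominated by the general term of a convergent
      series.\<close>
    have lim0: "(\<lambda>N. (a N + e N) / 2) \<longlonglongrightarrow> 0"
    proof (rule Lim_null_comparison)
      define B where "B k = real (k + 1) * (cmod (c k))\<^sup>2 + (cmod (cf \<phi> (Suc k)))\<^sup>2 + real (Suc k + 1) * (cmod (c (Suc k)))\<^sup>2 + (cmod (cf \<phi> k))\<^sup>2" for k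
      have "summable B"
        unfolding B_def
        by (intro summable_add Bessel \<phi>2(1) c[unfolded fdom_def] iffD2[OF summable_Suc_iff, of "\<lambda>k. real (k + 1) * (cmod (c k))\<^sup>2"] iffD2[OF summable_Suc_iff, of "\<lambda>k. (cmod (cf \<phi> k))\<^sup>2"])
      then show "B \<longlonglongrightarrow> 0" by (rule summable_LIMSEQ_zero)
      have "norm ((a k + e k) / 2) \<le> B k" for k
      proof -
        have g: "sqrt 2 * r * x * y \<le> r\<^sup>2 * x\<^sup>2 + y\<^sup>2" if "r \<ge> 0" "x \<ge> 0" "y \<ge> 0" for r x y :: real
        proof -
          have "sqrt 2 \<le> 2" by (rule real_le_lsqrt) auto
          then have "sqrt 2 * (r * x * y) \<le> 2 * (r * x * y)" using that by (intro mult_right_mono) auto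
          also have "\<dots> \<le> r\<^sup>2 * x\<^sup>2 + y\<^sup>2"
            using zero_le_power2[of "r * x - y"] by (simp add: power2_eq_square algebra_simps)
          finally show ?thesis by (simp add: mult.assoc)
        qed
        have "cmod (a k) \<le> real (k + 1) * (cmod (c k))\<^sup>2 + (cmod (cf \<phi> (Suc k)))\<^sup>2"
          using g[of "sqrt (real (k + 1))" "cmod (c k)" "cmod (cf \<phi> (Suc k))"]
          unfolding a_def sqrt_2_mult by (simp add: norm_mult)
        moreover have "cmod (e k) \<le> real (k + 1) * (cmod (c (Suc k)))\<^sup>2 + (cmod (cf \<phi> k))\<^sup>2"
          using g[of "sqrt (real (k + 1))" "cmod (c (Suc k))" "cmod (cf \<phi> k)"]
          unfolding e_def sqrt_2_mult by (simp add: norm_mult)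
        moreover have "real (k + 1) * (cmod (c (Suc k)))\<^sup>2 \<le> real (Suc k + 1) * (cmod (c (Suc k)))\<^sup>2"
          by (intro mult_right_mono) auto
        moreover have "norm ((a k + e k) / 2) \<le> cmod (a k) + cmod (e k)"
          using norm_triangle_ineq[of "a k" "e k"] norm_ge_zero[of "a k"] norm_ge_zero[of "e k"]
          unfolding norm_divide norm_numeral by linarith
        ultimately show ?thesis unfolding B_def by linarith
      qed
      then show "\<forall>\<^sub>F k in sequentially. norm ((a k + e k) / 2) \<le> B k" by simp
    qed
    have "(\<lambda>N. \<Sum>k<Suc N. c k * cf \<phi>' k + d k * cf \<phi> k) \<longlonglongrightarrow> 0"
      using lim0 unfolding tele by simp
    then have t0: "(\<lambda>N. \<Sum>k<N. c k * cf \<phi>' k + d k * cf \<phi> k) \<longlonglongrightarrow> 0"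
      by (rule LIMSEQ_imp_Suc)
    have t1: "(\<lambda>N. \<Sum>k<N. c k * cf \<phi>' k + d k * cf \<phi> k) \<longlonglongrightarrow> (LINT x|lborel. synth c x * \<phi>' x) + (LINT x|lborel. G x * \<phi> x)"
      using sums_add[OF P1 P2] unfolding sums_def .
    have "(LINT x|lborel. synth c x * \<phi>' x) + (LINT x|lborel. G x * \<phi> x) = 0"
      by (rule LIMSEQ_unique[OF t1 t0])
    then show "(LINT x|lborel. synth c x * \<phi>' x) = - (LINT x|lborel. G x * \<phi> x)"
      by (simp add: add_eq_0_iff2)
  qed
  then show ?thesis
    unfolding form_domain_def H1_def using synth_L2(1)[OF c] synth_continuous[OF c] x_synth_L2[OF c] G(1) by auto
qed

section \<open>The operator in coefficients\<close>

lemma fdom_delta: "fdom (\<lambda>j. if j = k then 1 else 0)"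
  unfolding fdom_def by (rule summable_finite[of "{k}"]) auto

lemma synth_delta: "synth (\<lambda>j. if j = k then 1 else 0) = (\<lambda>x. complex_of_real (hf k x))"
proof
  fix x
  have "synth (\<lambda>j. if j = k then 1 else 0) x = (\<Sum>j\<in>{k}. (if j = k then 1 else 0) * complex_of_real (hf j x))"
    unfolding synth_def by (rule suminf_finite) auto
  then show "synth (\<lambda>j. if j = k then 1 else 0) x = complex_of_real (hf k x)" by simp
qed

lemma hf_form_domain: "(\<lambda>x. complex_of_real (hf k x)) \<in> form_domain"
  using synth_form_domain[OF fdom_delta[of k]] unfolding synth_delta .

text \<open>Testing with the Hermite functions, which lie in the form domain, gives the equations
  for the coefficients. Conversely these equations sum up to the form identity by Parseval, since
  the point values of a test function are given by its series.\<close>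

theorem osc_op_iff:
  "(u, w) \<in> osc_op b s \<longleftrightarrow> u \<in> L2 \<and> w \<in> L2 \<and> fdom (cf u) \<and>
    (\<forall>k. cf w k = of_nat (2 * k + 1) * cf u k
       + s * (synth (cf u) b * complex_of_real (hf k b) - synth (cf u) (- b) * complex_of_real (hf k (- b))))"
  (is "_ \<longleftrightarrow> ?R")
proof
  assume "(u, w) \<in> osc_op b s"
  then obtain u0 where u0: "u \<in> L2" "w \<in> L2" "u0 \<in> form_domain" "L2_eq u u0"
    "\<And>v. v \<in> form_domain \<Longrightarrow> osc_form b s u0 v = L2_inner w v"
    unfolding osc_op_def by auto
  note d = form_domainD[OF u0(3)]
  have cu: "cf u = cf u0"
    by (rule ext, rule cf_cong[OF u0(4)]) (use L2_measurable[OF u0(1)] L2_measurable[OF d(1)] in auto)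
  have fd: "fdom (cf u)" unfolding cu by (rule form_domain_fdom[OF u0(3)])
  have pt: "u0 x = synth (cf u) x" for x
    unfolding cu by (rule synth_cf[OF d(1,2)]) (use fd cu in simp)
  have "cf w k = of_nat (2 * k + 1) * cf u k
       + s * (synth (cf u) b * complex_of_real (hf k b) - synth (cf u) (- b) * complex_of_real (hf k (- b)))" for k
  proof -
    let ?h = "\<lambda>x. complex_of_real (hf k x)"
    have "(\<lambda>j. of_nat (2 * j + 1) * cf u0 j * cnj (cf ?h j)) sums (of_nat (2 * k + 1) * cf u0 k * cnj (cf ?h k))"
    proof -
      have "(\<lambda>j. of_nat (2 * j + 1) * cf u0 j * cnj (cf ?h j)) = (\<lambda>j. if j = k then of_nat (2 * j + 1) * cf u0 j * cnj (cf ?h j) else 0)"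
        unfolding cf_hf by auto
      then show ?thesis using sums_single[of k "\<lambda>j. of_nat (2 * j + 1) * cf u0 j * cnj (cf ?h j)"] by simp
    qed
    with form_sums[OF u0(3) hf_form_domain[of k]]
    have "(LINT x|lborel. weak_deriv u0 x * cnj (weak_deriv ?h x) + complex_of_real (x\<^sup>2) * (u0 x * cnj (?h x))) = of_nat (2 * k + 1) * cf u0 k"
      using sums_unique2 unfolding cf_hf by fastforce
    moreover have "L2_inner w ?h = cf w k" unfolding L2_inner_def cf_def by simp
    moreover have "osc_form b s u0 ?h = L2_inner w ?h" by (rule u0(5)[OF hf_form_domain])
    ultimately show ?thesis unfolding osc_form_def by (simp add: pt cu)
  qed
  then show ?R using u0 fd by blast
next
  assume R: ?R
  then have u: "u \<in> L2" and w: "w \<in> L2" and fd: "fdom (cf u)"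
    and eq: "\<And>k. cf w k = of_nat (2 * k + 1) * cf u k
       + s * (synth (cf u) b * complex_of_real (hf k b) - synth (cf u) (- b) * complex_of_real (hf k (- b)))" by auto
  let ?u = "synth (cf u)"
  have u0: "?u \<in> form_domain" by (rule synth_form_domain[OF fd])
  have ueq: "L2_eq u ?u"
    by (rule hermite_unique[OF u synth_L2(1)[OF fd]]) (simp add: synth_L2(2)[OF fd])
  have "osc_form b s ?u v = L2_inner w v" if v: "v \<in> form_domain" for v
  proof -
    note e = form_domainD[OF v]
    note fv = form_domain_fdom[OF v]
    have vp: "(\<lambda>k. complex_of_real (hf k x) * cnj (cf v k)) sums cnj (v x)" for x
    proof -
      have "(\<lambda>k. cnj (cf v k * complex_of_real (hf k x))) sums cnj (synth (cf v) x)"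
        unfolding sums_cnj by (rule synth_sums[OF fv])
      then show ?thesis unfolding synth_cf[OF e(1,2) fv, of x] by (simp add: mult.commute)
    qed
    have "(\<lambda>k. of_nat (2 * k + 1) * cf u k * cnj (cf v k)
        + s * (?u b * (complex_of_real (hf k b) * cnj (cf v k)) - ?u (- b) * (complex_of_real (hf k (- b)) * cnj (cf v k))))
      sums osc_form b s ?u v"
      unfolding osc_form_def
      by (intro sums_add sums_mult sums_diff vp)
         (use form_sums[OF u0 v] in \<open>simp add: synth_L2(2)[OF fd]\<close>)
    moreover have "of_nat (2 * k + 1) * cf u k * cnj (cf v k)
        + s * (?u b * (complex_of_real (hf k b) * cnj (cf v k)) - ?u (- b) * (complex_of_real (hf k (- b)) * cnj (cf v k)))
       = cf w k * cnj (cf v k)" for k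
      unfolding eq[of k] by (simp add: algebra_simps)
    ultimately have "(\<lambda>k. cf w k * cnj (cf v k)) sums osc_form b s ?u v" by simp
    then show ?thesis using Parseval[OF w e(1)] sums_unique2 by blast
  qed
  then show "(u, w) \<in> osc_op b s"
    unfolding osc_op_def using u w u0 ueq by blast
qed

section \<open>The characteristic function\<close>

text \<open>Near an eigenvalue \<open>2 n + 1\<close> of the unperturbed oscillator, the \<open>n\<close>-th coefficient is kept as an
  unknown and all others are eliminated. \<open>Om n\<close> is a region where this is possible.\<close>

definition Om :: "nat \<Rightarrow> complex set" where
  "Om n = {z. Re z < 2 * real n + 5/2 \<and> (n = 0 \<or> Re z > 2 * real n - 1/2)}"

definition kd :: "nat \<Rightarrow> nat \<Rightarrow> real" where
  "kd n k = \<bar>real k - real n\<bar>"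

lemma kd_ge_1: "k \<noteq> n \<Longrightarrow> kd n k \<ge> 1"
  unfolding kd_def by (cases "k < n") auto

text \<open>\<open>Om n\<close> extends 3/2 to each side of 2n+1 (without limit to the left if n =
  0), so the distance to 2k+1 is at least 2|k-n| - 3/2; this is at least |k-n|/2 once |k-n| \<ge>
  1.\<close>

lemma Om_dist:
  assumes "z \<in> Om n" "k \<noteq> n"
  shows "kd n k / 2 \<le> cmod (of_nat (2 * k + 1) - z)"
proof -
  have "kd n k / 2 \<le> \<bar>Re (of_nat (2 * k + 1) - z)\<bar>"
  proof (cases "k < n")
    case True
    then have "Re z > 2 * real n - 1/2" "real n - real k \<ge> 1" using assms unfolding Om_def by auto
    then show ?thesis unfolding kd_def by (simp add: abs_if) 
  next
    case False
    then have "Re z < 2 * real n + 5/2" "real k - real n \<ge> 1" using assms unfolding Om_def by auto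
    then show ?thesis unfolding kd_def by (simp add: abs_if)
  qed
  then show ?thesis using abs_Re_le_cmod[of "of_nat (2 * k + 1) - z"] by linarith
qed

lemma Om_neq: "z \<in> Om n \<Longrightarrow> k \<noteq> n \<Longrightarrow> of_nat (2 * k + 1) - z \<noteq> 0"
  using Om_dist[of z n k] kd_ge_1[of k n] by auto

lemma open_Om: "open (Om n)"
  unfolding Om_def
  by (cases "n = 0") (auto intro!: open_Collect_conj open_Collect_less continuous_intros)

lemma convex_Om: "convex (Om n)"
proof (cases "n = 0")
  case True
  then have "Om n = {z. Re z < 2 * real n + 5/2}" unfolding Om_def by auto
  then show ?thesis by (simp only: convex_halfspace_Re_lt)
next
  case False
  then have "Om n = {z. Re z < 2 * real n + 5/2} \<inter> {z. Re z > 2 * real n - 1/2}" unfolding Om_def by auto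
  then show ?thesis by (simp only:) (intro convex_Int convex_halfspace_Re_lt convex_halfspace_Re_gt)
qed

text \<open>Neighbouring regions overlap, and \<open>Om 0\<close> contains a left half-plane. For Re
  z > 0 the index is chosen so that z lies in the strip of half-width 1 by which eigenvalues are
  numbered.\<close>

lemma Om_cover: "\<exists>n. z \<in> Om n \<and> (Re z > 0 \<longrightarrow> \<bar>Re z - (2 * real n + 1)\<bar> \<le> 1)"
proof (cases "Re z > 0")
  case True
  define n where "n = nat \<lfloor>Re z / 2\<rfloor>"
  have "real n \<le> Re z / 2" "Re z / 2 < real n + 1"
    using True of_int_floor_le[of "Re z / 2"] floor_correct[of "Re z / 2"] unfolding n_def by (auto simp: of_nat_nat)
  then show ?thesis unfolding Om_def by (intro exI[of _ n]) auto
next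
  case False
  then show ?thesis unfolding Om_def by (intro exI[of _ 0]) auto
qed

lemma strip_Om: "\<bar>Re z - (2 * real n + 1)\<bar> \<le> 1 \<Longrightarrow> z \<in> Om n"
  unfolding Om_def by auto

section \<open>Resolvent sums without their singular term\<close>

definition csum :: "(nat \<Rightarrow> real) \<Rightarrow> complex \<Rightarrow> complex" where
  "csum p z = (\<Sum>k. complex_of_real (p k) / (of_nat (2 * k + 1) - z))"

locale point_interaction =
  fixes b :: real
begin

text \<open>Fixed here once and for all: the constant D of the theorem is computed from it and must
  not depend on \<open>s\<close>.\<close>

definition bnd :: real where
  "bnd = (SOME A. A > 0 \<and> (\<forall>n. (hf n b)\<^sup>2 \<le> A / sqrt (real (n + 1))))"

lemma bnd: "bnd > 0" "(hf n b)\<^sup>2 \<le> bnd / sqrt (real (n + 1))"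
proof -
  have "\<exists>A. A > 0 \<and> (\<forall>n. (hf n b)\<^sup>2 \<le> A / sqrt (real (n + 1)))"
    using hf_local_bound[of "\<bar>b\<bar>"] by blast
  then have "bnd > 0 \<and> (\<forall>n. (hf n b)\<^sup>2 \<le> bnd / sqrt (real (n + 1)))"
    unfolding bnd_def by (rule someI_ex)
  then show "bnd > 0" "(hf n b)\<^sup>2 \<le> bnd / sqrt (real (n + 1))" by auto
qed

text \<open>One quantity bounds the sums \<open>csum\<close>, their Lipschitz constants and, with 1
  added, the right-hand sides \<open>rhs\<close>. The factor 4 stems from the Lipschitz estimate,
  where the 1/2 of \<open>Om_dist\<close> occurs twice.\<close>

definition sg :: "nat \<Rightarrow> real" where
  "sg n = (\<Sum>k. if k = n then 0 else 4 * (hf k b)\<^sup>2 / kd n k)"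

lemma Suc_le_kd:
  assumes "k \<noteq> n"
  shows "real (k + 1) \<le> real (n + 2) * kd n k"
proof -
  have "real (k + 1) \<le> real (n + 1) + kd n k" unfolding kd_def by simp
  also have "\<dots> \<le> real (n + 1) * kd n k + kd n k"
    using mult_left_mono[OF kd_ge_1[OF assms], of "real (n + 1)"] by simp
  finally show ?thesis by (simp add: algebra_simps)
qed

lemma sg_summable: "summable (\<lambda>k. if k = n then 0 else 4 * (hf k b)\<^sup>2 / kd n k)"
proof (rule summable_comparison_test'[where N = 0])
  show "summable (\<lambda>k. 4 * bnd * real (n + 2) * (1 / (real (k + 1) * sqrt (real (k + 1)))))"
    by (intro summable_mult summable_inverse_3_2)
  fix k
  show "norm (if k = n then 0 else 4 * (hf k b)\<^sup>2 / kd n k) \<le> 4 * bnd * real (n + 2) * (1 / (real (k + 1) * sqrt (real (k + 1))))"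
  proof (cases "k = n")
    case False
    have kd: "kd n k \<ge> 1" by (rule kd_ge_1[OF False])
    have "1 / kd n k \<le> real (n + 2) / real (k + 1)"
      using Suc_le_kd[OF False] kd by (simp add: field_simps)
    then have "4 * (hf k b)\<^sup>2 * (1 / kd n k) \<le> 4 * (bnd / sqrt (real (k + 1))) * (real (n + 2) / real (k + 1))"
      using bnd kd by (intro mult_mono) auto
    then show ?thesis using False kd by (simp add: field_simps)
  qed (use bnd in simp)
qed

lemma sg_nonneg: "sg n \<ge> 0"
  unfolding sg_def by (intro suminf_nonneg sg_summable) (auto simp: kd_def)

text \<open>Vanishing at \<open>n\<close> removes the only pole that \<open>csum p\<close> could
  have in \<open>Om n\<close>.\<close>

definition wt :: "nat \<Rightarrow> (nat \<Rightarrow> real) \<Rightarrow> bool" where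
  "wt n p \<longleftrightarrow> p n = 0 \<and> (\<forall>k. 0 \<le> p k \<and> p k \<le> (hf k b)\<^sup>2)"

lemma csum_term_bound:
  assumes p: "wt n p" and z: "z \<in> Om n"
  shows "cmod (complex_of_real (p k) / (of_nat (2 * k + 1) - z)) \<le> (if k = n then 0 else 4 * (hf k b)\<^sup>2 / kd n k) / 2"
proof (cases "k = n")
  case False
  have "cmod (complex_of_real (p k) / (of_nat (2 * k + 1) - z)) = p k / cmod (of_nat (2 * k + 1) - z)"
    using p unfolding wt_def by (simp add: norm_divide)
  also have "\<dots> \<le> (hf k b)\<^sup>2 / (kd n k / 2)"
    using p Om_dist[OF z False] kd_ge_1[OF False] unfolding wt_def by (intro frac_le) auto
  finally show ?thesis using False by (simp add: mult.commute)
qed (use p in \<open>simp add: wt_def\<close>)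

lemma csum_summable:
  assumes p: "wt n p" and z: "z \<in> Om n"
  shows "summable (\<lambda>k. complex_of_real (p k) / (of_nat (2 * k + 1) - z))"
  by (rule summable_norm_cancel, rule summable_comparison_test'[where N = 0, OF summable_divide[OF sg_summable[of n], of 2]])
     (use csum_term_bound[OF p z] in simp)

lemma csum_sums: "wt n p \<Longrightarrow> z \<in> Om n \<Longrightarrow> (\<lambda>k. complex_of_real (p k) / (of_nat (2 * k + 1) - z)) sums csum p z"
  unfolding csum_def by (rule summable_sums, rule csum_summable)

lemma csum_bound:
  assumes p: "wt n p" and z: "z \<in> Om n"
  shows "cmod (csum p z) \<le> sg n"
proof -
  have "cmod (csum p z) \<le> (\<Sum>k. (if k = n then 0 else 4 * (hf k b)\<^sup>2 / kd n k) / 2)"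
    unfolding csum_def
    by (rule norm_suminf_le[OF csum_term_bound[OF p z] summable_divide[OF sg_summable]])
  also have "\<dots> = sg n / 2" unfolding sg_def by (rule suminf_divide[OF sg_summable])
  finally show ?thesis using sg_nonneg[of n] by linarith
qed

lemma csum_lipschitz:
  assumes p: "wt n p" and z: "z \<in> Om n" and z': "z' \<in> Om n"
  shows "cmod (csum p z - csum p z') \<le> sg n * cmod (z - z')"
proof -
  let ?t = "\<lambda>z k. complex_of_real (p k) / (of_nat (2 * k + 1) - z)"
  have "(\<lambda>k. ?t z k - ?t z' k) sums (csum p z - csum p z')"
    by (rule sums_diff[OF csum_sums[OF p z] csum_sums[OF p z']])
  then have "csum p z - csum p z' = (\<Sum>k. ?t z k - ?t z' k)" by (rule sums_unique)
  also have "cmod \<dots> \<le> (\<Sum>k. (if k = n then 0 else 4 * (hf k b)\<^sup>2 / kd n k) * cmod (z - z'))"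
  proof (rule norm_suminf_le[OF _ summable_mult2[OF sg_summable]])
    fix k
    show "cmod (?t z k - ?t z' k) \<le> (if k = n then 0 else 4 * (hf k b)\<^sup>2 / kd n k) * cmod (z - z')"
    proof (cases "k = n")
      case False
      let ?d = "of_nat (2 * k + 1) - z" and ?d' = "of_nat (2 * k + 1) - z'"
      have nz: "?d \<noteq> 0" "?d' \<noteq> 0" using Om_neq z z' False by blast+
      have kd: "kd n k \<ge> 1" by (rule kd_ge_1[OF False])
      have "?t z k - ?t z' k = complex_of_real (p k) * (z - z') / (?d * ?d')"
        using nz by (simp add: divide_simps) (simp add: algebra_simps)
      then have "cmod (?t z k - ?t z' k) = p k * cmod (z - z') / (cmod ?d * cmod ?d')"
        using p unfolding wt_def by (simp add: norm_divide norm_mult)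
      also have "\<dots> \<le> ((hf k b)\<^sup>2 * cmod (z - z')) / (kd n k / 2 * (kd n k / 2))"
      proof (rule frac_le)
        show "kd n k / 2 * (kd n k / 2) \<le> cmod ?d * cmod ?d'"
          using Om_dist[OF z False] Om_dist[OF z' False] kd by (intro mult_mono) auto
        show "0 < kd n k / 2 * (kd n k / 2)" using kd by auto
      qed (use p in \<open>auto simp: wt_def intro: mult_right_mono\<close>)
      also have "\<dots> = 4 * (hf k b)\<^sup>2 * cmod (z - z') / kd n k * (1 / kd n k)"
        by simp
      also have "\<dots> \<le> 4 * (hf k b)\<^sup>2 * cmod (z - z') / kd n k * 1"
        using kd by (intro mult_left_mono) auto
      finally show ?thesis using False by simp
    qed (use p in \<open>simp add: wt_def\<close>)
  qed
  also have "\<dots> = sg n * cmod (z - z')" unfolding sg_def by (rule suminf_mult2[OF sg_summable, symmetric])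
  finally show ?thesis .
qed

lemma csum_holomorphic:
  assumes p: "wt n p"
  shows "csum p holomorphic_on Om n"
proof (rule holomorphic_uniform_sequence[OF open_Om, where f = "\<lambda>N z. \<Sum>k<N. complex_of_real (p k) / (of_nat (2 * k + 1) - z)"])
  fix N
  have "(\<lambda>z. complex_of_real (p k) / (of_nat (2 * k + 1) - z)) holomorphic_on Om n" for k
  proof (cases "k = n")
    case True
    then show ?thesis using p by (simp add: wt_def)
  next
    case False
    have "(\<lambda>z. complex_of_real (p k) * inverse (of_nat (2 * k + 1) - z)) holomorphic_on Om n"
      using Om_neq False by (intro holomorphic_intros) blast
    then show ?thesis by (simp add: divide_inverse)
  qed
  then show "(\<lambda>z. \<Sum>k<N. complex_of_real (p k) / (of_nat (2 * k + 1) - z)) holomorphic_on Om n"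
    by (intro holomorphic_on_sum)
next
  fix z assume "z \<in> Om n"
  then obtain d where d: "d > 0" "cball z d \<subseteq> Om n"
    using open_Om open_contains_cball by blast
  have "uniform_limit (cball z d) (\<lambda>N z. \<Sum>k<N. complex_of_real (p k) / (of_nat (2 * k + 1) - z)) (csum p) sequentially"
    unfolding csum_def[abs_def]
    by (rule Weierstrass_m_test[OF _ summable_divide[OF sg_summable[of n], of 2]]) (use csum_term_bound[OF p] d in blast)
  then show "\<exists>d>0. cball z d \<subseteq> Om n \<and> uniform_limit (cball z d) (\<lambda>N z. \<Sum>k<N. complex_of_real (p k) / (of_nat (2 * k + 1) - z)) (csum p) sequentially"
    using d by blast
qed

text \<open>The tail of the series is small uniformly in z, and each of the finitely many other
  terms is at most p_k / |Im z|.\<close>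

lemma csum_decay:
  assumes p: "wt n p" and e: "e > 0"
  shows "\<exists>Y. \<forall>z\<in>Om n. \<bar>Im z\<bar> \<ge> Y \<longrightarrow> cmod (csum p z) \<le> e"
proof -
  let ?g = "\<lambda>k. (if k = n then 0 else 4 * (hf k b)\<^sup>2 / kd n k) / 2"
  have sg: "summable ?g" by (rule summable_divide[OF sg_summable])
  obtain N where N: "norm (\<Sum>k. ?g (k + N)) < e / 2"
    using suminf_exist_split[OF half_gt_zero[OF e] sg] by blast
  define Y where "Y = 1 + 2 * (\<Sum>k<N. p k) / e"
  have p0: "p k \<ge> 0" for k using p by (simp add: wt_def)
  have Y1: "Y \<ge> 1" unfolding Y_def using e p0 by (auto intro!: divide_nonneg_pos sum_nonneg)
  have "cmod (csum p z) \<le> e" if z: "z \<in> Om n" and Y: "\<bar>Im z\<bar> \<ge> Y" for z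
  proof -
    let ?t = "\<lambda>k. complex_of_real (p k) / (of_nat (2 * k + 1) - z)"
    have sm: "summable ?t" by (rule csum_summable[OF p z])
    have "csum p z = (\<Sum>k. ?t (k + N)) + (\<Sum>k<N. ?t k)"
      unfolding csum_def by (rule suminf_split_initial_segment[OF sm])
    then have "cmod (csum p z) \<le> cmod (\<Sum>k. ?t (k + N)) + cmod (\<Sum>k<N. ?t k)"
      by (simp only:) (rule norm_triangle_ineq)
    moreover have "cmod (\<Sum>k. ?t (k + N)) \<le> (\<Sum>k. ?g (k + N))"
      by (rule norm_suminf_le[OF csum_term_bound[OF p z]]) (rule summable_ignore_initial_segment[OF sg])
    moreover have "cmod (\<Sum>k<N. ?t k) \<le> (\<Sum>k<N. p k / Y)"
    proof (rule sum_norm_le)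
      fix k
      have "\<bar>Im z\<bar> \<le> cmod (of_nat (2 * k + 1) - z)"
        using abs_Im_le_cmod[of "of_nat (2 * k + 1) - z"] by simp
      then show "cmod (?t k) \<le> p k / Y"
        using Y Y1 p0[of k] by (simp add: norm_divide frac_le)
    qed
    moreover have "(\<Sum>k<N. p k / Y) \<le> e / 2"
    proof -
      have "(\<Sum>k<N. p k) \<le> e / 2 * Y" unfolding Y_def using e by (simp add: field_simps)
      then show ?thesis using Y1 by (simp add: sum_divide_distrib[symmetric] field_simps)
    qed
    ultimately show ?thesis using N by simp
  qed
  then show ?thesis by blast
qed

text \<open>E and O refer to the parity of \<open>k + n\<close>. The perturbation couples only
  indices of different parity, so the two sums enter the determinant through their product.\<close>

definition pE :: "nat \<Rightarrow> nat \<Rightarrow> real" where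
  "pE n k = (if even (k + n) \<and> k \<noteq> n then (hf k b)\<^sup>2 else 0)"

definition pO :: "nat \<Rightarrow> nat \<Rightarrow> real" where
  "pO n k = (if odd (k + n) then (hf k b)\<^sup>2 else 0)"

lemma wt_pE: "wt n (pE n)" and wt_pO: "wt n (pO n)"
  unfolding wt_def pE_def pO_def by auto

definition cE :: "nat \<Rightarrow> complex \<Rightarrow> complex" where "cE n = csum (pE n)"
definition cO :: "nat \<Rightarrow> complex \<Rightarrow> complex" where "cO n = csum (pO n)"

text \<open>The determinant of the system for the two unknowns u_n and \<open>opp u (Suc n)\<close>.
  The factor 4 is the square of the 2 in \<open>op_iff\<close>.\<close>

definition chr :: "complex \<Rightarrow> nat \<Rightarrow> complex \<Rightarrow> complex" where
  "chr s n z = (of_nat (2 * n + 1) - z) * (1 - 4 * s\<^sup>2 * cE n z * cO n z) - 4 * s\<^sup>2 * of_real ((hf n b)\<^sup>2) * cO n z"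

text \<open>Half of u(b) - (-1)^k u(-b) for the function with these coefficients. Only the parity of
  \<open>k\<close> matters, so there are just two such numbers: \<open>opp u (Suc n)\<close>
  collects the indices with the parity of \<open>n\<close>, and \<open>opp u n\<close> the
  others.\<close>

definition opp :: "(nat \<Rightarrow> complex) \<Rightarrow> nat \<Rightarrow> complex" where
  "opp u k = (\<Sum>j. if even (j + k) then 0 else of_real (hf j b) * u j)"

lemma opp_summable:
  assumes "fdom u"
  shows "summable (\<lambda>j. if P j then 0 else complex_of_real (hf j b) * u j)"
proof (rule summable_norm_cancel, rule summable_comparison_test'[where N = 0])
  show "summable (\<lambda>j. cmod (u j * complex_of_real (hf j b)))" by (rule synth_uniform(1)[OF assms])
qed (auto simp: norm_mult)

lemma opp_sums: "fdom u \<Longrightarrow> (\<lambda>j. if even (j + k) then 0 else of_real (hf j b) * u j) sums opp u k"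
  unfolding opp_def by (rule summable_sums, rule opp_summable)

lemma opp_parity: "even (k + l) \<Longrightarrow> opp u k = opp u l"
  unfolding opp_def by (intro arg_cong[where f = suminf] ext) auto

text \<open>As h_j(-b) = (-1)^j h_j(b), in the difference of the two point interactions the terms
  with j + k even cancel and the others double.\<close>

lemma op_iff:
  "(u, w) \<in> osc_op b s \<longleftrightarrow> u \<in> L2 \<and> w \<in> L2 \<and> fdom (cf u) \<and>
    (\<forall>k. cf w k = of_nat (2 * k + 1) * cf u k + 2 * s * of_real (hf k b) * opp (cf u) k)"
proof -
  have "synth c b * complex_of_real (hf k b) - synth c (- b) * complex_of_real (hf k (- b)) = 2 * of_real (hf k b) * opp c k"
    if c: "fdom c" for c k
  proof -
    have "(\<lambda>j. c j * complex_of_real (hf j b) * complex_of_real (hf k b) - c j * complex_of_real (hf j (- b)) * complex_of_real (hf k (- b)))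
      sums (synth c b * complex_of_real (hf k b) - synth c (- b) * complex_of_real (hf k (- b)))"
      by (intro sums_diff sums_mult2 synth_sums c)
    moreover have "c j * complex_of_real (hf j b) * complex_of_real (hf k b) - c j * complex_of_real (hf j (- b)) * complex_of_real (hf k (- b))
      = 2 * of_real (hf k b) * (if even (j + k) then 0 else of_real (hf j b) * c j)" for j
    proof -
      have "complex_of_real (hf j (- b)) * complex_of_real (hf k (- b)) = (- 1) ^ (j + k) * (complex_of_real (hf j b) * complex_of_real (hf k b))"
        unfolding hf_minus by (simp add: power_add)
      then show ?thesis by (auto simp: mult.assoc)
    qed
    ultimately have "(\<lambda>j. 2 * of_real (hf k b) * (if even (j + k) then 0 else of_real (hf j b) * c j))
      sums (synth c b * complex_of_real (hf k b) - synth c (- b) * complex_of_real (hf k (- b)))" by simp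
    moreover have "(\<lambda>j. 2 * of_real (hf k b) * (if even (j + k) then 0 else of_real (hf j b) * c j)) sums (2 * of_real (hf k b) * opp c k)"
      by (intro sums_mult opp_sums c)
    ultimately show ?thesis by (rule sums_unique2)
  qed
  then show ?thesis unfolding osc_op_iff by (auto simp: mult.assoc mult.left_commute)
qed

text \<open>The contribution of the inhomogeneity \<open>f\<close> to the numbers
  \<open>opp\<close>, once all coefficients but the n-th have been solved for.\<close>

definition rhs :: "(nat \<Rightarrow> bool) \<Rightarrow> nat \<Rightarrow> (nat \<Rightarrow> complex) \<Rightarrow> complex \<Rightarrow> complex" where
  "rhs P n f z = (\<Sum>k. if P k \<and> k \<noteq> n then of_real (hf k b) * f k / (of_nat (2 * k + 1) - z) else 0)"

lemma rhs_term:
  assumes z: "z \<in> Om n" and t: "t > 0"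
  shows "cmod (if P k \<and> k \<noteq> n then of_real (hf k b) * f k / (of_nat (2 * k + 1) - z) else 0)
    \<le> (t * (cmod (f k))\<^sup>2 + (if k = n then 0 else 4 * (hf k b)\<^sup>2 / kd n k) / t) / 2"
proof (cases "P k \<and> k \<noteq> n")
  case True
  then have kn: "k \<noteq> n" by simp
  have kd: "kd n k \<ge> 1" by (rule kd_ge_1[OF kn])
  have "cmod (of_real (hf k b) * f k / (of_nat (2 * k + 1) - z)) = cmod (f k) * \<bar>hf k b\<bar> / cmod (of_nat (2 * k + 1) - z)"
    by (simp add: norm_mult norm_divide)
  also have "\<dots> \<le> cmod (f k) * \<bar>hf k b\<bar> / (kd n k / 2)"
    using Om_dist[OF z kn] kd by (intro divide_left_mono mult_pos_pos) auto
  also have "\<dots> = cmod (f k) * (2 * \<bar>hf k b\<bar> / kd n k)" by simp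
  also have "\<dots> \<le> (t * (cmod (f k))\<^sup>2 + (2 * \<bar>hf k b\<bar> / kd n k)\<^sup>2 / t) / 2"
    by (rule mult_le_half_weighted[OF t])
  also have "(2 * \<bar>hf k b\<bar> / kd n k)\<^sup>2 = 4 * (hf k b)\<^sup>2 / kd n k * (1 / kd n k)"
    by (simp add: power_divide power_mult_distrib power2_eq_square)
  also have "4 * (hf k b)\<^sup>2 / kd n k * (1 / kd n k) \<le> 4 * (hf k b)\<^sup>2 / kd n k * 1"
    using kd by (intro mult_left_mono) auto
  finally show ?thesis using True t by (simp add: divide_right_mono)
next
  case False
  then show ?thesis using t by (auto simp: kd_def intro!: add_nonneg_nonneg divide_nonneg_nonneg)
qed

lemma rhs_summable:
  assumes z: "z \<in> Om n" and f: "summable (\<lambda>k. (cmod (f k))\<^sup>2)"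
  shows "summable (\<lambda>k. if P k \<and> k \<noteq> n then of_real (hf k b) * f k / (of_nat (2 * k + 1) - z) else 0)"
proof (rule summable_norm_cancel, rule summable_comparison_test'[where N = 0])
  show "summable (\<lambda>k. (1 * (cmod (f k))\<^sup>2 + (if k = n then 0 else 4 * (hf k b)\<^sup>2 / kd n k) / 1) / 2)"
    by (intro summable_divide summable_add summable_mult f sg_summable)
qed (use rhs_term[OF z, of 1] in simp)

lemma rhs_bound:
  assumes z: "z \<in> Om n" and f: "summable (\<lambda>k. (cmod (f k))\<^sup>2)"
  shows "cmod (rhs P n f z) \<le> sqrt (\<Sum>k. (cmod (f k))\<^sup>2) * sqrt (sg n + 1)"
proof (cases "(\<Sum>k. (cmod (f k))\<^sup>2) = 0")
  case True
  then have "\<And>k. f k = 0" using suminf_eq_zero_iff[OF f] by simp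
  then have "rhs P n f z = (\<Sum>k. 0)" unfolding rhs_def by (intro arg_cong[where f = suminf]) auto
  then show ?thesis using True by simp
next
  case False
  define N where "N = (\<Sum>k. (cmod (f k))\<^sup>2)"
  have N: "N > 0" using False suminf_nonneg[OF f] unfolding N_def by simp
  \<comment> \<open>The weight that balances the two parts of \<open>rhs_term\<close>; the 1 added
    to \<open>sg n\<close> keeps it positive.\<close>
  define t where "t = sqrt (sg n + 1) / sqrt N"
  have t: "t > 0" unfolding t_def using N sg_nonneg[of n] by simp
  have "cmod (rhs P n f z) \<le> (\<Sum>k. (t * (cmod (f k))\<^sup>2 + (if k = n then 0 else 4 * (hf k b)\<^sup>2 / kd n k) / t) / 2)"
    unfolding rhs_def
    by (rule norm_suminf_le[OF rhs_term[OF z t]]) (intro summable_divide summable_add summable_mult f sg_summable)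
  also have "\<dots> = (t * N + sg n / t) / 2"
    unfolding N_def sg_def
    by (intro sums_unique[symmetric] sums_divide sums_add sums_mult summable_sums f sg_summable)
  also have "\<dots> \<le> (t * N + (sg n + 1) / t) / 2"
    using t by (intro divide_right_mono add_left_mono) auto
  also have "\<dots> = sqrt N * sqrt (sg n + 1)"
  proof -
    have e: "(sq / r * (r * r) + (sq * sq) / (sq / r)) / 2 = r * sq" if "r > 0" "sq > 0" for r sq :: real
      using that by (simp add: field_simps)
    show ?thesis using e[of "sqrt N" "sqrt (sg n + 1)"] N sg_nonneg[of n] unfolding t_def by simp
  qed
  finally show ?thesis unfolding N_def .
qed

text \<open>Solving the k-th equation for u_k, k \<noteq> n, multiplying by h_k(b) and summing over
  each parity class closes the system in u_n, \<open>opp u n\<close> and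
  \<open>opp u (Suc n)\<close>.\<close>

lemma reduced_eqs:
  assumes z: "z \<in> Om n" and u: "fdom u" and f: "summable (\<lambda>k. (cmod (f k))\<^sup>2)"
    and eq: "\<And>k. f k = (of_nat (2 * k + 1) - z) * u k + 2 * s * of_real (hf k b) * opp u k"
  shows "opp u (Suc n) = of_real (hf n b) * u n + rhs (\<lambda>k. even (k + n)) n f z - 2 * s * opp u n * cE n z"
    and "opp u n = rhs (\<lambda>k. odd (k + n)) n f z - 2 * s * opp u (Suc n) * cO n z"
proof -
  have uk: "of_real (hf k b) * u k = of_real (hf k b) * f k / (of_nat (2 * k + 1) - z)
     - 2 * s * opp u k * (of_real ((hf k b)\<^sup>2) / (of_nat (2 * k + 1) - z))" if "k \<noteq> n" for k
  proof -
    have "a * x = a * (d * x + 2 * s * a * y) / d - 2 * s * y * (a\<^sup>2 / d)" if "d \<noteq> 0" for a x d y :: complex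
      using that by (simp add: field_simps power2_eq_square)
    from this[OF Om_neq[OF z that]] show ?thesis unfolding eq[of k] by simp
  qed
  have "(\<lambda>k. (if even (k + n) \<and> k \<noteq> n then of_real (hf k b) * f k / (of_nat (2 * k + 1) - z) else 0)
      - 2 * s * opp u n * (complex_of_real (pE n k) / (of_nat (2 * k + 1) - z)))
    sums (rhs (\<lambda>k. even (k + n)) n f z - 2 * s * opp u n * cE n z)"
    unfolding rhs_def cE_def
    by (intro sums_diff sums_mult csum_sums[OF wt_pE z] summable_sums rhs_summable[OF z f])
  moreover have "(if even (k + n) \<and> k \<noteq> n then of_real (hf k b) * f k / (of_nat (2 * k + 1) - z) else 0)
      - 2 * s * opp u n * (complex_of_real (pE n k) / (of_nat (2 * k + 1) - z))
     = (if even (k + Suc n) then 0 else of_real (hf k b) * u k) - (if k = n then of_real (hf n b) * u n else 0)" for k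
    using uk[of k] opp_parity[of k n u] by (auto simp: pE_def)
  moreover have "(\<lambda>k. (if even (k + Suc n) then 0 else of_real (hf k b) * u k) - (if k = n then of_real (hf n b) * u n else 0))
    sums (opp u (Suc n) - of_real (hf n b) * u n)"
    using sums_single[of n "\<lambda>k. of_real (hf n b) * u n"] by (intro sums_diff opp_sums u) 
  ultimately have "opp u (Suc n) - of_real (hf n b) * u n = rhs (\<lambda>k. even (k + n)) n f z - 2 * s * opp u n * cE n z"
    using sums_unique2 by fastforce
  then show "opp u (Suc n) = of_real (hf n b) * u n + rhs (\<lambda>k. even (k + n)) n f z - 2 * s * opp u n * cE n z"
    by (simp add: algebra_simps)
  have "(\<lambda>k. (if odd (k + n) \<and> k \<noteq> n then of_real (hf k b) * f k / (of_nat (2 * k + 1) - z) else 0)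
      - 2 * s * opp u (Suc n) * (complex_of_real (pO n k) / (of_nat (2 * k + 1) - z)))
    sums (rhs (\<lambda>k. odd (k + n)) n f z - 2 * s * opp u (Suc n) * cO n z)"
    unfolding rhs_def cO_def
    by (intro sums_diff sums_mult csum_sums[OF wt_pO z] summable_sums rhs_summable[OF z f])
  moreover have "(if odd (k + n) \<and> k \<noteq> n then of_real (hf k b) * f k / (of_nat (2 * k + 1) - z) else 0)
      - 2 * s * opp u (Suc n) * (complex_of_real (pO n k) / (of_nat (2 * k + 1) - z))
     = (if even (k + n) then 0 else of_real (hf k b) * u k)" for k
    using uk[of k] opp_parity[of k "Suc n" u] by (auto simp: pO_def)
  ultimately have "(\<lambda>k. if even (k + n) then 0 else of_real (hf k b) * u k) sums (rhs (\<lambda>k. odd (k + n)) n f z - 2 * s * opp u (Suc n) * cO n z)"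
    by simp
  then show "opp u n = rhs (\<lambda>k. odd (k + n)) n f z - 2 * s * opp u (Suc n) * cO n z"
    using opp_sums[OF u, of n] sums_unique2 by blast
qed

text \<open>Cramer's rule for the remaining \<open>2 \<times> 2\<close> system.\<close>

lemma reduced_solution:
  assumes z: "z \<in> Om n" and u: "fdom u" and f: "summable (\<lambda>k. (cmod (f k))\<^sup>2)"
    and eq: "\<And>k. f k = (of_nat (2 * k + 1) - z) * u k + 2 * s * of_real (hf k b) * opp u k"
  defines "p \<equiv> f n - 2 * s * of_real (hf n b) * rhs (\<lambda>k. odd (k + n)) n f z"
    and "q \<equiv> rhs (\<lambda>k. even (k + n)) n f z - 2 * s * cE n z * rhs (\<lambda>k. odd (k + n)) n f z"
  shows "chr s n z * u n = p * (1 - 4 * s\<^sup>2 * cE n z * cO n z) + 4 * s\<^sup>2 * of_real (hf n b) * cO n z * q"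
    and "chr s n z * opp u (Suc n) = (of_nat (2 * n + 1) - z) * q + of_real (hf n b) * p"
proof -
  \<comment> \<open>With Y eliminated, i and ii are the two equations for x and X. Cramer's rule is
    stated without division by the determinant, so that it remains usable at the zeros of
    \<open>chr\<close>.\<close>
  have alg: "(w * (1 - 4 * s\<^sup>2 * E * Q) - 4 * s\<^sup>2 * a\<^sup>2 * Q) * x = (fn - 2 * s * a * fO) * (1 - 4 * s\<^sup>2 * E * Q) + 4 * s\<^sup>2 * a * Q * (fE - 2 * s * E * fO)
     \<and> (w * (1 - 4 * s\<^sup>2 * E * Q) - 4 * s\<^sup>2 * a\<^sup>2 * Q) * X = w * (fE - 2 * s * E * fO) + a * (fn - 2 * s * a * fO)"
    if 1: "X = a * x + fE - 2 * s * Y * E" and 2: "Y = fO - 2 * s * X * Q" and 3: "fn = w * x + 2 * s * a * Y"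
    for w E Q a x X Y fn fO fE :: complex
  proof -
    have i: "X * (1 - 4 * s\<^sup>2 * E * Q) = a * x + (fE - 2 * s * E * fO)"
    proof -
      have "X = a * x + fE - 2 * s * (fO - 2 * s * X * Q) * E" using 1 2 by simp
      then show ?thesis by (simp add: algebra_simps power2_eq_square)
    qed
    have ii: "w * x - 4 * s\<^sup>2 * a * Q * X = fn - 2 * s * a * fO"
      unfolding 3 2 by (simp add: algebra_simps power2_eq_square)
    have "(w * (1 - 4 * s\<^sup>2 * E * Q) - 4 * s\<^sup>2 * a\<^sup>2 * Q) * x = (w * x - 4 * s\<^sup>2 * a * Q * X) * (1 - 4 * s\<^sup>2 * E * Q) + 4 * s\<^sup>2 * a * Q * (X * (1 - 4 * s\<^sup>2 * E * Q) - a * x)"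
      by (simp add: algebra_simps power2_eq_square)
    moreover have "(w * (1 - 4 * s\<^sup>2 * E * Q) - 4 * s\<^sup>2 * a\<^sup>2 * Q) * X = w * (X * (1 - 4 * s\<^sup>2 * E * Q) - a * x) + a * (w * x - 4 * s\<^sup>2 * a * Q * X)"
      by (simp add: algebra_simps power2_eq_square)
    ultimately show ?thesis unfolding ii i by simp
  qed
  from alg[OF reduced_eqs[OF z u f eq] eq[of n]]
  show "chr s n z * u n = p * (1 - 4 * s\<^sup>2 * cE n z * cO n z) + 4 * s\<^sup>2 * of_real (hf n b) * cO n z * q"
    and "chr s n z * opp u (Suc n) = (of_nat (2 * n + 1) - z) * q + of_real (hf n b) * p"
    unfolding chr_def p_def q_def by (simp_all add: mult_ac)
qed

text \<open>Converse of \<open>reduced_eqs\<close>: every other coefficient is given explicitly by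
  its own equation and gains a factor 1/|k-n|, which is enough to stay in the form domain.\<close>

lemma construct:
  assumes z: "z \<in> Om n" and f: "summable (\<lambda>k. (cmod (f k))\<^sup>2)"
    and X: "X = of_real (hf n b) * x + rhs (\<lambda>k. even (k + n)) n f z - 2 * s * Y * cE n z"
    and Y: "Y = rhs (\<lambda>k. odd (k + n)) n f z - 2 * s * X * cO n z"
    and x: "f n = (of_nat (2 * n + 1) - z) * x + 2 * s * of_real (hf n b) * Y"
  obtains u where "fdom u" "u n = x" "opp u (Suc n) = X" "opp u n = Y"
    "\<And>k. f k = (of_nat (2 * k + 1) - z) * u k + 2 * s * of_real (hf k b) * opp u k"
proof -
  \<comment> \<open>The values that \<open>opp u k\<close> is meant to have; \<open>oV\<close>
    confirms them after the summation.\<close>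
  define V where "V k = (if even (k + n) then Y else X)" for k
  define u where "u k = (if k = n then x else (f k - 2 * s * of_real (hf k b) * V k) / (of_nat (2 * k + 1) - z))" for k
  define C where "C = cmod (2 * s) * (cmod X + cmod Y)"
  have C: "cmod (2 * s * V k) \<le> C" "C \<ge> 0" for k
    unfolding C_def V_def norm_mult by (auto intro!: mult_left_mono)
  have fd: "fdom u" unfolding fdom_def
  proof (rule summable_comparison_test'[where N = "Suc n"])
    show "summable (\<lambda>k. 8 * real (n + 2) * (cmod (f k))\<^sup>2 + 2 * real (n + 2) * C\<^sup>2 * (if k = n then 0 else 4 * (hf k b)\<^sup>2 / kd n k))"
      by (intro summable_add summable_mult f sg_summable)
    fix k assume "k \<ge> Suc n"
    then have kn: "k \<noteq> n" by simp
    have kd: "kd n k \<ge> 1" by (rule kd_ge_1[OF kn])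
    let ?g = "cmod (f k) + C * \<bar>hf k b\<bar>"
    have "cmod (u k) = cmod (f k - of_real (hf k b) * (2 * s * V k)) / cmod (of_nat (2 * k + 1) - z)"
      using kn unfolding u_def by (simp add: norm_divide mult_ac)
    also have "\<dots> \<le> ?g / (kd n k / 2)"
    proof (rule frac_le)
      have "cmod (f k - of_real (hf k b) * (2 * s * V k)) \<le> cmod (f k) + \<bar>hf k b\<bar> * cmod (2 * s * V k)"
        by (rule order_trans[OF norm_triangle_ineq4]) (simp add: norm_mult)
      also have "\<bar>hf k b\<bar> * cmod (2 * s * V k) \<le> \<bar>hf k b\<bar> * C" by (intro mult_left_mono C) auto
      finally show "cmod (f k - of_real (hf k b) * (2 * s * V k)) \<le> ?g" by (simp add: mult.commute)
      show "kd n k / 2 \<le> cmod (of_nat (2 * k + 1) - z)" by (rule Om_dist[OF z kn])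
    qed (use kd C in auto)
    finally have "(cmod (u k))\<^sup>2 \<le> (?g / (kd n k / 2))\<^sup>2" by (intro power_mono) auto
    also have "(g / (t / 2))\<^sup>2 = 4 * g\<^sup>2 / (t * t)" for g t :: real by (simp add: power2_eq_square)
    finally have u2: "(cmod (u k))\<^sup>2 \<le> 4 * ?g\<^sup>2 / (kd n k * kd n k)" .
    have g2: "?g\<^sup>2 \<le> 2 * (cmod (f k))\<^sup>2 + 2 * C\<^sup>2 * (hf k b)\<^sup>2"
      using zero_le_power2[of "cmod (f k) - C * \<bar>hf k b\<bar>"] 
      unfolding power2_sum power2_diff power_mult_distrib power2_abs by linarith
    have "real (k + 1) * (cmod (u k))\<^sup>2 \<le> (real (n + 2) * kd n k) * (4 * ?g\<^sup>2 / (kd n k * kd n k))"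
      using Suc_le_kd[OF kn] u2 kd by (intro mult_mono) auto
    also have "\<dots> = real (n + 2) * 4 / kd n k * ?g\<^sup>2" using kd by simp
    also have "\<dots> \<le> real (n + 2) * 4 / kd n k * (2 * (cmod (f k))\<^sup>2 + 2 * C\<^sup>2 * (hf k b)\<^sup>2)"
      using kd by (intro mult_left_mono g2) auto
    also have "\<dots> = 8 * real (n + 2) * (cmod (f k))\<^sup>2 * (1 / kd n k) + 2 * real (n + 2) * C\<^sup>2 * (4 * (hf k b)\<^sup>2 / kd n k)"
      using kd by (simp add: field_simps)
    also have "8 * real (n + 2) * (cmod (f k))\<^sup>2 * (1 / kd n k) \<le> 8 * real (n + 2) * (cmod (f k))\<^sup>2 * 1"
      using kd by (intro mult_left_mono) auto
    finally show "norm (real (k + 1) * (cmod (u k))\<^sup>2) \<le> 8 * real (n + 2) * (cmod (f k))\<^sup>2 + 2 * real (n + 2) * C\<^sup>2 * (if k = n then 0 else 4 * (hf k b)\<^sup>2 / kd n k)"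
      using kn by simp
  qed
  have uk: "of_real (hf k b) * u k = of_real (hf k b) * f k / (of_nat (2 * k + 1) - z)
     - 2 * s * V k * (of_real ((hf k b)\<^sup>2) / (of_nat (2 * k + 1) - z))" if "k \<noteq> n" for k
  proof -
    have "a * ((y - 2 * s * a * v) / d) = a * y / d - 2 * s * v * (a\<^sup>2 / d)" for a y d v :: complex
      by (simp add: diff_divide_distrib algebra_simps power2_eq_square)
    then show ?thesis using that unfolding u_def by simp
  qed
  have "(\<lambda>k. (if even (k + n) \<and> k \<noteq> n then of_real (hf k b) * f k / (of_nat (2 * k + 1) - z) else 0)
      - 2 * s * Y * (complex_of_real (pE n k) / (of_nat (2 * k + 1) - z)) + (if k = n then of_real (hf n b) * u n else 0))
    sums (rhs (\<lambda>k. even (k + n)) n f z - 2 * s * Y * cE n z + of_real (hf n b) * u n)"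
    unfolding rhs_def cE_def using sums_single[of n "\<lambda>k. of_real (hf n b) * u n"]
    by (intro sums_add sums_diff sums_mult csum_sums[OF wt_pE z] summable_sums rhs_summable[OF z f]) 
  moreover have "(if even (k + n) \<and> k \<noteq> n then of_real (hf k b) * f k / (of_nat (2 * k + 1) - z) else 0)
      - 2 * s * Y * (complex_of_real (pE n k) / (of_nat (2 * k + 1) - z)) + (if k = n then of_real (hf n b) * u n else 0)
     = (if even (k + Suc n) then 0 else of_real (hf k b) * u k)" for k
    using uk[of k] by (auto simp: pE_def V_def)
  ultimately have "(\<lambda>k. if even (k + Suc n) then 0 else of_real (hf k b) * u k) sums (rhs (\<lambda>k. even (k + n)) n f z - 2 * s * Y * cE n z + of_real (hf n b) * u n)"
    by simp
  moreover have "u n = x" by (simp add: u_def)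
  ultimately have oX: "opp u (Suc n) = X"
    using opp_sums[OF fd, of "Suc n"] sums_unique2 X by (fastforce simp: algebra_simps)
  have "(\<lambda>k. (if odd (k + n) \<and> k \<noteq> n then of_real (hf k b) * f k / (of_nat (2 * k + 1) - z) else 0)
      - 2 * s * X * (complex_of_real (pO n k) / (of_nat (2 * k + 1) - z)))
    sums (rhs (\<lambda>k. odd (k + n)) n f z - 2 * s * X * cO n z)"
    unfolding rhs_def cO_def
    by (intro sums_diff sums_mult csum_sums[OF wt_pO z] summable_sums rhs_summable[OF z f])
  moreover have "(if odd (k + n) \<and> k \<noteq> n then of_real (hf k b) * f k / (of_nat (2 * k + 1) - z) else 0)
      - 2 * s * X * (complex_of_real (pO n k) / (of_nat (2 * k + 1) - z))
     = (if even (k + n) then 0 else of_real (hf k b) * u k)" for k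
    using uk[of k] by (auto simp: pO_def V_def)
  ultimately have "(\<lambda>k. if even (k + n) then 0 else of_real (hf k b) * u k) sums (rhs (\<lambda>k. odd (k + n)) n f z - 2 * s * X * cO n z)"
    by simp
  then have oY: "opp u n = Y"
    using opp_sums[OF fd, of n] sums_unique2 Y by fastforce
  have oV: "opp u k = V k" for k
    using opp_parity[of k n u] opp_parity[of k "Suc n" u] oX oY unfolding V_def by auto
  have "f k = (of_nat (2 * k + 1) - z) * u k + 2 * s * of_real (hf k b) * opp u k" for k
  proof (cases "k = n")
    case True
    then show ?thesis using x oY by (simp add: u_def)
  next
    case False
    then show ?thesis unfolding oV using Om_neq[OF z False] by (simp add: u_def)
  qed
  then show thesis using that[of u] fd oX oY by (simp add: u_def)
qed

end

section \<open>Spectrum, eigenvalues and root spaces\<close>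

text \<open>Induction on the number of functionals: pass to the kernel of the last one and, if it is
  a proper subspace, adjoin one vector outside it. Independence and spanning being modulo null
  functions, the functionals have to vanish on these.\<close>

lemma has_L2_dim_functionals:
  fixes V :: "(real \<Rightarrow> complex) set"
  assumes "V \<noteq> {}"
    and "\<And>u v \<alpha>. u \<in> V \<Longrightarrow> v \<in> V \<Longrightarrow> (\<lambda>x. u x + \<alpha> * v x) \<in> V"
    and "\<And>(i::nat) u v \<alpha>. u \<in> V \<Longrightarrow> v \<in> V \<Longrightarrow> \<phi> i (\<lambda>x. u x + \<alpha> * v x) = \<phi> i u + \<alpha> * \<phi> i v"
    and "\<And>i u. u \<in> V \<Longrightarrow> L2_eq u (\<lambda>x. 0) \<Longrightarrow> \<phi> i u = (0::complex)"
    and "\<And>u. u \<in> V \<Longrightarrow> (\<And>i. i < q \<Longrightarrow> \<phi> i u = 0) \<Longrightarrow> L2_eq u (\<lambda>x. 0)"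
  shows "\<exists>m. has_L2_dim V m"
  using assms
proof (induction q arbitrary: V)
  case 0
  have "has_L2_dim V 0" unfolding has_L2_dim_def using 0(5) by auto
  then show ?case ..
next
  case (Suc q)
  note V = Suc.prems
  show ?case
  proof (cases "\<forall>u\<in>V. \<phi> q u = 0")
    case True
    show ?thesis
    proof (rule Suc.IH[OF V(1-4)])
      show "L2_eq u (\<lambda>x. 0)" if u: "u \<in> V" and i: "\<And>i. i < q \<Longrightarrow> \<phi> i u = 0" for u
      proof (rule V(5)[OF u])
        fix i assume "i < Suc q"
        then show "\<phi> i u = 0" using i[of i] True u by (cases "i = q") auto
      qed
    qed
  next
    case False
    then obtain us where us: "us \<in> V" "\<phi> q us \<noteq> 0" by blast
    have z: "(\<lambda>x. 0) \<in> V" using V(2)[OF us(1) us(1), of "- 1"] by simp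
    have sc: "(\<lambda>x. \<alpha> * v x) \<in> V" if "v \<in> V" for \<alpha> v using V(2)[OF z that, of \<alpha>] by simp
    define V' where "V' = {u \<in> V. \<phi> q u = 0}"
    have "\<exists>m. has_L2_dim V' m"
    proof (rule Suc.IH)
      show "V' \<noteq> {}" using z V(4)[OF z] unfolding V'_def L2_eq_def by auto
      show "(\<lambda>x. u x + \<alpha> * v x) \<in> V'" if "u \<in> V'" "v \<in> V'" for u v \<alpha>
        using that V(2,3) unfolding V'_def by simp
      show "\<phi> i (\<lambda>x. u x + \<alpha> * v x) = \<phi> i u + \<alpha> * \<phi> i v" if "u \<in> V'" "v \<in> V'" for i u v \<alpha>
        using that V(3) unfolding V'_def by simp
      show "\<phi> i u = 0" if "u \<in> V'" "L2_eq u (\<lambda>x. 0)" for i u using that V(4) unfolding V'_def by simp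
      show "L2_eq u (\<lambda>x. 0)" if "u \<in> V'" "\<And>i. i < q \<Longrightarrow> \<phi> i u = 0" for u
        using that V(5)[of u] unfolding V'_def by (auto simp: less_Suc_eq)
    qed
    then obtain m e where e: "\<And>i. i < m \<Longrightarrow> e i \<in> V'"
      "\<And>c :: nat \<Rightarrow> complex. L2_eq (\<lambda>x. \<Sum>i<m. c i * e i x) (\<lambda>x. 0) \<Longrightarrow> (\<forall>i<m. c i = 0)"
      "\<And>u. u \<in> V' \<Longrightarrow> \<exists>c :: nat \<Rightarrow> complex. L2_eq u (\<lambda>x. \<Sum>i<m. c i * e i x)"
      unfolding has_L2_dim_def by blast
    define e' where "e' = e(m := us)"
    have sum': "(\<Sum>i<Suc m. c i * e' i x) = (\<Sum>i<m. c i * e i x) + c m * us x" for c :: "nat \<Rightarrow> complex" and x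
    proof -
      have "(\<Sum>i<m. c i * e' i x) = (\<Sum>i<m. c i * e i x)"
        unfolding e'_def by (intro sum.cong) auto
      then show ?thesis by (simp add: e'_def)
    qed
    have S: "(\<lambda>x. \<Sum>i<l. c i * e i x) \<in> V \<and> \<phi> q (\<lambda>x. \<Sum>i<l. c i * e i x) = 0" if "l \<le> m" for l and c :: "nat \<Rightarrow> complex"
      using that
    proof (induction l)
      case 0 then show ?case using z V(4)[OF z] by (simp add: L2_eq_def)
    next
      case (Suc l)
      then have IH: "(\<lambda>x. \<Sum>i<l. c i * e i x) \<in> V" "\<phi> q (\<lambda>x. \<Sum>i<l. c i * e i x) = 0" and el: "e l \<in> V" "\<phi> q (e l) = 0"
        using e(1)[of l] unfolding V'_def by auto
      show ?case using V(2)[OF IH(1) el(1), of "c l"] V(3)[OF IH(1) el(1), of q "c l"] IH el by simp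
    qed
    have "has_L2_dim V (Suc m)"
      unfolding has_L2_dim_def
    proof (intro exI[of _ e'] conjI allI impI ballI)
      show "e' i \<in> V" if "i < Suc m" for i using that e(1)[of i] us unfolding e'_def V'_def by (auto simp: less_Suc_eq)
      show "c i = 0" if c: "L2_eq (\<lambda>x. \<Sum>i<Suc m. c i * e' i x) (\<lambda>x. 0)" and i: "i < Suc m" for c :: "nat \<Rightarrow> complex" and i
      proof -
        have S': "(\<lambda>x. (\<Sum>i<m. c i * e i x) + c m * us x) \<in> V"
          by (rule V(2)) (use S[of m c] us in auto)
        have "\<phi> q (\<lambda>x. (\<Sum>i<m. c i * e i x) + c m * us x) = 0"
          by (rule V(4)[OF S']) (use c in \<open>simp only: sum'\<close>)
        then have cm: "c m = 0" using V(3)[OF conjunct1[OF S[of m c]] us(1), of q "c m"] S[of m c] us by simp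
        then have "L2_eq (\<lambda>x. \<Sum>i<m. c i * e i x) (\<lambda>x. 0)" using c unfolding sum' by simp
        then show ?thesis using e(2)[of c] i cm by (auto simp: less_Suc_eq)
      qed
      show "\<exists>c :: nat \<Rightarrow> complex. L2_eq u (\<lambda>x. \<Sum>i<Suc m. c i * e' i x)" if u: "u \<in> V" for u
      proof -
        define t where "t = \<phi> q u / \<phi> q us"
        have "\<phi> q u + (- t) * \<phi> q us = 0" using us(2) by (simp add: t_def)
        then have "(\<lambda>x. u x + (- t) * us x) \<in> V'"
          using V(2)[OF u us(1), of "- t"] V(3)[OF u us(1), of q "- t"] unfolding V'_def by (simp only: mem_Collect_eq simp_thms)
        then obtain c :: "nat \<Rightarrow> complex" where c: "L2_eq (\<lambda>x. u x + (- t) * us x) (\<lambda>x. \<Sum>i<m. c i * e i x)" using e(3) by blast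
        have "L2_eq u (\<lambda>x. \<Sum>i<Suc m. (c(m := t)) i * e' i x)"
          using c unfolding sum' L2_eq_def
        proof eventually_elim
          case (elim x)
          have "(\<Sum>i<m. (c(m := t)) i * e i x) = (\<Sum>i<m. c i * e i x)" by (intro sum.cong) auto
          then show ?case using elim by (simp add: algebra_simps)
        qed
        then show ?thesis by blast
      qed
    qed
    then show ?thesis ..
  qed
qed

section \<open>The eigenvalue equation on coefficient sequences\<close>

lemma cf_null_iff: "u \<in> L2 \<Longrightarrow> L2_eq u (\<lambda>x. 0) \<longleftrightarrow> cf u = (\<lambda>k. 0)"
proof
  assume u: "u \<in> L2" and "L2_eq u (\<lambda>x. 0)"
  then have "cf u k = cf (\<lambda>x. 0) k" for k
    by (intro cf_cong) (use L2_measurable[OF u] in auto)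
  then show "cf u = (\<lambda>k. 0)" by (auto simp: fun_eq_iff)
next
  assume "u \<in> L2" "cf u = (\<lambda>k. 0)"
  then show "L2_eq u (\<lambda>x. 0)" by (intro hermite_complete) auto
qed

lemma fdom_lin:
  assumes u: "fdom u" and v: "fdom v"
  shows "fdom (\<lambda>k. u k + \<alpha> * v k)"
  unfolding fdom_def
proof (rule summable_comparison_test'[where N = 0])
  show "summable (\<lambda>k. 2 * (real (k + 1) * (cmod (u k))\<^sup>2) + 2 * (cmod \<alpha>)\<^sup>2 * (real (k + 1) * (cmod (v k))\<^sup>2))"
    using u v unfolding fdom_def by (intro summable_add summable_mult)
  fix k
  have "(cmod (u k + \<alpha> * v k))\<^sup>2 \<le> (cmod (u k) + cmod \<alpha> * cmod (v k))\<^sup>2"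
    by (intro power_mono) (auto intro: order_trans[OF norm_triangle_ineq] simp: norm_mult)
  also have "\<dots> \<le> 2 * (cmod (u k))\<^sup>2 + 2 * (cmod \<alpha>)\<^sup>2 * (cmod (v k))\<^sup>2"
    using zero_le_power2[of "cmod (u k) - cmod \<alpha> * cmod (v k)"]
    unfolding power2_sum power2_diff power_mult_distrib by linarith
  finally have "real (k + 1) * (cmod (u k + \<alpha> * v k))\<^sup>2 \<le> real (k + 1) * (2 * (cmod (u k))\<^sup>2 + 2 * (cmod \<alpha>)\<^sup>2 * (cmod (v k))\<^sup>2)"
    by (intro mult_left_mono) auto
  then show "norm (real (k + 1) * (cmod (u k + \<alpha> * v k))\<^sup>2) \<le> 2 * (real (k + 1) * (cmod (u k))\<^sup>2) + 2 * (cmod \<alpha>)\<^sup>2 * (real (k + 1) * (cmod (v k))\<^sup>2)"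
    by (simp add: algebra_simps)
qed

lemma fdom_0: "fdom (\<lambda>k. 0)" unfolding fdom_def by simp

context point_interaction
begin

lemma opp_lin:
  assumes u: "fdom u" and v: "fdom v"
  shows "opp (\<lambda>k. u k + \<alpha> * v k) j = opp u j + \<alpha> * opp v j"
proof -
  have "(\<lambda>i. (if even (i + j) then 0 else of_real (hf i b) * u i) + \<alpha> * (if even (i + j) then 0 else of_real (hf i b) * v i)) sums (opp u j + \<alpha> * opp v j)"
    by (intro sums_add sums_mult opp_sums u v)
  moreover have "(if even (i + j) then 0 else of_real (hf i b) * u i) + \<alpha> * (if even (i + j) then 0 else of_real (hf i b) * v i)
     = (if even (i + j) then 0 else of_real (hf i b) * (u i + \<alpha> * v i))" for i
    by (simp add: algebra_simps)
  ultimately have "(\<lambda>i. if even (i + j) then 0 else of_real (hf i b) * (u i + \<alpha> * v i)) sums (opp u j + \<alpha> * opp v j)" by simp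
  then show ?thesis using opp_sums[OF fdom_lin[OF u v, of \<alpha>], of j] sums_unique2 by blast
qed

lemma opp_0 [simp]: "opp (\<lambda>k. 0) j = 0" unfolding opp_def by (simp cong: if_cong)

text \<open>The operator minus z, acting on coefficients. It is defined for every sequence, so the
  domain is carried along separately as \<open>fdom\<close>.\<close>

definition tau :: "complex \<Rightarrow> complex \<Rightarrow> (nat \<Rightarrow> complex) \<Rightarrow> nat \<Rightarrow> complex" where
  "tau s z u k = (of_nat (2 * k + 1) - z) * u k + 2 * s * of_real (hf k b) * opp u k"

lemma tau_lin: "fdom u \<Longrightarrow> fdom v \<Longrightarrow> tau s z (\<lambda>k. u k + \<alpha> * v k) = (\<lambda>k. tau s z u k + \<alpha> * tau s z v k)"
  unfolding tau_def by (auto simp: opp_lin algebra_simps fun_eq_iff)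

lemma tau_0 [simp]: "tau s z (\<lambda>k. 0) = (\<lambda>k. 0)" unfolding tau_def by simp

lemma op_domain:
  assumes "(u, w) \<in> osc_op b s"
  shows "u \<in> L2" "w \<in> L2" "fdom (cf u)"
  using assms unfolding op_iff by auto

lemma tau_op:
  assumes "(u, w) \<in> osc_op b s"
  shows "(\<lambda>x. w x - z * u x) \<in> L2" "cf (\<lambda>x. w x - z * u x) = tau s z (cf u)"
proof -
  have u: "u \<in> L2" and w: "w \<in> L2" using assms unfolding op_iff by auto
  show "(\<lambda>x. w x - z * u x) \<in> L2" by (intro L2_diff L2_cmult u w)
  show "cf (\<lambda>x. w x - z * u x) = tau s z (cf u)"
    using assms unfolding op_iff tau_def by (auto simp: fun_eq_iff cf_diff L2_cmult cf_cmult algebra_simps)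
qed

lemma op_from_tau:
  assumes "u \<in> L2" "f \<in> L2" "fdom (cf u)" "cf f = tau s z (cf u)"
  shows "(u, \<lambda>x. f x + z * u x) \<in> osc_op b s"
  unfolding op_iff using assms
  by (auto simp: cf_add L2_cmult L2_add cf_cmult tau_def algebra_simps)

text \<open>The second reduced equation turns the vanishing of \<open>opp u (Suc n)\<close> into
  that of \<open>opp u n\<close>, and then every equation with k \<noteq> n gives u_k = 0. Two
  numbers thus determine a null vector.\<close>

lemma tau_null:
  assumes z: "z \<in> Om n" and u: "fdom u" and t: "tau s z u = (\<lambda>k. 0)" and x: "u n = 0" and X: "opp u (Suc n) = 0"
  shows "u = (\<lambda>k. 0)"
proof
  have eq: "0 = (of_nat (2 * k + 1) - z) * u k + 2 * s * of_real (hf k b) * opp u k" for k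
    using fun_cong[OF t, of k] unfolding tau_def by (rule sym)
  have r0: "rhs P n (\<lambda>k. 0) z = 0" for P unfolding rhs_def by (simp cong: if_cong)
  have Y: "opp u n = 0"
    using reduced_eqs(2)[OF z u _ eq] X r0 by simp
  fix k
  have "opp u k = 0" using X Y opp_parity[of k n u] opp_parity[of k "Suc n" u] by (cases "even (k + n)") auto
  then show "u k = 0" using eq[of k] Om_neq[OF z, of k] x by (cases "k = n") auto
qed

lemma rhs_0 [simp]: "rhs P n (\<lambda>k. 0) z = 0" unfolding rhs_def by (simp cong: if_cong)

text \<open>Cramer's rule with all entries bounded through \<open>sg n\<close>. The constant is
  uniform on bounded parts of \<open>Om n\<close>, because \<open>chain_step\<close> applies it at
  points tending to z.\<close>

lemma sol_bound:
  obtains K where "K \<ge> 0"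
    "\<And>z u f. z \<in> Om n \<Longrightarrow> cmod (of_nat (2 * n + 1) - z) \<le> R \<Longrightarrow> fdom u \<Longrightarrow> summable (\<lambda>k. (cmod (f k))\<^sup>2) \<Longrightarrow> f = tau s z u \<Longrightarrow>
       cmod (chr s n z) * cmod (u n) \<le> K * sqrt (\<Sum>k. (cmod (f k))\<^sup>2)"
    "\<And>z u f. z \<in> Om n \<Longrightarrow> cmod (of_nat (2 * n + 1) - z) \<le> R \<Longrightarrow> fdom u \<Longrightarrow> summable (\<lambda>k. (cmod (f k))\<^sup>2) \<Longrightarrow> f = tau s z u \<Longrightarrow>
       cmod (chr s n z) * cmod (opp u (Suc n)) \<le> K * sqrt (\<Sum>k. (cmod (f k))\<^sup>2)"
proof -
  define g where "g = sg n"
  define a where "a = \<bar>hf n b\<bar>"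
  define r where "r = sqrt (g + 1)"
  define \<sigma> where "\<sigma> = cmod s"
  define P where "P = 1 + 2 * \<sigma> * a * r"
  define Q where "Q = r + 2 * \<sigma> * g * r"
  define K where "K = P * (1 + 4 * \<sigma>\<^sup>2 * g * g) + 4 * \<sigma>\<^sup>2 * a * g * Q + (\<bar>R\<bar> * Q + a * P)"
  have nn: "g \<ge> 0" "a \<ge> 0" "r \<ge> 0" "\<sigma> \<ge> 0" unfolding g_def a_def r_def \<sigma>_def using sg_nonneg by auto
  then have nn2: "P \<ge> 0" "Q \<ge> 0" unfolding P_def Q_def by auto
  have K0: "K \<ge> 0" using nn nn2 unfolding K_def by auto
  have bd: "cmod (chr s n z) * cmod (u n) \<le> K * sqrt (\<Sum>k. (cmod (f k))\<^sup>2) \<and>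
     cmod (chr s n z) * cmod (opp u (Suc n)) \<le> K * sqrt (\<Sum>k. (cmod (f k))\<^sup>2)"
    if z: "z \<in> Om n" and R: "cmod (of_nat (2 * n + 1) - z) \<le> R" and u: "fdom u" and f: "summable (\<lambda>k. (cmod (f k))\<^sup>2)" and ft: "f = tau s z u" for z u f
  proof -
    define N where "N = sqrt (\<Sum>k. (cmod (f k))\<^sup>2)"
    have N: "N \<ge> 0" unfolding N_def using suminf_nonneg[OF f] by simp
    have eq: "f k = (of_nat (2 * k + 1) - z) * u k + 2 * s * of_real (hf k b) * opp u k" for k
      unfolding ft tau_def ..
    let ?fO = "rhs (\<lambda>k. odd (k + n)) n f z" and ?fE = "rhs (\<lambda>k. even (k + n)) n f z"
    let ?p = "f n - 2 * s * of_real (hf n b) * ?fO" and ?q = "?fE - 2 * s * cE n z * ?fO"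
    have fO: "cmod ?fO \<le> N * r" and fE: "cmod ?fE \<le> N * r"
      unfolding N_def r_def g_def by (rule rhs_bound[OF z f])+
    have E: "cmod (cE n z) \<le> g" and O: "cmod (cO n z) \<le> g"
      unfolding g_def cE_def cO_def by (rule csum_bound[OF wt_pE z], rule csum_bound[OF wt_pO z])
    have fn: "cmod (f n) \<le> N"
    proof -
      have "(cmod (f n))\<^sup>2 \<le> (\<Sum>k. (cmod (f k))\<^sup>2)"
        using sum_le_suminf[OF f, of "{n}"] by simp
      then show ?thesis unfolding N_def by (rule real_le_rsqrt)
    qed
    have p: "cmod ?p \<le> P * N"
    proof -
      have "cmod ?p \<le> cmod (f n) + 2 * \<sigma> * a * cmod ?fO"
        by (rule order_trans[OF norm_triangle_ineq4]) (simp add: norm_mult \<sigma>_def a_def)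
      also have "\<dots> \<le> N + 2 * \<sigma> * a * (N * r)" using nn by (intro add_mono mult_left_mono fn fO) auto
      finally show ?thesis unfolding P_def by (simp add: algebra_simps)
    qed
    have q: "cmod ?q \<le> Q * N"
    proof -
      have "cmod ?q \<le> cmod ?fE + 2 * \<sigma> * (cmod (cE n z) * cmod ?fO)"
        by (rule order_trans[OF norm_triangle_ineq4]) (simp add: norm_mult \<sigma>_def)
      also have "\<dots> \<le> N * r + 2 * \<sigma> * (g * (N * r))" using nn N by (intro add_mono mult_left_mono mult_mono fE fO E) auto
      finally show ?thesis unfolding Q_def by (simp add: algebra_simps)
    qed
    have one: "cmod (1 - 4 * s\<^sup>2 * cE n z * cO n z) \<le> 1 + 4 * \<sigma>\<^sup>2 * g * g"
    proof -
      have "cmod (1 - 4 * s\<^sup>2 * cE n z * cO n z) \<le> 1 + 4 * \<sigma>\<^sup>2 * (cmod (cE n z) * cmod (cO n z))"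
        by (rule order_trans[OF norm_triangle_ineq4]) (simp add: norm_mult norm_power \<sigma>_def)
      also have "\<dots> \<le> 1 + 4 * \<sigma>\<^sup>2 * (g * g)" using nn by (intro add_mono mult_left_mono mult_mono E O) auto
      finally show ?thesis by (simp add: mult.assoc)
    qed
    have b1: "cmod (chr s n z * u n) \<le> (P * (1 + 4 * \<sigma>\<^sup>2 * g * g) + 4 * \<sigma>\<^sup>2 * a * g * Q) * N"
    proof -
      have "cmod (chr s n z * u n) \<le> cmod ?p * cmod (1 - 4 * s\<^sup>2 * cE n z * cO n z) + 4 * \<sigma>\<^sup>2 * a * (cmod (cO n z) * cmod ?q)"
        unfolding reduced_solution(1)[OF z u f eq]
        by (rule order_trans[OF norm_triangle_ineq]) (simp add: norm_mult norm_power \<sigma>_def a_def mult.assoc)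
      also have "\<dots> \<le> (P * N) * (1 + 4 * \<sigma>\<^sup>2 * g * g) + 4 * \<sigma>\<^sup>2 * a * (g * (Q * N))"
        using nn nn2 N by (intro add_mono mult_left_mono mult_mono p q one O) auto
      finally show ?thesis by (simp add: algebra_simps)
    qed
    have b2: "cmod (chr s n z * opp u (Suc n)) \<le> (\<bar>R\<bar> * Q + a * P) * N"
    proof -
      have "cmod (chr s n z * opp u (Suc n)) \<le> cmod (of_nat (2 * n + 1) - z) * cmod ?q + a * cmod ?p"
        unfolding reduced_solution(2)[OF z u f eq]
        by (rule order_trans[OF norm_triangle_ineq]) (simp add: norm_mult a_def)
      also have "\<dots> \<le> \<bar>R\<bar> * (Q * N) + a * (P * N)"
        using nn nn2 N R by (intro add_mono mult_left_mono mult_mono p q) auto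
      finally show ?thesis by (simp add: algebra_simps)
    qed
    have "(P * (1 + 4 * \<sigma>\<^sup>2 * g * g) + 4 * \<sigma>\<^sup>2 * a * g * Q) * N \<le> K * N" "(\<bar>R\<bar> * Q + a * P) * N \<le> K * N"
      unfolding K_def using nn nn2 N by (auto intro!: mult_right_mono)
    then show ?thesis using b1 b2 unfolding norm_mult N_def by linarith
  qed
  show thesis
    by (rule that[OF K0]) (rule conjunct1[OF bd] conjunct2[OF bd]; assumption)+
qed

section \<open>Resolvent set and eigenvalues\<close>

lemma chr_algebra:
  fixes w E Q a p q s :: complex
  defines "D \<equiv> w * (1 - 4 * s\<^sup>2 * E * Q) - 4 * s\<^sup>2 * a\<^sup>2 * Q"
  assumes D: "D \<noteq> 0"
  shows "w * ((p * (1 - 4 * s\<^sup>2 * E * Q) + 4 * s\<^sup>2 * a * Q * q) / D) - 4 * s\<^sup>2 * a * Q * ((w * q + a * p) / D) = p"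
    and "((w * q + a * p) / D) * (1 - 4 * s\<^sup>2 * E * Q) = a * ((p * (1 - 4 * s\<^sup>2 * E * Q) + 4 * s\<^sup>2 * a * Q * q) / D) + q"
proof -
  have "w * (p * (1 - 4 * s\<^sup>2 * E * Q) + 4 * s\<^sup>2 * a * Q * q) - 4 * s\<^sup>2 * a * Q * (w * q + a * p) = p * D"
    unfolding D_def by (simp add: algebra_simps power2_eq_square)
  then have "(w * (p * (1 - 4 * s\<^sup>2 * E * Q) + 4 * s\<^sup>2 * a * Q * q) - 4 * s\<^sup>2 * a * Q * (w * q + a * p)) / D = p"
    using D by simp
  then show "w * ((p * (1 - 4 * s\<^sup>2 * E * Q) + 4 * s\<^sup>2 * a * Q * q) / D) - 4 * s\<^sup>2 * a * Q * ((w * q + a * p) / D) = p"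
    by (simp add: diff_divide_distrib)
  have "(w * q + a * p) * (1 - 4 * s\<^sup>2 * E * Q) = a * (p * (1 - 4 * s\<^sup>2 * E * Q) + 4 * s\<^sup>2 * a * Q * q) + q * D"
    unfolding D_def by (simp add: algebra_simps power2_eq_square)
  then have "(w * q + a * p) * (1 - 4 * s\<^sup>2 * E * Q) / D = (a * (p * (1 - 4 * s\<^sup>2 * E * Q) + 4 * s\<^sup>2 * a * Q * q) + q * D) / D"
    by simp
  also have "\<dots> = a * (p * (1 - 4 * s\<^sup>2 * E * Q) + 4 * s\<^sup>2 * a * Q * q) / D + q"
    unfolding add_divide_distrib[of "a * _"] using D by simp
  finally show "((w * q + a * p) / D) * (1 - 4 * s\<^sup>2 * E * Q) = a * ((p * (1 - 4 * s\<^sup>2 * E * Q) + 4 * s\<^sup>2 * a * Q * q) / D) + q"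
    unfolding times_divide_eq_left times_divide_eq_right .
qed

lemma square_sum_quotient_le:
  fixes F H t :: real
  assumes t: "t \<ge> 1"
  shows "((F + H) / (t / 2))\<^sup>2 \<le> 8 * F\<^sup>2 + 8 * H\<^sup>2 / t"
proof -
  have "(F + H)\<^sup>2 \<le> 2 * F\<^sup>2 + 2 * H\<^sup>2"
    using zero_le_power2[of "F - H"] unfolding power2_sum power2_diff by linarith
  then have "4 * (F + H)\<^sup>2 / (t * t) \<le> 4 * (2 * F\<^sup>2 + 2 * H\<^sup>2) / (t * t)"
    using t by (intro divide_right_mono) auto
  also have "\<dots> = 8 * F\<^sup>2 * (1 / (t * t)) + 8 * H\<^sup>2 / t * (1 / t)"
    by (simp add: add_divide_distrib)
  also have "\<dots> \<le> 8 * F\<^sup>2 * 1 + 8 * H\<^sup>2 / t * 1"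
  proof (intro add_mono mult_left_mono)
    have "1 \<le> t * t" using mult_mono[OF t t] t by simp
    then show "1 / (t * t) \<le> 1" by simp
  qed (use t in auto)
  finally show ?thesis unfolding power_divide by (simp add: power2_eq_square[of t] mult.commute[of 4])
qed

lemma resolvent_surj:
  assumes z: "z \<in> Om n" and D: "chr s n z \<noteq> 0" and f: "f \<in> L2"
  shows "\<exists>(u, w)\<in>osc_op b s. L2_eq (\<lambda>x. w x - z * u x) f"
proof -
    have fs: "summable (\<lambda>k. (cmod (cf f k))\<^sup>2)" by (rule Bessel[OF f])
    let ?fO = "rhs (\<lambda>k. odd (k + n)) n (cf f) z" and ?fE = "rhs (\<lambda>k. even (k + n)) n (cf f) z"
    define p where "p = cf f n - 2 * s * of_real (hf n b) * ?fO"
    define q where "q = ?fE - 2 * s * cE n z * ?fO"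
    define x where "x = (p * (1 - 4 * s\<^sup>2 * cE n z * cO n z) + 4 * s\<^sup>2 * of_real (hf n b) * cO n z * q) / chr s n z"
    define X where "X = ((of_nat (2 * n + 1) - z) * q + of_real (hf n b) * p) / chr s n z"
    define Y where "Y = ?fO - 2 * s * X * cO n z"
    have alg1: "(of_nat (2 * n + 1) - z) * x - 4 * s\<^sup>2 * of_real (hf n b) * cO n z * X = p"
      and alg2: "X * (1 - 4 * s\<^sup>2 * cE n z * cO n z) = of_real (hf n b) * x + q"
    proof -
      have c: "chr s n z = (of_nat (2 * n + 1) - z) * (1 - 4 * s\<^sup>2 * cE n z * cO n z) - 4 * s\<^sup>2 * (of_real (hf n b))\<^sup>2 * cO n z"
        unfolding chr_def of_real_power ..
      show "(of_nat (2 * n + 1) - z) * x - 4 * s\<^sup>2 * of_real (hf n b) * cO n z * X = p"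
        using chr_algebra(1)[of "of_nat (2 * n + 1) - z" s "cE n z" "cO n z" "of_real (hf n b)", folded c, OF D]
        unfolding x_def X_def .
      show "X * (1 - 4 * s\<^sup>2 * cE n z * cO n z) = of_real (hf n b) * x + q"
        using chr_algebra(2)[of "of_nat (2 * n + 1) - z" s "cE n z" "cO n z" "of_real (hf n b)", folded c, OF D]
        unfolding x_def X_def .
    qed
    have 1: "X = of_real (hf n b) * x + ?fE - 2 * s * Y * cE n z"
      using alg2 unfolding Y_def q_def by (simp add: algebra_simps power2_eq_square)
    have 2: "cf f n = (of_nat (2 * n + 1) - z) * x + 2 * s * of_real (hf n b) * Y"
    proof -
      have "cf f n = p + 2 * s * of_real (hf n b) * ?fO" unfolding p_def by simp
      then show ?thesis unfolding alg1[symmetric] Y_def by (simp add: algebra_simps power2_eq_square)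
    qed
    obtain u where u: "fdom u" "\<And>k. cf f k = (of_nat (2 * k + 1) - z) * u k + 2 * s * of_real (hf k b) * opp u k"
      by (rule construct[OF z fs 1 Y_def 2]) (rule that)
    have "(synth u, \<lambda>x. f x + z * synth u x) \<in> osc_op b s"
    proof (rule op_from_tau)
      have "cf (synth u) = u" using synth_L2(2)[OF u(1)] by auto
      then show "fdom (cf (synth u))" "cf f = tau s z (cf (synth u))" using u unfolding tau_def by auto
    qed (use synth_L2(1)[OF u(1)] f in auto)
    then show ?thesis by (intro bexI[of _ "(synth u, \<lambda>x. f x + z * synth u x)"]) (auto simp: L2_eq_def)
  qed

text \<open>\<open>sol_bound\<close> controls u_n and one of the two numbers \<open>opp\<close>, the
  reduced equation the other. Each remaining coefficient is estimated from its own equation, where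
  the factor 1/|k-n| makes the squares summable.\<close>

lemma resolvent_bound:
  assumes z: "z \<in> Om n" and D: "chr s n z \<noteq> 0"
  shows "\<exists>M. \<forall>(u, w)\<in>osc_op b s. L2_norm u \<le> M * L2_norm (\<lambda>x. w x - z * u x)"
proof -
  obtain K where K: "K \<ge> 0" and Kb:
    "\<And>z' u f. z' \<in> Om n \<Longrightarrow> cmod (of_nat (2 * n + 1) - z') \<le> cmod (of_nat (2 * n + 1) - z) \<Longrightarrow> fdom u \<Longrightarrow> summable (\<lambda>k. (cmod (f k))\<^sup>2) \<Longrightarrow> f = tau s z' u \<Longrightarrow>
       cmod (chr s n z') * cmod (u n) \<le> K * sqrt (\<Sum>k. (cmod (f k))\<^sup>2)"
    "\<And>z' u f. z' \<in> Om n \<Longrightarrow> cmod (of_nat (2 * n + 1) - z') \<le> cmod (of_nat (2 * n + 1) - z) \<Longrightarrow> fdom u \<Longrightarrow> summable (\<lambda>k. (cmod (f k))\<^sup>2) \<Longrightarrow> f = tau s z' u \<Longrightarrow>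
       cmod (chr s n z') * cmod (opp u (Suc n)) \<le> K * sqrt (\<Sum>k. (cmod (f k))\<^sup>2)"
    by (rule sol_bound[of n "cmod (of_nat (2 * n + 1) - z)" s]) (rule that)
  define d where "d = cmod (chr s n z)"
  have d: "d > 0" unfolding d_def using D by simp
  define L where "L = K / d + (sqrt (sg n + 1) + 2 * cmod s * (K / d) * sg n)"
  have "0 \<le> K / d" "0 \<le> sqrt (sg n + 1) + 2 * cmod s * (K / d) * sg n" using K d sg_nonneg[of n] by auto
  then have L0: "L \<ge> 0" "K / d \<le> L" "sqrt (sg n + 1) + 2 * cmod s * (K / d) * sg n \<le> L" unfolding L_def by linarith+
  define M where "M = L\<^sup>2 + 8 + 8 * (cmod s)\<^sup>2 * L\<^sup>2 * sg n"
  have M0: "M \<ge> 0" unfolding M_def using sg_nonneg[of n] by auto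
  have bd: "L2_norm u \<le> sqrt M * L2_norm (\<lambda>x. w x - z * u x)" if uw: "(u, w) \<in> osc_op b s" for u w
  proof -
    define f where "f = (\<lambda>x. w x - z * u x)"
    note t = op_domain[OF uw] tau_op[OF uw, of z, folded f_def]
    define c where "c = cf u"
    have fs: "summable (\<lambda>k. (cmod (cf f k))\<^sup>2)" by (rule Bessel[OF t(4)])
    have Nf: "N2 f = (\<Sum>k. (cmod (cf f k))\<^sup>2)" by (rule sums_unique[OF Parseval_norm[OF t(4)]])
    define N where "N = sqrt (N2 f)"
    have N0: "N \<ge> 0" "N\<^sup>2 = N2 f" unfolding N_def by auto
    have eq: "cf f k = (of_nat (2 * k + 1) - z) * c k + 2 * s * of_real (hf k b) * opp c k" for k
      using t(5) unfolding c_def tau_def by auto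
    have fd: "fdom c" unfolding c_def by (rule t(3))
    have "d * cmod (c n) \<le> K * N" "d * cmod (opp c (Suc n)) \<le> K * N"
      using Kb(1)[OF z order_refl fd fs t(5)[folded c_def]] Kb(2)[OF z order_refl fd fs t(5)[folded c_def]]
      unfolding d_def N_def Nf .
    then have x: "cmod (c n) \<le> K / d * N" and X: "cmod (opp c (Suc n)) \<le> K / d * N"
      using d by (auto simp: field_simps)
    have Y: "cmod (opp c n) \<le> (sqrt (sg n + 1) + 2 * cmod s * (K / d) * sg n) * N"
    proof -
      have "cmod (opp c n) \<le> cmod (rhs (\<lambda>k. odd (k + n)) n (cf f) z) + 2 * cmod s * (cmod (opp c (Suc n)) * cmod (cO n z))"
        unfolding reduced_eqs(2)[OF z fd fs eq]
        by (rule order_trans[OF norm_triangle_ineq4]) (simp add: norm_mult)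
      also have "\<dots> \<le> N * sqrt (sg n + 1) + 2 * cmod s * ((K / d * N) * sg n)"
      proof (intro add_mono mult_left_mono mult_mono X)
        show "cmod (rhs (\<lambda>k. odd (k + n)) n (cf f) z) \<le> N * sqrt (sg n + 1)"
          using rhs_bound[OF z fs] unfolding N_def Nf .
        show "cmod (cO n z) \<le> sg n" unfolding cO_def by (rule csum_bound[OF wt_pO z])
      qed (use K d N0 in auto)
      finally show ?thesis by (simp add: algebra_simps)
    qed
    have V: "cmod (opp c k) \<le> L * N" for k
    proof -
      have "K / d * N \<le> L * N" "(sqrt (sg n + 1) + 2 * cmod s * (K / d) * sg n) * N \<le> L * N"
        by (rule mult_right_mono[OF L0(2) N0(1)], rule mult_right_mono[OF L0(3) N0(1)])
      then show ?thesis using X Y opp_parity[of k n c] opp_parity[of k "Suc n" c] by (cases "even (k + n)") auto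
    qed
    have tb: "(cmod (c k))\<^sup>2 \<le> (if k = n then L\<^sup>2 * N2 f else 0) + (8 * (cmod (cf f k))\<^sup>2 + 8 * (cmod s)\<^sup>2 * L\<^sup>2 * N2 f * (if k = n then 0 else 4 * (hf k b)\<^sup>2 / kd n k))" for k
    proof (cases "k = n")
      case True
      have "cmod (c n) \<le> L * N" using x L0(2) N0 mult_right_mono[OF L0(2) N0(1)] by linarith
      then have "(cmod (c n))\<^sup>2 \<le> (L * N)\<^sup>2" by (intro power_mono) auto
      also have "\<dots> = L\<^sup>2 * N2 f" by (simp add: power_mult_distrib N0(2))
      finally have "(cmod (c n))\<^sup>2 \<le> L\<^sup>2 * N2 f + 8 * (cmod (cf f n))\<^sup>2"
        using zero_le_power2[of "cmod (cf f n)"] by linarith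
      then show ?thesis using True by simp
    next
      case False
      have kd: "kd n k \<ge> 1" by (rule kd_ge_1[OF False])
      let ?h = "2 * cmod s * \<bar>hf k b\<bar> * (L * N)"
      have "c k = (cf f k - 2 * s * of_real (hf k b) * opp c k) / (of_nat (2 * k + 1) - z)"
        using Om_neq[OF z False] unfolding eq[of k] by simp
      then have "cmod (c k) = cmod (cf f k - 2 * s * of_real (hf k b) * opp c k) / cmod (of_nat (2 * k + 1) - z)"
        by (simp add: norm_divide)
      also have "\<dots> \<le> (cmod (cf f k) + ?h) / (kd n k / 2)"
      proof (rule frac_le)
        have "cmod (cf f k - 2 * s * of_real (hf k b) * opp c k) \<le> cmod (cf f k) + 2 * cmod s * \<bar>hf k b\<bar> * cmod (opp c k)"
          by (rule order_trans[OF norm_triangle_ineq4]) (simp add: norm_mult)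
        also have "\<dots> \<le> cmod (cf f k) + ?h" by (intro add_left_mono mult_left_mono V) auto
        finally show "cmod (cf f k - 2 * s * of_real (hf k b) * opp c k) \<le> cmod (cf f k) + ?h" .
        show "kd n k / 2 \<le> cmod (of_nat (2 * k + 1) - z)" by (rule Om_dist[OF z False])
      qed (use kd L0 N0 in auto)
      finally have "(cmod (c k))\<^sup>2 \<le> ((cmod (cf f k) + ?h) / (kd n k / 2))\<^sup>2" by (intro power_mono) auto
      also have "\<dots> \<le> 8 * (cmod (cf f k))\<^sup>2 + 8 * ?h\<^sup>2 / kd n k"
        by (rule square_sum_quotient_le[OF kd])
      also have "8 * ?h\<^sup>2 / kd n k = 8 * (cmod s)\<^sup>2 * L\<^sup>2 * N\<^sup>2 * (4 * (hf k b)\<^sup>2 / kd n k)"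
        by (simp only: power_mult_distrib power2_abs) simp
      also have "N\<^sup>2 = N2 f" by (rule N0(2))
      finally show ?thesis using False by simp
    qed
    have "N2 u \<le> L\<^sup>2 * N2 f + (8 * N2 f + 8 * (cmod s)\<^sup>2 * L\<^sup>2 * N2 f * sg n)"
    proof (rule sums_le[OF tb])
      show "(\<lambda>k. (cmod (c k))\<^sup>2) sums N2 u" unfolding c_def by (rule Parseval_norm[OF t(1)])
      show "(\<lambda>k. (if k = n then L\<^sup>2 * N2 f else 0) + (8 * (cmod (cf f k))\<^sup>2 + 8 * (cmod s)\<^sup>2 * L\<^sup>2 * N2 f * (if k = n then 0 else 4 * (hf k b)\<^sup>2 / kd n k)))
        sums (L\<^sup>2 * N2 f + (8 * N2 f + 8 * (cmod s)\<^sup>2 * L\<^sup>2 * N2 f * sg n))"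
        unfolding sg_def using sums_single[of n "\<lambda>k. L\<^sup>2 * N2 f"]
        by (intro sums_add sums_mult Parseval_norm t(4) summable_sums sg_summable) 
    qed
    also have "\<dots> = M * N2 f" unfolding M_def by (simp add: algebra_simps)
    finally have "sqrt (N2 u) \<le> sqrt (M * N2 f)" by simp
    then show ?thesis unfolding L2_norm_N2 real_sqrt_mult f_def .
  qed
  show ?thesis by (intro exI[of _ "sqrt M"] ballI) (auto intro: bd)
qed

lemma resolventI:
  assumes z: "z \<in> Om n" and D: "chr s n z \<noteq> 0"
  shows "z \<in> resolvent_set (osc_op b s)"
  unfolding resolvent_set_def using resolvent_surj[OF z D] resolvent_bound[OF z D] by simp

lemma eigenvalue_iff:
  assumes z: "z \<in> Om n"
  shows "eigenvalue (osc_op b s) z \<longleftrightarrow> chr s n z = 0"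
proof
  assume "eigenvalue (osc_op b s) z"
  then obtain u w where uw: "(u, w) \<in> osc_op b s" "\<not> L2_eq u (\<lambda>x. 0)" "L2_eq w (\<lambda>x. z * u x)"
    unfolding eigenvalue_def by blast
  note t = op_domain[OF uw(1)] tau_op[OF uw(1), of z]
  have "L2_eq (\<lambda>x. w x - z * u x) (\<lambda>x. 0)" using uw(3) unfolding L2_eq_def by eventually_elim simp
  then have t0: "tau s z (cf u) = (\<lambda>k. 0)" using t(5) cf_null_iff[OF t(4)] by simp
  show "chr s n z = 0"
  proof (rule ccontr)
    assume nz: "chr s n z \<noteq> 0"
    have eq: "(\<lambda>k. 0) k = (of_nat (2 * k + 1) - z) * cf u k + 2 * s * of_real (hf k b) * opp (cf u) k" for k
      using t0 unfolding tau_def by (auto simp: fun_eq_iff)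
    have s0: "summable (\<lambda>k. (cmod ((\<lambda>k. 0) (k::nat)))\<^sup>2)" by simp
    have "cf u n = 0" "opp (cf u) (Suc n) = 0"
      using reduced_solution[OF z t(3) s0 eq] nz by auto
    then have "cf u = (\<lambda>k. 0)" by (rule tau_null[OF z t(3) t0])
    then show False using uw(2) cf_null_iff[OF t(1)] by simp
  qed
next
  assume D: "chr s n z = 0"
  define w where "w = of_nat (2 * n + 1) - z"
  define a where "a = complex_of_real (hf n b)"
  define e where "e = 1 - 4 * s\<^sup>2 * cE n z * cO n z"
  define c where "c = 4 * s\<^sup>2 * a * cO n z"
  have D': "w * e - a * c = 0" using D unfolding chr_def w_def e_def c_def a_def by (simp add: power2_eq_square mult_ac)
  \<comment> \<open>A non-zero null vector of the singular matrix with rows (w, -c) and (-a, e),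
    read off from the first row or, if that is zero, from the second.\<close>
  obtain x X where xX: "w * x = c * X" "X * e = a * x" "x \<noteq> 0 \<or> X \<noteq> 0"
  proof (cases "w = 0 \<and> c = 0")
    case False
    then show thesis using that[of c w] D' by (auto simp: mult.commute)
  next
    case True
    show thesis
    proof (cases "e = 0 \<and> a = 0")
      case False
      then show thesis using that[of e a] True by auto
    next
      case True2: True
      show thesis using that[of 1 0] True True2 by auto
    qed
  qed
  define Y where "Y = - 2 * s * X * cO n z"
  have s0: "summable (\<lambda>k. (cmod ((\<lambda>k. 0) (k::nat)))\<^sup>2)" by simp
  have 1: "X = of_real (hf n b) * x + rhs (\<lambda>k. even (k + n)) n (\<lambda>k. 0) z - 2 * s * Y * cE n z"
    using xX(2) unfolding Y_def e_def a_def by (simp add: algebra_simps power2_eq_square)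
  have 2: "Y = rhs (\<lambda>k. odd (k + n)) n (\<lambda>k. 0) z - 2 * s * X * cO n z" unfolding Y_def by simp
  have 3: "(\<lambda>k. 0) n = (of_nat (2 * n + 1) - z) * x + 2 * s * of_real (hf n b) * Y"
    using xX(1) unfolding Y_def c_def a_def w_def by (simp add: algebra_simps power2_eq_square)
  obtain u where u: "fdom u" "u n = x" "opp u (Suc n) = X" 
     "\<And>k. (\<lambda>k. 0) k = (of_nat (2 * k + 1) - z) * u k + 2 * s * of_real (hf k b) * opp u k"
    by (rule construct[OF z s0 1 2 3]) (rule that)
  have cu: "cf (synth u) = u" using synth_L2(2)[OF u(1)] by auto
  have "(synth u, \<lambda>x. (\<lambda>x. 0) x + z * synth u x) \<in> osc_op b s"
  proof (rule op_from_tau)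
    show "fdom (cf (synth u))" "cf (\<lambda>x. 0) = tau s z (cf (synth u))" unfolding cu using u unfolding tau_def by (auto simp: fun_eq_iff)
  qed (use synth_L2(1)[OF u(1)] L2_zero in auto)
  moreover have "\<not> L2_eq (synth u) (\<lambda>x. 0)"
  proof
    assume "L2_eq (synth u) (\<lambda>x. 0)"
    then have "u = (\<lambda>k. 0)" using cf_null_iff[OF synth_L2(1)[OF u(1)]] cu by simp
    then show False using u(2,3) xX(3) by simp
  qed
  ultimately show "eigenvalue (osc_op b s) z"
    unfolding eigenvalue_def by (intro bexI[of _ "(synth u, \<lambda>x. (\<lambda>x. 0) x + z * synth u x)"]) (auto simp: L2_eq_def)
qed

lemma eigenvalue_spectrum:
  assumes "eigenvalue (osc_op b s) z"
  shows "z \<in> spectrum (osc_op b s)"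
proof -
  obtain u w where uw: "(u, w) \<in> osc_op b s" "\<not> L2_eq u (\<lambda>x. 0)" "L2_eq w (\<lambda>x. z * u x)"
    using assms unfolding eigenvalue_def by blast
  note t = op_domain[OF uw(1)] tau_op[OF uw(1), of z]
  have "L2_eq (\<lambda>x. w x - z * u x) (\<lambda>x. 0)" using uw(3) unfolding L2_eq_def by eventually_elim simp
  then have "L2_norm (\<lambda>x. w x - z * u x) = 0" using N2_eq_0_iff[OF t(4)] unfolding L2_norm_N2 by simp
  moreover have "L2_norm u > 0" using N2_eq_0_iff[OF t(1)] uw(2) N2_nonneg[of u] unfolding L2_norm_N2 by (simp add: less_le)
  ultimately have "\<not> L2_norm u \<le> K * L2_norm (\<lambda>x. w x - z * u x)" for K by simp
  then show ?thesis using uw(1) unfolding spectrum_def resolvent_set_def by fastforce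
qed

lemma spectrum_iff: "z \<in> Om n \<Longrightarrow> z \<in> spectrum (osc_op b s) \<longleftrightarrow> chr s n z = 0"
  using resolventI[of z n s] eigenvalue_iff[of z n s] eigenvalue_spectrum[of s z] unfolding spectrum_def by blast

section \<open>Zeros of the characteristic function\<close>

lemma chr_holomorphic: "chr s n holomorphic_on Om n"
  unfolding chr_def[abs_def] cE_def cO_def
  by (intro holomorphic_intros csum_holomorphic wt_pE wt_pO)

text \<open>Far from the real axis both sums are small, so 2n+1 - z dominates. This shows that
  \<open>chr\<close> is not constant and confines the eigenvalues of each strip to a bounded
  set.\<close>

lemma chr_im_bound:
  "\<exists>Y>0. \<forall>z\<in>Om n. \<bar>Im z\<bar> \<ge> Y \<longrightarrow> chr s n z \<noteq> 0"
proof -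
  \<comment> \<open>Makes |s| e at most 1/4, hence 4 |s|^2 e^2 at most 1/4.\<close>
  define e where "e = 1 / (4 * (cmod s + 1))"
  have e0: "e > 0" unfolding e_def by (simp add: add_nonneg_pos)
  obtain Y1 where Y1: "\<And>z. z \<in> Om n \<Longrightarrow> \<bar>Im z\<bar> \<ge> Y1 \<Longrightarrow> cmod (cE n z) \<le> e"
    using csum_decay[OF wt_pE[of n] e0] unfolding cE_def by blast
  obtain Y2 where Y2: "\<And>z. z \<in> Om n \<Longrightarrow> \<bar>Im z\<bar> \<ge> Y2 \<Longrightarrow> cmod (cO n z) \<le> e"
    using csum_decay[OF wt_pO[of n] e0] unfolding cO_def by blast
  define Y where "Y = max (max Y1 Y2) (8 * (cmod s)\<^sup>2 * (hf n b)\<^sup>2 * e + 1)"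
  have "Y > 0" unfolding Y_def using e0 by (simp add: less_max_iff_disj add_nonneg_pos)
  moreover have "chr s n z \<noteq> 0" if z: "z \<in> Om n" and im: "\<bar>Im z\<bar> \<ge> Y" for z
  proof
    assume D: "chr s n z = 0"
    define w where "w = of_nat (2 * n + 1) - z"
    have w: "cmod w \<ge> Y" using abs_Im_le_cmod[of w] im unfolding w_def by simp
    have E: "cmod (cE n z) \<le> e" and O: "cmod (cO n z) \<le> e" using Y1 Y2 z im unfolding Y_def by auto
    have "w = 4 * s\<^sup>2 * cE n z * cO n z * w + 4 * s\<^sup>2 * of_real ((hf n b)\<^sup>2) * cO n z"
      using D unfolding chr_def w_def by (simp add: algebra_simps)
    then have "cmod w \<le> cmod (4 * s\<^sup>2 * cE n z * cO n z * w) + cmod (4 * s\<^sup>2 * of_real ((hf n b)\<^sup>2) * cO n z)"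
      using norm_triangle_ineq[of "4 * s\<^sup>2 * cE n z * cO n z * w" "4 * s\<^sup>2 * of_real ((hf n b)\<^sup>2) * cO n z"] by simp
    also have "\<dots> = 4 * (cmod s)\<^sup>2 * (cmod (cE n z) * cmod (cO n z)) * cmod w + 4 * (cmod s)\<^sup>2 * (hf n b)\<^sup>2 * cmod (cO n z)"
      by (simp add: norm_mult norm_power)
    also have "\<dots> \<le> 4 * (cmod s)\<^sup>2 * (e * e) * cmod w + 4 * (cmod s)\<^sup>2 * (hf n b)\<^sup>2 * e"
      using E O e0 by (intro add_mono mult_left_mono mult_right_mono mult_mono) auto
    also have "4 * (cmod s)\<^sup>2 * (e * e) * cmod w \<le> 1 / 4 * cmod w"
    proof (rule mult_right_mono)
      have "(cmod s + 1) * e = 1 / 4"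
      proof -
        have "cmod s + 1 \<noteq> 0" using norm_ge_zero[of s] by linarith
        then show ?thesis unfolding e_def by simp
      qed
      then have "cmod s * e \<le> 1 / 4" using e0 by (simp add: distrib_right)
      then have "(cmod s * e)\<^sup>2 \<le> (1 / 4)\<^sup>2" using e0 by (intro power_mono) auto
      then show "4 * (cmod s)\<^sup>2 * (e * e) \<le> 1 / 4" by (simp add: power2_eq_square field_simps)
    qed simp
    finally have "cmod w * (3 / 4) \<le> 4 * (cmod s)\<^sup>2 * (hf n b)\<^sup>2 * e" by simp
    moreover have "cmod w \<ge> 8 * (cmod s)\<^sup>2 * (hf n b)\<^sup>2 * e + 1" using w unfolding Y_def by simp
    moreover have "0 \<le> 4 * (cmod s)\<^sup>2 * (hf n b)\<^sup>2 * e" using e0 by simp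
    ultimately show False by linarith
  qed
  ultimately show ?thesis by blast
qed

lemma chr_not_constant:
  assumes "chr s n z = 0" "z \<in> Om n"
  shows "\<not> chr s n constant_on Om n"
proof -
  obtain Y where Y: "Y > 0" "\<And>z. z \<in> Om n \<Longrightarrow> \<bar>Im z\<bar> \<ge> Y \<Longrightarrow> chr s n z \<noteq> 0" using chr_im_bound[of n s] by blast
  have m: "Complex (Re z) Y \<in> Om n" using assms(2) unfolding Om_def by auto
  have nz: "chr s n (Complex (Re z) Y) \<noteq> 0" by (rule Y(2)[OF m]) simp
  show ?thesis
  proof
    assume "chr s n constant_on Om n"
    then obtain y where "\<And>x. x \<in> Om n \<Longrightarrow> chr s n x = y" unfolding constant_on_def by blast
    from this[OF m] this[OF assms(2)] show False using nz assms(1) by simp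
  qed
qed

text \<open>The lower bound is demanded only for some arbitrarily small increments. That suffices
  for \<open>chain_step\<close>, and \<open>order_1_upper\<close> establishes it along vertical
  increments only.\<close>

definition order_at_most :: "complex \<Rightarrow> nat \<Rightarrow> complex \<Rightarrow> nat \<Rightarrow> bool" where
  "order_at_most s n z p \<longleftrightarrow> (\<exists>c>0. \<forall>e>0. \<exists>\<epsilon>. \<epsilon> \<noteq> 0 \<and> cmod \<epsilon> < e \<and> z + \<epsilon> \<in> Om n \<and> c * cmod \<epsilon> ^ p \<le> cmod (chr s n (z + \<epsilon>)))"

lemma chr_zero_isolated:
  assumes z: "z \<in> Om n" and D: "chr s n z = 0"
  shows "\<exists>r>0. ball z r \<subseteq> Om n \<and> (\<forall>y\<in>ball z r. chr s n y = 0 \<longrightarrow> y = z)" "\<exists>p. order_at_most s n z p"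
proof -
  obtain g r p where g: "0 < p" "0 < r" "ball z r \<subseteq> Om n" "g holomorphic_on ball z r"
    "\<And>w. w \<in> ball z r \<Longrightarrow> chr s n w = (w - z) ^ p * g w" "\<And>w. w \<in> ball z r \<Longrightarrow> g w \<noteq> 0"
    by (rule holomorphic_factor_zero_nonconstant[OF chr_holomorphic open_Om convex_connected[OF convex_Om] z D chr_not_constant[OF D z]])
       (rule that)
  show "\<exists>r>0. ball z r \<subseteq> Om n \<and> (\<forall>y\<in>ball z r. chr s n y = 0 \<longrightarrow> y = z)"
  proof (intro exI[of _ r] conjI ballI impI)
    fix y assume y: "y \<in> ball z r" "chr s n y = 0"
    then show "y = z" using g(5)[OF y(1)] g(6)[OF y(1)] by simp
  qed (use g in auto)
  have zb: "z \<in> ball z r" using g by simp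
  have "isCont g z" using holomorphic_on_imp_continuous_on[OF g(4)] zb by (simp add: continuous_on_eq_continuous_at)
  then have "\<forall>e>0. \<exists>d>0. \<forall>y. dist y z < d \<longrightarrow> dist (g y) (g z) < e"
    unfolding continuous_at_eps_delta .
  moreover have "cmod (g z) / 2 > 0" using g(6)[OF zb] by simp
  ultimately obtain \<delta> where \<delta>: "\<delta> > 0" "\<And>y. dist y z < \<delta> \<Longrightarrow> cmod (g y - g z) < cmod (g z) / 2"
    unfolding dist_norm[of "g _"] by meson
  have "order_at_most s n z p"
    unfolding order_at_most_def
  proof (intro exI[of _ "cmod (g z) / 2"] conjI allI impI)
    show "cmod (g z) / 2 > 0" using g(6)[OF zb] by simp
    fix e :: real assume e: "e > 0"
    define t where "t = min (min e r) \<delta> / 2"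
    have t: "t > 0" "t < e" "t < r" "t < \<delta>" unfolding t_def using e g \<delta> by auto
    define \<epsilon> where "\<epsilon> = complex_of_real t"
    have c: "cmod \<epsilon> = t" unfolding \<epsilon>_def using t by simp
    have b: "z + \<epsilon> \<in> ball z r" using c t by (simp add: dist_norm)
    have "cmod (g (z + \<epsilon>) - g z) < cmod (g z) / 2" using \<delta>(2)[of "z + \<epsilon>"] c t by (simp add: dist_norm)
    then have "cmod (g z) / 2 \<le> cmod (g (z + \<epsilon>))" using norm_triangle_ineq2[of "g z" "g (z + \<epsilon>)"] by (simp add: norm_minus_commute)
    then have "cmod (g z) / 2 * cmod \<epsilon> ^ p \<le> cmod (g (z + \<epsilon>)) * cmod \<epsilon> ^ p" by (intro mult_right_mono) auto
    also have "\<dots> = cmod (chr s n (z + \<epsilon>))" unfolding g(5)[OF b] by (simp add: norm_mult norm_power)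
    finally have "cmod (g z) / 2 * cmod \<epsilon> ^ p \<le> cmod (chr s n (z + \<epsilon>))" .
    then show "\<exists>\<epsilon>. \<epsilon> \<noteq> 0 \<and> cmod \<epsilon> < e \<and> z + \<epsilon> \<in> Om n \<and> cmod (g z) / 2 * cmod \<epsilon> ^ p \<le> cmod (chr s n (z + \<epsilon>))"
      using b g(3) c t by (intro exI[of _ \<epsilon>]) auto
  qed
  then show "\<exists>p. order_at_most s n z p" ..
qed

section \<open>Jordan chains and root spaces\<close>

lemma tau_pow_0 [simp]: "(tau s z ^^ j) (\<lambda>k. 0) = (\<lambda>k. 0)"
  by (induction j) auto

lemma tau_pow_Suc: "(tau s z ^^ Suc j) c = (tau s z ^^ j) (tau s z c)"
  by (simp add: funpow_swap1)

lemma ker_pow_iff: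
  "u \<in> ker_pow (osc_op b s) z m \<longleftrightarrow> u \<in> L2 \<and> (\<forall>j<m. fdom ((tau s z ^^ j) (cf u))) \<and> (tau s z ^^ m) (cf u) = (\<lambda>k. 0)"
proof (induction m arbitrary: u)
  case 0
  show ?case using cf_null_iff[of u] by auto
next
  case (Suc m)
  show ?case
  proof
    assume "u \<in> ker_pow (osc_op b s) z (Suc m)"
    then obtain w where uw: "(u, w) \<in> osc_op b s" and f: "(\<lambda>x. w x - z * u x) \<in> ker_pow (osc_op b s) z m" by auto
    note t = op_domain[OF uw] tau_op[OF uw, of z]
    have IH: "\<forall>j<m. fdom ((tau s z ^^ j) (tau s z (cf u)))" "(tau s z ^^ m) (tau s z (cf u)) = (\<lambda>k. 0)"
      using f unfolding Suc.IH t(5) by auto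
    have "fdom ((tau s z ^^ j) (cf u))" if "j < Suc m" for j
    proof (cases j)
      case 0 then show ?thesis using t(3) by simp
    next
      case (Suc i)
      then have "i < m" using that by simp
      then show ?thesis using IH(1) unfolding Suc tau_pow_Suc by blast
    qed
    then show "u \<in> L2 \<and> (\<forall>j<Suc m. fdom ((tau s z ^^ j) (cf u))) \<and> (tau s z ^^ Suc m) (cf u) = (\<lambda>k. 0)"
      unfolding tau_pow_Suc using t(1) IH(2) by simp
  next
    assume a: "u \<in> L2 \<and> (\<forall>j<Suc m. fdom ((tau s z ^^ j) (cf u))) \<and> (tau s z ^^ Suc m) (cf u) = (\<lambda>k. 0)"
    have d0: "fdom (cf u)" using a by (auto dest: spec[of _ 0])
    have d1: "fdom (tau s z (cf u))"
    proof (cases m)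
      case 0 then show ?thesis using a fdom_0 by simp
    next
      case (Suc i)
      then have "fdom ((tau s z ^^ Suc 0) (cf u))" using a by blast
      then show ?thesis by simp
    qed
    define f where "f = synth (tau s z (cf u))"
    have f: "f \<in> L2" "cf f = tau s z (cf u)"
      unfolding f_def using synth_L2[OF d1] by auto
    have op: "(u, \<lambda>x. f x + z * u x) \<in> osc_op b s"
      by (rule op_from_tau) (use a f d0 in auto)
    have "fdom ((tau s z ^^ j) (cf f))" if "j < m" for j
    proof -
      have "fdom ((tau s z ^^ Suc j) (cf u))" using a that by blast
      then show ?thesis unfolding f(2) tau_pow_Suc .
    qed
    moreover have "(tau s z ^^ m) (cf f) = (\<lambda>k. 0)" using a unfolding f(2) tau_pow_Suc by blast
    ultimately have "f \<in> ker_pow (osc_op b s) z m" unfolding Suc.IH using f(1) by blast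
    then have "(\<lambda>x. (f x + z * u x) - z * u x) \<in> ker_pow (osc_op b s) z m" by simp
    then show "u \<in> ker_pow (osc_op b s) z (Suc m)" using op by auto
  qed
qed

lemma tau_shift: "tau s (z + \<epsilon>) u k = tau s z u k - \<epsilon> * u k"
  unfolding tau_def by (simp add: algebra_simps)

lemma tau_combination:
  assumes "\<And>j. j < (l::nat) \<Longrightarrow> fdom (y j)"
  shows "fdom (\<lambda>k. \<Sum>j<l. c j * y j k) \<and> opp (\<lambda>k. \<Sum>j<l. c j * y j k) i = (\<Sum>j<l. c j * opp (y j) i)
    \<and> tau s z (\<lambda>k. \<Sum>j<l. c j * y j k) = (\<lambda>k. \<Sum>j<l. c j * tau s z (y j) k)"
  using assms
proof (induction l)
  case 0
  then show ?case using fdom_0 by simp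
next
  case (Suc l)
  then have IH: "fdom (\<lambda>k. \<Sum>j<l. c j * y j k)" "opp (\<lambda>k. \<Sum>j<l. c j * y j k) i = (\<Sum>j<l. c j * opp (y j) i)"
    "tau s z (\<lambda>k. \<Sum>j<l. c j * y j k) = (\<lambda>k. \<Sum>j<l. c j * tau s z (y j) k)" and yl: "fdom (y l)" by auto
  show ?case
    using fdom_lin[OF IH(1) yl, of "c l"] opp_lin[OF IH(1) yl, of "c l" i] tau_lin[OF IH(1) yl, of s z "c l"]
    unfolding IH(2,3) by simp
qed

lemma small_multiple_imp_0:
  fixes x C :: real
  assumes "x \<ge> 0" "\<And>e. e > 0 \<Longrightarrow> \<exists>t. 0 \<le> t \<and> t < e \<and> x \<le> t * C"
  shows "x = 0"
proof (rule ccontr)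
  assume "x \<noteq> 0"
  then have x: "x > 0" using assms(1) by simp
  have e: "x / (\<bar>C\<bar> + 1) > 0" using x by (intro divide_pos_pos) auto
  obtain t where t: "0 \<le> t" "t < x / (\<bar>C\<bar> + 1)" "x \<le> t * C" using assms(2)[OF e] by blast
  have "x \<le> t * (\<bar>C\<bar> + 1)" using t mult_left_mono[of C "\<bar>C\<bar> + 1" t] by linarith
  also have "\<dots> < x" using t(2) by (simp add: field_simps)
  finally show False by simp
qed

text \<open>If \<open>y\<^sub>j = (L - z)\<^sup>j u\<close> and \<open>y\<^sub>m\<^sub>+\<^sub>1 = 0\<close>, then \<open>v = \<Sum> \<epsilon>\<^sup>m\<^sup>-\<^sup>j y\<^sub>j\<close> satisfies \<open>(L - z - \<epsilon>) v = - \<epsilon>\<^sup>m\<^sup>+\<^sup>1 u\<close>,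
  so Cramer's rule gives \<open>v = O(\<epsilon>\<^sup>m\<^sup>+\<^sup>1\<^sup>-\<^sup>p)\<close>, while \<open>v \<rightarrow> y\<^sub>m\<close>.\<close>

lemma chain_step:
  assumes z: "z \<in> Om n" and ord: "order_at_most s n z p" and pm: "p \<le> m"
    and fd: "\<And>j. j \<le> m \<Longrightarrow> fdom ((tau s z ^^ j) c)" and t0: "(tau s z ^^ Suc m) c = (\<lambda>k. 0)"
  shows "(tau s z ^^ m) c = (\<lambda>k. 0)"
proof -
  define y where "y j = (tau s z ^^ j) c" for j
  have ys: "tau s z (y j) = y (Suc j)" for j unfolding y_def by simp
  have yf: "fdom (y j)" if "j < Suc m" for j unfolding y_def using fd that by simp
  have y0: "y 0 = c" and ym: "y (Suc m) = (\<lambda>k. 0)" unfolding y_def using t0 by simp_all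
  define v where "v \<epsilon> = (\<lambda>k. \<Sum>j<Suc m. \<epsilon> ^ (m - j) * y j k)" for \<epsilon>
  have v: "fdom (v \<epsilon>)" "opp (v \<epsilon>) i = (\<Sum>j<Suc m. \<epsilon> ^ (m - j) * opp (y j) i)"
    "tau s z (v \<epsilon>) = (\<lambda>k. \<Sum>j<Suc m. \<epsilon> ^ (m - j) * y (Suc j) k)" for \<epsilon> i
    using tau_combination[of "Suc m" y "\<lambda>j. \<epsilon> ^ (m - j)" i s z, OF yf] unfolding v_def ys by blast+
  have tv: "tau s (z + \<epsilon>) (v \<epsilon>) = (\<lambda>k. - (\<epsilon> ^ Suc m) * c k)" for \<epsilon>
  proof
    fix k
    have "tau s (z + \<epsilon>) (v \<epsilon>) k = (\<Sum>j<Suc m. \<epsilon> ^ (m - j) * y (Suc j) k) - \<epsilon> * (\<Sum>j<Suc m. \<epsilon> ^ (m - j) * y j k)"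
      unfolding tau_shift v(3) unfolding v_def ..
    also have "\<dots> = (\<Sum>j<Suc m. \<epsilon> ^ (Suc m - Suc j) * y (Suc j) k - \<epsilon> ^ (Suc m - j) * y j k)"
      unfolding sum_distrib_left sum_subtractf[symmetric]
    proof (rule sum.cong[OF refl])
      fix j assume "j \<in> {..<Suc m}"
      then have "Suc m - j = Suc (m - j)" by auto
      then show "\<epsilon> ^ (m - j) * y (Suc j) k - \<epsilon> * (\<epsilon> ^ (m - j) * y j k) = \<epsilon> ^ (Suc m - Suc j) * y (Suc j) k - \<epsilon> ^ (Suc m - j) * y j k"
        by simp
    qed
    also have "\<dots> = \<epsilon> ^ (Suc m - Suc m) * y (Suc m) k - \<epsilon> ^ (Suc m - 0) * y 0 k"
      by (rule sum_lessThan_telescope)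
    finally show "tau s (z + \<epsilon>) (v \<epsilon>) k = - (\<epsilon> ^ Suc m) * c k" unfolding ym y0 by simp
  qed
  have cs: "summable (\<lambda>k. (cmod (c k))\<^sup>2)" using fdom_summable[OF yf[of 0]] unfolding y0 by simp
  define S where "S = sqrt (\<Sum>k. (cmod (c k))\<^sup>2)"
  have S0: "S \<ge> 0" unfolding S_def using suminf_nonneg[OF cs] by simp
  have fs: "summable (\<lambda>k. (cmod (- (\<epsilon> ^ Suc m) * c k))\<^sup>2)"
    and fS: "sqrt (\<Sum>k. (cmod (- (\<epsilon> ^ Suc m) * c k))\<^sup>2) = cmod \<epsilon> ^ Suc m * S" for \<epsilon>
  proof -
    have e: "(cmod (- (\<epsilon> ^ Suc m) * c k))\<^sup>2 = (cmod \<epsilon> ^ Suc m)\<^sup>2 * (cmod (c k))\<^sup>2" for k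
      by (simp only: norm_mult norm_minus_cancel norm_power power_mult_distrib)
    show "summable (\<lambda>k. (cmod (- (\<epsilon> ^ Suc m) * c k))\<^sup>2)" unfolding e by (rule summable_mult[OF cs])
    show "sqrt (\<Sum>k. (cmod (- (\<epsilon> ^ Suc m) * c k))\<^sup>2) = cmod \<epsilon> ^ Suc m * S"
      unfolding e suminf_mult[OF cs] real_sqrt_mult S_def by simp
  qed
  obtain K where K: "K \<ge> 0" and Kb:
    "\<And>z' u f. z' \<in> Om n \<Longrightarrow> cmod (of_nat (2 * n + 1) - z') \<le> cmod (of_nat (2 * n + 1) - z) + 1 \<Longrightarrow> fdom u \<Longrightarrow> summable (\<lambda>k. (cmod (f k))\<^sup>2) \<Longrightarrow> f = tau s z' u \<Longrightarrow>
       cmod (chr s n z') * cmod (u n) \<le> K * sqrt (\<Sum>k. (cmod (f k))\<^sup>2)"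
    "\<And>z' u f. z' \<in> Om n \<Longrightarrow> cmod (of_nat (2 * n + 1) - z') \<le> cmod (of_nat (2 * n + 1) - z) + 1 \<Longrightarrow> fdom u \<Longrightarrow> summable (\<lambda>k. (cmod (f k))\<^sup>2) \<Longrightarrow> f = tau s z' u \<Longrightarrow>
       cmod (chr s n z') * cmod (opp u (Suc n)) \<le> K * sqrt (\<Sum>k. (cmod (f k))\<^sup>2)"
    by (rule sol_bound[of n "cmod (of_nat (2 * n + 1) - z) + 1" s]) (rule that)
  obtain c0 where c0: "c0 > 0" and oe: "\<And>e. e > 0 \<Longrightarrow> \<exists>\<epsilon>. \<epsilon> \<noteq> 0 \<and> cmod \<epsilon> < e \<and> z + \<epsilon> \<in> Om n \<and> c0 * cmod \<epsilon> ^ p \<le> cmod (chr s n (z + \<epsilon>))"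
    using ord unfolding order_at_most_def by blast
  \<comment> \<open>Division by |chr| costs the p-th power of |\<epsilon>|, and p \<le> m leaves at
    least one factor |\<epsilon>|.\<close>
  have quot: "X \<le> r * (K * S / c0)"
    if b: "D * X \<le> K * (r ^ Suc m * S)" and D: "c0 * r ^ p \<le> D" and r: "0 < r" "r < 1" and X: "X \<ge> 0" for D X r :: real
  proof -
    have "r ^ p * (c0 * X) \<le> D * X" using mult_right_mono[OF D X] by (simp add: mult_ac)
    also have "\<dots> \<le> K * (r ^ Suc m * S)" by (rule b)
    also have "\<dots> = r ^ p * (r ^ (Suc m - p) * (K * S))"
    proof -
      have "r ^ Suc m = r ^ p * r ^ (Suc m - p)" using pm by (simp flip: power_add)
      then show ?thesis by (simp only: mult_ac)
    qed
    finally have "c0 * X \<le> r ^ (Suc m - p) * (K * S)" using r by (simp only: mult_le_cancel_left_pos zero_less_power)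
    also have "\<dots> \<le> r ^ 1 * (K * S)"
      using pm r K S0 by (intro mult_right_mono power_decreasing) auto
    finally show ?thesis using c0 by (simp add: field_simps)
  qed
  \<comment> \<open>Used for g j = y_j(n) and for g j = \<open>opp (y j) (Suc n)\<close>: a
    polynomial in \<epsilon> with constant term g m is small along a sequence tending to 0, so g m
    is arbitrarily small.\<close>
  have lim: "(\<exists>t. 0 \<le> t \<and> t < e \<and> cmod (g m) \<le> t * ((\<Sum>j<m. cmod (g j)) + K * S / c0))"
    if e: "e > 0" and gb: "\<And>\<epsilon>. cmod \<epsilon> < 1 \<Longrightarrow> z + \<epsilon> \<in> Om n \<Longrightarrow> cmod (chr s n (z + \<epsilon>)) * cmod (\<Sum>j<Suc m. \<epsilon> ^ (m - j) * g j) \<le> K * (cmod \<epsilon> ^ Suc m * S)"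
    for e and g :: "nat \<Rightarrow> complex"
  proof -
    have "min e 1 > 0" using e by simp
    then obtain \<epsilon> where \<epsilon>: "\<epsilon> \<noteq> 0" "cmod \<epsilon> < min e 1" "z + \<epsilon> \<in> Om n" "c0 * cmod \<epsilon> ^ p \<le> cmod (chr s n (z + \<epsilon>))"
      using oe by blast
    let ?G = "\<Sum>j<Suc m. \<epsilon> ^ (m - j) * g j"
    have "cmod ?G \<le> cmod \<epsilon> * (K * S / c0)"
      by (rule quot[OF gb \<epsilon>(4)]) (use \<epsilon> in auto)
    moreover have "cmod (\<Sum>j<m. \<epsilon> ^ (m - j) * g j) \<le> (\<Sum>j<m. cmod \<epsilon> * cmod (g j))"
    proof (rule sum_norm_le)
      fix j assume "j \<in> {..<m}"
      then have "cmod \<epsilon> ^ (m - j) \<le> cmod \<epsilon> ^ 1" using \<epsilon>(2) by (intro power_decreasing) auto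
      then show "cmod (\<epsilon> ^ (m - j) * g j) \<le> cmod \<epsilon> * cmod (g j)"
        unfolding norm_mult norm_power by (intro mult_right_mono) auto
    qed
    moreover have gm: "?G - (\<Sum>j<m. \<epsilon> ^ (m - j) * g j) = g m" by simp
    moreover have "cmod (g m) \<le> cmod ?G + cmod (\<Sum>j<m. \<epsilon> ^ (m - j) * g j)"
      using norm_triangle_ineq4[of ?G "\<Sum>j<m. \<epsilon> ^ (m - j) * g j"] unfolding gm .
    ultimately have "cmod (g m) \<le> cmod \<epsilon> * (K * S / c0) + (\<Sum>j<m. cmod \<epsilon> * cmod (g j))"
      by linarith
    also have "\<dots> = cmod \<epsilon> * ((\<Sum>j<m. cmod (g j)) + K * S / c0)"
      by (simp only: sum_distrib_left[symmetric] distrib_left add.commute)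
    finally show ?thesis using \<epsilon>(2) by (intro exI[of _ "cmod \<epsilon>"]) auto
  qed
  have cond: "cmod (of_nat (2 * n + 1) - (z + \<epsilon>)) \<le> cmod (of_nat (2 * n + 1) - z) + 1" if "cmod \<epsilon> < 1" for \<epsilon>
  proof -
    have "of_nat (2 * n + 1) - (z + \<epsilon>) = (of_nat (2 * n + 1) - z) - \<epsilon>" by simp
    then have "cmod (of_nat (2 * n + 1) - (z + \<epsilon>)) \<le> cmod (of_nat (2 * n + 1) - z) + cmod \<epsilon>"
      by (simp only: norm_triangle_ineq4)
    then show ?thesis using that by linarith
  qed
  have "cmod (y m n) = 0"
  proof (rule small_multiple_imp_0[OF norm_ge_zero], rule lim)
    fix \<epsilon> assume e: "cmod \<epsilon> < 1" "z + \<epsilon> \<in> Om n"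
    show "cmod (chr s n (z + \<epsilon>)) * cmod (\<Sum>j<Suc m. \<epsilon> ^ (m - j) * y j n) \<le> K * (cmod \<epsilon> ^ Suc m * S)"
      using Kb(1)[OF e(2) cond[OF e(1)] v(1) fs tv[symmetric]] unfolding fS v_def .
  qed
  moreover have "cmod (opp (y m) (Suc n)) = 0"
  proof (rule small_multiple_imp_0[OF norm_ge_zero], rule lim)
    fix \<epsilon> assume e: "cmod \<epsilon> < 1" "z + \<epsilon> \<in> Om n"
    show "cmod (chr s n (z + \<epsilon>)) * cmod (\<Sum>j<Suc m. \<epsilon> ^ (m - j) * opp (y j) (Suc n)) \<le> K * (cmod \<epsilon> ^ Suc m * S)"
      using Kb(2)[OF e(2) cond[OF e(1)] v(1) fs tv[symmetric]] unfolding fS v(2) .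
  qed
  ultimately have "y m = (\<lambda>k. 0)"
    by (intro tau_null[OF z yf[of m], of s]) (simp_all add: ys ym)
  then show ?thesis unfolding y_def .
qed

lemma ker_pow_mono: "k \<le> m \<Longrightarrow> ker_pow (osc_op b s) z k \<subseteq> ker_pow (osc_op b s) z m"
proof (induction m rule: dec_induct)
  case (step i)
  have "ker_pow (osc_op b s) z i \<subseteq> ker_pow (osc_op b s) z (Suc i)"
  proof
    fix u assume "u \<in> ker_pow (osc_op b s) z i"
    then have u: "u \<in> L2" "\<forall>j<i. fdom ((tau s z ^^ j) (cf u))" "(tau s z ^^ i) (cf u) = (\<lambda>k. 0)" unfolding ker_pow_iff by auto
    have "fdom ((tau s z ^^ j) (cf u))" if "j < Suc i" for j
      using that u(2,3) fdom_0 by (cases "j = i") auto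
    then show "u \<in> ker_pow (osc_op b s) z (Suc i)" unfolding ker_pow_iff using u(1,3) by simp
  qed
  then show ?case using step by blast
qed simp

lemma root_space_eq:
  assumes z: "z \<in> Om n" and ord: "order_at_most s n z p"
  shows "root_space (osc_op b s) z = ker_pow (osc_op b s) z p"
proof -
  have st: "ker_pow (osc_op b s) z (Suc m) \<subseteq> ker_pow (osc_op b s) z m" if "p \<le> m" for m
  proof
    fix u assume "u \<in> ker_pow (osc_op b s) z (Suc m)"
    then have u: "u \<in> L2" "\<forall>j<Suc m. fdom ((tau s z ^^ j) (cf u))" "(tau s z ^^ Suc m) (cf u) = (\<lambda>k. 0)" unfolding ker_pow_iff by blast+
    have "(tau s z ^^ m) (cf u) = (\<lambda>k. 0)"
      by (rule chain_step[OF z ord that _ u(3)]) (use u(2) in auto)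
    then show "u \<in> ker_pow (osc_op b s) z m" unfolding ker_pow_iff using u by auto
  qed
  have "ker_pow (osc_op b s) z m \<subseteq> ker_pow (osc_op b s) z p" if "p \<le> m" for m
    using that by (induction m rule: dec_induct) (use st in blast)+
  then have "ker_pow (osc_op b s) z k \<subseteq> ker_pow (osc_op b s) z p" for k
    using ker_pow_mono[of k p] by (cases "k \<le> p") auto
  then show ?thesis unfolding root_space_def by blast
qed

lemma tau_pow_lin:
  assumes "\<And>i. i < j \<Longrightarrow> fdom ((tau s z ^^ i) c)" "\<And>i. i < j \<Longrightarrow> fdom ((tau s z ^^ i) d)"
  shows "(tau s z ^^ j) (\<lambda>k. c k + \<alpha> * d k) = (\<lambda>k. (tau s z ^^ j) c k + \<alpha> * (tau s z ^^ j) d k)"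
  using assms by (induction j) (auto simp: tau_lin)

text \<open>The functionals are the n-th entry and \<open>opp\<close> of the first p iterates of
  \<open>tau\<close>, two for each iterate. If all of them vanish, \<open>tau_null\<close> works
  down from the p-th iterate to u itself.\<close>

lemma root_space_finite_dim:
  assumes z: "z \<in> Om n" and ord: "order_at_most s n z p"
  shows "\<exists>m. has_L2_dim (root_space (osc_op b s) z) m"
  unfolding root_space_eq[OF z ord]
proof (rule has_L2_dim_functionals)
  let ?\<phi> = "\<lambda>i u. if i div 2 < p then (if even i then (tau s z ^^ (i div 2)) (cf u) n else opp ((tau s z ^^ (i div 2)) (cf u)) (Suc n)) else 0"
  have lin: "(tau s z ^^ j) (cf (\<lambda>x. u x + \<alpha> * v x)) = (\<lambda>k. (tau s z ^^ j) (cf u) k + \<alpha> * (tau s z ^^ j) (cf v) k)"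
    if "u \<in> ker_pow (osc_op b s) z p" "v \<in> ker_pow (osc_op b s) z p" "j \<le> p" for u v \<alpha> j
  proof -
    have "cf (\<lambda>x. u x + \<alpha> * v x) = (\<lambda>k. cf u k + \<alpha> * cf v k)"
      using that unfolding ker_pow_iff by (auto simp: fun_eq_iff cf_add L2_cmult cf_cmult)
    then show ?thesis using that unfolding ker_pow_iff by (simp add: tau_pow_lin)
  qed
  have "(\<lambda>x. 0) \<in> ker_pow (osc_op b s) z p"
  proof -
    have "cf (\<lambda>x. 0) = (\<lambda>k. 0)" by auto
    then show ?thesis unfolding ker_pow_iff by (simp add: L2_zero fdom_0)
  qed
  then show "ker_pow (osc_op b s) z p \<noteq> {}" by blast
  show "(\<lambda>x. u x + \<alpha> * v x) \<in> ker_pow (osc_op b s) z p" if uv: "u \<in> ker_pow (osc_op b s) z p" "v \<in> ker_pow (osc_op b s) z p" for u v \<alpha>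
  proof -
    have "fdom ((tau s z ^^ j) (cf (\<lambda>x. u x + \<alpha> * v x)))" if "j < p" for j
      unfolding lin[OF uv less_imp_le[OF that]] using uv that unfolding ker_pow_iff by (intro fdom_lin) auto
    moreover have "(tau s z ^^ p) (cf (\<lambda>x. u x + \<alpha> * v x)) = (\<lambda>k. 0)"
      unfolding lin[OF uv order_refl] using uv unfolding ker_pow_iff by simp
    moreover have "(\<lambda>x. u x + \<alpha> * v x) \<in> L2" using uv unfolding ker_pow_iff by (intro L2_add L2_cmult) auto
    ultimately show ?thesis unfolding ker_pow_iff by blast
  qed
  show "?\<phi> i (\<lambda>x. u x + \<alpha> * v x) = ?\<phi> i u + \<alpha> * ?\<phi> i v" if uv: "u \<in> ker_pow (osc_op b s) z p" "v \<in> ker_pow (osc_op b s) z p" for i u v \<alpha>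
  proof (cases "i div 2 < p")
    case True
    have "fdom ((tau s z ^^ (i div 2)) (cf u))" "fdom ((tau s z ^^ (i div 2)) (cf v))" using uv True unfolding ker_pow_iff by auto
    then show ?thesis using lin[OF uv less_imp_le[OF True], of \<alpha>] True by (simp add: opp_lin)
  qed simp
  show "?\<phi> i u = 0" if u: "u \<in> ker_pow (osc_op b s) z p" "L2_eq u (\<lambda>x. 0)" for i u
  proof -
    have "cf u = (\<lambda>k. 0)" using u cf_null_iff[of u] unfolding ker_pow_iff by blast
    then show ?thesis by simp
  qed
  show "L2_eq u (\<lambda>x. 0)" if u: "u \<in> ker_pow (osc_op b s) z p" and zero: "\<And>i. i < 2 * p \<Longrightarrow> ?\<phi> i u = 0" for u
  proof -
    have u': "u \<in> L2" "\<forall>j<p. fdom ((tau s z ^^ j) (cf u))" "(tau s z ^^ p) (cf u) = (\<lambda>k. 0)" using u unfolding ker_pow_iff by auto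
    have "(tau s z ^^ (p - j)) (cf u) = (\<lambda>k. 0)" if "j \<le> p" for j
      using that
    proof (induction j)
      case 0 then show ?case using u' by simp
    next
      case (Suc j)
      define i where "i = p - Suc j"
      have i: "i < p" "Suc i = p - j" using Suc.prems unfolding i_def by auto
      have "(tau s z ^^ i) (cf u) = (\<lambda>k. 0)"
      proof (rule tau_null[OF z])
        show "fdom ((tau s z ^^ i) (cf u))" using u' i by blast
        show "tau s z ((tau s z ^^ i) (cf u)) = (\<lambda>k. 0)" using Suc i by (metis Suc_leD funpow.simps(2) o_apply)
        show "(tau s z ^^ i) (cf u) n = 0" using zero[of "2 * i"] i by simp
        show "opp ((tau s z ^^ i) (cf u)) (Suc n) = 0" using zero[of "2 * i + 1"] i by simp
      qed
      then show ?case unfolding i_def .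
    qed
    from this[of p] have "cf u = (\<lambda>k. 0)" by simp
    then show ?thesis using cf_null_iff[OF u'(1)] by simp
  qed
qed

theorem osc_discrete_spectrum: "discrete_spectrum (osc_op b s)"
  unfolding discrete_spectrum_def
proof (intro ballI conjI)
  fix z assume zs: "z \<in> spectrum (osc_op b s)"
  obtain n where z: "z \<in> Om n" using Om_cover by blast
  have D: "chr s n z = 0" using zs spectrum_iff[OF z] by simp
  obtain r where r: "r > 0" "ball z r \<subseteq> Om n" "\<forall>y\<in>ball z r. chr s n y = 0 \<longrightarrow> y = z"
    using chr_zero_isolated(1)[OF z D] by blast
  have "ball z r \<inter> spectrum (osc_op b s) = {z}"
  proof (intro equalityI subsetI)
    fix y assume y: "y \<in> ball z r \<inter> spectrum (osc_op b s)"
    then have "chr s n y = 0" using spectrum_iff[of y n s] r(2) by blast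
    then show "y \<in> {z}" using r(3) y by blast
  qed (use zs r in auto)
  then show "z isolated_in spectrum (osc_op b s)"
    unfolding isolated_in_def using zs open_ball by blast
  show "eigenvalue (osc_op b s) z" using eigenvalue_iff[OF z] D by simp
  obtain p where "order_at_most s n z p" using chr_zero_isolated(2)[OF z D] by blast
  then show "\<exists>m. has_L2_dim (root_space (osc_op b s) z) m" by (rule root_space_finite_dim[OF z])
qed

text \<open>Order one makes the root space equal to the kernel. The kernel is one-dimensional
  because the matrix of the reduced system is not zero: if w, a and h(z) all vanished,
  \<open>chr\<close> would be o(\<epsilon>) at z + \<epsilon>.\<close>

lemma simple_eigenvalueI:
  assumes z: "z \<in> Om n" and ev: "eigenvalue (osc_op b s) z" and ord: "order_at_most s n z 1"
  shows "simple_eigenvalue (osc_op b s) z"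
proof -
  define w where "w = of_nat (2 * n + 1) - z"
  define a where "a = complex_of_real (hf n b)"
  define h where "h y = 1 - 4 * s\<^sup>2 * cE n y * cO n y" for y
  define d where "d = 4 * s\<^sup>2 * a * cO n z"
  have nz: "\<not> (w = 0 \<and> a = 0 \<and> h z = 0)"
  proof
    assume A: "w = 0 \<and> a = 0 \<and> h z = 0"
    obtain c0 where c0: "c0 > 0" and oe: "\<And>e. e > 0 \<Longrightarrow> \<exists>\<epsilon>. \<epsilon> \<noteq> 0 \<and> cmod \<epsilon> < e \<and> z + \<epsilon> \<in> Om n \<and> c0 * cmod \<epsilon> ^ 1 \<le> cmod (chr s n (z + \<epsilon>))"
      using ord unfolding order_at_most_def by blast
    have "h holomorphic_on Om n"
      unfolding h_def[abs_def] cE_def cO_def by (intro holomorphic_intros csum_holomorphic wt_pE wt_pO)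
    then have "isCont h z"
      using z open_Om holomorphic_on_imp_continuous_on continuous_on_eq_continuous_at by blast
    then obtain \<delta> where \<delta>: "\<delta> > 0" "\<And>y. dist y z < \<delta> \<Longrightarrow> dist (h y) (h z) < c0"
      using c0 unfolding continuous_at_eps_delta by meson
    obtain \<epsilon> where \<epsilon>: "\<epsilon> \<noteq> 0" "cmod \<epsilon> < \<delta>" "c0 * cmod \<epsilon> ^ 1 \<le> cmod (chr s n (z + \<epsilon>))" using oe[OF \<delta>(1)] by blast
    have "hf n b = 0" using A unfolding a_def by simp
    then have "chr s n (z + \<epsilon>) = (w - \<epsilon>) * h (z + \<epsilon>)" unfolding chr_def w_def h_def by simp
    then have "cmod (chr s n (z + \<epsilon>)) = cmod \<epsilon> * cmod (h (z + \<epsilon>))" using A by (simp add: norm_mult)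
    also have "\<dots> < cmod \<epsilon> * c0"
      using \<delta>(2)[of "z + \<epsilon>"] \<epsilon> A by (intro mult_strict_left_mono) (auto simp: dist_norm)
    finally show False using \<epsilon>(3) by (simp add: mult.commute)
  qed
  have rel: "w * cf u n = d * opp (cf u) (Suc n)" "opp (cf u) (Suc n) * h z = a * cf u n"
    if u: "u \<in> ker_pow (osc_op b s) z 1" for u
  proof -
    have u': "u \<in> L2" "fdom (cf u)" "tau s z (cf u) = (\<lambda>k. 0)" using u unfolding ker_pow_iff by auto
    have s0: "summable (\<lambda>k. (cmod ((\<lambda>k. 0) (k::nat)))\<^sup>2)" by simp
    have eq: "(\<lambda>k. 0) k = (of_nat (2 * k + 1) - z) * cf u k + 2 * s * of_real (hf k b) * opp (cf u) k" for k
      using fun_cong[OF u'(3), of k] unfolding tau_def by (rule sym)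
    note re = reduced_eqs[OF z u'(2) s0 eq, unfolded rhs_0]
    have 1: "opp (cf u) n = - 2 * s * opp (cf u) (Suc n) * cO n z" using re(2) by simp
    show "w * cf u n = d * opp (cf u) (Suc n)"
      using eq[of n] unfolding 1 w_def d_def a_def by (simp add: algebra_simps power2_eq_square)
    have "opp (cf u) (Suc n) = a * cf u n - 2 * s * opp (cf u) n * cE n z" using re(1) unfolding a_def by simp
    then have "opp (cf u) (Suc n) = a * cf u n + 4 * s\<^sup>2 * opp (cf u) (Suc n) * cO n z * cE n z"
      unfolding 1 by (simp add: power2_eq_square mult_ac)
    then show "opp (cf u) (Suc n) * h z = a * cf u n" unfolding h_def by (simp add: algebra_simps)
  qed
  obtain v v' where v: "(v, v') \<in> osc_op b s" "\<not> L2_eq v (\<lambda>x. 0)" "L2_eq v' (\<lambda>x. z * v x)"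
    using ev unfolding eigenvalue_def by blast
  note t = op_domain[OF v(1)] tau_op[OF v(1), of z]
  have "L2_eq (\<lambda>x. v' x - z * v x) (\<lambda>x. 0)" using v(3) unfolding L2_eq_def by eventually_elim simp
  then have tv: "tau s z (cf v) = (\<lambda>k. 0)" using t(5) cf_null_iff[OF t(4)] by simp
  then have vk: "v \<in> ker_pow (osc_op b s) z 1" unfolding ker_pow_iff using t by simp
  define x where "x = cf v n"
  define X where "X = opp (cf v) (Suc n)"
  have xX: "x \<noteq> 0 \<or> X \<noteq> 0"
  proof (rule ccontr)
    assume "\<not> ?thesis"
    then have "cf v = (\<lambda>k. 0)" by (intro tau_null[OF z t(3) tv]) (auto simp: x_def X_def)
    then show False using v(2) cf_null_iff[OF t(1)] by simp
  qed
  have "has_L2_dim (ker_pow (osc_op b s) z 1) 1"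
    unfolding has_L2_dim_def
  proof (intro exI[of _ "\<lambda>_. v"] conjI allI impI ballI)
    show "v \<in> ker_pow (osc_op b s) z 1" by (rule vk)
    show "c i = 0" if c: "L2_eq (\<lambda>x. \<Sum>i<1. c i * v x) (\<lambda>x. 0)" and i: "i < 1" for c :: "nat \<Rightarrow> complex" and i
    proof (rule ccontr)
      assume "c i \<noteq> 0"
      then have "L2_eq v (\<lambda>x. 0)" using c i unfolding L2_eq_def by simp
      then show False using v(2) by simp
    qed
    show "\<exists>c :: nat \<Rightarrow> complex. L2_eq u (\<lambda>x. \<Sum>i<1. c i * v x)" if u: "u \<in> ker_pow (osc_op b s) z 1" for u
    proof -
      have u': "u \<in> L2" "fdom (cf u)" "tau s z (cf u) = (\<lambda>k. 0)" using u unfolding ker_pow_iff by auto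
      define y where "y = cf u n"
      define Y where "Y = opp (cf u) (Suc n)"
      note ru = rel[OF u, folded y_def Y_def] and rv = rel[OF vk, folded x_def X_def]
      have pr: "x * Y = y * X"
      proof -
        consider "w \<noteq> 0" | "h z \<noteq> 0" | "w = 0" "h z = 0" "a \<noteq> 0" using nz by blast
        then show ?thesis
        proof cases
          case 1
          have "w * (x * Y) = w * (y * X)" using ru(1) rv(1) by (metis mult.assoc mult.commute)
          then show ?thesis using 1 by simp
        next
          case 2
          have "h z * (x * Y) = h z * (y * X)" using ru(2) rv(2) by (metis mult.assoc mult.commute)
          then show ?thesis using 2 by simp
        next
          case 3
          then have "x = 0" "y = 0" using ru(2) rv(2) by auto
          then show ?thesis by simp
        qed
      qed
      obtain \<alpha> where \<alpha>: "y = \<alpha> * x" "Y = \<alpha> * X"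
      proof (cases "x = 0")
        case False
        have "Y = y / x * X" using pr False by (simp add: field_simps)
        then show thesis using that[of "y / x"] False by simp
      next
        case True
        then have X0: "X \<noteq> 0" using xX by simp
        then have "y = 0" using pr True by simp
        then show thesis using that[of "Y / X"] True X0 by simp
      qed
      have "(\<lambda>k. cf u k + (- \<alpha>) * cf v k) = (\<lambda>k. 0)"
      proof (rule tau_null[OF z fdom_lin[OF u'(2) t(3)]])
        show "tau s z (\<lambda>k. cf u k + (- \<alpha>) * cf v k) = (\<lambda>k. 0)" unfolding tau_lin[OF u'(2) t(3)] u'(3) tv by simp
        show "cf u n + (- \<alpha>) * cf v n = 0" using \<alpha>(1) unfolding y_def x_def by simp
        show "opp (\<lambda>k. cf u k + (- \<alpha>) * cf v k) (Suc n) = 0" unfolding opp_lin[OF u'(2) t(3)] using \<alpha>(2) unfolding Y_def X_def by simp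
      qed
      then have "cf u k = cf (\<lambda>x. \<alpha> * v x) k" for k unfolding cf_cmult by (simp add: fun_eq_iff add_eq_0_iff2)
      then have "L2_eq u (\<lambda>x. \<alpha> * v x)" by (intro hermite_unique u' L2_cmult t)
      then show ?thesis by (intro exI[of _ "\<lambda>_. \<alpha>"]) simp
    qed
  qed
  then show ?thesis unfolding simple_eigenvalue_def root_space_eq[OF z ord] using ev by simp
qed

end

section \<open>Eigenvalues far out\<close>

lemma inverse_Suc_le_ln: "n > 0 \<Longrightarrow> 1 / real (Suc n) \<le> ln (real (Suc n)) - ln (real n)"
proof -
  assume n: "n > 0"
  have "ln (real n / real (Suc n)) \<le> real n / real (Suc n) - 1" using n by (intro ln_le_minus_one) auto
  moreover have "ln (real n / real (Suc n)) = ln (real n) - ln (real (Suc n))"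
    using n by (simp add: ln_div)
  moreover have "real n / real (Suc n) - 1 = - (1 / real (Suc n))"
    by (simp add: divide_simps)
  ultimately show ?thesis by linarith
qed

lemma harm_le_ln: "(harm (Suc n) :: real) \<le> 1 + ln (real (Suc n))"
proof (induction n)
  case 0
  show ?case by (simp add: harm_def)
next
  case (Suc n)
  have "harm (Suc (Suc n)) = harm (Suc n) + 1 / real (Suc (Suc n))"
    unfolding harm_Suc[of "Suc n"] by (simp add: inverse_eq_divide)
  then show ?case using Suc inverse_Suc_le_ln[of "Suc n"] by linarith
qed

text \<open>The geometric mean is at most the maximum, and the maximum is at most j + |j -
  m|.\<close>

lemma sqrt_mult_le_max:
  fixes j m :: real
  assumes "j > 0" "m > 0"
  shows "sqrt m * sqrt j \<le> j + \<bar>j - m\<bar>"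
proof -
  have "m * j \<le> (j + \<bar>j - m\<bar>)\<^sup>2"
  proof (cases "j \<ge> m")
    case True
    have "m * j \<le> j * j" using True assms by (intro mult_right_mono) auto
    also have "\<dots> \<le> (j + \<bar>j - m\<bar>) * (j + \<bar>j - m\<bar>)" using assms by (intro mult_mono) auto
    finally show ?thesis by (simp add: power2_eq_square)
  next
    case False
    then have "j + \<bar>j - m\<bar> = m" by simp
    then show ?thesis using False assms by (simp add: power2_eq_square)
  qed
  then have "sqrt (m * j) \<le> j + \<bar>j - m\<bar>" using assms by (intro real_le_lsqrt) auto
  then show ?thesis by (simp add: real_sqrt_mult)
qed

text \<open>Splits the product into two terms whose sums over j are both harmonic, with the factor 1
  / sqrt m in front.\<close>

lemma near_term_le:
  fixes j m :: real
  assumes j: "j > 0" and m: "m > 0" and jm: "j \<noteq> m"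
  shows "1 / (sqrt j * \<bar>j - m\<bar>) \<le> 1 / sqrt m * (1 / \<bar>j - m\<bar>) + 1 / sqrt m * (1 / j)"
proof -
  have d: "\<bar>j - m\<bar> > 0" using jm by simp
  have sj: "sqrt j * sqrt j = j" using j by simp
  have sp: "sqrt j > 0" "sqrt m > 0" using j m by auto
  have "sqrt m * sqrt j \<le> j + \<bar>j - m\<bar>" by (rule sqrt_mult_le_max[OF j m])
  then have "sqrt m * sqrt j / (sqrt m * j * \<bar>j - m\<bar>) \<le> (j + \<bar>j - m\<bar>) / (sqrt m * j * \<bar>j - m\<bar>)"
    using j d sp by (intro divide_right_mono) auto
  moreover have "sqrt m * sqrt j / (sqrt m * j * \<bar>j - m\<bar>) = 1 / (sqrt j * \<bar>j - m\<bar>)"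
  proof -
    have "r * t / (r * (t * t) * d) = 1 / (t * d)" if "r > 0" "t > 0" "d > 0" for r t d :: real
      using that by (simp add: field_simps)
    from this[OF sp(2) sp(1) d] show ?thesis unfolding sj .
  qed
  moreover have "(j + \<bar>j - m\<bar>) / (sqrt m * j * \<bar>j - m\<bar>) = 1 / sqrt m * (1 / \<bar>j - m\<bar>) + 1 / sqrt m * (1 / j)"
    using j d sp by (simp add: add_divide_distrib)
  ultimately show ?thesis by simp
qed

text \<open>Here k - n is at least (k+1)/2, so the term is O(k^(-3/2)) and can be compared with a
  telescoping difference.\<close>

lemma far_term_le:
  assumes "k \<ge> 2 * (n + 1)"
  shows "1 / (sqrt (real (k + 1)) * (real k - real n)) \<le> 4 * (1 / sqrt (real k) - 1 / sqrt (real (k + 1)))"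
proof -
  define p where "p = sqrt (real k)"
  define q where "q = sqrt (real (k + 1))"
  have p: "p > 0" "q > 0" "p \<le> q" "p * p = real k" "q * q = real (k + 1)" using assms unfolding p_def q_def by auto
  have e: "q * q - p * p = 1" using p by simp
  have d: "real k - real n \<ge> q * q / 2" using assms unfolding p by simp
  have "1 / (q * (real k - real n)) \<le> 1 / (q * (q * q / 2))"
  proof (intro divide_left_mono mult_left_mono mult_pos_pos d)
    show "0 < real k - real n" using assms by simp
  qed (use p in auto)
  also have "\<dots> = 2 / (q * q * q)" using p by simp
  also have "\<dots> \<le> 4 / (p * q * (p + q))"
  proof -
    have "p * q * (p + q) \<le> q * q * (q + q)" using p by (intro mult_mono add_mono) auto
    then have "4 / (q * q * (q + q)) \<le> 4 / (p * q * (p + q))" using p by (intro divide_left_mono) auto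
    moreover have "2 / (q * q * q) = 4 / (q * q * (q + q))" using p(2) by (simp add: field_simps)
    ultimately show ?thesis by simp
  qed
  also have "\<dots> = 4 * (1 / p - 1 / q)"
  proof -
    have "1 / p - 1 / q = (q - p) / (p * q)" using p by (simp add: field_simps)
    also have "\<dots> = (q * q - p * p) / (p * q * (p + q))"
    proof -
      have "q * q - p * p = (q - p) * (p + q)" by (simp add: algebra_simps)
      moreover have "p + q \<noteq> 0" using p(1,2) by simp
      ultimately show ?thesis by simp
    qed
    finally show ?thesis unfolding e by simp
  qed
  finally show ?thesis unfolding p_def q_def .
qed

lemma sum_inverse_dist_le:
  assumes "n < N"
  shows "(\<Sum>k\<in>{..<N} - {n}. 1 / kd n k) \<le> 2 * harm N"
proof -
  have e: "{..<N} - {n} = {..<n} \<union> {n<..<N}" using assms by auto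
  have "(\<Sum>k\<in>{..<N} - {n}. 1 / kd n k) = (\<Sum>k<n. 1 / kd n k) + (\<Sum>k\<in>{n<..<N}. 1 / kd n k)"
    unfolding e by (rule sum.union_disjoint) auto
  also have "(\<Sum>k<n. 1 / kd n k) = (\<Sum>i\<in>{1..n}. inverse (real i))"
    by (rule sum.reindex_bij_witness[of _ "\<lambda>i. n - i" "\<lambda>k. n - k"]) (auto simp: kd_def inverse_eq_divide of_nat_diff)
  also have "\<dots> \<le> (\<Sum>i\<in>{1..N}. inverse (real i))"
    using assms by (intro sum_mono2) auto
  also have "(\<Sum>k\<in>{n<..<N}. 1 / kd n k) = (\<Sum>i\<in>{1..<N - n}. inverse (real i))"
    by (rule sum.reindex_bij_witness[of _ "\<lambda>i. n + i" "\<lambda>k. k - n"]) (auto simp: kd_def inverse_eq_divide)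
  also have "\<dots> \<le> (\<Sum>i\<in>{1..N}. inverse (real i))"
    by (intro sum_mono2) auto
  finally show ?thesis unfolding harm_def by simp
qed

text \<open>Up to a factor, \<open>sg n\<close> with h_k(b)^2 replaced by its decay rate, so that b
  no longer occurs.\<close>

definition sgk :: "nat \<Rightarrow> real" where
  "sgk n = (\<Sum>k. if k = n then 0 else 1 / (sqrt (real (k + 1)) * kd n k))"

lemma sgk_partial: "(\<Sum>k<N. if k = n then 0 else 1 / (sqrt (real (k + 1)) * kd n k)) \<le> 20 * ln (real (n + 2)) / sqrt (real (n + 1))"
proof -
  define M where "M = 2 * (n + 1)"
  define r where "r = 1 / sqrt (real (n + 1))"
  have r: "r > 0" unfolding r_def by simp
  let ?t = "\<lambda>k. if k = n then 0 else 1 / (sqrt (real (k + 1)) * kd n k)"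
  have t0: "?t k \<ge> 0" for k by (simp add: kd_def)
  have near: "(\<Sum>k<M. ?t k) \<le> 3 * r * harm M"
  proof -
    have nM: "n < M" unfolding M_def by simp
    have "(\<Sum>k<M. ?t k) = (\<Sum>k\<in>{..<M} - {n}. ?t k)"
      by (rule sum.mono_neutral_right) auto
    also have "\<dots> \<le> (\<Sum>k\<in>{..<M} - {n}. r * (1 / kd n k) + r * (1 / real (k + 1)))"
    proof (rule sum_mono)
      fix k assume k: "k \<in> {..<M} - {n}"
      have "\<bar>real (k + 1) - real (n + 1)\<bar> = kd n k" unfolding kd_def by simp
      then show "?t k \<le> r * (1 / kd n k) + r * (1 / real (k + 1))"
        using near_term_le[of "real (k + 1)" "real (n + 1)"] k unfolding r_def by auto
    qed
    also have "\<dots> = r * (\<Sum>k\<in>{..<M} - {n}. 1 / kd n k) + r * (\<Sum>k\<in>{..<M} - {n}. 1 / real (k + 1))"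
      by (simp only: sum.distrib sum_distrib_left)
    also have "(\<Sum>k\<in>{..<M} - {n}. 1 / real (k + 1)) \<le> (\<Sum>k<M. 1 / real (k + 1))"
      by (intro sum_mono2) auto
    also have "(\<Sum>k<M. 1 / real (k + 1)) = harm M"
      unfolding harm_def by (rule sum.reindex_bij_witness[of _ "\<lambda>i. i - 1" Suc]) (auto simp: inverse_eq_divide)
    finally have "(\<Sum>k<M. ?t k) \<le> r * (\<Sum>k\<in>{..<M} - {n}. 1 / kd n k) + r * harm M" using r by simp
    also have "r * (\<Sum>k\<in>{..<M} - {n}. 1 / kd n k) \<le> r * (2 * harm M)"
      using r by (intro mult_left_mono sum_inverse_dist_le nM) auto
    finally show ?thesis by (simp add: algebra_simps)
  qed
  have far: "(\<Sum>k\<in>{M..<N}. ?t k) \<le> 4 * r"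
  proof (cases "M \<le> N")
    case True
    have "(\<Sum>k\<in>{M..<N}. ?t k) \<le> (\<Sum>k\<in>{M..<N}. 4 * (1 / sqrt (real k) - 1 / sqrt (real (k + 1))))"
    proof (rule sum_mono)
      fix k assume "k \<in> {M..<N}"
      then have k: "k \<ge> 2 * (n + 1)" unfolding M_def by simp
      then have "kd n k = real k - real n" unfolding kd_def by simp
      then show "?t k \<le> 4 * (1 / sqrt (real k) - 1 / sqrt (real (k + 1)))"
        using far_term_le[OF k] k by simp
    qed
    also have "\<dots> = 4 * - (\<Sum>k\<in>{M..<N}. 1 / sqrt (real (Suc k)) - 1 / sqrt (real k))"
      unfolding sum_distrib_left[symmetric] sum_negf[symmetric] by simp
    also have "(\<Sum>k\<in>{M..<N}. 1 / sqrt (real (Suc k)) - 1 / sqrt (real k)) = 1 / sqrt (real N) - 1 / sqrt (real M)"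
      by (rule sum_Suc_diff'[OF True])
    also have "4 * - (1 / sqrt (real N) - 1 / sqrt (real M)) \<le> 4 * (1 / sqrt (real M))" by simp
    also have "\<dots> \<le> 4 * r"
      unfolding r_def M_def by (intro mult_left_mono divide_left_mono real_sqrt_le_mono) auto
    finally show ?thesis .
  next
    case False
    then show ?thesis using r by simp
  qed
  have "(\<Sum>k<N. ?t k) \<le> (\<Sum>k\<in>{..<M} \<union> {M..<N}. ?t k)"
    using t0 by (intro sum_mono2) auto
  also have "\<dots> = (\<Sum>k<M. ?t k) + (\<Sum>k\<in>{M..<N}. ?t k)"
    by (rule sum.union_disjoint) auto
  also have "\<dots> \<le> 3 * r * harm M + 4 * r" using near far by linarith
  \<comment> \<open>The constant 20: with l = ln (n + 2) one has 3 (1 + 2 l) + 4 = 7 + 6 l \<le> 20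
    l, since 2 l \<ge> 1.\<close>
  also have "\<dots> \<le> r * (20 * ln (real (n + 2)))"
  proof -
    have "harm M \<le> 1 + ln (real M)" using harm_le_ln[of "2 * n + 1"] unfolding M_def by simp
    also have "ln (real M) \<le> ln ((real (n + 2))\<^sup>2)"
      unfolding M_def
    proof (subst ln_le_cancel_iff)
      show "0 < (real (n + 2))\<^sup>2" by (intro zero_less_power) simp
      show "real (2 * (n + 1)) \<le> (real (n + 2))\<^sup>2" by (simp add: power2_eq_square algebra_simps)
    qed simp_all
    also have "\<dots> = 2 * ln (real (n + 2))" by (subst ln_realpow) auto
    finally have h: "harm M \<le> 1 + 2 * ln (real (n + 2))" by simp
    have "ln 2 \<le> ln (real (n + 2))" by (subst ln_le_cancel_iff) auto
    moreover have "1 / 2 \<le> ln (2::real)"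
      using ln_le_minus_one[of "1 / 2 :: real"] by (simp add: ln_div)
    ultimately have l: "1 \<le> 2 * ln (real (n + 2))" by linarith
    have "3 * r * harm M + 4 * r = r * (3 * harm M + 4)" by (simp add: algebra_simps)
    also have "\<dots> \<le> r * (20 * ln (real (n + 2)))" using h l r by (intro mult_left_mono) auto
    finally show ?thesis .
  qed
  finally show ?thesis unfolding r_def by simp
qed

lemma sgk_summable: "summable (\<lambda>k. if k = n then 0 else 1 / (sqrt (real (k + 1)) * kd n k))"
  by (rule summableI_nonneg_bounded[of _ "20 * ln (real (n + 2)) / sqrt (real (n + 1))"])
     (use sgk_partial[where n = n] in \<open>auto simp: kd_def\<close>)

lemma sgk_le: "sgk n \<le> 20 * ln (real (n + 2)) / sqrt (real (n + 1))"
  unfolding sgk_def by (rule suminf_le_const[OF sgk_summable sgk_partial])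

section \<open>Contraction near an unperturbed eigenvalue\<close>

context point_interaction
begin

text \<open>The 80 is 4 from \<open>sg\<close> times 20 from \<open>sgk_le\<close>. As it dominates
  h_n(b)^2 too, a single small parameter governs all estimates.\<close>

definition sgb :: "nat \<Rightarrow> real" where
  "sgb n = 80 * bnd * (ln (real (n + 2)) / sqrt (real (n + 1)))"

lemma half_le_ln: "1 / 2 \<le> ln (real (n + 2))"
proof -
  have "ln 2 \<le> ln (real (n + 2))" by (subst ln_le_cancel_iff) auto
  moreover have "1 / 2 \<le> ln (2::real)"
    using ln_le_minus_one[of "1 / 2 :: real"] by (simp add: ln_div)
  ultimately show ?thesis by linarith
qed

lemma sgb: "sgb n \<ge> 0" "sg n \<le> sgb n" "(hf n b)\<^sup>2 \<le> sgb n"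
proof -
  have l: "1 / 2 \<le> ln (real (n + 2))" by (rule half_le_ln)
  show "sgb n \<ge> 0" unfolding sgb_def using bnd(1) l by auto
  have "sg n \<le> (\<Sum>k. 4 * bnd * (if k = n then 0 else 1 / (sqrt (real (k + 1)) * kd n k)))"
    unfolding sg_def
  proof (rule suminf_le[OF _ sg_summable summable_mult[OF sgk_summable]])
    fix k
    show "(if k = n then 0 else 4 * (hf k b)\<^sup>2 / kd n k) \<le> 4 * bnd * (if k = n then 0 else 1 / (sqrt (real (k + 1)) * kd n k))"
    proof (cases "k = n")
      case False
      have "4 * (hf k b)\<^sup>2 / kd n k \<le> 4 * (bnd / sqrt (real (k + 1))) / kd n k"
        using bnd(2)[of k] by (intro divide_right_mono mult_left_mono) (auto simp: kd_def)
      then show ?thesis using False by simp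
    qed simp
  qed
  also have "\<dots> = 4 * bnd * sgk n" unfolding sgk_def by (rule suminf_mult[OF sgk_summable])
  also have "\<dots> \<le> 4 * bnd * (20 * ln (real (n + 2)) / sqrt (real (n + 1)))"
    using bnd(1) by (intro mult_left_mono sgk_le) auto
  finally show "sg n \<le> sgb n" unfolding sgb_def by simp
  have "(hf n b)\<^sup>2 \<le> bnd / sqrt (real (n + 1))" by (rule bnd(2))
  also have "\<dots> \<le> bnd * (80 * ln (real (n + 2))) / sqrt (real (n + 1))"
  proof (rule divide_right_mono)
    have "1 \<le> 80 * ln (real (n + 2))" using l by linarith
    then show "bnd \<le> bnd * (80 * ln (real (n + 2)))" using mult_left_mono[of 1 "80 * ln (real (n + 2))" bnd] bnd(1) by simp
  qed simp
  also have "\<dots> = 80 * bnd * (ln (real (n + 2)) / sqrt (real (n + 1)))" by simp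
  finally show "(hf n b)\<^sup>2 \<le> sgb n" unfolding sgb_def .
qed

text \<open>The zeros of \<open>chr\<close> are the fixed points of the map that takes z to 2n+1 - 4
  s^2 psi(z).\<close>

definition psi :: "nat \<Rightarrow> complex \<Rightarrow> complex" where
  "psi n z = cO n z * ((of_nat (2 * n + 1) - z) * cE n z + of_real ((hf n b)\<^sup>2))"

lemma chr_psi: "chr s n z = (of_nat (2 * n + 1) - z) - 4 * s\<^sup>2 * psi n z"
  unfolding chr_def psi_def by (simp add: algebra_simps)

lemma cE_cO_bounds:
  assumes "z \<in> Om n"
  shows "cmod (cE n z) \<le> sgb n" "cmod (cO n z) \<le> sgb n"
  using csum_bound[OF wt_pE assms] csum_bound[OF wt_pO assms] sgb(2)[of n] unfolding cE_def cO_def by linarith+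

lemma cE_cO_lipschitz:
  assumes "z \<in> Om n" "z' \<in> Om n"
  shows "cmod (cE n z - cE n z') \<le> sgb n * cmod (z - z')" "cmod (cO n z - cO n z') \<le> sgb n * cmod (z - z')"
  using csum_lipschitz[OF wt_pE assms] csum_lipschitz[OF wt_pO assms] mult_right_mono[OF sgb(2)[of n] norm_ge_zero[of "z - z'"]]
  unfolding cE_def cO_def by linarith+

lemma psi_bound:
  assumes z: "z \<in> Om n"
  shows "cmod (psi n z) \<le> (sgb n)\<^sup>2 * (1 + cmod (of_nat (2 * n + 1) - z))"
proof -
  let ?w = "of_nat (2 * n + 1) - z"
  have "cmod (?w * cE n z + of_real ((hf n b)\<^sup>2)) \<le> cmod ?w * cmod (cE n z) + (hf n b)\<^sup>2"
    by (rule order_trans[OF norm_triangle_ineq]) (simp add: norm_mult norm_power)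
  also have "\<dots> \<le> cmod ?w * sgb n + sgb n"
    by (intro add_mono mult_left_mono cE_cO_bounds z sgb) auto
  finally have "cmod (psi n z) \<le> sgb n * (cmod ?w * sgb n + sgb n)"
    unfolding psi_def norm_mult using sgb(1)[of n] by (intro mult_mono cE_cO_bounds z) auto
  then show ?thesis by (simp add: algebra_simps power2_eq_square)
qed

lemma psi_lipschitz:
  assumes z: "z \<in> Om n" and z': "z' \<in> Om n"
  shows "cmod (psi n z - psi n z') \<le> (sgb n)\<^sup>2 * (2 + cmod (of_nat (2 * n + 1) - z) + cmod (of_nat (2 * n + 1) - z')) * cmod (z - z')"
proof -
  let ?w = "of_nat (2 * n + 1) - z" and ?w' = "of_nat (2 * n + 1) - z'"
  let ?a = "complex_of_real ((hf n b)\<^sup>2)" and ?d = "cmod (z - z')" and ?g = "sgb n"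
  have ww: "cmod (?w - ?w') = ?d" by (simp add: norm_minus_commute)
  have "psi n z - psi n z' = (cO n z - cO n z') * (?w * cE n z + ?a) + cO n z' * ((?w - ?w') * cE n z + ?w' * (cE n z - cE n z'))"
    unfolding psi_def by (simp add: algebra_simps)
  then have "cmod (psi n z - psi n z') \<le> cmod (cO n z - cO n z') * cmod (?w * cE n z + ?a) + cmod (cO n z') * cmod ((?w - ?w') * cE n z + ?w' * (cE n z - cE n z'))"
    using norm_triangle_ineq[of "(cO n z - cO n z') * (?w * cE n z + ?a)" "cO n z' * ((?w - ?w') * cE n z + ?w' * (cE n z - cE n z'))"]
    by (simp only: norm_mult)
  also have "\<dots> \<le> (?g * ?d) * (cmod ?w * ?g + ?g) + ?g * (?d * ?g + cmod ?w' * (?g * ?d))"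
  proof (intro add_mono mult_mono cE_cO_lipschitz cE_cO_bounds z z')
    show "cmod (?w * cE n z + ?a) \<le> cmod ?w * ?g + ?g"
      by (rule order_trans[OF norm_triangle_ineq], unfold norm_mult norm_of_real, intro add_mono mult_left_mono cE_cO_bounds z)
         (use sgb(3) in auto)
    show "cmod ((?w - ?w') * cE n z + ?w' * (cE n z - cE n z')) \<le> ?d * ?g + cmod ?w' * (?g * ?d)"
      by (rule order_trans[OF norm_triangle_ineq], unfold norm_mult ww, intro add_mono mult_left_mono cE_cO_bounds cE_cO_lipschitz z z') auto
  qed (use sgb(1) in auto)
  also have "\<dots> = ?g\<^sup>2 * (2 + cmod ?w + cmod ?w') * ?d" by (simp add: algebra_simps power2_eq_square)
  finally show ?thesis .
qed

text \<open>Makes 4 s^2 psi a contraction with factor 1/2 on the disc of radius 1/2 around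
  2n+1.\<close>

definition weak_at :: "complex \<Rightarrow> nat \<Rightarrow> bool" where
  "weak_at s n \<longleftrightarrow> 4 * (cmod s)\<^sup>2 * (sgb n)\<^sup>2 \<le> 1 / 8"

text \<open>A zero satisfies |w| \<le> (1 + |w|) / 8 with w = 2n+1 - z, whence 1/7. This localises
  all zeros in \<open>Om n\<close>, however large their imaginary part.\<close>

lemma zero_near_centre:
  assumes z: "z \<in> Om n" and D: "chr s n z = 0" and s: "weak_at s n"
  shows "cmod (of_nat (2 * n + 1) - z) \<le> 1 / 7"
proof -
  let ?w = "of_nat (2 * n + 1) - z"
  have "?w = 4 * s\<^sup>2 * psi n z" using D unfolding chr_psi by simp
  then have "cmod ?w = 4 * (cmod s)\<^sup>2 * cmod (psi n z)" by (simp add: norm_mult norm_power)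
  also have "\<dots> \<le> 4 * (cmod s)\<^sup>2 * ((sgb n)\<^sup>2 * (1 + cmod ?w))"
    by (intro mult_left_mono psi_bound z) auto
  also have "\<dots> \<le> 1 / 8 * (1 + cmod ?w)"
    using mult_right_mono[OF s[unfolded weak_at_def], of "1 + cmod ?w"] by (simp add: mult.assoc)
  finally show ?thesis by simp
qed

lemma chr_difference:
  assumes z: "z \<in> Om n" and z': "z' \<in> Om n" and s: "weak_at s n"
    and w: "cmod (of_nat (2 * n + 1) - z) \<le> 1 / 2" "cmod (of_nat (2 * n + 1) - z') \<le> 1 / 2"
  shows "cmod (4 * s\<^sup>2 * psi n z - 4 * s\<^sup>2 * psi n z') \<le> 1 / 2 * cmod (z - z')"
proof -
  have "4 * s\<^sup>2 * psi n z - 4 * s\<^sup>2 * psi n z' = 4 * s\<^sup>2 * (psi n z - psi n z')" by (simp add: algebra_simps)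
  then have "cmod (4 * s\<^sup>2 * psi n z - 4 * s\<^sup>2 * psi n z') = 4 * (cmod s)\<^sup>2 * cmod (psi n z - psi n z')"
    by (simp add: norm_mult norm_power)
  also have "\<dots> \<le> 4 * (cmod s)\<^sup>2 * ((sgb n)\<^sup>2 * (2 + cmod (of_nat (2 * n + 1) - z) + cmod (of_nat (2 * n + 1) - z')) * cmod (z - z'))"
    by (intro mult_left_mono psi_lipschitz z z') auto
  also have "\<dots> = 4 * (cmod s)\<^sup>2 * (sgb n)\<^sup>2 * ((2 + cmod (of_nat (2 * n + 1) - z) + cmod (of_nat (2 * n + 1) - z')) * cmod (z - z'))"
    by (simp only: mult.assoc)
  also have "\<dots> \<le> 1 / 8 * (4 * cmod (z - z'))"
    using s w unfolding weak_at_def by (intro mult_mono mult_right_mono) auto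
  finally show ?thesis by simp
qed

text \<open>The part 4 s^2 psi has Lipschitz constant 1/2, so \<open>chr\<close> changes by at least
  half of the increment.\<close>

lemma order_1_weak:
  assumes z: "z \<in> Om n" and D: "chr s n z = 0" and s: "weak_at s n"
  shows "order_at_most s n z 1"
  unfolding order_at_most_def
proof (intro exI[of _ "1/2::real"] conjI allI impI)
  fix e :: real assume e: "e > 0"
  define t where "t = min e (1/4) / 2"
  \<comment> \<open>A vertical increment does not leave \<open>Om n\<close>, which restricts the
    real part only.\<close>
  define \<epsilon> where "\<epsilon> = \<i> * complex_of_real t"
  have t: "t > 0" "t < e" "t \<le> 1 / 4" unfolding t_def using e by auto
  have c: "cmod \<epsilon> = t" "\<epsilon> \<noteq> 0" unfolding \<epsilon>_def using t by (auto simp: norm_mult)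
  have z': "z + \<epsilon> \<in> Om n" using z unfolding Om_def \<epsilon>_def by simp
  have w: "cmod (of_nat (2 * n + 1) - z) \<le> 1 / 7" by (rule zero_near_centre[OF z D s])
  have "of_nat (2 * n + 1) - (z + \<epsilon>) = (of_nat (2 * n + 1) - z) - \<epsilon>" by simp
  then have "cmod (of_nat (2 * n + 1) - (z + \<epsilon>)) \<le> cmod (of_nat (2 * n + 1) - z) + cmod \<epsilon>"
    by (simp only: norm_triangle_ineq4)
  then have w': "cmod (of_nat (2 * n + 1) - (z + \<epsilon>)) \<le> 1 / 2"
    using w c t by linarith
  have "chr s n (z + \<epsilon>) = chr s n z - \<epsilon> - (4 * s\<^sup>2 * psi n (z + \<epsilon>) - 4 * s\<^sup>2 * psi n z)"
    unfolding chr_psi by simp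
  then have e1: "chr s n (z + \<epsilon>) = - (\<epsilon> + (4 * s\<^sup>2 * psi n (z + \<epsilon>) - 4 * s\<^sup>2 * psi n z))" unfolding D by simp
  have "cmod (4 * s\<^sup>2 * psi n (z + \<epsilon>) - 4 * s\<^sup>2 * psi n z) \<le> 1 / 2 * cmod (z + \<epsilon> - z)"
    by (rule chr_difference[OF z' z s w']) (use w in simp)
  then have "cmod \<epsilon> / 2 \<le> cmod (chr s n (z + \<epsilon>))"
    unfolding e1 norm_minus_cancel using norm_diff_ineq[of \<epsilon> "4 * s\<^sup>2 * psi n (z + \<epsilon>) - 4 * s\<^sup>2 * psi n z"] by simp
  then show "\<exists>\<epsilon>. \<epsilon> \<noteq> 0 \<and> cmod \<epsilon> < e \<and> z + \<epsilon> \<in> Om n \<and> 1 / 2 * cmod \<epsilon> ^ 1 \<le> cmod (chr s n (z + \<epsilon>))"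
    using z' c t by (intro exI[of _ \<epsilon>]) auto
qed simp

lemma centre_disc_Om: "cmod (of_nat (2 * n + 1) - z) \<le> 1 / 2 \<Longrightarrow> z \<in> Om n"
  using abs_Re_le_cmod[of "of_nat (2 * n + 1) - z"] unfolding Om_def by auto

text \<open>Banach's fixed point theorem on the disc of radius 1/2; \<open>zero_near_centre\<close>
  brings every zero of the strip into this disc.\<close>

lemma unique_zero_weak:
  assumes s: "weak_at s n"
  shows "\<exists>!z. \<bar>Re z - (2 * real n + 1)\<bar> \<le> 1 \<and> chr s n z = 0"
proof -
  let ?c = "of_nat (2 * n + 1) :: complex"
  let ?f = "\<lambda>z. ?c - 4 * s\<^sup>2 * psi n z"
  have Omc: "z \<in> Om n" if "z \<in> cball ?c (1 / 2)" for z
    using that by (intro centre_disc_Om) (simp add: dist_norm)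
  have lip: "dist (?f z) (?f z') \<le> 1 / 2 * dist z z'" if z: "z \<in> cball ?c (1 / 2)" and z': "z' \<in> cball ?c (1 / 2)" for z z'
  proof -
    have "dist (?f z) (?f z') = cmod (4 * s\<^sup>2 * psi n z - 4 * s\<^sup>2 * psi n z')"
      unfolding dist_norm by (simp add: norm_minus_commute)
    also have "\<dots> \<le> 1 / 2 * cmod (z - z')"
      by (rule chr_difference[OF Omc[OF z] Omc[OF z'] s]) (use z z' in \<open>simp_all add: dist_norm\<close>)
    finally show ?thesis by (simp only: dist_norm)
  qed
  have img: "?f ` cball ?c (1 / 2) \<subseteq> cball ?c (1 / 2)"
    proof (rule image_subsetI)
      fix z assume z: "z \<in> cball ?c (1 / 2)"
      then have w: "cmod (?c - z) \<le> 1 / 2" by (simp add: dist_norm)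
      have "cmod (4 * s\<^sup>2 * psi n z) = 4 * (cmod s)\<^sup>2 * cmod (psi n z)" by (simp add: norm_mult norm_power)
      also have "\<dots> \<le> 4 * (cmod s)\<^sup>2 * ((sgb n)\<^sup>2 * (1 + cmod (?c - z)))"
        by (intro mult_left_mono psi_bound Omc z) auto
      also have "\<dots> = 4 * (cmod s)\<^sup>2 * (sgb n)\<^sup>2 * (1 + cmod (?c - z))" by simp
      also have "\<dots> \<le> 1 / 8 * (1 + 1 / 2)" using s w unfolding weak_at_def by (intro mult_mono) auto
      finally show "?f z \<in> cball ?c (1 / 2)" by (simp add: dist_norm)
    qed
  have "\<exists>!z\<in>cball ?c (1 / 2). ?f z = z"
  proof (rule Banach_fix[OF complete_eq_closed[THEN iffD2, OF closed_cball] _ _ _ img lip])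
    show "cball ?c (1 / 2) \<noteq> {}" by simp
  qed simp_all
  then obtain z where z: "z \<in> cball ?c (1 / 2)" "?f z = z" and u: "\<And>y. y \<in> cball ?c (1 / 2) \<Longrightarrow> ?f y = y \<Longrightarrow> y = z" by blast
  have w: "cmod (?c - z) \<le> 1 / 2" using z(1) by (simp add: dist_norm)
  show ?thesis
  proof (rule ex1I[of _ z])
    have "\<bar>Re z - (2 * real n + 1)\<bar> \<le> 1" using abs_Re_le_cmod[of "?c - z"] w by simp
    moreover have "chr s n z = 0" unfolding chr_psi using z(2) by (simp add: algebra_simps)
    ultimately show "\<bar>Re z - (2 * real n + 1)\<bar> \<le> 1 \<and> chr s n z = 0" ..
    fix y assume y: "\<bar>Re y - (2 * real n + 1)\<bar> \<le> 1 \<and> chr s n y = 0"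
    then have yo: "y \<in> Om n" by (intro strip_Om) auto
    have "cmod (?c - y) \<le> 1 / 7" by (rule zero_near_centre[OF yo _ s]) (use y in auto)
    then show "y = z"
      by (intro u) (use y in \<open>auto simp: dist_norm chr_psi algebra_simps\<close>)
  qed
qed

lemma sgb_tendsto: "sgb \<longlonglongrightarrow> 0"
proof -
  have "(\<lambda>n. ln (real (n + 2)) / sqrt (real (n + 1))) \<longlonglongrightarrow> 0" by real_asymp
  then have "(\<lambda>n. 80 * bnd * (ln (real (n + 2)) / sqrt (real (n + 1)))) \<longlonglongrightarrow> 80 * bnd * 0" by (intro tendsto_intros)
  then show ?thesis unfolding sgb_def[abs_def] by simp
qed

lemma eventually_weak: "eventually (weak_at s) sequentially"
proof -
  have "(\<lambda>n. 4 * (cmod s)\<^sup>2 * (sgb n)\<^sup>2) \<longlonglongrightarrow> 4 * (cmod s)\<^sup>2 * 0\<^sup>2" by (intro tendsto_intros sgb_tendsto)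
  then have "eventually (\<lambda>n. 4 * (cmod s)\<^sup>2 * (sgb n)\<^sup>2 < 1 / 8) sequentially"
    by (rule order_tendstoD) simp
  then show ?thesis by eventually_elim (simp add: weak_at_def)
qed

end

section \<open>Mehler's formula on the diagonal\<close>

text \<open>The recursion, solved once for h_(k+1) and once for h_(k-2), has the same mixed term in
  both squares. It cancels in the difference, and a linear recursion for the squares
  remains.\<close>

lemma hf_sq_rec:
  assumes "k \<ge> 1"
  shows "real (k + 1) * (hf (k + 1) x)\<^sup>2 = (2 * x\<^sup>2 - real k) * (hf k x)\<^sup>2 + (real k - 2 * x\<^sup>2) * (hf (k - 1) x)\<^sup>2
     + real (k - 1) * (hf (k - 2) x)\<^sup>2"
proof -
  have sq: "(sqrt (real j) * y)\<^sup>2 = real j * y\<^sup>2" for j y by (simp add: power_mult_distrib)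
  have "real (k + 1) * (hf (k + 1) x)\<^sup>2 = (sqrt 2 * x * hf k x - sqrt (real k) * hf (k - 1) x)\<^sup>2"
    unfolding hf_rec[symmetric] sq ..
  moreover have "real (k - 1) * (hf (k - 2) x)\<^sup>2 = (sqrt 2 * x * hf (k - 1) x - sqrt (real k) * hf k x)\<^sup>2"
  proof -
    have "sqrt (real k) * hf k x = sqrt 2 * x * hf (k - 1) x - sqrt (real (k - 1)) * hf (k - 2) x"
      using hf_rec[of "k - 1" x] assms by (simp add: numeral_2_eq_2)
    then have "sqrt 2 * x * hf (k - 1) x - sqrt (real k) * hf k x = sqrt (real (k - 1)) * hf (k - 2) x" by simp
    then show ?thesis by (simp only: sq)
  qed
  moreover have "(r2 * x * a - rk * c)\<^sup>2 - (r2 * x * c - rk * a)\<^sup>2 = (r2\<^sup>2 * x\<^sup>2 - rk\<^sup>2) * a\<^sup>2 + (rk\<^sup>2 - r2\<^sup>2 * x\<^sup>2) * c\<^sup>2"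
    for r2 rk a c :: real by (simp add: power2_eq_square algebra_simps)
  from this[of "sqrt 2" "hf k x" "sqrt (real k)" "hf (k - 1) x"]
  have "(sqrt 2 * x * hf k x - sqrt (real k) * hf (k - 1) x)\<^sup>2 - (sqrt 2 * x * hf (k - 1) x - sqrt (real k) * hf k x)\<^sup>2
     = (2 * x\<^sup>2 - real k) * (hf k x)\<^sup>2 + (real k - 2 * x\<^sup>2) * (hf (k - 1) x)\<^sup>2" by simp
  ultimately show ?thesis by linarith
qed

text \<open>The diagonal of Mehler's kernel, with r in the unit disc in place of the time
  variable.\<close>

definition mehler :: "real \<Rightarrow> complex \<Rightarrow> complex" where
  "mehler x r = (\<Sum>k. complex_of_real ((hf k x)\<^sup>2) * r ^ k)"

lemma mehler_summable:
  assumes "cmod r < 1"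
  shows "summable (\<lambda>k. complex_of_real ((hf k x)\<^sup>2) * r ^ k)" "summable (\<lambda>k. (hf k x)\<^sup>2 * cmod r ^ k)"
proof -
  obtain A where A: "A > 0" "\<And>n y. \<bar>y\<bar> \<le> \<bar>x\<bar> \<Longrightarrow> (hf n y)\<^sup>2 \<le> A / sqrt (real (n + 1))"
    using hf_local_bound[of "\<bar>x\<bar>"] by blast
  have le: "(hf k x)\<^sup>2 \<le> A" for k
  proof -
    have "A / sqrt (real (k + 1)) \<le> A / 1" using A(1) by (intro divide_left_mono) auto
    then show ?thesis using A(2)[of x k] by simp
  qed
  show 1: "summable (\<lambda>k. (hf k x)\<^sup>2 * cmod r ^ k)"
  proof (rule summable_comparison_test'[where N = 0])
    show "summable (\<lambda>k. A * cmod r ^ k)" using assms by (intro summable_mult summable_geometric) simp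
    show "norm ((hf k x)\<^sup>2 * cmod r ^ k) \<le> A * cmod r ^ k" for k
      using le[of k] by (simp add: mult_right_mono)
  qed
  show "summable (\<lambda>k. complex_of_real ((hf k x)\<^sup>2) * r ^ k)"
    by (rule summable_norm_cancel) (use 1 in \<open>simp add: norm_mult norm_power\<close>)
qed

lemma shift_sums:
  fixes f :: "nat \<Rightarrow> complex"
  assumes "(\<lambda>k. f k * r ^ k) sums S"
  shows "(\<lambda>k. (if k < m then 0 else f (k - m)) * r ^ k) sums (r ^ m * S)"
proof -
  have "(\<lambda>k. (if k + m < m then 0 else f (k + m - m)) * r ^ (k + m)) sums (r ^ m * S)"
    using sums_mult[OF assms, of "r ^ m"] by (simp add: power_add mult_ac)
  then show ?thesis
    by (subst (asm) sums_iff_shift) simp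
qed

text \<open>The recursion for the squares, read as a first-order differential equation for their
  generating function. The four shifts combine to 1 + r - r^2 - r^3 = (1 - r^2)(1 + r).\<close>

lemma mehler_deriv:
  assumes r: "cmod r < 1"
  obtains D where "(mehler x has_field_derivative D) (at r)"
    "(1 - r\<^sup>2) * (1 + r) * D = (r * (1 + r) + 2 * of_real (x\<^sup>2) * (1 - r)) * mehler x r"
proof -
  define c where "c k = complex_of_real ((hf k x)\<^sup>2)" for k
  define D where "D = (\<Sum>k. diffs c k * r ^ k)"
  have sm: "summable (\<lambda>k. c k * z ^ k)" if "norm z < 1" for z unfolding c_def using mehler_summable that by blast
  have d: "(mehler x has_field_derivative D) (at r)"
    using termdiffs_strong'[of 1 c r, OF sm r] unfolding mehler_def[abs_def] c_def D_def by simp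
  have Ms: "(\<lambda>k. c k * r ^ k) sums mehler x r"
    unfolding mehler_def c_def by (rule summable_sums, rule mehler_summable[OF r])
  have Ds: "(\<lambda>k. diffs c k * r ^ k) sums D"
    unfolding D_def by (rule summable_sums, rule termdiff_converges[OF r sm])
  define X where "X = complex_of_real (2 * x\<^sup>2)"
  let ?s = "\<lambda>m f k. if k < m then 0 else f (k - (m::nat)) :: complex"
  have L: "(\<lambda>k. ?s 0 (diffs c) k * r ^ k + ?s 1 (diffs c) k * r ^ k - ?s 2 (diffs c) k * r ^ k - ?s 3 (diffs c) k * r ^ k)
     sums (r ^ 0 * D + r ^ 1 * D - r ^ 2 * D - r ^ 3 * D)"
    by (intro sums_add sums_diff shift_sums Ds)
  have R: "(\<lambda>k. X * (?s 0 c k * r ^ k) + (1 - X) * (?s 1 c k * r ^ k) + ?s 2 c k * r ^ k)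
     sums (X * (r ^ 0 * mehler x r) + (1 - X) * (r ^ 1 * mehler x r) + r ^ 2 * mehler x r)"
    by (intro sums_add sums_mult shift_sums Ms)
  have dc: "diffs c k = of_nat (Suc k) * c (Suc k)" for k by (simp add: diffs_def)
  have rc: "of_nat (Suc (Suc n)) * c (Suc (Suc n)) = (X - of_nat (Suc n)) * c (Suc n) + (of_nat (Suc n) - X) * c n + of_nat n * c (n - 1)" for n
  proof -
    have "complex_of_real (real (Suc n + 1) * (hf (Suc n + 1) x)\<^sup>2) = complex_of_real ((2 * x\<^sup>2 - real (Suc n)) * (hf (Suc n) x)\<^sup>2 + (real (Suc n) - 2 * x\<^sup>2) * (hf (Suc n - 1) x)\<^sup>2
     + real (Suc n - 1) * (hf (Suc n - 2) x)\<^sup>2)"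
      by (subst hf_sq_rec) simp_all
    then show ?thesis unfolding c_def X_def by (simp add: numeral_2_eq_2)
  qed
  have c1: "c (Suc 0) = X * c 0"
  proof -
    have "(hf (Suc 0) x)\<^sup>2 = 2 * x\<^sup>2 * (hf 0 x)\<^sup>2" by (simp add: hf.simps(2) power_mult_distrib)
    then show ?thesis unfolding c_def X_def by (simp only: of_real_mult)
  qed
  have coef: "?s 0 (diffs c) k + ?s 1 (diffs c) k - ?s 2 (diffs c) k - ?s 3 (diffs c) k = X * ?s 0 c k + (1 - X) * ?s 1 c k + ?s 2 c k" for k
  proof -
    \<comment> \<open>The first three coefficients are apart because the shifted sequences begin
      with zeros.\<close>
    consider "k = 0" | "k = 1" | "k = 2" | n where "k = n + 3"
      by (metis One_nat_def add.commute add_2_eq_Suc' less_2_cases_iff not_less numeral_2_eq_2 numeral_3_eq_3 le_Suc_ex le_less less_Suc_eq_le)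
    then show ?thesis
    proof cases
      case 1 then show ?thesis by (simp add: dc c1)
    next
      case 2 then show ?thesis using rc[of 0] by (simp add: dc algebra_simps)
    next
      case 3 then show ?thesis using rc[of 1] by (simp add: dc algebra_simps numeral_2_eq_2)
    next
      case (4 n)
      then show ?thesis using rc[of "Suc (Suc n)"] by (simp add: dc algebra_simps numeral_3_eq_3 numeral_2_eq_2)
    qed
  qed
  have "(\<lambda>k. ?s 0 (diffs c) k * r ^ k + ?s 1 (diffs c) k * r ^ k - ?s 2 (diffs c) k * r ^ k - ?s 3 (diffs c) k * r ^ k)
     = (\<lambda>k. (?s 0 (diffs c) k + ?s 1 (diffs c) k - ?s 2 (diffs c) k - ?s 3 (diffs c) k) * r ^ k)"
    by (simp only: left_diff_distrib distrib_right)
  also have "\<dots> = (\<lambda>k. X * (?s 0 c k * r ^ k) + (1 - X) * (?s 1 c k * r ^ k) + ?s 2 c k * r ^ k)"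
    unfolding coef by (simp only: distrib_right mult.assoc)
  finally have "r ^ 0 * D + r ^ 1 * D - r ^ 2 * D - r ^ 3 * D = X * (r ^ 0 * mehler x r) + (1 - X) * (r ^ 1 * mehler x r) + r ^ 2 * mehler x r"
    using L R sums_unique2 by (simp only:)
  then have "(1 - r\<^sup>2) * (1 + r) * D = (r * (1 + r) + X * (1 - r)) * mehler x r"
    by (simp add: algebra_simps power2_eq_square power3_eq_cube)
  then show thesis using that[OF d] unfolding X_def by simp
qed

text \<open>The closed form (pi (1 - r^2))^(-1/2) exp (- x^2 (1 - r)/(1 + r)), squared to avoid a
  branch of the root. The left side has derivative 0 by \<open>mehler_deriv\<close>, and its value
  at r = 0 comes from h_0.\<close>

lemma mehler_identity:
  assumes r: "cmod r < 1"
  shows "(mehler x r)\<^sup>2 * (1 - r\<^sup>2) * exp (2 * of_real (x\<^sup>2) * ((1 - r) / (1 + r))) = 1 / of_real pi"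
proof -
  define N where "N r = (mehler x r)\<^sup>2 * (1 - r\<^sup>2) * exp (2 * of_real (x\<^sup>2) * ((1 - r) / (1 + r)))" for r
  have nz: "1 + z \<noteq> 0" if "cmod z < 1" for z :: complex
  proof
    assume "1 + z = 0"
    then have "z = - 1" by (simp add: add_eq_0_iff)
    then show False using that by simp
  qed
  have "(N has_field_derivative 0) (at z within ball 0 1)" if "z \<in> ball 0 1" for z
  proof -
    have z: "cmod z < 1" using that by simp
    note n = nz[OF z]
    obtain D where D: "(mehler x has_field_derivative D) (at z)"
      "(1 - z\<^sup>2) * (1 + z) * D = (z * (1 + z) + 2 * of_real (x\<^sup>2) * (1 - z)) * mehler x z"
      using mehler_deriv[OF z] by blast
    let ?X = "2 * complex_of_real (x\<^sup>2)" and ?M = "mehler x z"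
    let ?e = "exp (?X * ((1 - z) / (1 + z)))"
    have q: "((\<lambda>z. ?X * ((1 - z) / (1 + z))) has_field_derivative ?X * (- 2 / (1 + z)\<^sup>2)) (at z)"
    proof -
      have "((\<lambda>z. (1 - z) / (1 + z)) has_field_derivative - 2 / (1 + z)\<^sup>2) (at z)"
        using n by (auto intro!: derivative_eq_intros simp: power2_eq_square)
      then show ?thesis by (rule DERIV_cmult)
    qed
    have m2: "((\<lambda>z. (mehler x z)\<^sup>2) has_field_derivative 2 * ?M * D) (at z)"
      by (rule derivative_eq_intros D(1) | simp)+
    have z2: "((\<lambda>z. 1 - z\<^sup>2) has_field_derivative - (2 * z)) (at z)"
      by (rule derivative_eq_intros | simp)+
    have "(N has_field_derivative ((2 * ?M * D) * (1 - z\<^sup>2) + (- (2 * z)) * ?M\<^sup>2) * ?e + (?e * (?X * (- 2 / (1 + z)\<^sup>2))) * (?M\<^sup>2 * (1 - z\<^sup>2))) (at z)"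
      unfolding N_def[abs_def]
      by (rule DERIV_mult[OF DERIV_mult[OF m2 z2] DERIV_chain2[OF DERIV_exp q]])
    moreover have "((2 * ?M * D) * (1 - z\<^sup>2) + (- (2 * z)) * ?M\<^sup>2) * ?e + (?e * (?X * (- 2 / (1 + z)\<^sup>2))) * (?M\<^sup>2 * (1 - z\<^sup>2)) = 0"
    proof -
      have f: "(1 - z\<^sup>2) / (1 + z)\<^sup>2 = (1 - z) / (1 + z)"
      proof -
        have "1 - z\<^sup>2 = (1 - z) * (1 + z)" by (simp add: power2_eq_square algebra_simps)
        then show ?thesis using n by (simp add: power2_eq_square)
      qed
      have "(1 + z) * ((2 * ?M * D) * (1 - z\<^sup>2) + (- (2 * z)) * ?M\<^sup>2) = 2 * ?M * ((1 - z\<^sup>2) * (1 + z) * D) - 2 * z * (1 + z) * ?M\<^sup>2"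
        by (simp add: algebra_simps)
      also have "\<dots> = 2 * ?X * (1 - z) * ?M\<^sup>2"
        unfolding D(2) by (simp add: algebra_simps power2_eq_square)
      finally have g: "(2 * ?M * D) * (1 - z\<^sup>2) + (- (2 * z)) * ?M\<^sup>2 = 2 * ?X * ?M\<^sup>2 * ((1 - z) / (1 + z))"
        using n by (simp add: field_simps)
      have "(?e * (?X * (- 2 / (1 + z)\<^sup>2))) * (?M\<^sup>2 * (1 - z\<^sup>2)) = - (2 * ?X * ?M\<^sup>2 * ((1 - z\<^sup>2) / (1 + z)\<^sup>2)) * ?e"
        by simp
      then show ?thesis unfolding g f by simp
    qed
    ultimately show ?thesis by (simp add: has_field_derivative_at_within)
  qed
  then obtain c where c: "\<And>z. z \<in> ball 0 1 \<Longrightarrow> N z = c"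
    using has_field_derivative_zero_constant[OF convex_ball, of 0 1 N] by blast
  have "N r = N 0" using c[of r] c[of 0] r by simp
  also have "N 0 = 1 / of_real pi"
  proof -
    have m0: "mehler x 0 = complex_of_real ((hf 0 x)\<^sup>2)" unfolding mehler_def using powser_zero[of "\<lambda>k. complex_of_real ((hf k x)\<^sup>2)"] by simp
    have "(hf 0 x)\<^sup>2 = exp (- x\<^sup>2) / sqrt pi"
      by (simp add: hf.simps power_divide flip: exp_double)
    then have "((hf 0 x)\<^sup>2)\<^sup>2 = exp (- 2 * x\<^sup>2) / pi"
      by (simp add: power_divide flip: exp_double)
    then have "((hf 0 x)\<^sup>2)\<^sup>2 * exp (2 * x\<^sup>2) = 1 / pi"
      by (simp flip: exp_add)
    then have "complex_of_real (((hf 0 x)\<^sup>2)\<^sup>2 * exp (2 * x\<^sup>2)) = complex_of_real (1 / pi)" by simp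
    then show ?thesis using exp_of_real[of "2 * x\<^sup>2", where 'a = complex] unfolding N_def m0 by simp
  qed
  finally show ?thesis unfolding N_def .
qed

lemma mehler_bound:
  assumes r: "cmod r < 1"
  shows "cmod (mehler x r) \<le> 1 / sqrt (pi * cmod (1 - r\<^sup>2))"
proof -
  have n: "1 + r \<noteq> 0"
  proof
    assume "1 + r = 0"
    then have "r = - 1" by (simp add: add_eq_0_iff)
    then show False using r by simp
  qed
  have n2: "1 - r\<^sup>2 \<noteq> 0"
  proof
    assume "1 - r\<^sup>2 = 0"
    then have "(cmod r)\<^sup>2 = 1" by (simp add: norm_power[symmetric])
    then show False using r norm_ge_zero[of r] by (auto simp: power2_eq_1_iff)
  qed
  have "Re ((1 - r) / (1 + r)) = (1 - (cmod r)\<^sup>2) / (cmod (1 + r))\<^sup>2"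
    unfolding Re_divide cmod_power2 by (simp add: power2_eq_square algebra_simps)
  moreover have "(cmod r)\<^sup>2 \<le> 1" using r by (simp add: power_le_one)
  ultimately have re: "Re ((1 - r) / (1 + r)) \<ge> 0" by simp
  have "Re (2 * of_real (x\<^sup>2) * ((1 - r) / (1 + r))) = 2 * x\<^sup>2 * Re ((1 - r) / (1 + r))"
  proof -
    have "2 * of_real (x\<^sup>2) * ((1 - r) / (1 + r)) = (2 * x\<^sup>2) *\<^sub>R ((1 - r) / (1 + r))"
      by (simp add: scaleR_conv_of_real)
    then show ?thesis by (simp only: scaleR_complex.simps)
  qed
  then have e: "cmod (exp (2 * of_real (x\<^sup>2) * ((1 - r) / (1 + r)))) \<ge> 1"
    using re by (simp only: norm_exp_eq_Re one_le_exp_iff) simp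
  have "cmod ((mehler x r)\<^sup>2 * (1 - r\<^sup>2) * exp (2 * of_real (x\<^sup>2) * ((1 - r) / (1 + r)))) = cmod (1 / of_real pi)"
    unfolding mehler_identity[OF r] ..
  then have "(cmod (mehler x r))\<^sup>2 * cmod (1 - r\<^sup>2) * cmod (exp (2 * of_real (x\<^sup>2) * ((1 - r) / (1 + r)))) = 1 / pi"
    by (simp only: norm_mult norm_power norm_divide norm_of_real norm_one) simp
  moreover have "(cmod (mehler x r))\<^sup>2 * cmod (1 - r\<^sup>2) * 1 \<le> (cmod (mehler x r))\<^sup>2 * cmod (1 - r\<^sup>2) * cmod (exp (2 * of_real (x\<^sup>2) * ((1 - r) / (1 + r))))"
    by (intro mult_left_mono e) auto
  ultimately have "(cmod (mehler x r))\<^sup>2 * cmod (1 - r\<^sup>2) \<le> 1 / pi" by simp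
  then have "(cmod (mehler x r))\<^sup>2 \<le> 1 / (pi * cmod (1 - r\<^sup>2))"
    using n2 by (simp add: field_simps)
  then have "cmod (mehler x r) \<le> sqrt (1 / (pi * cmod (1 - r\<^sup>2)))" by (rule real_le_rsqrt)
  then show ?thesis by (simp add: real_sqrt_divide)
qed

text \<open>\<sigma> = 1 selects the even and \<sigma> = -1 the odd indices.\<close>

definition par :: "real \<Rightarrow> nat \<Rightarrow> bool" where
  "par \<sigma> k \<longleftrightarrow> (- 1) ^ k = \<sigma>"

lemma mehler_part:
  assumes r: "cmod r < 1" and \<sigma>: "\<sigma> = 1 \<or> \<sigma> = - 1"
  shows "(\<lambda>k. (if par \<sigma> k then complex_of_real ((hf k x)\<^sup>2) else 0) * r ^ k) sums ((mehler x r + of_real \<sigma> * mehler x (- r)) / 2)"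
    and "cmod ((mehler x r + of_real \<sigma> * mehler x (- r)) / 2) \<le> 1 / sqrt (pi * cmod (1 - r\<^sup>2))"
proof -
  have r': "cmod (- r) < 1" using r by simp
  have "(\<lambda>k. (complex_of_real ((hf k x)\<^sup>2) * r ^ k + of_real \<sigma> * (complex_of_real ((hf k x)\<^sup>2) * (- r) ^ k)) / 2) sums ((mehler x r + of_real \<sigma> * mehler x (- r)) / 2)"
    unfolding mehler_def
    by (intro sums_divide sums_add sums_mult summable_sums mehler_summable(1) r r')
  moreover have "(complex_of_real ((hf k x)\<^sup>2) * r ^ k + of_real \<sigma> * (complex_of_real ((hf k x)\<^sup>2) * (- r) ^ k)) / 2
     = (if par \<sigma> k then complex_of_real ((hf k x)\<^sup>2) else 0) * r ^ k" for k
    using \<sigma> unfolding par_def by (cases "even k") (auto simp: minus_one_power_iff power_minus_odd)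
  ultimately show "(\<lambda>k. (if par \<sigma> k then complex_of_real ((hf k x)\<^sup>2) else 0) * r ^ k) sums ((mehler x r + of_real \<sigma> * mehler x (- r)) / 2)"
    by simp
  have "cmod (mehler x r + of_real \<sigma> * mehler x (- r)) \<le> cmod (mehler x r) + cmod (mehler x (- r))"
    using \<sigma> by (intro order_trans[OF norm_triangle_ineq]) (auto simp: norm_mult)
  then show "cmod ((mehler x r + of_real \<sigma> * mehler x (- r)) / 2) \<le> 1 / sqrt (pi * cmod (1 - r\<^sup>2))"
    using mehler_bound[OF r, of x] mehler_bound[OF r', of x] by (simp add: norm_divide)
qed

section \<open>An integral majorant\<close>

lemma sin_ge_cubic:
  assumes "0 \<le> (x::real)" "x \<le> 2"
  shows "x - x ^ 3 / 6 \<le> sin x"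
proof -
  have s: "(\<Sum>m<7. sin_coeff m * x ^ m) = x - x ^ 3 / 6 + x ^ 5 / 120"
  proof -
    have "{..<7::nat} = {0, 1, 2, 3, 4, 5, 6}" by auto
    then show ?thesis by (simp add: sin_coeff_def fact_numeral)
  qed
  have "\<bar>sin x - (\<Sum>m<7. sin_coeff m * x ^ m)\<bar> \<le> inverse (fact 7) * \<bar>x\<bar> ^ 7"
    by (rule Maclaurin_sin_bound)
  then have "sin x \<ge> x - x ^ 3 / 6 + x ^ 5 / 120 - inverse (fact 7) * \<bar>x\<bar> ^ 7" unfolding s by linarith
  \<comment> \<open>The remainder of order 7 is absorbed by the term of order 5, as x^2 \<le> 4 is
    below 7!/5! = 42.\<close>
  moreover have "inverse (fact 7) * \<bar>x\<bar> ^ 7 \<le> x ^ 5 / 120"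
  proof -
    have "x ^ 2 \<le> 2 ^ 2" using assms by (intro power_mono) auto
    then have "x ^ 5 * x ^ 2 \<le> x ^ 5 * 42" using assms by (intro mult_left_mono) auto
    then have "x ^ 7 \<le> 42 * x ^ 5" by (simp flip: power_add)
    then show ?thesis using assms by (simp add: fact_numeral)
  qed
  ultimately show ?thesis by linarith
qed

text \<open>With y = 2 t this is (1 + y^2/8) / sqrt y, a majorant of (sin y)^(-1/2) up to y = pi/2.
  The Taylor coefficient at 0 would be 1/12; 1/8 suffices on the whole interval, and the
  antiderivatives stay elementary.\<close>

definition mu :: "real \<Rightarrow> real" where
  "mu t = 1 / sqrt (2 * t) + 1 / 8 * (2 * t) * sqrt (2 * t)"

lemma inverse_sqrt_sin_le:
  assumes t: "0 < t" "t \<le> pi / 4"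
  shows "1 / sqrt (sin (2 * t)) \<le> mu t"
proof -
  define y where "y = 2 * t"
  have y: "0 < y" "y \<le> pi / 2" unfolding y_def using t by auto
  have y1: "y \<le> 1571 / 1000" using y(2) pi_approx by simp
  have "y * y \<le> 1571 / 1000 * (1571 / 1000)" using y y1 by (intro mult_mono) auto
  then have y2: "y * y \<le> 2.47" by simp
  have c: "y - y ^ 3 / 6 \<le> sin y" by (rule sin_ge_cubic) (use y y1 in auto)
  have s0: "0 < sin y" using y by (intro sin_gt_zero) auto
  \<comment> \<open>The cubic lower bound for sin leaves the inequality 10 y^2 + y^4 \<le> 32, which
    y^2 \<le> 2.47 satisfies.\<close>
  have key: "y \<le> sin y * (1 + y * y / 8)\<^sup>2"
  proof -
    have "10 * (y * y) + (y * y) * (y * y) \<le> 10 * 2.47 + 2.47 * 2.47"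
      using y2 y by (intro add_mono mult_mono) auto
    then have "0 \<le> 32 - 10 * (y * y) - (y * y) * (y * y)" by simp
    then have "0 \<le> y * (y * y) * (32 - 10 * (y * y) - (y * y) * (y * y)) / 384" using y by simp
    also have "\<dots> = (y - y ^ 3 / 6) * (1 + y * y / 8)\<^sup>2 - y"
      by (simp add: power2_eq_square power3_eq_cube field_simps)
    finally have "y \<le> (y - y ^ 3 / 6) * (1 + y * y / 8)\<^sup>2" by simp
    also have "\<dots> \<le> sin y * (1 + y * y / 8)\<^sup>2" using c by (intro mult_right_mono) auto
    finally show ?thesis .
  qed
  have sy: "sqrt y > 0" "sqrt y * sqrt y = y" using y by auto
  have "sqrt y \<le> sqrt (sin y * (1 + y * y / 8)\<^sup>2)" using key by simp
  also have "\<dots> = sqrt (sin y) * (1 + y * y / 8)" using y by (simp add: real_sqrt_mult)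
  finally have "1 / sqrt (sin y) \<le> (1 + y * y / 8) / sqrt y"
    using sy s0 by (simp add: field_simps)
  also have "\<dots> = mu t"
  proof -
    have "y * y / sqrt y = y * sqrt y" using sy by (simp add: field_simps)
    then show ?thesis unfolding mu_def y_def[symmetric] by (simp add: add_divide_distrib)
  qed
  finally show ?thesis unfolding y_def .
qed

text \<open>Reflected at pi/4, like sin (2 t).\<close>

definition maj :: "real \<Rightarrow> real" where
  "maj t = (if t \<le> pi / 4 then mu t else mu (pi / 2 - t))"

lemma maj_ge:
  assumes "0 < t" "t < pi / 2"
  shows "1 / sqrt (sin (2 * t)) \<le> maj t"
proof (cases "t \<le> pi / 4")
  case True
  then show ?thesis unfolding maj_def using inverse_sqrt_sin_le[of t] assms by simp
next
  case False
  have "sin (2 * (pi / 2 - t)) = sin (2 * t)" by (simp add: right_diff_distrib)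
  then show ?thesis unfolding maj_def using inverse_sqrt_sin_le[of "pi / 2 - t"] assms False by simp
qed

text \<open>\<open>Lam\<close> and \<open>Gam\<close> are the first and second antiderivatives of
  the majorant \<open>mu\<close>; the second one serves weights linear in t.\<close>

definition Lam :: "real \<Rightarrow> real" where
  "Lam t = sqrt (2 * t) + 1 / 40 * (2 * t)\<^sup>2 * sqrt (2 * t)"

definition Gam :: "real \<Rightarrow> real" where
  "Gam t = 1 / 3 * (2 * t) * sqrt (2 * t) + 1 / 280 * (2 * t) ^ 3 * sqrt (2 * t)"

lemma sqrt2_deriv: "t > 0 \<Longrightarrow> ((\<lambda>t. sqrt (2 * t)) has_real_derivative 1 / sqrt (2 * t)) (at t)"
  by (auto intro!: derivative_eq_intros simp: field_simps)

lemma Lam_deriv: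
  assumes t: "t > 0"
  shows "(Lam has_real_derivative mu t) (at t)"
proof -
  define q where "q = sqrt (2 * t)"
  have q: "q > 0" "q * q = 2 * t" unfolding q_def using t by auto
  have d: "((\<lambda>t. (2 * t)\<^sup>2) has_real_derivative 8 * t) (at t)"
    by (auto intro!: derivative_eq_intros simp: power2_eq_square)
  have "(Lam has_real_derivative 1 / sqrt (2 * t) + (1 / 40 * (8 * t) * sqrt (2 * t) + 1 / sqrt (2 * t) * (1 / 40 * (2 * t)\<^sup>2))) (at t)"
    unfolding Lam_def[abs_def]
    by (rule DERIV_add[OF sqrt2_deriv[OF t] DERIV_mult[OF DERIV_cmult[OF d] sqrt2_deriv[OF t]]])
  moreover have "1 / q + (1 / 40 * (8 * t) * q + 1 / q * (1 / 40 * (2 * t)\<^sup>2)) = mu t"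
  proof -
    have "1 / q * (2 * t)\<^sup>2 = (2 * t) * q" unfolding q(2)[symmetric] using q(1) by (simp add: power2_eq_square)
    then have "1 / q * (1 / 40 * (2 * t)\<^sup>2) = 1 / 40 * ((2 * t) * q)"
      unfolding mult.left_commute[of "1 / q" "1 / 40"] by (simp only:)
    then show ?thesis unfolding mu_def q_def[symmetric] by (simp add: algebra_simps)
  qed
  moreover note q_def
  ultimately show ?thesis by simp
qed

lemma Gam_deriv:
  assumes t: "t > 0"
  shows "(Gam has_real_derivative Lam t) (at t)"
proof -
  define q where "q = sqrt (2 * t)"
  have q: "q > 0" "q * q = 2 * t" unfolding q_def using t by auto
  have d1: "((\<lambda>t. 2 * t) has_real_derivative 2) (at t)" by (auto intro!: derivative_eq_intros)
  have d3: "((\<lambda>t. (2 * t) ^ 3) has_real_derivative 6 * (2 * t)\<^sup>2) (at t)"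
    by (auto intro!: derivative_eq_intros)
  have "(Gam has_real_derivative (1 / 3 * 2 * sqrt (2 * t) + 1 / sqrt (2 * t) * (1 / 3 * (2 * t))) + (1 / 280 * (6 * (2 * t)\<^sup>2) * sqrt (2 * t) + 1 / sqrt (2 * t) * (1 / 280 * (2 * t) ^ 3))) (at t)"
    unfolding Gam_def[abs_def]
    by (rule DERIV_add[OF DERIV_mult[OF DERIV_cmult[OF d1] sqrt2_deriv[OF t]] DERIV_mult[OF DERIV_cmult[OF d3] sqrt2_deriv[OF t]]])
  moreover have "(1 / 3 * 2 * q + 1 / q * (1 / 3 * (2 * t))) + (1 / 280 * (6 * (2 * t)\<^sup>2) * q + 1 / q * (1 / 280 * (2 * t) ^ 3)) = Lam t"
  proof -
    have 1: "1 / q * (2 * t) = q" unfolding q(2)[symmetric] using q(1) by simp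
    have "1 / q * (2 * t) ^ 3 = (2 * t)\<^sup>2 * (1 / q * (2 * t))" by (simp add: power2_eq_square power3_eq_cube)
    then have 2: "1 / q * (2 * t) ^ 3 = (2 * t)\<^sup>2 * q" unfolding 1 .
    have A: "1 / q * (1 / 3 * (2 * t)) = 1 / 3 * q"
      using 1 unfolding mult.left_commute[of "1 / q" "1 / 3"] by (simp only:)
    have B: "1 / q * (1 / 280 * (2 * t) ^ 3) = 1 / 280 * ((2 * t)\<^sup>2 * q)"
      using 2 unfolding mult.left_commute[of "1 / q" "1 / 280"] by (simp only:)
    show ?thesis unfolding A B Lam_def q_def[symmetric] by (simp add: algebra_simps)
  qed
  moreover note q_def
  ultimately show ?thesis by simp
qed

lemma continuous_Lam [continuous_intros]: "continuous_on A f \<Longrightarrow> continuous_on A (\<lambda>t. Lam (f t))"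
  unfolding Lam_def by (intro continuous_intros)

lemma continuous_Gam [continuous_intros]: "continuous_on A f \<Longrightarrow> continuous_on A (\<lambda>t. Gam (f t))"
  unfolding Gam_def by (intro continuous_intros)

text \<open>By the symmetry about pi/4 a linear weight contributes its value there, and the terms
  with \<open>Gam\<close> cancel.\<close>

lemma maj_integral:
  shows "((\<lambda>t. (\<alpha> + \<beta> * t) * maj t) has_integral (\<alpha> + \<beta> * (pi / 4)) * (2 * Lam (pi / 4))) {0..pi/2}"
proof -
  let ?F = "\<lambda>t. (\<alpha> + \<beta> * t) * Lam t - \<beta> * Gam t"
  let ?G = "\<lambda>t. - ((\<alpha> + \<beta> * t) * Lam (pi / 2 - t)) - \<beta> * Gam (pi / 2 - t)"
  have "((\<lambda>t. (\<alpha> + \<beta> * t) * mu t) has_integral ?F (pi / 4) - ?F 0) {0..pi/4}"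
  proof (rule fundamental_theorem_of_calculus_interior)
    show "continuous_on {0..pi/4} ?F" by (intro continuous_intros)
    fix t :: real assume "t \<in> {0<..<pi/4}"
    then have t: "t > 0" by simp
    have "(?F has_real_derivative (\<alpha> + \<beta> * t) * mu t) (at t)"
      by (auto intro!: derivative_eq_intros Lam_deriv[OF t] Gam_deriv[OF t])
    then show "(?F has_vector_derivative (\<alpha> + \<beta> * t) * mu t) (at t)"
      by (simp add: has_real_derivative_iff_has_vector_derivative)
  qed simp
  then have 1: "((\<lambda>t. (\<alpha> + \<beta> * t) * maj t) has_integral ?F (pi / 4) - ?F 0) {0..pi/4}"
    by (rule has_integral_eq[rotated]) (simp add: maj_def)
  have "((\<lambda>t. (\<alpha> + \<beta> * t) * mu (pi / 2 - t)) has_integral ?G (pi / 2) - ?G (pi / 4)) {pi/4..pi/2}"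
  proof (rule fundamental_theorem_of_calculus_interior)
    show "continuous_on {pi/4..pi/2} ?G" by (intro continuous_intros)
    fix t :: real assume "t \<in> {pi/4<..<pi/2}"
    then have t: "pi / 2 - t > 0" by simp
    have l: "((\<lambda>t. Lam (pi / 2 - t)) has_real_derivative mu (pi / 2 - t) * (- 1)) (at t)"
      by (rule DERIV_chain2[where f = Lam and g = "\<lambda>t. pi / 2 - t", OF Lam_deriv[OF t]]) (auto intro!: derivative_eq_intros)
    have g: "((\<lambda>t. Gam (pi / 2 - t)) has_real_derivative Lam (pi / 2 - t) * (- 1)) (at t)"
      by (rule DERIV_chain2[where f = Gam and g = "\<lambda>t. pi / 2 - t", OF Gam_deriv[OF t]]) (auto intro!: derivative_eq_intros)
    have "(?G has_real_derivative (\<alpha> + \<beta> * t) * mu (pi / 2 - t)) (at t)"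
      by (auto intro!: derivative_eq_intros l g simp: algebra_simps)
    then show "(?G has_vector_derivative (\<alpha> + \<beta> * t) * mu (pi / 2 - t)) (at t)"
      by (simp add: has_real_derivative_iff_has_vector_derivative)
  qed simp
  then have 2: "((\<lambda>t. (\<alpha> + \<beta> * t) * maj t) has_integral ?G (pi / 2) - ?G (pi / 4)) {pi/4..pi/2}"
    by (rule has_integral_spike_finite[of "{pi/4}", rotated 2]) (auto simp: maj_def)
  have "((\<lambda>t. (\<alpha> + \<beta> * t) * maj t) has_integral (?F (pi / 4) - ?F 0) + (?G (pi / 2) - ?G (pi / 4))) {0..pi/2}"
    by (rule has_integral_combine[OF _ _ 1 2]) auto
  moreover have "(?F (pi / 4) - ?F 0) + (?G (pi / 2) - ?G (pi / 4)) = (\<alpha> + \<beta> * (pi / 4)) * (2 * Lam (pi / 4))"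
  proof -
    have z: "Lam 0 = 0" "Gam 0 = 0" "pi / 2 - pi / 2 = 0" "pi / 2 - pi / 4 = pi / 4" by (simp_all add: Lam_def Gam_def)
    show ?thesis unfolding z by (simp add: algebra_simps)
  qed
  ultimately show ?thesis by (simp only:)
qed

text \<open>The integral of \<open>maj\<close> over (0, pi/2) divided by sqrt (2 pi), about 1.062;
  (sin 2t)^(-1/2) itself would give about 1.046.\<close>

definition cI :: real where "cI = 1 + pi\<^sup>2 / 160"

lemma Lam_cI: "2 * Lam (pi / 4) / sqrt (2 * pi) = cI"
proof -
  define q where "q = sqrt (pi / 2)"
  have q: "q > 0" unfolding q_def by simp
  have "sqrt (2 * pi) = sqrt (2\<^sup>2 * (pi / 2))" by (simp add: power2_eq_square)
  also have "\<dots> = 2 * q" unfolding q_def real_sqrt_mult by simp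
  finally have s: "sqrt (2 * pi) = 2 * q" .
  have "Lam (pi / 4) = q * cI"
    unfolding Lam_def q_def cI_def by (simp add: power2_eq_square algebra_simps)
  then show ?thesis unfolding s using q by simp
qed

section \<open>Small couplings\<close>

text \<open>The square of the modulus on the right is (1 - \<rho>^2)^2 + (2 \<rho> sin 2t)^2. The
  bound survives the limit \<rho> = 1.\<close>

lemma norm_one_minus_square_ge:
  assumes "\<rho> \<ge> 0"
  shows "2 * \<rho> * \<bar>sin (2 * t)\<bar> \<le> cmod (1 - (of_real \<rho> * cis (- (2 * t)))\<^sup>2)"
proof -
  have r: "(of_real \<rho> * cis (- (2 * t)))\<^sup>2 = of_real (\<rho>\<^sup>2) * cis (- (4 * t))"
    by (simp add: power_mult_distrib power2_eq_square cis_mult)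
  have re: "Re (1 - of_real (\<rho>\<^sup>2) * cis (- (4 * t))) = 1 - \<rho>\<^sup>2 * cos (4 * t)"
    and im: "Im (1 - of_real (\<rho>\<^sup>2) * cis (- (4 * t))) = \<rho>\<^sup>2 * sin (4 * t)"
    by (simp_all add: Re_power2 Im_power2 flip: of_real_power)
  have c4: "cos (4 * t) = 1 - 2 * (sin (2 * t))\<^sup>2"
    using cos_double_sin[of "2 * t"] by simp
  have "(cmod (1 - of_real (\<rho>\<^sup>2) * cis (- (4 * t))))\<^sup>2 = (1 - \<rho>\<^sup>2 * cos (4 * t))\<^sup>2 + (\<rho>\<^sup>2 * sin (4 * t))\<^sup>2"
    unfolding cmod_power2 re im ..
  also have "\<dots> = 1 - 2 * \<rho>\<^sup>2 * cos (4 * t) + \<rho>\<^sup>2 * \<rho>\<^sup>2 * ((sin (4 * t))\<^sup>2 + (cos (4 * t))\<^sup>2)"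
    by algebra
  also have "\<dots> = (1 - \<rho>\<^sup>2)\<^sup>2 + (2 * \<rho> * \<bar>sin (2 * t)\<bar>)\<^sup>2"
    unfolding sin_cos_squared_add mult_1_right unfolding c4 power_mult_distrib power2_abs by algebra
  finally have "(2 * \<rho> * \<bar>sin (2 * t)\<bar>)\<^sup>2 \<le> (cmod (1 - of_real (\<rho>\<^sup>2) * cis (- (4 * t))))\<^sup>2" by simp
  then show ?thesis unfolding r by (rule power2_le_imp_le) simp
qed

lemma abs_exp_minus_diff:
  fixes x y :: real
  assumes "x \<ge> 0" "y \<ge> 0"
  shows "\<bar>exp (- x) - exp (- y)\<bar> \<le> \<bar>x - y\<bar>"
proof -
  have *: "exp (- x) - exp (- y) \<le> y - x" if "0 \<le> x" "x \<le> y" for x y :: real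
  proof -
    have "exp (- x) - exp (- y) = exp (- x) * (1 - exp (- (y - x)))"
      by (simp add: right_diff_distrib flip: exp_add)
    also have "\<dots> \<le> 1 * (y - x)"
      using that exp_ge_add_one_self[of "x - y"] by (intro mult_mono) (auto simp: algebra_simps)
    finally show ?thesis by simp
  qed
  show ?thesis
  proof (cases "x \<le> y")
    case True
    then have "exp (- y) \<le> exp (- x)" by simp
    then show ?thesis using *[OF assms(1) True] True by simp
  next
    case False
    then have "exp (- x) \<le> exp (- y)" by simp
    then show ?thesis using *[OF assms(2), of x] False by simp
  qed
qed

lemma norm_exp_minus_1_le: "cmod (exp x - 1) \<le> exp (cmod x) * cmod x"
proof -
  have "cmod (exp x - exp 0) \<le> exp (cmod x) * cmod (x - 0)"
  proof (rule field_differentiable_bound[where S = "cball 0 (cmod x)" and f' = exp])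
    show "(exp has_field_derivative exp y) (at y within cball 0 (cmod x))" for y
      by (rule has_field_derivative_at_within[OF DERIV_exp])
    show "cmod (exp y) \<le> exp (cmod x)" if "y \<in> cball 0 (cmod x)" for y
      using norm_exp[of y] that by (simp add: order_trans)
  qed auto
  then show ?thesis by simp
qed

section \<open>Parity parts of the propagator and their time integrals\<close>

context point_interaction
begin

definition pw :: "real \<Rightarrow> nat \<Rightarrow> real" where
  "pw \<sigma> k = (if par \<sigma> k then (hf k b)\<^sup>2 else 0)"

lemma pw_bounds: "0 \<le> pw \<sigma> k" "pw \<sigma> k \<le> (hf k b)\<^sup>2"
  unfolding pw_def by auto

text \<open>Finite sums may be integrated term by term; the limits in \<open>N\<close> and then in
  the radius are taken in \<open>ef_combination_bound\<close>.\<close>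

definition spart :: "real \<Rightarrow> nat \<Rightarrow> complex \<Rightarrow> complex" where
  "spart \<sigma> N r = (\<Sum>k<N. complex_of_real (pw \<sigma> k) * r ^ k)"

definition tail :: "nat \<Rightarrow> real \<Rightarrow> real" where
  "tail N \<rho> = (\<Sum>k. (hf (k + N) b)\<^sup>2 * \<rho> ^ (k + N))"

lemma hf_sq_power_summable: "0 \<le> \<rho> \<Longrightarrow> \<rho> < 1 \<Longrightarrow> summable (\<lambda>k. (hf k b)\<^sup>2 * \<rho> ^ k)"
  using mehler_summable(2)[of "complex_of_real \<rho>" b] by simp

lemma tail_tendsto:
  assumes "0 \<le> \<rho>" "\<rho> < 1"
  shows "(\<lambda>N. tail N \<rho>) \<longlonglongrightarrow> 0"
  unfolding tail_def by (rule suminf_exist_split2[OF hf_sq_power_summable[OF assms]])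

text \<open>Mehler's bound combined with |1 - r^2| \<ge> 2 \<rho> sin 2t, plus the tail cut off at
  \<open>N\<close>.\<close>

lemma spart_bound:
  assumes \<sigma>: "\<sigma> = 1 \<or> \<sigma> = - 1" and \<rho>: "0 < \<rho>" "\<rho> < 1" and t: "0 < t" "t < pi / 2"
  shows "cmod (spart \<sigma> N (of_real \<rho> * cis (- (2 * t)))) \<le> maj t / sqrt (2 * pi * \<rho>) + tail N \<rho>"
proof -
  define r where "r = of_real \<rho> * cis (- (2 * t))"
  have cr: "cmod r = \<rho>" unfolding r_def using \<rho> by (simp add: norm_mult)
  have r1: "cmod r < 1" using cr \<rho> by simp
  define M where "M = (mehler b r + of_real \<sigma> * mehler b (- r)) / 2"
  have Ms: "(\<lambda>k. complex_of_real (pw \<sigma> k) * r ^ k) sums M"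
    using mehler_part(1)[OF r1 \<sigma>, of b] unfolding M_def pw_def by (simp add: if_distrib cong: if_cong)
  have s0: "sin (2 * t) > 0" using t by (intro sin_gt_zero) auto
  have "cmod M \<le> 1 / sqrt (pi * cmod (1 - r\<^sup>2))" unfolding M_def by (rule mehler_part(2)[OF r1 \<sigma>])
  also have "\<dots> \<le> 1 / sqrt (pi * (2 * \<rho> * sin (2 * t)))"
  proof -
    have l: "2 * \<rho> * sin (2 * t) \<le> cmod (1 - r\<^sup>2)"
      using norm_one_minus_square_ge[of \<rho> t] \<rho> s0 unfolding r_def by simp
    have p: "0 < 2 * \<rho> * sin (2 * t)" using \<rho> s0 by simp
    show ?thesis
      by (intro divide_left_mono real_sqrt_le_mono mult_left_mono mult_pos_pos l real_sqrt_gt_zero p order.strict_trans2[OF p l]) simp_all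
  qed
  also have "\<dots> = 1 / sqrt (sin (2 * t)) / sqrt (2 * pi * \<rho>)" by (simp add: real_sqrt_mult mult_ac)
  also have "\<dots> \<le> maj t / sqrt (2 * pi * \<rho>)" using \<rho> by (intro divide_right_mono maj_ge t) auto
  finally have Mb: "cmod M \<le> maj t / sqrt (2 * pi * \<rho>)" .
  have "M - spart \<sigma> N r = (\<Sum>k. complex_of_real (pw \<sigma> (k + N)) * r ^ (k + N))"
    unfolding spart_def sums_unique[OF Ms] by (rule suminf_minus_initial_segment[symmetric, OF sums_summable[OF Ms]])
  also have "cmod \<dots> \<le> tail N \<rho>"
    unfolding tail_def
  proof (rule norm_suminf_le)
    show "summable (\<lambda>k. (hf (k + N) b)\<^sup>2 * \<rho> ^ (k + N))"
      by (rule summable_ignore_initial_segment[OF hf_sq_power_summable]) (use \<rho> in auto)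
    show "cmod (complex_of_real (pw \<sigma> (k + N)) * r ^ (k + N)) \<le> (hf (k + N) b)\<^sup>2 * \<rho> ^ (k + N)" for k
      unfolding norm_mult norm_power cr norm_of_real using pw_bounds[of \<sigma> "k + N"] \<rho> by (intro mult_right_mono) auto
  qed
  finally have "cmod (M - spart \<sigma> N r) \<le> tail N \<rho>" .
  then show ?thesis using Mb norm_triangle_ineq4[of M "M - spart \<sigma> N r"] unfolding r_def[symmetric] by simp
qed

text \<open>A linear majorant of g covers both applications: a constant for the size of
  \<open>ef\<close>, a multiple of t for its Lipschitz constant.\<close>

lemma weighted_integral_bound:
  fixes g :: "real \<Rightarrow> complex"
  assumes \<sigma>: "\<sigma> = 1 \<or> \<sigma> = - 1" and \<rho>: "0 < \<rho>" "\<rho> < 1" and g: "continuous_on {0..pi/2} g"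
    and gb: "\<And>t. 0 \<le> t \<Longrightarrow> t \<le> pi / 2 \<Longrightarrow> cmod (g t) \<le> \<alpha> + \<beta> * t" and ab: "\<alpha> \<ge> 0" "\<beta> \<ge> 0"
  shows "cmod (integral {0..pi/2} (\<lambda>t. g t * spart \<sigma> N (of_real \<rho> * cis (- (2 * t)))))
    \<le> (\<alpha> + \<beta> * (pi / 4)) * cI / sqrt \<rho> + (\<alpha> + \<beta> * (pi / 2)) * tail N \<rho> * (pi / 2)"
proof -
  let ?f = "\<lambda>t. g t * spart \<sigma> N (of_real \<rho> * cis (- (2 * t)))"
  let ?m = "\<lambda>t. (\<alpha> + \<beta> * t) * maj t * (1 / sqrt (2 * pi * \<rho>)) + (\<alpha> + \<beta> * (pi / 2)) * tail N \<rho>"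
  have t0: "tail N \<rho> \<ge> 0"
    unfolding tail_def using \<rho> by (intro suminf_nonneg summable_ignore_initial_segment[OF hf_sq_power_summable]) auto
  have fc: "continuous_on {0..pi/2} ?f"
    unfolding spart_def cis_conv_exp by (intro continuous_intros g)
  have fi: "?f integrable_on {0..pi/2}" by (rule integrable_continuous_interval[OF fc])
  have mi: "(?m has_integral (\<alpha> + \<beta> * (pi / 4)) * (2 * Lam (pi / 4)) * (1 / sqrt (2 * pi * \<rho>)) + (\<alpha> + \<beta> * (pi / 2)) * tail N \<rho> * (pi / 2)) {0..pi/2}"
  proof (rule has_integral_add)
    show "((\<lambda>t. (\<alpha> + \<beta> * t) * maj t * (1 / sqrt (2 * pi * \<rho>))) has_integral (\<alpha> + \<beta> * (pi / 4)) * (2 * Lam (pi / 4)) * (1 / sqrt (2 * pi * \<rho>))) {0..pi/2}"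
      by (rule has_integral_mult_left[OF maj_integral])
    show "((\<lambda>t. (\<alpha> + \<beta> * (pi / 2)) * tail N \<rho>) has_integral (\<alpha> + \<beta> * (pi / 2)) * tail N \<rho> * (pi / 2)) {0..pi/2}"
      using has_integral_const_real[of "(\<alpha> + \<beta> * (pi / 2)) * tail N \<rho>" 0 "pi/2"] by (simp add: mult_ac)
  qed
  \<comment> \<open>On the open interval, because \<open>maj\<close> is a majorant only where sin 2t
    > 0.\<close>
  have "cmod (integral {0<..<pi/2} ?f) \<le> integral {0<..<pi/2} ?m"
  proof (rule integral_norm_bound_integral)
    show "?f integrable_on {0<..<pi/2}" using fi by (simp add: integrable_on_open_interval_real)
    show "?m integrable_on {0<..<pi/2}" using mi by (simp only: integrable_on_open_interval_real has_integral_integrable)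
    fix t :: real assume "t \<in> {0<..<pi/2}"
    then have t: "0 < t" "t < pi / 2" by auto
    have at: "0 \<le> \<alpha> + \<beta> * t" "\<alpha> + \<beta> * t \<le> \<alpha> + \<beta> * (pi / 2)" using ab t mult_left_mono[of "t" "pi / 2" \<beta>] by auto
    have "cmod (?f t) \<le> (\<alpha> + \<beta> * t) * (maj t / sqrt (2 * pi * \<rho>) + tail N \<rho>)"
      unfolding norm_mult using gb[of t] spart_bound[OF \<sigma> \<rho> t, of N] t at by (intro mult_mono) auto
    also have "\<dots> = (\<alpha> + \<beta> * t) * maj t * (1 / sqrt (2 * pi * \<rho>)) + (\<alpha> + \<beta> * t) * tail N \<rho>"
      by (simp add: distrib_left)
    also have "\<dots> \<le> ?m t" using at t0 by (intro add_left_mono mult_right_mono) auto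
    finally show "norm (?f t) \<le> ?m t" .
  qed
  then have "cmod (integral {0..pi/2} ?f) \<le> integral {0..pi/2} ?m"
    by (simp only: integral_open_interval_real)
  also have "\<dots> = (\<alpha> + \<beta> * (pi / 4)) * (2 * Lam (pi / 4)) * (1 / sqrt (2 * pi * \<rho>)) + (\<alpha> + \<beta> * (pi / 2)) * tail N \<rho> * (pi / 2)"
    by (rule integral_unique[OF mi])
  also have "(\<alpha> + \<beta> * (pi / 4)) * (2 * Lam (pi / 4)) * (1 / sqrt (2 * pi * \<rho>)) = (\<alpha> + \<beta> * (pi / 4)) * (2 * Lam (pi / 4) / sqrt (2 * pi)) / sqrt \<rho>"
    by (simp add: real_sqrt_mult)
  finally show ?thesis unfolding Lam_cI .
qed

text \<open>The factor that exp (i (z - 1) t) gains over [0, pi/2]. Its square equals 1 exactly at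
  the odd integers.\<close>

definition qf :: "complex \<Rightarrow> complex" where
  "qf z = exp (\<i> * (z - 1) * of_real (pi / 2))"

text \<open>exp (i (z - 1 - 2k) t) integrates to a multiple of 1/(2k+1-z), and the end point pi/2
  contributes (-1)^k \<open>qf z\<close>, the same for all k of one parity. This is why the parities
  are treated apart.\<close>

lemma term_integral:
  assumes z: "Im z > 0" and p: "par \<sigma> k"
  shows "((\<lambda>t. \<i> * (exp (\<i> * (z - 1) * of_real t) * (of_real \<rho> * cis (- (2 * t))) ^ k)) has_integral
    (1 - of_real \<sigma> * qf z) * (of_real \<rho> ^ k / (of_nat (2 * k + 1) - z))) {0..pi/2}"
proof -
  define c where "c = \<i> * (z - 1 - of_nat (2 * k))"
  have c0: "c \<noteq> 0"
  proof
    assume "c = 0"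
    then have "z - 1 - of_nat (2 * k) = 0" unfolding c_def mult_eq_0_iff by simp
    then have "Im (z - 1 - of_nat (2 * k)) = 0" by simp
    then show False using z by simp
  qed
  have d0: "of_nat (2 * k + 1) - z \<noteq> 0"
  proof
    assume "of_nat (2 * k + 1) - z = 0"
    then have "Im (of_nat (2 * k + 1) - z) = 0" by simp
    then show False using z by simp
  qed
  have "((\<lambda>t. exp (c * of_real t)) has_integral exp (c * of_real (pi / 2)) / c - exp (c * of_real 0) / c) {0..pi/2}"
  proof (rule fundamental_theorem_of_calculus)
    fix t :: real
    have "((\<lambda>y. exp (c * y) / c) has_field_derivative exp (c * of_real t)) (at (of_real t))"
      using c0 by (auto intro!: derivative_eq_intros)
    from has_vector_derivative_real_field[OF this, of "{0..pi/2}"]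
    show "((\<lambda>t. exp (c * of_real t) / c) has_vector_derivative exp (c * of_real t)) (at t within {0..pi/2})" by simp
  qed simp
  then have i: "((\<lambda>t. \<i> * of_real \<rho> ^ k * exp (c * of_real t)) has_integral \<i> * of_real \<rho> ^ k * (exp (c * of_real (pi / 2)) / c - exp (c * of_real 0) / c)) {0..pi/2}"
    by (rule has_integral_mult_right)
  have e1: "\<i> * of_real \<rho> ^ k * exp (c * of_real t) = \<i> * (exp (\<i> * (z - 1) * of_real t) * (of_real \<rho> * cis (- (2 * t))) ^ k)" for t
  proof -
    have "cis (- (2 * t)) ^ k = exp (- \<i> * of_nat (2 * k) * of_real t)"
      unfolding cis_conv_exp exp_of_nat_mult[symmetric] by (simp add: mult_ac)
    then have "exp (\<i> * (z - 1) * of_real t) * cis (- (2 * t)) ^ k = exp (c * of_real t)"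
      unfolding c_def by (simp add: algebra_simps flip: exp_add)
    then show ?thesis unfolding power_mult_distrib by (simp add: mult_ac)
  qed
  have e2: "exp (c * of_real (pi / 2)) = of_real \<sigma> * qf z"
  proof -
    have "c * of_real (pi / 2) = \<i> * (z - 1) * of_real (pi / 2) + of_nat k * (- (\<i> * of_real pi))"
      unfolding c_def by (simp add: algebra_simps)
    then have "exp (c * of_real (pi / 2)) = qf z * exp (- (\<i> * of_real pi)) ^ k"
      unfolding qf_def by (simp only: exp_add exp_of_nat_mult)
    also have "exp (- (\<i> * of_real pi)) = - 1" by (simp add: exp_minus)
    also have "(- 1 :: complex) ^ k = of_real \<sigma>" using p unfolding par_def by (metis of_real_1 of_real_minus of_real_power)
    finally show ?thesis by (simp add: mult.commute)
  qed
  have "\<i> * of_real \<rho> ^ k * (exp (c * of_real (pi / 2)) / c - exp (c * of_real 0) / c) = (1 - of_real \<sigma> * qf z) * (of_real \<rho> ^ k / (of_nat (2 * k + 1) - z))"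
  proof -
    have "c = - \<i> * (of_nat (2 * k + 1) - z)" unfolding c_def by (simp add: algebra_simps)
    then have "\<i> / c = - 1 / (of_nat (2 * k + 1) - z)" by (simp only:) (simp add: d0 del: of_nat_add of_nat_mult)
    then have "\<i> / c * (of_real \<rho> ^ k * (of_real \<sigma> * qf z - 1)) = - 1 / (of_nat (2 * k + 1) - z) * (of_real \<rho> ^ k * (of_real \<sigma> * qf z - 1))" by (simp only:)
    moreover have "\<i> * of_real \<rho> ^ k * (exp (c * of_real (pi / 2)) / c - exp (c * of_real 0) / c) = \<i> / c * (of_real \<rho> ^ k * (of_real \<sigma> * qf z - 1))"
      unfolding e2 by (simp add: diff_divide_distrib algebra_simps)
    moreover have "- 1 / D * (y * (x - 1)) = (1 - x) * (y / D)" for D x y :: complex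
      by (simp add: algebra_simps diff_divide_distrib)
    ultimately show ?thesis by (simp only:)
  qed
  then show ?thesis using i unfolding e1 by simp
qed

lemma spart_integral:
  assumes z: "Im z > 0"
  shows "((\<lambda>t. \<i> * (exp (\<i> * (z - 1) * of_real t) * spart \<sigma> N (of_real \<rho> * cis (- (2 * t))))) has_integral
    (1 - of_real \<sigma> * qf z) * (\<Sum>k<N. of_real (pw \<sigma> k) * (of_real \<rho> ^ k / (of_nat (2 * k + 1) - z)))) {0..pi/2}"
proof -
  have "((\<lambda>t. \<Sum>k<N. of_real (pw \<sigma> k) * (\<i> * (exp (\<i> * (z - 1) * of_real t) * (of_real \<rho> * cis (- (2 * t))) ^ k))) has_integral
    (\<Sum>k<N. of_real (pw \<sigma> k) * ((1 - of_real \<sigma> * qf z) * (of_real \<rho> ^ k / (of_nat (2 * k + 1) - z))))) {0..pi/2}"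
  proof (rule has_integral_sum)
    fix k
    show "((\<lambda>t. of_real (pw \<sigma> k) * (\<i> * (exp (\<i> * (z - 1) * of_real t) * (of_real \<rho> * cis (- (2 * t))) ^ k))) has_integral
      of_real (pw \<sigma> k) * ((1 - of_real \<sigma> * qf z) * (of_real \<rho> ^ k / (of_nat (2 * k + 1) - z)))) {0..pi/2}"
    proof (cases "par \<sigma> k")
      case True
      show ?thesis by (rule has_integral_mult_right[OF term_integral[OF z True]])
    next
      case False
      then show ?thesis by (simp add: pw_def)
    qed
  qed simp
  then show ?thesis
    unfolding spart_def sum_distrib_left by (simp only: mult_ac)
qed

text \<open>The factor cancels the poles of the sum, so \<open>ef\<close> can be bounded
  independently of the distance to the unperturbed eigenvalues.\<close>

definition ef :: "real \<Rightarrow> complex \<Rightarrow> complex" where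
  "ef \<sigma> z = (1 - of_real \<sigma> * qf z) * csum (pw \<sigma>) z"

text \<open>\<open>csum_term_bound\<close> excludes the n-th term, which is added
  separately.\<close>

lemma pw_terms_summable:
  assumes z: "z \<in> Om n"
  shows "summable (\<lambda>k. cmod (complex_of_real (pw \<sigma> k) / (of_nat (2 * k + 1) - z)))"
proof -
  have w: "wt n (\<lambda>k. if k = n then 0 else pw \<sigma> k)" unfolding wt_def using pw_bounds by auto
  have "summable (\<lambda>k. cmod (complex_of_real (if k = n then 0 else pw \<sigma> k) / (of_nat (2 * k + 1) - z)))"
    by (rule summable_comparison_test'[where N = 0, OF summable_divide[OF sg_summable[of n], of 2]])
       (use csum_term_bound[OF w z] in simp)
  moreover have "summable (\<lambda>k. if k = n then cmod (complex_of_real (pw \<sigma> k) / (of_nat (2 * k + 1) - z)) else 0)"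
    by (rule summable_finite[of "{n}"]) auto
  ultimately have "summable (\<lambda>k. cmod (complex_of_real (if k = n then 0 else pw \<sigma> k) / (of_nat (2 * k + 1) - z)) + (if k = n then cmod (complex_of_real (pw \<sigma> k) / (of_nat (2 * k + 1) - z)) else 0))"
    by (rule summable_add)
  then show ?thesis by (rule summable_cong[THEN iffD1, rotated]) (auto intro: always_eventually)
qed

text \<open>Continuity up to radius 1 recovers \<open>csum\<close> from its Abel means; the
  convergence is uniform by the majorant of \<open>pw_terms_summable\<close>.\<close>

lemma csum_abel:
  assumes z: "z \<in> Om n"
  shows "continuous_on {0..1} (\<lambda>\<rho>::real. \<Sum>k. of_real (pw \<sigma> k) * (of_real \<rho> ^ k / (of_nat (2 * k + 1) - z)))"
proof (rule uniform_limit_theorem[OF _ Weierstrass_m_test[OF _ pw_terms_summable[OF z]]])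
  show "\<forall>\<^sub>F N in sequentially. continuous_on {0..1} (\<lambda>\<rho>. \<Sum>k<N. of_real (pw \<sigma> k) * (of_real \<rho> ^ k / (of_nat (2 * k + 1) - z)))"
    by (intro always_eventually allI continuous_on_sum continuous_on_mult continuous_on_const)
       (simp only: divide_inverse, intro continuous_intros)
  fix k and \<rho> :: real assume "\<rho> \<in> {0..1}"
  then have "\<bar>\<rho>\<bar> ^ k \<le> 1" by (intro power_le_one) auto
  then have "\<bar>\<rho>\<bar> ^ k * cmod (complex_of_real (pw \<sigma> k) / (of_nat (2 * k + 1) - z)) \<le> 1 * cmod (complex_of_real (pw \<sigma> k) / (of_nat (2 * k + 1) - z))"
    by (intro mult_right_mono) auto
  then show "cmod (of_real (pw \<sigma> k) * (of_real \<rho> ^ k / (of_nat (2 * k + 1) - z))) \<le> cmod (complex_of_real (pw \<sigma> k) / (of_nat (2 * k + 1) - z))"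
    by (simp only: norm_mult norm_divide norm_power norm_of_real) (simp add: mult_ac)
qed simp

text \<open>The representation of the resolvent by the time-periodic propagator, in the limit of an Abel summation.\<close>

lemma ef_combination_bound:
  assumes \<sigma>: "\<sigma> = 1 \<or> \<sigma> = - 1" and z: "z \<in> Om n" "Im z > 0" and z': "z' \<in> Om n" "Im z' > 0"
    and gb: "\<And>t. 0 \<le> t \<Longrightarrow> t \<le> pi / 2 \<Longrightarrow> cmod (exp (\<i> * (z - 1) * of_real t) - c * exp (\<i> * (z' - 1) * of_real t)) \<le> \<alpha> + \<beta> * t"
    and ab: "\<alpha> \<ge> 0" "\<beta> \<ge> 0"
  shows "cmod (ef \<sigma> z - c * ef \<sigma> z') \<le> (\<alpha> + \<beta> * (pi / 4)) * cI"
proof -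
  let ?G = "\<lambda>z \<rho>. \<Sum>k. of_real (pw \<sigma> k) * (of_real \<rho> ^ k / (of_nat (2 * k + 1) - z))"
  let ?P = "\<lambda>N z \<rho>. \<Sum>k<N. of_real (pw \<sigma> k) * (of_real \<rho> ^ k / (of_nat (2 * k + 1) - z))"
  let ?D = "\<lambda>z. 1 - of_real \<sigma> * qf z"
  have b1: "cmod (?D z * ?G z \<rho> - c * (?D z' * ?G z' \<rho>)) \<le> (\<alpha> + \<beta> * (pi / 4)) * cI / sqrt \<rho>" if \<rho>: "0 < \<rho>" "\<rho> < 1" for \<rho> :: real
  proof -
    have fin: "cmod (?D z * ?P N z \<rho> - c * (?D z' * ?P N z' \<rho>)) \<le> (\<alpha> + \<beta> * (pi / 4)) * cI / sqrt \<rho> + (\<alpha> + \<beta> * (pi / 2)) * tail N \<rho> * (pi / 2)" for N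
    proof -
      let ?g = "\<lambda>t. exp (\<i> * (z - 1) * of_real t) - c * exp (\<i> * (z' - 1) * of_real t)"
      have "((\<lambda>t. \<i> * (exp (\<i> * (z - 1) * of_real t) * spart \<sigma> N (of_real \<rho> * cis (- (2 * t)))) - c * (\<i> * (exp (\<i> * (z' - 1) * of_real t) * spart \<sigma> N (of_real \<rho> * cis (- (2 * t)))))) has_integral
        (?D z * ?P N z \<rho> - c * (?D z' * ?P N z' \<rho>))) {0..pi/2}"
        by (rule has_integral_diff[OF spart_integral[OF z(2)] has_integral_mult_right[OF spart_integral[OF z'(2)]]])
      moreover have "\<i> * (exp (\<i> * (z - 1) * of_real t) * spart \<sigma> N (of_real \<rho> * cis (- (2 * t)))) - c * (\<i> * (exp (\<i> * (z' - 1) * of_real t) * spart \<sigma> N (of_real \<rho> * cis (- (2 * t)))))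
         = (\<i> * ?g t) * spart \<sigma> N (of_real \<rho> * cis (- (2 * t)))" for t
        by (simp add: algebra_simps)
      ultimately have "((\<lambda>t. (\<i> * ?g t) * spart \<sigma> N (of_real \<rho> * cis (- (2 * t)))) has_integral
        (?D z * ?P N z \<rho> - c * (?D z' * ?P N z' \<rho>))) {0..pi/2}" by (simp only:)
      then have e: "integral {0..pi/2} (\<lambda>t. (\<i> * ?g t) * spart \<sigma> N (of_real \<rho> * cis (- (2 * t)))) = ?D z * ?P N z \<rho> - c * (?D z' * ?P N z' \<rho>)"
        by (rule integral_unique)
      have gc: "continuous_on {0..pi/2} (\<lambda>t. \<i> * ?g t)" by (intro continuous_intros)
      show ?thesis unfolding e[symmetric]
        by (rule weighted_integral_bound[OF \<sigma> \<rho> gc _ ab]) (use gb in \<open>simp add: norm_mult\<close>)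
    qed
    have sm: "summable (\<lambda>k. of_real (pw \<sigma> k) * (of_real \<rho> ^ k / (of_nat (2 * k + 1) - y)))" if y: "y \<in> Om n" for y
    proof (rule summable_norm_cancel, rule summable_comparison_test'[where N = 0, OF pw_terms_summable[OF y, of \<sigma>]])
      fix k
      have "\<bar>\<rho>\<bar> ^ k \<le> 1" using \<rho> by (intro power_le_one) auto
      then have "\<bar>\<rho>\<bar> ^ k * cmod (complex_of_real (pw \<sigma> k) / (of_nat (2 * k + 1) - y)) \<le> 1 * cmod (complex_of_real (pw \<sigma> k) / (of_nat (2 * k + 1) - y))"
        by (intro mult_right_mono) auto
      then show "norm (cmod (of_real (pw \<sigma> k) * (of_real \<rho> ^ k / (of_nat (2 * k + 1) - y)))) \<le> cmod (complex_of_real (pw \<sigma> k) / (of_nat (2 * k + 1) - y))"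
        unfolding real_norm_def abs_norm_cancel
        by (simp only: norm_mult norm_divide norm_power norm_of_real) (simp add: mult_ac)
    qed
    have "(\<lambda>N. cmod (?D z * ?P N z \<rho> - c * (?D z' * ?P N z' \<rho>))) \<longlonglongrightarrow> cmod (?D z * ?G z \<rho> - c * (?D z' * ?G z' \<rho>))"
      by (intro tendsto_intros summable_LIMSEQ sm z z')
    moreover have "(\<lambda>N. (\<alpha> + \<beta> * (pi / 4)) * cI / sqrt \<rho> + (\<alpha> + \<beta> * (pi / 2)) * tail N \<rho> * (pi / 2)) \<longlonglongrightarrow> (\<alpha> + \<beta> * (pi / 4)) * cI / sqrt \<rho> + (\<alpha> + \<beta> * (pi / 2)) * 0 * (pi / 2)"
      using \<rho> by (intro tendsto_intros tail_tendsto) auto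
    ultimately have "cmod (?D z * ?G z \<rho> - c * (?D z' * ?G z' \<rho>)) \<le> (\<alpha> + \<beta> * (pi / 4)) * cI / sqrt \<rho> + (\<alpha> + \<beta> * (pi / 2)) * 0 * (pi / 2)"
      using fin by (intro LIMSEQ_le) auto
    then show ?thesis by simp
  qed
  \<comment> \<open>Radii tending to 1 from inside the disc, where Mehler's formula is
    available.\<close>
  define r where "r j = 1 - 1 / real (j + 2)" for j
  have r: "0 < r j" "r j < 1" "r j \<in> {0..1}" for j unfolding r_def by (auto simp: field_simps)
  have rl: "r \<longlonglongrightarrow> 1" unfolding r_def by real_asymp
  have Gl: "(\<lambda>j. ?G y (r j)) \<longlonglongrightarrow> ?G y 1" if y: "y \<in> Om n" for y
    by (rule continuous_on_tendsto_compose[OF csum_abel[OF y] rl]) (use r in \<open>auto intro: always_eventually\<close>)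
  have "(\<lambda>j. cmod (?D z * ?G z (r j) - c * (?D z' * ?G z' (r j)))) \<longlonglongrightarrow> cmod (?D z * ?G z 1 - c * (?D z' * ?G z' 1))"
    by (intro tendsto_norm tendsto_diff tendsto_mult tendsto_const Gl z z')
  moreover have "(\<lambda>j. (\<alpha> + \<beta> * (pi / 4)) * cI / sqrt (r j)) \<longlonglongrightarrow> (\<alpha> + \<beta> * (pi / 4)) * cI / sqrt 1"
    by (intro tendsto_intros rl) auto
  ultimately have "cmod (?D z * ?G z 1 - c * (?D z' * ?G z' 1)) \<le> (\<alpha> + \<beta> * (pi / 4)) * cI / sqrt 1"
    using b1[OF r(1,2)] by (intro LIMSEQ_le) auto
  moreover have "?G y 1 = csum (pw \<sigma>) y" for y unfolding csum_def by simp
  ultimately show ?thesis unfolding ef_def by simp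
qed

lemma ef_bound:
  assumes \<sigma>: "\<sigma> = 1 \<or> \<sigma> = - 1" and z: "z \<in> Om n" "Im z > 0"
  shows "cmod (ef \<sigma> z) \<le> cI"
proof -
  have "cmod (ef \<sigma> z - 0 * ef \<sigma> z) \<le> (1 + 0 * (pi / 4)) * cI"
  proof (rule ef_combination_bound[OF \<sigma> z z])
    fix t :: real assume "0 \<le> t"
    then show "cmod (exp (\<i> * (z - 1) * of_real t) - 0 * exp (\<i> * (z - 1) * of_real t)) \<le> 1 + 0 * t"
      using z(2) by simp
  qed auto
  then show ?thesis by simp
qed

text \<open>The time factors differ by |exp (-h t) - exp (-h' t)| \<le> |h - h'| t, and the weight t
  contributes its mean value pi/4.\<close>

lemma ef_vertical_lipschitz:
  assumes \<sigma>: "\<sigma> = 1 \<or> \<sigma> = - 1" and z: "z \<in> Om n" "Im z \<ge> 0" and h: "h > 0" "h' > 0"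
  shows "cmod (ef \<sigma> (z + \<i> * of_real h) - ef \<sigma> (z + \<i> * of_real h')) \<le> pi / 4 * cI * \<bar>h - h'\<bar>"
proof -
  have "cmod (ef \<sigma> (z + \<i> * of_real h) - 1 * ef \<sigma> (z + \<i> * of_real h')) \<le> (0 + \<bar>h - h'\<bar> * (pi / 4)) * cI"
  proof (rule ef_combination_bound[OF \<sigma>])
    show "z + \<i> * of_real h \<in> Om n" "z + \<i> * of_real h' \<in> Om n" using z(1) unfolding Om_def by auto
    show "0 < Im (z + \<i> * of_real h)" "0 < Im (z + \<i> * of_real h')" using z(2) h by auto
    fix t :: real assume t: "0 \<le> t"
    have e: "exp (\<i> * (z + \<i> * of_real y - 1) * of_real t) = exp (\<i> * (z - 1) * of_real t) * of_real (exp (- (y * t)))" for y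
    proof -
      have "\<i> * (z + \<i> * of_real y - 1) * of_real t = \<i> * (z - 1) * of_real t + of_real (- (y * t))"
        by (simp add: algebra_simps)
      then show ?thesis by (simp only: exp_add exp_of_real)
    qed
    have "exp (\<i> * (z + \<i> * of_real h - 1) * of_real t) - 1 * exp (\<i> * (z + \<i> * of_real h' - 1) * of_real t)
      = exp (\<i> * (z - 1) * of_real t) * of_real (exp (- (h * t)) - exp (- (h' * t)))"
      unfolding e by (simp add: right_diff_distrib)
    then have "cmod (exp (\<i> * (z + \<i> * of_real h - 1) * of_real t) - 1 * exp (\<i> * (z + \<i> * of_real h' - 1) * of_real t))
      = cmod (exp (\<i> * (z - 1) * of_real t)) * \<bar>exp (- (h * t)) - exp (- (h' * t))\<bar>"
      by (simp only: norm_mult norm_of_real)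
    also have "\<dots> \<le> 1 * \<bar>h * t - h' * t\<bar>"
      using z(2) t h by (intro mult_mono abs_exp_minus_diff) auto
    also have "\<dots> = 0 + \<bar>h - h'\<bar> * t" using t by (simp add: abs_mult flip: left_diff_distrib)
    finally show "cmod (exp (\<i> * (z + \<i> * of_real h - 1) * of_real t) - 1 * exp (\<i> * (z + \<i> * of_real h' - 1) * of_real t)) \<le> 0 + \<bar>h - h'\<bar> * t" .
  qed auto
  then show ?thesis by (simp add: mult_ac)
qed

text \<open>With the n-th term restored, \<open>chr\<close> is w = 2n+1 - z times 1 - 4 s^2 times
  the product of the full even and odd sums. Multiplication by 1 - q^2 = (1 - q)(1 + q) turns these
  sums into \<open>ef\<close>.\<close>

lemma chr_ef:
  assumes z: "z \<in> Om n" "Im z > 0"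
  shows "chr s n z * (1 - (qf z)\<^sup>2) = (of_nat (2 * n + 1) - z) * (1 - (qf z)\<^sup>2 - 4 * s\<^sup>2 * (ef 1 z * ef (- 1) z))"
proof -
  define w where "w = of_nat (2 * n + 1) - z"
  have "Im w \<noteq> 0" using z(2) unfolding w_def by simp
  then have w0: "w \<noteq> 0" by auto
  have sm: "summable (\<lambda>k. complex_of_real (pw \<sigma> k) / (of_nat (2 * k + 1) - z))" for \<sigma>
    by (rule summable_norm_cancel[OF pw_terms_summable[OF z(1)]])
  have E: "csum (pw ((- 1) ^ n)) z = cE n z + of_real ((hf n b)\<^sup>2) / w"
  proof -
    have "(\<lambda>k. complex_of_real (pE n k) / (of_nat (2 * k + 1) - z) + (if k = n then of_real ((hf n b)\<^sup>2) / w else 0)) sums (cE n z + of_real ((hf n b)\<^sup>2) / w)"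
      unfolding cE_def by (intro sums_add csum_sums[OF wt_pE z(1)] sums_single[of n "\<lambda>k. of_real ((hf n b)\<^sup>2) / w"])
    moreover have "complex_of_real (pE n k) / (of_nat (2 * k + 1) - z) + (if k = n then of_real ((hf n b)\<^sup>2) / w else 0) = complex_of_real (pw ((- 1) ^ n) k) / (of_nat (2 * k + 1) - z)" for k
      unfolding pE_def pw_def par_def w_def by (auto simp: minus_one_power_iff)
    ultimately have "(\<lambda>k. complex_of_real (pw ((- 1) ^ n) k) / (of_nat (2 * k + 1) - z)) sums (cE n z + of_real ((hf n b)\<^sup>2) / w)"
      by (simp only:)
    then show ?thesis unfolding csum_def[of "pw _"] by (rule sums_unique[symmetric])
  qed
  have O: "csum (pw (- ((- 1) ^ n))) z = cO n z"
  proof -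
    have "pw (- ((- 1) ^ n)) = pO n"
      unfolding pw_def[abs_def] pO_def[abs_def] par_def by (auto simp: minus_one_power_iff fun_eq_iff)
    then show ?thesis unfolding cO_def by simp
  qed
  have prod: "csum (pw 1) z * csum (pw (- 1)) z = (cE n z + of_real ((hf n b)\<^sup>2) / w) * cO n z"
    using E O by (cases "even n") (auto simp: mult.commute)
  have g: "w * (1 - 4 * y * X) * (1 - q) = w * (1 - q - 4 * y * ((1 - q) * X))" for y X q by (simp add: algebra_simps)
  have "chr s n z = w * (1 - 4 * s\<^sup>2 * (csum (pw 1) z * csum (pw (- 1)) z))"
    unfolding prod chr_def w_def[symmetric] using w0 by (simp add: field_simps)
  then have "chr s n z * (1 - (qf z)\<^sup>2) = w * ((1 - (qf z)\<^sup>2) - 4 * s\<^sup>2 * ((1 - (qf z)\<^sup>2) * (csum (pw 1) z * csum (pw (- 1)) z)))"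
    by (simp only: g)
  also have "(1 - (qf z)\<^sup>2) * (csum (pw 1) z * csum (pw (- 1)) z) = ef 1 z * ef (- 1) z"
    unfolding ef_def by (simp add: algebra_simps power2_eq_square)
  finally show ?thesis unfolding w_def .
qed

text \<open>3/8 exceeds 1/e and still meets the condition \<tau> < 2/3 of
  \<open>order_1_upper\<close>.\<close>

lemma coupling_constant: "cmod s \<le> 3 / 8 \<Longrightarrow> 4 * (cmod s)\<^sup>2 * cI\<^sup>2 < 2 / 3"
proof -
  assume s: "cmod s \<le> 3 / 8"
  have p: "pi \<le> 3142 / 1000" using pi_approx by simp
  then have "pi\<^sup>2 \<le> (3142 / 1000)\<^sup>2" by (intro power_mono) auto
  then have "cI \<le> 10618 / 10000" "cI \<ge> 0" unfolding cI_def by (auto simp: power2_eq_square)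
  then have "cI\<^sup>2 \<le> (10618 / 10000)\<^sup>2" by (intro power_mono) auto
  moreover have "(cmod s)\<^sup>2 \<le> (3 / 8)\<^sup>2" using s by (intro power_mono) auto
  ultimately have "(cmod s)\<^sup>2 * cI\<^sup>2 \<le> (3 / 8)\<^sup>2 * (10618 / 10000)\<^sup>2" by (intro mult_mono) auto
  moreover have "4 * ((3 / 8)\<^sup>2 * (10618 / 10000)\<^sup>2) < (2 / 3 :: real)" by (simp add: power2_eq_square)
  ultimately show ?thesis unfolding mult.assoc by linarith
qed

text \<open>Along z + i h the function H = 1 - q^2 - F is at most a multiple of \<open>chr\<close>.
  The term q^2 = Q exp (-pi h) has slope pi |Q| with |Q| \<ge> 1 - \<tau>, whereas F has Lipschitz
  constant \<tau> pi/2. For \<tau> < 2/3 the first wins, so H and hence \<open>chr\<close> grow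
  linearly in h.\<close>

lemma order_1_upper:
  assumes z: "z \<in> Om n" "Im z \<ge> 0" and D: "chr s n z = 0" and s: "cmod s \<le> 3 / 8"
  shows "order_at_most s n z 1"
proof -
  define \<tau> where "\<tau> = 4 * (cmod s)\<^sup>2 * cI\<^sup>2"
  have \<tau>: "0 \<le> \<tau>" "\<tau> < 2 / 3" unfolding \<tau>_def using coupling_constant[OF s] by auto
  define \<zeta> where "\<zeta> h = z + \<i> * of_real h" for h :: real
  define w where "w h = of_nat (2 * n + 1) - \<zeta> h" for h
  define F where "F h = 4 * s\<^sup>2 * (ef 1 (\<zeta> h) * ef (- 1) (\<zeta> h))" for h
  define Q where "Q = (qf z)\<^sup>2"
  define H where "H h = 1 - (qf (\<zeta> h))\<^sup>2 - F h" for h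
  have \<zeta>: "\<zeta> h \<in> Om n" for h using z(1) unfolding \<zeta>_def Om_def by simp
  have \<zeta>i: "Im (\<zeta> h) > 0" if "h > 0" for h using z(2) that unfolding \<zeta>_def by simp
  have qh: "(qf (\<zeta> h))\<^sup>2 = Q * of_real (exp (- (pi * h)))" for h
  proof -
    have "(qf (\<zeta> h))\<^sup>2 = exp (of_nat 2 * (\<i> * (\<zeta> h - 1) * of_real (pi / 2)))" unfolding qf_def exp_of_nat_mult ..
    also have "of_nat 2 * (\<i> * (\<zeta> h - 1) * of_real (pi / 2)) = of_nat 2 * (\<i> * (z - 1) * of_real (pi / 2)) + of_real (- (pi * h))"
      unfolding \<zeta>_def by (simp add: algebra_simps)
    finally show ?thesis unfolding Q_def qf_def by (simp only: exp_add exp_of_nat_mult exp_of_real)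
  qed
  have Fb: "cmod (F h) \<le> \<tau>" if "h > 0" for h
  proof -
    have "cmod (F h) = 4 * (cmod s)\<^sup>2 * (cmod (ef 1 (\<zeta> h)) * cmod (ef (- 1) (\<zeta> h)))"
      unfolding F_def by (simp add: norm_mult norm_power)
    also have "\<dots> \<le> 4 * (cmod s)\<^sup>2 * (cI * cI)"
      using ef_bound[OF _ \<zeta>[of h] \<zeta>i[OF that]] by (intro mult_left_mono mult_mono) (auto intro: order_trans[OF norm_ge_zero])
    finally show ?thesis unfolding \<tau>_def by (simp add: power2_eq_square)
  qed
  have Fl: "cmod (F h - F h') \<le> \<tau> * (pi / 2) * \<bar>h - h'\<bar>" if h: "h > 0" "h' > 0" for h h'
  proof -
    let ?a = "ef 1 (\<zeta> h)" and ?a' = "ef 1 (\<zeta> h')" and ?c = "ef (- 1) (\<zeta> h)" and ?c' = "ef (- 1) (\<zeta> h')"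
    have l: "cmod (?a - ?a') \<le> pi / 4 * cI * \<bar>h - h'\<bar>" "cmod (?c - ?c') \<le> pi / 4 * cI * \<bar>h - h'\<bar>"
      unfolding \<zeta>_def by (rule ef_vertical_lipschitz[OF _ z h], simp)+
    have bd: "cmod ?c \<le> cI" "cmod ?a' \<le> cI" using ef_bound[OF _ \<zeta>[of h] \<zeta>i[OF h(1)]] ef_bound[OF _ \<zeta>[of h'] \<zeta>i[OF h(2)]] by auto
    have c0: "cI \<ge> 0" unfolding cI_def by simp
    have "F h - F h' = 4 * s\<^sup>2 * ((?a - ?a') * ?c + ?a' * (?c - ?c'))" unfolding F_def by (simp add: algebra_simps)
    then have "cmod (F h - F h') = 4 * (cmod s)\<^sup>2 * cmod ((?a - ?a') * ?c + ?a' * (?c - ?c'))" by (simp add: norm_mult norm_power)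
    also have "\<dots> \<le> 4 * (cmod s)\<^sup>2 * ((pi / 4 * cI * \<bar>h - h'\<bar>) * cI + cI * (pi / 4 * cI * \<bar>h - h'\<bar>))"
    proof (rule mult_left_mono[OF order_trans[OF norm_triangle_ineq]])
      show "cmod ((?a - ?a') * ?c) + cmod (?a' * (?c - ?c')) \<le> (pi / 4 * cI * \<bar>h - h'\<bar>) * cI + cI * (pi / 4 * cI * \<bar>h - h'\<bar>)"
        unfolding norm_mult using c0 by (intro add_mono mult_mono l bd) auto
    qed simp
    also have "\<dots> = \<tau> * (pi / 2) * \<bar>h - h'\<bar>" unfolding \<tau>_def by (simp add: power2_eq_square)
    finally show ?thesis .
  qed
  \<comment> \<open>Since q^2 = exp (- i pi w), |1 - q^2| is at most P |w|. Thus
    \<open>chr_ef\<close> can be divided by w, even if z is 2n+1 and w tends to 0 along the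
    path.\<close>
  define P where "P = exp (pi * (cmod (w 0) + 1)) * pi"
  have P: "P > 0" unfolding P_def by simp
  have wn: "cmod (w h) \<le> cmod (w 0) + 1" "w h \<noteq> 0" if "0 < h" "h \<le> 1" for h
  proof -
    have "w h = w 0 - \<i> * of_real h" unfolding w_def \<zeta>_def by simp
    then show "cmod (w h) \<le> cmod (w 0) + 1" using norm_triangle_ineq4[of "w 0" "\<i> * of_real h"] that by (simp add: norm_mult)
    have "Im (w h) \<noteq> 0" using \<zeta>i[OF that(1)] unfolding w_def by simp
    then show "w h \<noteq> 0" by auto
  qed
  have HP: "cmod (H h) \<le> P * cmod (chr s n (\<zeta> h))" if h: "0 < h" "h \<le> 1" for h
  proof -
    have "(qf (\<zeta> h))\<^sup>2 = exp (- (\<i> * of_real pi * w h))"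
    proof -
      have "(qf (\<zeta> h))\<^sup>2 = exp (of_nat 2 * (\<i> * (\<zeta> h - 1) * of_real (pi / 2)))" unfolding qf_def exp_of_nat_mult ..
      also have "of_nat 2 * (\<i> * (\<zeta> h - 1) * of_real (pi / 2)) = - (\<i> * of_real pi * w h) + of_nat n * (2 * of_real pi * \<i>)"
        unfolding w_def by (simp add: field_simps)
      finally show ?thesis by (simp only: exp_add exp_of_nat_mult exp_two_pi_i power_one mult_1_right)
    qed
    then have "cmod (1 - (qf (\<zeta> h))\<^sup>2) \<le> exp (cmod (- (\<i> * of_real pi * w h))) * cmod (- (\<i> * of_real pi * w h))"
      using norm_exp_minus_1_le[of "- (\<i> * of_real pi * w h)"] by (simp only: norm_minus_commute)
    also have "cmod (- (\<i> * of_real pi * w h)) = pi * cmod (w h)" by (simp add: norm_mult)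
    also have "exp (pi * cmod (w h)) * (pi * cmod (w h)) \<le> P * cmod (w h)"
      unfolding P_def using wn[OF h] by (simp add: mult_right_mono mult.assoc)
    finally have q: "cmod (1 - (qf (\<zeta> h))\<^sup>2) \<le> P * cmod (w h)" .
    have "cmod (w h) * cmod (H h) = cmod (chr s n (\<zeta> h)) * cmod (1 - (qf (\<zeta> h))\<^sup>2)"
      using chr_ef[OF \<zeta> \<zeta>i[OF h(1)], of s] unfolding H_def F_def w_def by (metis norm_mult)
    also have "\<dots> \<le> cmod (chr s n (\<zeta> h)) * (P * cmod (w h))" by (intro mult_left_mono q) auto
    finally have "cmod (w h) * cmod (H h) \<le> cmod (w h) * (P * cmod (chr s n (\<zeta> h)))" by (simp add: mult_ac)
    then show ?thesis using wn(2)[OF h] by simp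
  qed
  have ev: "eventually (\<lambda>h::real. 0 < h \<and> h \<le> 1) (at_right 0)"
    by (auto simp: eventually_at intro!: exI[of _ 1])
  have H0: "((\<lambda>h. cmod (H h)) \<longlongrightarrow> 0) (at_right 0)"
  proof (rule Lim_null_comparison)
    show "\<forall>\<^sub>F h in at_right 0. norm (cmod (H h)) \<le> P * cmod (chr s n (\<zeta> h))"
      using ev by eventually_elim (simp add: HP)
    have "isCont (chr s n) z"
      using z(1) open_Om holomorphic_on_imp_continuous_on[OF chr_holomorphic] continuous_on_eq_continuous_at by blast
    moreover have "(\<zeta> \<longlongrightarrow> z + \<i> * of_real 0) (at_right 0)"
      unfolding \<zeta>_def[abs_def] by (intro tendsto_intros)
    ultimately have "((\<lambda>h. chr s n (\<zeta> h)) \<longlongrightarrow> chr s n z) (at_right 0)"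
      by (intro isCont_tendsto_compose[of z "chr s n"]) auto
    then have "((\<lambda>h. P * cmod (chr s n (\<zeta> h))) \<longlongrightarrow> P * cmod (chr s n z)) (at_right 0)" by (intro tendsto_intros)
    then show "((\<lambda>h. P * cmod (chr s n (\<zeta> h))) \<longlongrightarrow> 0) (at_right 0)" unfolding D by simp
  qed
  \<comment> \<open>H tends to 0, so |1 - Q| is at most the bound \<tau> of F.\<close>
  have Q1: "1 - \<tau> \<le> cmod Q"
  proof -
    have "((\<lambda>h. cmod (1 - Q * of_real (exp (- (pi * h)))) - cmod (H h)) \<longlongrightarrow> cmod (1 - Q * of_real (exp (- (pi * 0)))) - 0) (at_right 0)"
      by (intro tendsto_intros H0)
    moreover have "eventually (\<lambda>h. cmod (1 - Q * of_real (exp (- (pi * h)))) - cmod (H h) \<le> \<tau>) (at_right 0)"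
      using ev
    proof eventually_elim
      case (elim h)
      have "1 - Q * of_real (exp (- (pi * h))) = H h + F h" unfolding H_def qh by simp
      then show ?case using norm_triangle_ineq[of "H h" "F h"] Fb[of h] elim by simp
    qed
    ultimately have "cmod (1 - Q * of_real (exp (- (pi * 0)))) - 0 \<le> \<tau>" by (rule tendsto_upperbound) simp
    then show ?thesis using norm_triangle_ineq2[of 1 Q] by simp
  qed
  \<comment> \<open>pi \<delta> is the surplus of the slope of q^2 over that of F; half of it is
    given up to the quadratic term of the exponential.\<close>
  define \<delta> where "\<delta> = 1 - 3 / 2 * \<tau>"
  have \<delta>: "\<delta> > 0" "\<delta> \<le> 1" unfolding \<delta>_def using \<tau> by auto
  \<comment> \<open>The height h is compared with a second height h' tending to 0, because F is
    controlled at positive heights only.\<close>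
  have Hl: "pi * \<delta> / 2 * h \<le> cmod (H h)" if h: "0 < h" "pi * h \<le> \<delta>" for h
  proof -
    have "((\<lambda>h'. cmod Q * \<bar>exp (- (pi * h)) - exp (- (pi * h'))\<bar> - \<tau> * (pi / 2) * \<bar>h - h'\<bar> - cmod (H h'))
      \<longlongrightarrow> cmod Q * \<bar>exp (- (pi * h)) - exp (- (pi * 0))\<bar> - \<tau> * (pi / 2) * \<bar>h - 0\<bar> - 0) (at_right 0)"
      by (intro tendsto_intros H0)
    moreover have "eventually (\<lambda>h'. cmod Q * \<bar>exp (- (pi * h)) - exp (- (pi * h'))\<bar> - \<tau> * (pi / 2) * \<bar>h - h'\<bar> - cmod (H h') \<le> cmod (H h)) (at_right 0)"
      using ev
    proof eventually_elim
      case (elim h')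
      have "Q * of_real (exp (- (pi * h)) - exp (- (pi * h'))) = H h' - H h - (F h - F h')"
        unfolding H_def qh by (simp add: algebra_simps)
      then have "cmod Q * \<bar>exp (- (pi * h)) - exp (- (pi * h'))\<bar> = cmod (H h' - H h - (F h - F h'))"
        by (metis norm_mult norm_of_real)
      also have "\<dots> \<le> cmod (H h') + cmod (H h) + cmod (F h - F h')"
        using norm_triangle_ineq4[of "H h' - H h" "F h - F h'"] norm_triangle_ineq4[of "H h'" "H h"] by linarith
      finally show ?case using Fl[of h h'] h elim by simp
    qed
    ultimately have "cmod Q * \<bar>exp (- (pi * h)) - exp (- (pi * 0))\<bar> - \<tau> * (pi / 2) * \<bar>h - 0\<bar> - 0 \<le> cmod (H h)"
      by (rule tendsto_upperbound) simp
    then have a: "cmod Q * (1 - exp (- (pi * h))) - \<tau> * (pi / 2) * h \<le> cmod (H h)" using h by (simp add: abs_if)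
    have b: "pi * h - (pi * h)\<^sup>2 / 2 \<le> 1 - exp (- (pi * h))"
    proof -
      have "((\<lambda>x::real. 1 - exp (- x) - x + x\<^sup>2 / 2)) 0 \<le> ((\<lambda>x::real. 1 - exp (- x) - x + x\<^sup>2 / 2)) (pi * h)"
      proof (rule DERIV_nonneg_imp_nondecreasing, use h in simp, intro exI conjI)
        fix x :: real assume "0 \<le> x"
        show "((\<lambda>x. 1 - exp (- x) - x + x\<^sup>2 / 2) has_real_derivative exp (- x) - 1 + x) (at x)"
          by (auto intro!: derivative_eq_intros)
        show "0 \<le> exp (- x) - 1 + x" using exp_ge_add_one_self[of "- x"] by linarith
      qed
      then show ?thesis by simp
    qed
    have x: "0 \<le> pi * h" "pi * h \<le> 1" using h \<delta> by auto
    have nn: "0 \<le> pi * h - (pi * h)\<^sup>2 / 2"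
    proof -
      have "(pi * h)\<^sup>2 \<le> pi * h * 1" unfolding power2_eq_square using x by (intro mult_left_mono) auto
      then show ?thesis using x by linarith
    qed
    have "(1 - \<tau>) * (pi * h - (pi * h)\<^sup>2 / 2) \<le> cmod Q * (1 - exp (- (pi * h)))"
      using Q1 b nn \<tau> by (intro mult_mono) auto
    moreover have "(1 - \<tau>) * (pi * h - (pi * h)\<^sup>2 / 2) \<ge> (1 - \<tau>) * (pi * h) - (pi * h)\<^sup>2 / 2"
    proof -
      have "(1 - \<tau>) * ((pi * h)\<^sup>2 / 2) \<le> 1 * ((pi * h)\<^sup>2 / 2)" using \<tau> by (intro mult_right_mono) auto
      then show ?thesis by (simp add: right_diff_distrib)
    qed
    moreover have "(pi * h)\<^sup>2 \<le> \<delta> * (pi * h)" unfolding power2_eq_square using x h by (intro mult_right_mono) auto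
    ultimately have "(1 - \<tau>) * (pi * h) - \<delta> * (pi * h) / 2 - \<tau> * (pi / 2) * h \<le> cmod (H h)" using a by linarith
    moreover have "(1 - \<tau>) * (pi * h) - \<delta> * (pi * h) / 2 - \<tau> * (pi / 2) * h = pi * \<delta> / 2 * h"
      unfolding \<delta>_def by (simp add: field_simps)
    ultimately show ?thesis by (simp only:)
  qed
  show ?thesis unfolding order_at_most_def
  proof (intro exI[of _ "pi * \<delta> / 2 / P :: real"] conjI allI impI)
    show "pi * \<delta> / 2 / P > 0" using \<delta> P by simp
    fix e :: real assume e: "e > 0"
    define h where "h = min (min e 1) (\<delta> / pi) / 2"
    have h: "0 < h" "h < e" "h \<le> 1" "pi * h \<le> \<delta>"
    proof -
      have m: "0 < min (min e 1) (\<delta> / pi)" using e \<delta> by simp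
      show "0 < h" unfolding h_def using m by simp
      have "min (min e 1) (\<delta> / pi) \<le> e" "min (min e 1) (\<delta> / pi) \<le> 1" "min (min e 1) (\<delta> / pi) \<le> \<delta> / pi" by auto
      then have h': "h < e" "h \<le> 1" "h \<le> \<delta> / pi" unfolding h_def using m by linarith+
      show "h < e" "h \<le> 1" by fact+
      from h'(3) show "pi * h \<le> \<delta>" by (simp add: field_simps)
    qed
    have "pi * \<delta> / 2 * h \<le> P * cmod (chr s n (\<zeta> h))" using Hl[OF h(1,4)] HP[OF h(1,3)] by linarith
    then have "pi * \<delta> / 2 / P * h \<le> cmod (chr s n (\<zeta> h))" using P by (simp add: field_simps)
    then show "\<exists>\<epsilon>. \<epsilon> \<noteq> 0 \<and> cmod \<epsilon> < e \<and> z + \<epsilon> \<in> Om n \<and> pi * \<delta> / 2 / P * cmod \<epsilon> ^ 1 \<le> cmod (chr s n (z + \<epsilon>))"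
      using h \<zeta>[of h] unfolding \<zeta>_def by (intro exI[of _ "\<i> * of_real h"]) (simp add: norm_mult)
  qed
qed

section \<open>Reflection in the real axis\<close>

lemma Om_cnj: "cnj z \<in> Om n \<longleftrightarrow> z \<in> Om n"
  unfolding Om_def by simp

lemma csum_cnj:
  assumes "wt n p" "z \<in> Om n"
  shows "csum p (cnj z) = cnj (csum p z)"
proof -
  have "(\<lambda>k. cnj (complex_of_real (p k) / (of_nat (2 * k + 1) - z))) sums cnj (csum p z)"
    unfolding sums_cnj by (rule csum_sums[OF assms])
  then have "(\<lambda>k. complex_of_real (p k) / (of_nat (2 * k + 1) - cnj z)) sums cnj (csum p z)" by simp
  then show ?thesis unfolding csum_def by (rule sums_unique[symmetric])
qed

lemma chr_cnj: "z \<in> Om n \<Longrightarrow> chr (cnj s) n (cnj z) = cnj (chr s n z)"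
  unfolding chr_def cE_def cO_def by (simp add: csum_cnj[OF wt_pE] csum_cnj[OF wt_pO])

text \<open>The integral representation is for the upper half-plane. Zeros below the axis are
  reflected, which replaces s by its conjugate and preserves |s|.\<close>

lemma small_coupling_simple:
  assumes s: "cmod s \<le> 3 / 8" and ev: "eigenvalue (osc_op b s) z"
  shows "simple_eigenvalue (osc_op b s) z"
proof -
  obtain n where z: "z \<in> Om n" using Om_cover by blast
  have D: "chr s n z = 0" using ev eigenvalue_iff[OF z] by simp
  have "order_at_most s n z 1"
  proof (cases "Im z \<ge> 0")
    case True
    show ?thesis by (rule order_1_upper[OF z True D s])
  next
    case False
    have "order_at_most (cnj s) n (cnj z) 1"
      by (rule order_1_upper) (use z D s False in \<open>simp_all add: Om_cnj chr_cnj\<close>)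
    then obtain c where c: "c > 0" "\<And>e. e > 0 \<Longrightarrow> \<exists>\<epsilon>. \<epsilon> \<noteq> 0 \<and> cmod \<epsilon> < e \<and> cnj z + \<epsilon> \<in> Om n \<and> c * cmod \<epsilon> ^ 1 \<le> cmod (chr (cnj s) n (cnj z + \<epsilon>))"
      unfolding order_at_most_def by blast
    show ?thesis unfolding order_at_most_def
    proof (intro exI[of _ c] conjI allI impI c(1))
      fix e :: real assume "e > 0"
      then obtain \<epsilon> where \<epsilon>: "\<epsilon> \<noteq> 0" "cmod \<epsilon> < e" "cnj z + \<epsilon> \<in> Om n" "c * cmod \<epsilon> ^ 1 \<le> cmod (chr (cnj s) n (cnj z + \<epsilon>))"
        using c(2) by blast
      have e: "cnj z + \<epsilon> = cnj (z + cnj \<epsilon>)" by simp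
      have m: "z + cnj \<epsilon> \<in> Om n" using \<epsilon>(3) unfolding e Om_cnj .
      have "cmod (chr (cnj s) n (cnj z + \<epsilon>)) = cmod (chr s n (z + cnj \<epsilon>))"
        unfolding e chr_cnj[OF m] by simp
      then show "\<exists>\<epsilon>. \<epsilon> \<noteq> 0 \<and> cmod \<epsilon> < e \<and> z + \<epsilon> \<in> Om n \<and> c * cmod \<epsilon> ^ 1 \<le> cmod (chr s n (z + \<epsilon>))"
        using \<epsilon> m by (intro exI[of _ "cnj \<epsilon>"]) simp
    qed
  qed
  then show ?thesis by (rule simple_eigenvalueI[OF z ev])
qed

end

section \<open>Large quantum numbers\<close>

lemma even_sin_half_pi: "even n \<Longrightarrow> sin (real n * pi / 2) = 0"
  by (elim evenE) simp

lemma odd_cos_half_pi: "odd n \<Longrightarrow> cos (real n * pi / 2) = 0"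
  by (elim oddE) (simp add: add_divide_distrib distrib_right cos_add)

lemma cos_shift_npi: "cos (x + real m * pi) = (- 1) ^ m * cos x"
  by (simp add: cos_add)

lemma sin_shift_npi: "sin (x + real m * pi) = (- 1) ^ m * sin x"
  by (simp add: sin_add)

definition kk :: "nat \<Rightarrow> real" where "kk n = sqrt (2 * real n + 1)"

lemma kk: "kk n > 0" "(kk n)\<^sup>2 = 2 * real n + 1" "kk n \<ge> 1"
  unfolding kk_def by auto

text \<open>The amplitude and phase of the solution of \<open>- y'' = (2 n + 1) y\<close> with the initial data of \<open>hf n\<close> at \<open>0\<close>.\<close>

definition rho :: "nat \<Rightarrow> real" where
  "rho n = hf n 0 * cos (real n * pi / 2) + hfd n 0 / kk n * sin (real n * pi / 2)"

lemma hf_0_odd: "odd n \<Longrightarrow> hf n 0 = 0"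
  using hf_minus[of n 0] by simp

lemma hfd_0_even: "even n \<Longrightarrow> hfd n 0 = 0"
  using hfd_minus[of n 0] by simp

text \<open>For even n the derivative vanishes at 0, for odd n the value; the phase n pi/2 merges
  both cases into one formula.\<close>

lemma hf_0_rho: "hf n 0 = rho n * cos (real n * pi / 2)" "hfd n 0 / kk n = rho n * sin (real n * pi / 2)"
proof -
  have p: "(sin (real n * pi / 2))\<^sup>2 + (cos (real n * pi / 2))\<^sup>2 = 1" by simp
  have "hf n 0 = rho n * cos (real n * pi / 2) \<and> hfd n 0 / kk n = rho n * sin (real n * pi / 2)"
  proof (cases "even n")
    case True
    have c: "cos (real n * pi / 2) * cos (real n * pi / 2) = 1"
      using p even_sin_half_pi[OF True] by (simp add: power2_eq_square)
    show ?thesis unfolding rho_def using hfd_0_even[OF True] even_sin_half_pi[OF True] c by (simp add: mult.assoc)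
  next
    case False
    have c: "sin (real n * pi / 2) * sin (real n * pi / 2) = 1"
      using p odd_cos_half_pi[OF False] by (simp add: power2_eq_square)
    have r: "rho n = hfd n 0 / kk n * sin (real n * pi / 2)" unfolding rho_def using hf_0_odd[OF False] by simp
    show ?thesis
    proof
      show "hf n 0 = rho n * cos (real n * pi / 2)" using hf_0_odd[OF False] odd_cos_half_pi[OF False] by simp
      show "hfd n 0 / kk n = rho n * sin (real n * pi / 2)" by (simp only: r mult.assoc c mult_1_right)
    qed
  qed
  then show "hf n 0 = rho n * cos (real n * pi / 2)" "hfd n 0 / kk n = rho n * sin (real n * pi / 2)" by auto
qed

lemma rho_sq: "(rho n)\<^sup>2 = (if even n then (hf n 0)\<^sup>2 else (hfd n 0)\<^sup>2 / (2 * real n + 1))"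
proof -
  have "(rho n)\<^sup>2 = (rho n)\<^sup>2 * ((sin (real n * pi / 2))\<^sup>2 + (cos (real n * pi / 2))\<^sup>2)" by simp
  also have "\<dots> = (hf n 0)\<^sup>2 + (hfd n 0 / kk n)\<^sup>2" unfolding hf_0_rho power_mult_distrib by algebra
  finally show ?thesis using hf_0_odd[of n] hfd_0_even[of n] by (simp add: power_divide kk)
qed

lemma interval_deviation:
  fixes F :: "real \<Rightarrow> real"
  assumes b: "b \<ge> 0" and F: "\<And>y. (F has_real_derivative F' y) (at y)" and B: "\<And>y. 0 \<le> y \<Longrightarrow> y \<le> b \<Longrightarrow> \<bar>F' y\<bar> \<le> B"
  shows "\<bar>F b - F 0\<bar> \<le> B * b"
proof -
  have "norm (F b - F 0) \<le> B * norm (b - 0)"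
    by (rule field_differentiable_bound[where S = "{0..b}" and f' = F'])
       (use b B in \<open>auto intro: has_field_derivative_at_within F\<close>)
  then show ?thesis using b by simp
qed

text \<open>F propagates the data of h_n at y freely to b. It equals h_n(b) at y = b and the
  trigonometric solution at y = 0, and its derivative contains only the neglected potential, y^2 h_n
  / k. G does the same for the derivative.\<close>

lemma hf_wkb:
  assumes b: "b \<ge> 0" and M: "\<And>y. 0 \<le> y \<Longrightarrow> y \<le> b \<Longrightarrow> \<bar>hf n y\<bar> \<le> M"
  shows "\<bar>hf n b - rho n * cos (kk n * b - real n * pi / 2)\<bar> \<le> b ^ 3 * M / kk n"
    and "\<bar>hfd n b / kk n + rho n * sin (kk n * b - real n * pi / 2)\<bar> \<le> b ^ 3 * M / kk n"
proof -
  let ?k = "kk n"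
  have k: "?k > 0" by (rule kk)
  have M0: "M \<ge> 0" using M[of 0] b abs_ge_zero[of "hf n 0"] by linarith
  have bd: "\<bar>c * y\<^sup>2 * hf n y / ?k\<bar> \<le> b\<^sup>2 * M / ?k" if y: "0 \<le> y" "y \<le> b" and c: "\<bar>c\<bar> \<le> 1" for y c
  proof -
    have "\<bar>c\<bar> * y\<^sup>2 * \<bar>hf n y\<bar> \<le> 1 * b\<^sup>2 * M"
      using y c M[OF y] by (intro mult_mono power_mono) auto
    then show ?thesis using k by (simp add: abs_mult divide_right_mono)
  qed
  have sq: "hf n y * (2 * real n + 1) = hf n y * ?k * ?k" for y
    using kk(2)[of n] by (simp add: power2_eq_square)
  let ?F = "\<lambda>y. hf n y * cos (?k * (b - y)) + hfd n y / ?k * sin (?k * (b - y))"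
  have "\<bar>?F b - ?F 0\<bar> \<le> b\<^sup>2 * M / ?k * b"
  proof (rule interval_deviation[OF b])
    show "(?F has_real_derivative sin (?k * (b - y)) * y\<^sup>2 * hf n y / ?k) (at y)" for y
      using k sq[of y] by (auto intro!: derivative_eq_intros hf_deriv hfd_deriv simp: field_simps)
    show "\<bar>sin (?k * (b - y)) * y\<^sup>2 * hf n y / ?k\<bar> \<le> b\<^sup>2 * M / ?k" if "0 \<le> y" "y \<le> b" for y
      by (rule bd[OF that]) simp
  qed
  moreover have "?F 0 = rho n * cos (?k * b - real n * pi / 2)"
    unfolding hf_0_rho cos_diff by (simp add: algebra_simps)
  ultimately show "\<bar>hf n b - rho n * cos (?k * b - real n * pi / 2)\<bar> \<le> b ^ 3 * M / ?k"
    by (simp add: power3_eq_cube power2_eq_square mult_ac)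
  let ?G = "\<lambda>y. hfd n y / ?k * cos (?k * (b - y)) - hf n y * sin (?k * (b - y))"
  have "\<bar>?G b - ?G 0\<bar> \<le> b\<^sup>2 * M / ?k * b"
  proof (rule interval_deviation[OF b])
    show "(?G has_real_derivative cos (?k * (b - y)) * y\<^sup>2 * hf n y / ?k) (at y)" for y
      using k sq[of y] by (auto intro!: derivative_eq_intros hf_deriv hfd_deriv simp: field_simps)
    show "\<bar>cos (?k * (b - y)) * y\<^sup>2 * hf n y / ?k\<bar> \<le> b\<^sup>2 * M / ?k" if "0 \<le> y" "y \<le> b" for y
      by (rule bd[OF that]) simp
  qed
  moreover have "?G 0 = - (rho n * sin (?k * b - real n * pi / 2))"
    unfolding hf_0_rho sin_diff by (simp add: algebra_simps)
  ultimately show "\<bar>hfd n b / ?k + rho n * sin (?k * b - real n * pi / 2)\<bar> \<le> b ^ 3 * M / ?k"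
    by (simp add: power3_eq_cube power2_eq_square mult_ac)
qed

section \<open>An approximate Green function\<close>

locale positive_point_interaction = point_interaction +
  assumes b_pos: "b > 0"
begin

text \<open>A constant for all of [-b, b], whereas \<open>bnd\<close> concerns the point b
  alone.\<close>

definition lb :: real where
  "lb = (SOME A. A > 0 \<and> (\<forall>n x. \<bar>x\<bar> \<le> b \<longrightarrow> (hf n x)\<^sup>2 \<le> A / sqrt (real (n + 1))))"

definition mu :: "nat \<Rightarrow> real" where "mu n = sqrt (lb / sqrt (real (n + 1)))"

lemma lb: "lb > 0" and hf_mu: "\<bar>x\<bar> \<le> b \<Longrightarrow> \<bar>hf n x\<bar> \<le> mu n"
proof -
  have l: "lb > 0 \<and> (\<forall>n x. \<bar>x\<bar> \<le> b \<longrightarrow> (hf n x)\<^sup>2 \<le> lb / sqrt (real (n + 1)))"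
    unfolding lb_def by (rule someI_ex[OF hf_local_bound])
  then show "lb > 0" by blast
  show "\<bar>hf n x\<bar> \<le> mu n" if "\<bar>x\<bar> \<le> b"
    unfolding mu_def using l that by (intro real_le_rsqrt) simp
qed

definition th :: "nat \<Rightarrow> real" where "th n = kk n * b - real n * pi / 2"

lemma wkb:
  "\<bar>hf n b - rho n * cos (th n)\<bar> \<le> b ^ 3 * mu n / kk n"
  "\<bar>hfd n b / kk n + rho n * sin (th n)\<bar> \<le> b ^ 3 * mu n / kk n"
  unfolding th_def using hf_wkb[of b n "mu n"] hf_mu b_pos by auto

text \<open>An approximation to the Green function with poles at \<open>b\<close> and \<open>-b\<close>, of the parity opposite to that of \<open>hf n\<close>, at the energy
  \<open>2 n + 1\<close>: it is proportional to \<open>hf n\<close> outside \<open>[-b, b]\<close>, and trigonometric inside.\<close>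

definition ta :: "nat \<Rightarrow> real \<Rightarrow> real" where
  "ta n x = cos (kk n * x - real (n + 1) * (pi / 2))"

definition td :: "nat \<Rightarrow> real \<Rightarrow> real" where
  "td n x = - kk n * sin (kk n * x - real (n + 1) * (pi / 2))"

text \<open>The clamped arguments glue the three pieces together, which makes continuity evident;
  \<open>gt_in\<close>, \<open>gt_right\<close> and \<open>gt_left\<close> recover the
  cases.\<close>

definition gt :: "nat \<Rightarrow> real \<Rightarrow> real" where
  "gt n x = hf n b * ta n (max (- b) (min b x)) + sin (th n) * (hf n (max b x) - hf n b)
    - sin (th n) * (hf n (min (- b) x) - hf n (- b))"

text \<open>The left minus the right derivative of \<open>gt n\<close> at b, that is, the strength
  of the source there.\<close>

definition jp :: "nat \<Rightarrow> real" where
  "jp n = hf n b * kk n * cos (th n) - sin (th n) * hfd n b"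

lemma ta_deriv: "(ta n has_real_derivative td n x) (at x)"
  unfolding ta_def[abs_def] td_def by (auto intro!: derivative_eq_intros)

lemma td_deriv: "(td n has_real_derivative - (2 * real n + 1) * ta n x) (at x)"
  unfolding ta_def td_def[abs_def] kk(2)[symmetric] by (auto intro!: derivative_eq_intros simp: power2_eq_square)

lemma ta_b: "ta n b = sin (th n)" and td_b: "td n b = kk n * cos (th n)"
proof -
  have e: "kk n * b - real (n + 1) * (pi / 2) = th n - pi / 2" unfolding th_def by (simp add: field_simps)
  show "ta n b = sin (th n)" "td n b = kk n * cos (th n)"
    unfolding ta_def td_def e by (simp_all add: cos_diff sin_diff)
qed

lemma ta_minus: "ta n (- x) = - ((- 1) ^ n * ta n x)" and td_minus: "td n (- x) = (- 1) ^ n * td n x"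
proof -
  have e: "kk n * (- x) - real (n + 1) * (pi / 2) = - (kk n * x - real (n + 1) * (pi / 2) + real (n + 1) * pi)"
    by (simp add: field_simps)
  show "ta n (- x) = - ((- 1) ^ n * ta n x)" "td n (- x) = (- 1) ^ n * td n x"
    unfolding ta_def td_def e cos_minus sin_minus cos_shift_npi sin_shift_npi by simp_all
qed

lemma gt_in: "\<bar>x\<bar> \<le> b \<Longrightarrow> gt n x = hf n b * ta n x"
proof -
  assume "\<bar>x\<bar> \<le> b"
  then have "max (- b) (min b x) = x" "max b x = b" "min (- b) x = - b" by auto
  then show ?thesis unfolding gt_def by simp
qed

lemma gt_right: "b \<le> x \<Longrightarrow> gt n x = sin (th n) * hf n x"
  unfolding gt_def using b_pos by (simp add: max_def min_def ta_b algebra_simps)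

lemma gt_left: "x \<le> - b \<Longrightarrow> gt n x = - sin (th n) * hf n x"
proof -
  assume x: "x \<le> - b"
  have "hf n b * ta n (- b) = - sin (th n) * hf n (- b)" unfolding ta_minus ta_b hf_minus by simp
  then show ?thesis unfolding gt_def using b_pos x by (simp add: max_def min_def algebra_simps)
qed

lemma gt_minus: "gt n (- x) = - ((- 1) ^ n * gt n x)"
proof -
  consider "\<bar>x\<bar> \<le> b" | "b \<le> x" | "x \<le> - b" by linarith
  then show ?thesis
  proof cases
    case 1 then show ?thesis by (simp add: gt_in ta_minus)
  next
    case 2 then show ?thesis by (simp add: gt_left gt_right hf_minus)
  next
    case 3 then show ?thesis by (simp add: gt_left gt_right hf_minus)
  qed
qed

lemma gt_continuous: "continuous_on A (gt n)"
  unfolding gt_def[abs_def] ta_def by (intro continuous_intros)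

lemma gt_decay: "\<exists>C. \<forall>x. \<bar>gt n x\<bar> \<le> C * exp (- x\<^sup>2 / 4)"
proof -
  obtain C where C: "\<And>x. \<bar>hf n x\<bar> \<le> C * exp (- x\<^sup>2 / 4)" using hf_decay[of n] by blast
  have C0: "C \<ge> 0" using C[of 0] abs_ge_zero[of "hf n 0"] by simp
  show ?thesis
  proof (intro exI allI)
    fix x
    show "\<bar>gt n x\<bar> \<le> (C + \<bar>hf n b\<bar> * exp (b\<^sup>2 / 4)) * exp (- x\<^sup>2 / 4)"
    proof (cases "\<bar>x\<bar> \<le> b")
      case True
      have "x\<^sup>2 \<le> b\<^sup>2" using True b_pos by (simp add: abs_le_square_iff[symmetric])
      then have e: "1 \<le> exp (b\<^sup>2 / 4) * exp (- x\<^sup>2 / 4)" by (simp flip: exp_add)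
      have "\<bar>gt n x\<bar> \<le> \<bar>hf n b\<bar> * 1" unfolding gt_in[OF True] abs_mult ta_def by (intro mult_left_mono) auto
      also have "\<dots> \<le> \<bar>hf n b\<bar> * (exp (b\<^sup>2 / 4) * exp (- x\<^sup>2 / 4))" by (intro mult_left_mono e) auto
      also have "\<dots> \<le> (C + \<bar>hf n b\<bar> * exp (b\<^sup>2 / 4)) * exp (- x\<^sup>2 / 4)" using C0 by (simp add: distrib_right)
      finally show ?thesis .
    next
      case False
      then have "\<bar>gt n x\<bar> = \<bar>sin (th n)\<bar> * \<bar>hf n x\<bar>"
        using gt_left[of x n] gt_right[of x n] by (cases "x \<ge> 0") (auto simp: abs_mult)
      also have "\<dots> \<le> 1 * (C * exp (- x\<^sup>2 / 4))" by (intro mult_mono C) auto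
      also have "\<dots> \<le> (C + \<bar>hf n b\<bar> * exp (b\<^sup>2 / 4)) * exp (- x\<^sup>2 / 4)" by (simp add: distrib_right)
      finally show ?thesis .
    qed
  qed
qed

lemma gt_measurable [measurable]: "gt n \<in> borel_measurable borel"
  by (rule borel_measurable_continuous_onI[OF gt_continuous])

lemma gt_L2: "(\<lambda>x. complex_of_real (gt n x)) \<in> L2"
  by (rule L2_gauss_decay[OF gt_measurable gt_decay])

lemma gt_hf_integrable: "integrable lborel (\<lambda>x. gt n x * hf j x)"
  by (rule integrable_gauss_decay'[OF _ gauss_decay_mult[OF gt_decay hf_decay]]) measurable

lemma cf_gt: "cf (\<lambda>x. complex_of_real (gt n x)) j = complex_of_real (LINT x|lborel. gt n x * hf j x)"
  unfolding cf_def by (simp flip: of_real_mult)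

lemma cf_gt_same_parity:
  assumes "even (j + n)"
  shows "(LINT x|lborel. gt n x * hf j x) = 0"
proof -
  have "(- 1) ^ n * (- 1) ^ j = (1::real)" using assms by (simp flip: power_add add: add.commute)
  then have "gt n (- x) * hf j (- x) = - (gt n x * hf j x)" for x
    unfolding gt_minus hf_minus by (metis (no_types, lifting) minus_mult_left mult.assoc mult.commute mult.left_neutral)
  then show ?thesis
    using lborel_integral_real_affine[of "- 1" "\<lambda>x. gt n x * hf j x" 0] by simp
qed

text \<open>Used outside [-b, b] with p = x^2, where the potential cancels, and inside with p = 0,
  where x^2 remains.\<close>

lemma wronskian_deriv:
  assumes F: "\<And>x. (F has_real_derivative F' x) (at x)" "\<And>x. (F' has_real_derivative (p x - (2 * real n + 1)) * F x) (at x)"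
  shows "((\<lambda>x. F x * hfd j x - F' x * hf j x) has_real_derivative
    (x\<^sup>2 - p x - (2 * real j - 2 * real n)) * F x * hf j x) (at x)"
  by (auto intro!: derivative_eq_intros F hf_deriv hfd_deriv simp: algebra_simps)

text \<open>Integrating the Wronskians over the three pieces leaves the jumps at b and -b, which
  agree by parity, and the integral over [-b, b] of the potential missing there. The latter is the
  error; an exact Green function would have none.\<close>

lemma cf_gt_opposite_parity:
  assumes p: "odd (j + n)"
  shows "\<bar>(2 * real j - 2 * real n) * (LINT x|lborel. gt n x * hf j x) - 2 * jp n * hf j b\<bar> \<le> 2 * b ^ 3 * \<bar>hf n b\<bar> * mu j"
proof -
  let ?f = "\<lambda>x. gt n x * hf j x"
  define c where "c = 2 * real j - 2 * real n"
  define P where "P x = hf n x * hfd j x - hfd n x * hf j x" for x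
  define Q where "Q x = ta n x * hfd j x - td n x * hf j x" for x
  have eps: "(- 1) ^ j = - ((- 1) ^ n :: real)" using p by (auto simp: minus_one_power_iff)
  have e2: "(- 1) ^ n * ((- 1) ^ n * y) = (y::real)" for y by (simp flip: power_add mult.assoc)
  have Pm: "P (- b) = P b" unfolding P_def hf_minus hfd_minus eps by (simp add: e2 mult_ac)
  have Qm: "Q (- b) = - Q b" unfolding Q_def ta_minus td_minus hf_minus hfd_minus eps by (simp add: e2 mult_ac)
  have Pd: "(P has_real_derivative - c * (hf n x * hf j x)) (at x)" for x
    using wronskian_deriv[of "hf n" "hfd n" "\<lambda>x. x\<^sup>2" n j x] hf_deriv hfd_deriv unfolding P_def[abs_def] c_def by (simp add: mult_ac)
  have Qd: "(Q has_real_derivative (x\<^sup>2 - c) * (ta n x * hf j x)) (at x)" for x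
    using wronskian_deriv[of "ta n" "td n" "\<lambda>x. 0" n j x] ta_deriv td_deriv unfolding Q_def[abs_def] c_def by (simp add: mult_ac)
  have cf: "continuous_on UNIV ?f" by (intro continuous_intros gt_continuous)
  have ic: "isCont ?f x" for x using cf continuous_on_eq_continuous_at by blast
  have icc: "isCont (\<lambda>x. c * ?f x) x" for x by (intro continuous_intros ic)
  have si: "set_integrable lborel A (\<lambda>x. c * ?f x)" if "A \<in> sets lborel" for A
    unfolding set_integrable_def by (intro integrable_mult_indicator that integrable_mult_right gt_hf_integrable)
  have tP: "(P \<longlongrightarrow> 0) at_top" "(P \<longlongrightarrow> 0) at_bot"
  proof -
    have a: "((\<lambda>x. hf n x * hfd j x) \<longlongrightarrow> 0) F \<Longrightarrow> ((\<lambda>x. hfd n x * hf j x) \<longlongrightarrow> 0) F \<Longrightarrow> (P \<longlongrightarrow> 0) F" for F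
      unfolding P_def[abs_def] using tendsto_diff[of "\<lambda>x. hf n x * hfd j x" 0 F "\<lambda>x. hfd n x * hf j x" 0] by simp
    show "(P \<longlongrightarrow> 0) at_top" "(P \<longlongrightarrow> 0) at_bot"
      by (rule a; intro gauss_decay_tendsto gauss_decay_mult hf_decay hfd_decay)+
  qed
  have cP: "(P \<longlongrightarrow> P x) F" if "F \<le> at x" for F x
    using DERIV_isCont[OF Pd[of x]] that unfolding isCont_def by (rule tendsto_mono[rotated])
  have right: "(LBINT x=ereal b..\<infinity>. c * ?f x) = - (sin (th n) * 0) - - (sin (th n) * P b)"
  proof (rule interval_integral_FTC_integrable[where F = "\<lambda>x. - (sin (th n) * P x)"])
    fix x assume "ereal b < ereal x"
    then have x: "b \<le> x" by simp
    show "((\<lambda>x. - (sin (th n) * P x)) has_vector_derivative c * ?f x) (at x)"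
      unfolding gt_right[OF x] has_real_derivative_iff_has_vector_derivative[symmetric]
      by (auto intro!: derivative_eq_intros Pd)
  next
    show "(((\<lambda>x. - (sin (th n) * P x)) \<circ> real_of_ereal) \<longlongrightarrow> - (sin (th n) * 0)) (at_left \<infinity>)"
      unfolding ereal_tendsto_simps by (intro tendsto_intros tP)
    show "(((\<lambda>x. - (sin (th n) * P x)) \<circ> real_of_ereal) \<longlongrightarrow> - (sin (th n) * P b)) (at_right (ereal b))"
      unfolding ereal_tendsto_simps by (intro tendsto_intros cP at_le) simp
  qed (auto intro: icc si)
  have left: "(LBINT x=-\<infinity>..ereal (- b). c * ?f x) = sin (th n) * P (- b) - sin (th n) * 0"
  proof (rule interval_integral_FTC_integrable[where F = "\<lambda>x. sin (th n) * P x"])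
    fix x assume "ereal x < ereal (- b)"
    then have x: "x \<le> - b" by simp
    show "((\<lambda>x. sin (th n) * P x) has_vector_derivative c * ?f x) (at x)"
      unfolding gt_left[OF x] has_real_derivative_iff_has_vector_derivative[symmetric]
      by (auto intro!: derivative_eq_intros Pd)
  next
    show "(((\<lambda>x. sin (th n) * P x) \<circ> real_of_ereal) \<longlongrightarrow> sin (th n) * 0) (at_right (- \<infinity>))"
      unfolding ereal_tendsto_simps by (intro tendsto_intros tP)
    show "(((\<lambda>x. sin (th n) * P x) \<circ> real_of_ereal) \<longlongrightarrow> sin (th n) * P (- b)) (at_left (ereal (- b)))"
      unfolding ereal_tendsto_simps by (intro tendsto_intros cP at_le) simp
  qed (auto intro: icc si)
  let ?m = "LBINT x=ereal (- b)..ereal b. c * ?f x"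
  have mid: "\<bar>?m + 2 * (hf n b * Q b)\<bar> \<le> 2 * b ^ 3 * \<bar>hf n b\<bar> * mu j"
  proof -
    let ?r = "\<lambda>x. hf n b * (x\<^sup>2 * (ta n x * hf j x))"
    have m: "?m = integral {- b..b} (\<lambda>x. c * ?f x)"
      by (rule interval_integral_eq_integral) (use b_pos si in auto)
    have m': "((\<lambda>x. c * ?f x) has_integral ?m) {- b..b}"
      unfolding m by (intro integrable_integral integrable_continuous_interval continuous_intros gt_continuous)
    have "((\<lambda>x. hf n b * ((x\<^sup>2 - c) * (ta n x * hf j x))) has_integral hf n b * Q b - hf n b * Q (- b)) {- b..b}"
      by (rule fundamental_theorem_of_calculus)
         (use b_pos in \<open>auto simp flip: has_real_derivative_iff_has_vector_derivative intro!: DERIV_cmult has_field_derivative_at_within[OF Qd]\<close>)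
    from has_integral_add[OF m' this]
    have "((\<lambda>x. c * ?f x + hf n b * ((x\<^sup>2 - c) * (ta n x * hf j x))) has_integral ?m + (hf n b * Q b - hf n b * Q (- b))) {- b..b}" .
    moreover have "c * ?f x + hf n b * ((x\<^sup>2 - c) * (ta n x * hf j x)) = ?r x" if "x \<in> {- b..b}" for x
    proof -
      have "gt n x = hf n b * ta n x" using that by (intro gt_in) auto
      then show ?thesis by (simp add: algebra_simps)
    qed
    ultimately have r: "(?r has_integral ?m + (hf n b * Q b - hf n b * Q (- b))) {- b..b}"
      by (rule has_integral_eq[rotated])
    have "norm (integral {- b..b} ?r) \<le> (\<bar>hf n b\<bar> * (b\<^sup>2 * (1 * mu j))) * (b - - b)"
    proof (rule integral_bound)
      show "continuous_on {- b..b} ?r" unfolding ta_def by (intro continuous_intros)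
      fix t assume "t \<in> {- b..b}"
      then have t: "\<bar>t\<bar> \<le> b" by auto
      then have "t\<^sup>2 \<le> b\<^sup>2" using b_pos by (simp add: abs_le_square_iff[symmetric])
      then show "norm (?r t) \<le> \<bar>hf n b\<bar> * (b\<^sup>2 * (1 * mu j))"
        unfolding real_norm_def abs_mult using hf_mu[OF t, of j] by (intro mult_left_mono mult_mono) (auto simp: ta_def)
    qed (use b_pos in simp)
    then show ?thesis unfolding integral_unique[OF r] Qm by (simp add: power3_eq_cube power2_eq_square mult_ac)
  qed
  have ii: "interval_lebesgue_integrable lborel x y (\<lambda>x. c * ?f x)" for x y
    unfolding interval_lebesgue_integrable_def by (auto intro: si)
  have "(LBINT x=-\<infinity>..\<infinity>. c * ?f x) = (LBINT x=-\<infinity>..ereal (- b). c * ?f x) + ?m + (LBINT x=ereal b..\<infinity>. c * ?f x)"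
    by (simp only: interval_integral_sum[OF ii])
  also have "(LBINT x=-\<infinity>..\<infinity>. c * ?f x) = c * (LINT x|lborel. ?f x)"
    by (simp add: interval_lebesgue_integral_def set_lebesgue_integral_def)
  finally have "c * (LINT x|lborel. ?f x) = ?m + 2 * (hf n b * Q b) + 2 * (sin (th n) * P b - hf n b * Q b)"
    unfolding left right Pm by simp
  moreover have "sin (th n) * P b - hf n b * Q b = jp n * hf j b"
    unfolding P_def Q_def ta_b td_b jp_def by (simp add: algebra_simps)
  ultimately show ?thesis using mid unfolding c_def by (simp add: mult_ac)
qed

end

section \<open>Amplitude of the Hermite functions\<close>

lemma cmult_bigo: "f \<in> O(g) \<Longrightarrow> (\<lambda>n. c * f n) \<in> O(g)" for f g :: "nat \<Rightarrow> real"
  by (cases "c = 0") auto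

lemma power4_eq_square_square: "x ^ 4 = (x\<^sup>2)\<^sup>2" for x :: real
  by (simp only: power_mult[symmetric]) simp

text \<open>The recursion at 0 multiplies (2j+1) h_(2j)(0)^4 by the inverse of the next factor of
  Wallis' product, and h_0(0)^4 = 1/pi.\<close>

lemma hf_0_wallis: "real (2 * j + 1) * (hf (2 * j) 0) ^ 4 * (\<Prod>k=1..j. (4 * (real k)\<^sup>2) / (4 * (real k)\<^sup>2 - 1)) = 1 / pi"
proof (induction j)
  case 0
  have "(sqrt (sqrt pi)) ^ 4 = pi"
  proof -
    show ?thesis unfolding power4_eq_square_square by simp
  qed
  then show ?case by (simp add: hf.simps power_divide)
next
  case (Suc j)
  let ?P = "\<Prod>k=1..j. (4 * (real k)\<^sup>2) / (4 * (real k)\<^sup>2 - 1)"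
  have r: "(hf (2 * Suc j) 0) ^ 4 = (real (2 * j + 1) / real (2 * j + 2))\<^sup>2 * (hf (2 * j) 0) ^ 4"
  proof -
    have "2 * Suc j = Suc (Suc (2 * j))" by simp
    then show ?thesis unfolding power4_eq_square_square by (simp only: hf_zero_Suc_Suc power_mult_distrib)
  qed
  have d: "4 * (real (Suc j))\<^sup>2 - 1 = real (2 * j + 1) * real (2 * j + 3)" "4 * (real (Suc j))\<^sup>2 = (real (2 * j + 2))\<^sup>2"
    by (simp_all add: power2_eq_square algebra_simps)
  let ?F = "\<lambda>k. (4 * (real k)\<^sup>2) / (4 * (real k)\<^sup>2 - 1)"
  have f: "?F (Suc j) = (real (2 * j + 2))\<^sup>2 / (real (2 * j + 1) * real (2 * j + 3))"
    by (simp only: d(1)) (simp only: d(2))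
  have p: "prod ?F {1..Suc j} = ?F (Suc j) * ?P" by (rule prod.nat_ivl_Suc') simp
  have g: "z * ((x / y)\<^sup>2 * h) * (y\<^sup>2 / (x * z) * p) = x * h * p" if "x \<noteq> 0" "y \<noteq> 0" "z \<noteq> 0" for x y z h p :: real
    using that by (simp add: power2_eq_square field_simps)
  have n: "2 * Suc j + 1 = 2 * j + 3" by simp
  have "real (2 * Suc j + 1) * (hf (2 * Suc j) 0) ^ 4 * prod ?F {1..Suc j} = real (2 * j + 1) * (hf (2 * j) 0) ^ 4 * ?P"
    unfolding r p f n by (rule g) simp_all
  then show ?case using Suc by simp
qed

text \<open>(2j+1) h_(2j)(0)^4 decreases and 2j h_(2j)(0)^4 increases to the common limit
  (1/pi)/(pi/2), so the inequalities hold for every j.\<close>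

lemma hf_0_even_bounds:
  shows "2 / pi\<^sup>2 \<le> real (2 * j + 1) * (hf (2 * j) 0) ^ 4" "real (2 * j) * (hf (2 * j) 0) ^ 4 \<le> 2 / pi\<^sup>2"
proof -
  define w where "w j = (hf (2 * j) 0) ^ 4" for j
  define X where "X j = real (2 * j + 1) * w j" for j
  define P where "P j = (\<Prod>k=1..j. (4 * (real k)\<^sup>2) / (4 * (real k)\<^sup>2 - 1))" for j
  have r: "w (Suc j) = (real (2 * j + 1) / real (2 * j + 2))\<^sup>2 * w j" for j
  proof -
    have "2 * Suc j = Suc (Suc (2 * j))" by simp
    then show ?thesis unfolding w_def power4_eq_square_square by (simp only: hf_zero_Suc_Suc power_mult_distrib)
  qed
  have w0: "w j \<ge> 0" for j unfolding w_def by simp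
  have e: "X j = 1 / pi / P j" for j
  proof -
    have "X j * P j = 1 / pi" using hf_0_wallis[of j] unfolding X_def w_def P_def .
    moreover from this have "P j \<noteq> 0" by auto
    ultimately show ?thesis by (simp add: field_simps)
  qed
  have "(\<lambda>j. 1 / pi / P j) \<longlonglongrightarrow> 1 / pi / (pi / 2)"
    using wallis unfolding P_def by (intro tendsto_intros) auto
  then have l: "X \<longlonglongrightarrow> 2 / pi\<^sup>2" unfolding e[symmetric] by (simp add: power2_eq_square)
  have d: "decseq X"
  proof (rule decseq_SucI)
    fix j
    have "real (2 * Suc j + 1) * (real (2 * j + 1) / real (2 * j + 2))\<^sup>2 \<le> real (2 * j + 1)"
      unfolding power_divide times_divide_eq_right
      by (subst pos_divide_le_eq, simp) (simp add: power2_eq_square algebra_simps)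
    from mult_right_mono[OF this w0[of j]] show "X (Suc j) \<le> X j" unfolding X_def r by (simp only: mult.assoc)
  qed
  have i: "incseq (\<lambda>j. real (2 * j) * w j)"
  proof (rule incseq_SucI)
    fix j
    have "real (2 * j) \<le> real (2 * Suc j) * (real (2 * j + 1) / real (2 * j + 2))\<^sup>2"
      unfolding power_divide times_divide_eq_right
      by (subst pos_le_divide_eq, simp) (simp add: power2_eq_square algebra_simps)
    from mult_right_mono[OF this w0[of j]] show "real (2 * j) * w j \<le> real (2 * Suc j) * w (Suc j)" unfolding r by (simp only: mult.assoc)
  qed
  have "(\<lambda>j. real (2 * j) / real (2 * j + 1)) \<longlonglongrightarrow> 1" by real_asymp
  from tendsto_mult[OF this l] have "(\<lambda>j. real (2 * j) * w j) \<longlonglongrightarrow> 2 / pi\<^sup>2"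
    unfolding X_def by (simp add: mult.assoc)
  from incseq_le[OF i this] show "real (2 * j) * (hf (2 * j) 0) ^ 4 \<le> 2 / pi\<^sup>2" unfolding w_def .
  from decseq_ge[OF d l] show "2 / pi\<^sup>2 \<le> real (2 * j + 1) * (hf (2 * j) 0) ^ 4" unfolding X_def w_def .
qed

text \<open>For odd n the datum h_n'(0) = sqrt (2n) h_(n-1)(0) shifts the index by one and brings in
  the factor 2n/(2n+1). The bounds are weakened to cover both parities at once.\<close>

lemma rho_fourth:
  assumes "n \<ge> 2"
  shows "2 / pi\<^sup>2 * (1 / (real n + 1) * (2 * real n / (2 * real n + 1))\<^sup>2) \<le> (rho n) ^ 4"
    and "(rho n) ^ 4 \<le> 2 / pi\<^sup>2 * (1 / (real n - 1))"
proof -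
  let ?q = "(2 * real n / (2 * real n + 1))\<^sup>2"
  have q: "?q \<le> 1" "?q \<ge> 0" using assms by (auto intro!: power_le_one)
  have c0: "2 / pi\<^sup>2 > 0" by simp
  have d1: "c * (1 / p) \<le> h" if "c \<le> p * h" "p > 0" for c p h :: real using that by (simp add: field_simps)
  have d2: "h \<le> c * (1 / p)" if "p * h \<le> c" "p > 0" for c p h :: real using that by (simp add: field_simps)
  have "2 / pi\<^sup>2 * (1 / (real n + 1) * ?q) \<le> (rho n) ^ 4 \<and> (rho n) ^ 4 \<le> 2 / pi\<^sup>2 * (1 / (real n - 1))"
  proof (cases "even n")
    case True
    then obtain j where j: "n = 2 * j" by (rule evenE)
    have r: "(rho n) ^ 4 = (hf (2 * j) 0) ^ 4" unfolding power4_eq_square_square rho_sq using True j by simp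
    have n: "real (2 * j + 1) = real n + 1" "real (2 * j) = real n" unfolding j by simp_all
    have l: "2 / pi\<^sup>2 * (1 / (real n + 1)) \<le> (rho n) ^ 4" "(rho n) ^ 4 \<le> 2 / pi\<^sup>2 * (1 / real n)"
      using d1[OF hf_0_even_bounds(1)[of j]] d2[OF hf_0_even_bounds(2)[of j]] assms unfolding r n by auto
    have "2 / pi\<^sup>2 * (1 / (real n + 1) * ?q) \<le> 2 / pi\<^sup>2 * (1 / (real n + 1) * 1)"
      using q c0 by (intro mult_left_mono) auto
    moreover have "2 / pi\<^sup>2 * (1 / real n) \<le> 2 / pi\<^sup>2 * (1 / (real n - 1))"
      using assms c0 by (intro mult_left_mono divide_left_mono) auto
    ultimately show ?thesis using l by simp
  next
    case False
    then obtain j where j: "n = 2 * j + 1" by (rule oddE)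
    have "hfd n 0 = sqrt (2 * real n) * hf (2 * j) 0" unfolding hfd_def j by simp
    then have "(rho n)\<^sup>2 = 2 * real n / (2 * real n + 1) * (hf (2 * j) 0)\<^sup>2"
      unfolding rho_sq using False by (simp add: power_mult_distrib)
    then have r: "(rho n) ^ 4 = ?q * (hf (2 * j) 0) ^ 4" unfolding power4_eq_square_square by (simp only: power_mult_distrib)
    have n: "real (2 * j + 1) = real n" "real (2 * j) = real n - 1" unfolding j by simp_all
    have l: "2 / pi\<^sup>2 * (1 / real n) \<le> (hf (2 * j) 0) ^ 4" "(hf (2 * j) 0) ^ 4 \<le> 2 / pi\<^sup>2 * (1 / (real n - 1))"
      using d1[OF hf_0_even_bounds(1)[of j]] d2[OF hf_0_even_bounds(2)[of j]] assms unfolding n by auto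
    have "2 / pi\<^sup>2 * (1 / (real n + 1) * ?q) \<le> 2 / pi\<^sup>2 * (1 / real n * ?q)"
      using q c0 assms by (intro mult_left_mono mult_right_mono divide_left_mono) auto
    also have "\<dots> = ?q * (2 / pi\<^sup>2 * (1 / real n))" by simp
    also have "\<dots> \<le> (rho n) ^ 4" unfolding r by (intro mult_left_mono l q)
    finally have a: "2 / pi\<^sup>2 * (1 / (real n + 1) * ?q) \<le> (rho n) ^ 4" .
    have "(rho n) ^ 4 \<le> 1 * (2 / pi\<^sup>2 * (1 / (real n - 1)))"
      unfolding r by (intro mult_mono l q) auto
    then show ?thesis using a by simp
  qed
  then show "2 / pi\<^sup>2 * (1 / (real n + 1) * ?q) \<le> (rho n) ^ 4" "(rho n) ^ 4 \<le> 2 / pi\<^sup>2 * (1 / (real n - 1))" by auto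
qed

lemma rho_fourth_asymp: "(\<lambda>n. (rho n) ^ 4 - 2 / pi\<^sup>2 / real n) \<in> O(\<lambda>n. real n powr (- 2))"
proof -
  let ?u = "\<lambda>n. 1 / (real n - 1) - 1 / real n" and ?l = "\<lambda>n. 1 / (real n + 1) * (2 * real n / (2 * real n + 1))\<^sup>2 - 1 / real n"
  have "(\<lambda>n. (rho n) ^ 4 - 2 / pi\<^sup>2 / real n) \<in> O(\<lambda>n. \<bar>?u n\<bar> + \<bar>?l n\<bar>)"
  proof (rule bigoI[of _ "2 / pi\<^sup>2"])
    show "\<forall>\<^sub>F n in sequentially. norm ((rho n) ^ 4 - 2 / pi\<^sup>2 / real n) \<le> 2 / pi\<^sup>2 * norm (\<bar>?u n\<bar> + \<bar>?l n\<bar>)"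
      using eventually_ge_at_top[of "2::nat"]
    proof eventually_elim
      case (elim n)
      let ?c = "2 / pi\<^sup>2"
      have c: "?c \<ge> 0" by simp
      have "(rho n) ^ 4 - ?c / real n \<le> ?c * ?u n" "?c * ?l n \<le> (rho n) ^ 4 - ?c / real n"
        using rho_fourth[OF elim] by (simp_all add: right_diff_distrib)
      moreover have "?c * ?u n \<le> ?c * \<bar>?u n\<bar>" "- (?c * \<bar>?l n\<bar>) \<le> ?c * ?l n"
        using mult_left_mono[OF abs_ge_self c, of "?u n"] mult_left_mono[OF abs_ge_minus_self c, of "?l n"] by linarith+
      moreover have "0 \<le> ?c * \<bar>?u n\<bar>" "0 \<le> ?c * \<bar>?l n\<bar>" by (intro mult_nonneg_nonneg c abs_ge_zero)+
      ultimately have "\<bar>(rho n) ^ 4 - ?c / real n\<bar> \<le> ?c * \<bar>?u n\<bar> + ?c * \<bar>?l n\<bar>" by linarith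
      moreover have "norm (\<bar>?u n\<bar> + \<bar>?l n\<bar>) = \<bar>?u n\<bar> + \<bar>?l n\<bar>"
        unfolding real_norm_def by (intro abs_of_nonneg add_nonneg_nonneg abs_ge_zero)
      ultimately show ?case by (simp only: real_norm_def distrib_left)
    qed
  qed
  also have "(\<lambda>n. \<bar>?u n\<bar> + \<bar>?l n\<bar>) \<in> O(\<lambda>n. real n powr (- 2))" by real_asymp
  finally show ?thesis .
qed

text \<open>The square of k \<rho>^2 is known from the fourth power; dividing the difference of
  squares by a sum that is at least 2/pi extracts the root.\<close>

lemma kk_rho_asymp: "(\<lambda>n. kk n * (rho n)\<^sup>2 - 2 / pi) \<in> O(\<lambda>n. real n powr (- 1))"
proof -
  let ?e = "\<lambda>n. (rho n) ^ 4 - 2 / pi\<^sup>2 / real n"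
  have "(\<lambda>n. kk n * (rho n)\<^sup>2 - 2 / pi) \<in> O(\<lambda>n. (2 * real n + 1) * ?e n + 2 / pi\<^sup>2 * (1 / real n))"
  proof (rule bigoI[of _ "pi / 2"])
    show "\<forall>\<^sub>F n in sequentially. norm (kk n * (rho n)\<^sup>2 - 2 / pi) \<le> pi / 2 * norm ((2 * real n + 1) * ?e n + 2 / pi\<^sup>2 * (1 / real n))"
      using eventually_ge_at_top[of "1::nat"]
    proof eventually_elim
      case (elim n)
      let ?t = "kk n * (rho n)\<^sup>2"
      have t0: "?t \<ge> 0" using kk(1)[of n] by simp
      have "?t\<^sup>2 = (2 * real n + 1) * (rho n) ^ 4" unfolding power_mult_distrib kk power4_eq_square_square ..
      then have "(2 * real n + 1) * ?e n + 2 / pi\<^sup>2 * (1 / real n) = ?t\<^sup>2 - (2 / pi)\<^sup>2"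
        using elim by (simp add: field_simps power2_eq_square)
      also have "\<dots> = (?t - 2 / pi) * (?t + 2 / pi)" by (simp add: power2_eq_square algebra_simps)
      finally have e: "norm ((2 * real n + 1) * ?e n + 2 / pi\<^sup>2 * (1 / real n)) = \<bar>?t - 2 / pi\<bar> * \<bar>?t + 2 / pi\<bar>"
        by (simp only: real_norm_def abs_mult)
      have "\<bar>?t - 2 / pi\<bar> * (2 / pi) \<le> \<bar>?t - 2 / pi\<bar> * \<bar>?t + 2 / pi\<bar>"
        using t0 by (intro mult_left_mono) auto
      then have "pi / 2 * (\<bar>?t - 2 / pi\<bar> * (2 / pi)) \<le> pi / 2 * (\<bar>?t - 2 / pi\<bar> * \<bar>?t + 2 / pi\<bar>)"
        by (rule mult_left_mono) simp
      moreover have "pi / 2 * (y * (2 / pi)) = y" for y by simp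
      ultimately show ?case unfolding e by (simp only: real_norm_def)
    qed
  qed
  also have "(\<lambda>n. (2 * real n + 1) * ?e n + 2 / pi\<^sup>2 * (1 / real n)) \<in> O(\<lambda>n. real n powr (- 1))"
  proof (rule sum_in_bigo)
    have "(\<lambda>n. (2 * real n + 1) * ?e n) \<in> O(\<lambda>n. (2 * real n + 1) * real n powr (- 2))"
      by (intro landau_o.big.mult rho_fourth_asymp) simp
    also have "(\<lambda>n. (2 * real n + 1) * real n powr (- 2)) \<in> O(\<lambda>n. real n powr (- 1))" by real_asymp
    finally show "(\<lambda>n. (2 * real n + 1) * ?e n) \<in> O(\<lambda>n. real n powr (- 1))" .
    have "(\<lambda>n. 1 / real n) \<in> O(\<lambda>n. real n powr (- 1))" by real_asymp
    then show "(\<lambda>n. 2 / pi\<^sup>2 * (1 / real n)) \<in> O(\<lambda>n. real n powr (- 1))" by (rule cmult_bigo)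
  qed
  finally show ?thesis .
qed

lemma rho_bigo: "rho \<in> O(\<lambda>n. real n powr (- 1 / 4))"
proof -
  have "rho \<in> O(\<lambda>n. sqrt (1 / sqrt (real n)))"
  proof (rule landau_o.big_mono)
    show "\<forall>\<^sub>F n in sequentially. norm (rho n) \<le> norm (sqrt (1 / sqrt (real n)))"
      using eventually_ge_at_top[of "1::nat"]
    proof eventually_elim
      case (elim n)
      have "(rho n)\<^sup>2 \<le> 1 / sqrt (real n)"
      proof (cases "even n")
        case True
        have "(rho n)\<^sup>2 \<le> 1 / sqrt (real (n + 1))" unfolding rho_sq using True hf_zero_bound[of n] by simp
        also have "\<dots> \<le> 1 / sqrt (real n)" using elim by (intro divide_left_mono) auto
        finally show ?thesis .
      next
        case False
        have "hfd n 0 = sqrt (2 * real n) * hf (n - 1) 0" unfolding hfd_def by simp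
        then have "(rho n)\<^sup>2 = 2 * real n / (2 * real n + 1) * (hf (n - 1) 0)\<^sup>2"
          unfolding rho_sq using False by (simp add: power_mult_distrib)
        also have "\<dots> \<le> 1 * (1 / sqrt (real (n - 1 + 1)))"
          by (intro mult_mono hf_zero_bound) auto
        finally show ?thesis using elim by simp
      qed
      then show ?case by (simp add: real_le_rsqrt)
    qed
  qed
  also have "(\<lambda>n. sqrt (1 / sqrt (real n))) \<in> O(\<lambda>n. real n powr (- 1 / 4))" by real_asymp
  finally show ?thesis .
qed

text \<open>The profile of the second-order term: h_n(b)^2 contributes cos^2 of the phase and
  O(2n+1) contributes sin cos.\<close>

definition csin :: "real \<Rightarrow> real" where "csin x = (cos x) ^ 3 * sin x"

lemma csin_alt: "csin x = sin (2 * x) / 4 + sin (4 * x) / 8"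
proof -
  have s: "(sin x)\<^sup>2 + (cos x)\<^sup>2 = 1" by simp
  have s4: "sin (4 * x) = 2 * (2 * sin x * cos x) * ((cos x)\<^sup>2 - (sin x)\<^sup>2)"
    using sin_double[of "2 * x"] by (simp add: sin_double cos_double)
  have g: "2 * u * v / 4 + 2 * (2 * u * v) * w / 8 = u * v * (1 + w) / 2" for u v w :: real by (simp add: field_simps)
  have "sin (2 * x) / 4 + sin (4 * x) / 8 = sin x * cos x * (1 + ((cos x)\<^sup>2 - (sin x)\<^sup>2)) / 2"
    unfolding s4 sin_double by (rule g)
  also have "1 + ((cos x)\<^sup>2 - (sin x)\<^sup>2) = 2 * (cos x)\<^sup>2" using s by linarith
  finally show ?thesis unfolding csin_def by (simp add: power3_eq_cube power2_eq_square)
qed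

lemma csin_lipschitz: "\<bar>csin x - csin y\<bar> \<le> \<bar>x - y\<bar>"
proof -
  have "norm (csin x - csin y) \<le> 1 * norm (x - y)"
  proof (rule field_differentiable_bound[where S = UNIV and f' = "\<lambda>x. cos (2 * x) / 2 + cos (4 * x) / 2"])
    show "(csin has_field_derivative cos (2 * z) / 2 + cos (4 * z) / 2) (at z within UNIV)" for z
      unfolding csin_alt[abs_def] by (auto intro!: derivative_eq_intros)
    show "norm (cos (2 * z) / 2 + cos (4 * z) / 2) \<le> 1" for z :: real
      using cos_le_one[of "2 * z"] cos_le_one[of "4 * z"] cos_ge_minus_one[of "2 * z"] cos_ge_minus_one[of "4 * z"]
      unfolding real_norm_def abs_le_iff by linarith
  qed auto
  then show ?thesis by simp
qed

text \<open>Doubling the phase turns the shift n pi/2 into the sign (-1)^n and quadrupling removes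
  it; this is the origin of the sign in \<open>kappa\<close>.\<close>

lemma kappa_csin: "kappa b n = - (2 / pi * csin (b * sqrt (2 * real n) - real n * pi / 2))"
proof -
  let ?x = "b * sqrt (2 * real n)"
  have e: "2 * (?x - real n * pi / 2) = - (- 2 * ?x + real n * pi)" "4 * (?x - real n * pi / 2) = - (- 4 * ?x + real (2 * n) * pi)"
    by (simp_all add: field_simps)
  have "sin (2 * (?x - real n * pi / 2)) = (- 1) ^ n * sin (2 * ?x)" "sin (4 * (?x - real n * pi / 2)) = sin (4 * ?x)"
    unfolding e sin_minus sin_shift_npi by simp_all
  then show ?thesis unfolding kappa_def csin_alt by (simp add: field_simps)
qed

section \<open>The opposite-parity sum at the unperturbed eigenvalue\<close>

context positive_point_interaction
begin

definition gc :: "nat \<Rightarrow> nat \<Rightarrow> real" where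
  "gc n j = (LINT x|lborel. gt n x * hf j x)"

lemma kd_diff: "\<bar>2 * real j - 2 * real n\<bar> = 2 * kd n j"
  unfolding kd_def by (simp add: abs_if)

lemma mu_nonneg: "mu n \<ge> 0" and mu_sq: "mu n * mu n = lb / sqrt (real (n + 1))"
  unfolding mu_def using lb by (auto simp flip: real_sqrt_mult)

text \<open>Decay of order j^(-5/4), enough for \<open>gt n\<close> to have coefficients in
  \<open>fdom\<close>, so that its Hermite series may be evaluated at b.\<close>

lemma gc_bound: "\<bar>gc n j\<bar> \<le> (\<bar>jp n\<bar> + b ^ 3 * \<bar>hf n b\<bar>) * mu j * (real (n + 2) / real (j + 1))"
proof (cases "even (j + n)")
  case True
  then show ?thesis unfolding gc_def cf_gt_same_parity[OF True] using mu_nonneg b_pos by (auto intro!: mult_nonneg_nonneg add_nonneg_nonneg)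
next
  case False
  then have jn: "j \<noteq> n" by auto
  have kd: "kd n j > 0" using kd_ge_1[OF jn] by simp
  have "2 * kd n j * \<bar>gc n j\<bar> = \<bar>(2 * real j - 2 * real n) * gc n j\<bar>" unfolding abs_mult kd_diff ..
  also have "\<dots> \<le> 2 * \<bar>jp n\<bar> * \<bar>hf j b\<bar> + 2 * b ^ 3 * \<bar>hf n b\<bar> * mu j"
    using cf_gt_opposite_parity[OF False] abs_triangle_ineq2[of "(2 * real j - 2 * real n) * gc n j" "2 * jp n * hf j b"]
    unfolding gc_def[symmetric] abs_mult[of "2 * jp n"] abs_mult[of 2] by linarith
  also have "\<dots> \<le> 2 * \<bar>jp n\<bar> * mu j + 2 * b ^ 3 * \<bar>hf n b\<bar> * mu j"
    using hf_mu[of b j] b_pos by (intro add_right_mono mult_left_mono) auto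
  finally have "kd n j * \<bar>gc n j\<bar> \<le> (\<bar>jp n\<bar> + b ^ 3 * \<bar>hf n b\<bar>) * mu j" by (simp add: algebra_simps)
  then have "\<bar>gc n j\<bar> \<le> (\<bar>jp n\<bar> + b ^ 3 * \<bar>hf n b\<bar>) * mu j * (1 / kd n j)" using kd by (simp add: field_simps)
  also have "\<dots> \<le> (\<bar>jp n\<bar> + b ^ 3 * \<bar>hf n b\<bar>) * mu j * (real (n + 2) / real (j + 1))"
  proof (rule mult_left_mono)
    show "1 / kd n j \<le> real (n + 2) / real (j + 1)" using Suc_le_kd[OF jn] kd by (simp add: field_simps)
    show "0 \<le> (\<bar>jp n\<bar> + b ^ 3 * \<bar>hf n b\<bar>) * mu j" using mu_nonneg b_pos by (intro mult_nonneg_nonneg add_nonneg_nonneg) auto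
  qed
  finally show ?thesis .
qed

lemma gt_fdom: "fdom (cf (\<lambda>x. complex_of_real (gt n x)))"
  unfolding fdom_def
proof (rule summable_comparison_test'[where N = 0])
  let ?K = "(\<bar>jp n\<bar> + b ^ 3 * \<bar>hf n b\<bar>)\<^sup>2 * lb * (real (n + 2))\<^sup>2"
  show "summable (\<lambda>j. ?K * (1 / (real (j + 1) * sqrt (real (j + 1)))))"
    by (intro summable_mult summable_inverse_3_2)
  fix j
  have "(cmod (cf (\<lambda>x. complex_of_real (gt n x)) j))\<^sup>2 = \<bar>gc n j\<bar>\<^sup>2"
    unfolding cf_gt gc_def norm_of_real ..
  also have "\<dots> \<le> ((\<bar>jp n\<bar> + b ^ 3 * \<bar>hf n b\<bar>) * mu j * (real (n + 2) / real (j + 1)))\<^sup>2"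
    by (intro power_mono gc_bound) auto
  also have "\<dots> = (\<bar>jp n\<bar> + b ^ 3 * \<bar>hf n b\<bar>)\<^sup>2 * (mu j * mu j) * ((real (n + 2))\<^sup>2 / (real (j + 1))\<^sup>2)"
    by (simp only: power_mult_distrib power_divide) (simp only: power2_eq_square)
  finally have "real (j + 1) * (cmod (cf (\<lambda>x. complex_of_real (gt n x)) j))\<^sup>2 \<le> real (j + 1) * ((\<bar>jp n\<bar> + b ^ 3 * \<bar>hf n b\<bar>)\<^sup>2 * (mu j * mu j) * ((real (n + 2))\<^sup>2 / (real (j + 1))\<^sup>2))"
    by (intro mult_left_mono) auto
  also have "\<dots> = ?K * (1 / (real (j + 1) * sqrt (real (j + 1))))"
  proof -
    have g: "p * (q * (l / s) * (m / p\<^sup>2)) = q * l * m * (1 / (p * s))" if "p \<noteq> 0" for p q l s m :: real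
      using that by (simp add: power2_eq_square mult_ac)
    show ?thesis unfolding mu_sq by (rule g) simp
  qed
  finally show "norm (real (j + 1) * (cmod (cf (\<lambda>x. complex_of_real (gt n x)) j))\<^sup>2) \<le> ?K * (1 / (real (j + 1) * sqrt (real (j + 1))))"
    by simp
qed

lemma gc_sums: "(\<lambda>j. gc n j * hf j b) sums (sin (th n) * hf n b)"
proof -
  have c: "continuous_on UNIV (\<lambda>x. complex_of_real (gt n x))" by (intro continuous_intros gt_continuous)
  have "(\<lambda>j. cf (\<lambda>x. complex_of_real (gt n x)) j * complex_of_real (hf j b)) sums complex_of_real (gt n b)"
    by (subst synth_cf[OF gt_L2 c gt_fdom, of b]) (rule synth_sums[OF gt_fdom])
  then have "(\<lambda>j. complex_of_real (gc n j * hf j b)) sums complex_of_real (gt n b)"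
    unfolding cf_gt gc_def by simp
  then show ?thesis unfolding sums_of_real_iff using gt_right[of b n] by simp
qed

definition on :: "nat \<Rightarrow> real" where "on n = Re (cO n (of_nat (2 * n + 1)))"

lemma centre_Om: "of_nat (2 * n + 1) \<in> Om n"
  by (rule centre_disc_Om) simp

lemma on_sums: "(\<lambda>k. pO n k / (2 * real k - 2 * real n)) sums on n"
  and cO_centre: "cO n (of_nat (2 * n + 1)) = complex_of_real (on n)"
proof -
  have e: "complex_of_real (pO n k) / (of_nat (2 * k + 1) - of_nat (2 * n + 1)) = complex_of_real (pO n k / (2 * real k - 2 * real n))" for k
    by simp
  have s: "(\<lambda>k. complex_of_real (pO n k / (2 * real k - 2 * real n))) sums cO n (of_nat (2 * n + 1))"
    using csum_sums[OF wt_pO[of n] centre_Om] unfolding e cO_def .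
  from sums_Re[OF s] show "(\<lambda>k. pO n k / (2 * real k - 2 * real n)) sums on n" unfolding on_def by simp
  have "Im (cO n (of_nat (2 * n + 1))) = 0"
    using sums_unique2[OF sums_Im[OF s]] by simp
  then show "cO n (of_nat (2 * n + 1)) = complex_of_real (on n)" unfolding on_def by (simp add: complex_eq_iff)
qed

lemma on_bound: "\<bar>on n\<bar> \<le> sgb n"
  using abs_Re_le_cmod[of "cO n (of_nat (2 * n + 1))"] cE_cO_bounds(2)[OF centre_Om, of n] unfolding on_def by linarith

text \<open>Two series are compared term by term: 2 jp h_k(b)^2 / (2k - 2n) for the sum in question,
  and the Hermite series of gt(b) = sin(\<theta>) h_n(b), where \<theta> is \<open>th n\<close>. The
  terms differ by O(mu_k^2 / |k-n|), which adds up to \<open>sgk n\<close>.\<close>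

lemma on_green: "\<bar>2 * jp n * on n - sin (th n) * hf n b\<bar> \<le> b ^ 3 * \<bar>hf n b\<bar> * lb * sgk n"
proof -
  let ?t = "\<lambda>k. 2 * jp n * (pO n k / (2 * real k - 2 * real n)) - gc n k * hf k b"
  let ?s = "\<lambda>k. b ^ 3 * \<bar>hf n b\<bar> * lb * (if k = n then 0 else 1 / (sqrt (real (k + 1)) * kd n k))"
  have s: "?t sums (2 * jp n * on n - sin (th n) * hf n b)"
    by (intro sums_diff sums_mult on_sums gc_sums)
  have "norm (suminf ?t) \<le> suminf ?s"
  proof (rule norm_suminf_le)
    show "summable ?s" by (intro summable_mult sgk_summable)
    fix k
    show "norm (?t k) \<le> ?s k"
    proof (cases "odd (k + n)")
      case True
      then have kn: "k \<noteq> n" by auto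
      have kd: "kd n k > 0" using kd_ge_1[OF kn] by simp
      have d0: "2 * real k - 2 * real n \<noteq> 0" using kn by simp
      have "?t k = - (((2 * real k - 2 * real n) * gc n k - 2 * jp n * hf k b) * hf k b / (2 * real k - 2 * real n))"
        using d0 True by (simp add: pO_def field_simps power2_eq_square)
      then have "norm (?t k) = \<bar>(2 * real k - 2 * real n) * gc n k - 2 * jp n * hf k b\<bar> * \<bar>hf k b\<bar> / (2 * kd n k)"
        by (simp only: real_norm_def abs_minus_cancel abs_divide abs_mult kd_diff)
      also have "\<dots> \<le> (2 * b ^ 3 * \<bar>hf n b\<bar> * mu k) * mu k / (2 * kd n k)"
        using cf_gt_opposite_parity[OF True] hf_mu[of b k] b_pos mu_nonneg kd unfolding gc_def[symmetric]
        by (intro divide_right_mono mult_mono) auto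
      also have "\<dots> = b ^ 3 * \<bar>hf n b\<bar> * (mu k * mu k) / kd n k" by simp
      finally show ?thesis unfolding mu_sq using kn by simp
    next
      case False
      then have "?t k = 0" unfolding gc_def by (simp add: cf_gt_same_parity pO_def)
      moreover have "0 \<le> ?s k" using b_pos lb by (auto simp: kd_def)
      ultimately show ?thesis by simp
    qed
  qed
  also have "suminf ?s = b ^ 3 * \<bar>hf n b\<bar> * lb * sgk n"
    unfolding sgk_def by (rule suminf_mult[OF sgk_summable])
  finally show ?thesis unfolding sums_unique[OF s, symmetric] by simp
qed

lemma sgk_nonneg: "sgk n \<ge> 0"
  unfolding sgk_def by (intro suminf_nonneg sgk_summable) (auto simp: kd_def)

section \<open>Orders of magnitude\<close>

lemma mu_bigo: "mu \<in> O(\<lambda>n. real n powr (- 1 / 4))"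
proof -
  have "(\<lambda>n. sqrt (lb / sqrt (real (n + 1)))) \<in> O(\<lambda>n. real n powr (- 1 / 4))" using lb by real_asymp
  then show ?thesis unfolding mu_def[abs_def] .
qed

lemma hf_b_bigo: "(\<lambda>n. hf n b) \<in> O(\<lambda>n. real n powr (- 1 / 4))"
  by (rule landau_o.big_trans[OF landau_o.big_mono mu_bigo]) (use hf_mu[of b] b_pos mu_nonneg in auto)

lemma wkb_bigo: "(\<lambda>n. hf n b - rho n * cos (th n)) \<in> O(\<lambda>n. real n powr (- 3 / 4))"
proof -
  have "(\<lambda>n. hf n b - rho n * cos (th n)) \<in> O(\<lambda>n. mu n * (1 / kk n))"
    by (intro bigoI[of _ "b ^ 3"] always_eventually allI)
       (use wkb(1) in \<open>simp add: abs_mult abs_of_nonneg[OF mu_nonneg] abs_of_pos[OF kk(1)]\<close>)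
  also have "(\<lambda>n. mu n * (1 / kk n)) \<in> O(\<lambda>n. real n powr (- 1 / 4) * (1 / sqrt (2 * real n + 1)))"
    unfolding kk_def by (intro landau_o.big.mult mu_bigo) simp
  also have "(\<lambda>n. real n powr (- 1 / 4) * (1 / sqrt (2 * real n + 1))) \<in> O(\<lambda>n. real n powr (- 3 / 4))" by real_asymp
  finally show ?thesis .
qed

text \<open>With h_n(b) close to \<rho> cos \<theta> and h_n'(b)/k close to - \<rho> sin \<theta>,
  the two products in \<open>jp\<close> add up to k \<rho> (cos^2 + sin^2).\<close>

lemma jp_bigo: "(\<lambda>n. jp n - kk n * rho n) \<in> O(\<lambda>n. real n powr (- 1 / 4))"
proof (rule landau_o.big_trans[OF bigoI mu_bigo], rule always_eventually, rule allI)
  fix n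
  have k: "kk n > 0" by (rule kk)
  have sc: "(sin (th n))\<^sup>2 + (cos (th n))\<^sup>2 = 1" by simp
  have g: "k * (c * (h - r * c) - s * (d / k + r * s)) = h * k * c - s * d - k * r * (s\<^sup>2 + c\<^sup>2)" if "k \<noteq> 0" for k c h r s d :: real
    using that by (simp add: field_simps power2_eq_square)
  have "jp n - kk n * rho n = kk n * (cos (th n) * (hf n b - rho n * cos (th n)) - sin (th n) * (hfd n b / kk n + rho n * sin (th n)))"
    unfolding jp_def using k g[of "kk n"] sc by (simp only: mult_1_right)
  also have "\<bar>\<dots>\<bar> \<le> kk n * (b ^ 3 * mu n / kk n + b ^ 3 * mu n / kk n)"
  proof -
    have m: "\<bar>c * x\<bar> \<le> M" if "\<bar>c\<bar> \<le> 1" "\<bar>x\<bar> \<le> M" for c x M :: real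
      using mult_mono[of "\<bar>c\<bar>" 1 "\<bar>x\<bar>" M] that by (simp add: abs_mult)
    show ?thesis
      unfolding abs_mult[of "kk n"] abs_of_pos[OF k] using k
      by (intro mult_left_mono order_trans[OF abs_triangle_ineq4] add_mono m wkb) auto
  qed
  also have "\<dots> = 2 * b ^ 3 * mu n" using k by simp
  finally show "norm (jp n - kk n * rho n) \<le> 2 * b ^ 3 * norm (mu n)" using mu_nonneg[of n] by simp
qed

lemma sgk_bigo: "sgk \<in> O(\<lambda>n. ln (real n) * real n powr (- 1 / 2))"
proof -
  have "sgk \<in> O(\<lambda>n. 20 * ln (real (n + 2)) / sqrt (real (n + 1)))"
    by (intro landau_o.big_mono always_eventually allI) (metis sgk_le sgk_nonneg abs_of_nonneg order_trans abs_ge_self real_norm_def)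
  also have "(\<lambda>n. 20 * ln (real (n + 2)) / sqrt (real (n + 1))) \<in> O(\<lambda>n. ln (real n) * real n powr (- 1 / 2))" by real_asymp
  finally show ?thesis .
qed

lemma sgb_bigo: "sgb \<in> O(\<lambda>n. ln (real n) * real n powr (- 1 / 2))"
proof -
  have "(\<lambda>n. ln (real (n + 2)) / sqrt (real (n + 1))) \<in> O(\<lambda>n. ln (real n) * real n powr (- 1 / 2))" by real_asymp
  then show ?thesis unfolding sgb_def[abs_def] by (rule cmult_bigo)
qed

lemma on_bigo: "on \<in> O(\<lambda>n. ln (real n) * real n powr (- 1 / 2))"
  by (rule landau_o.big_trans[OF landau_o.big_mono sgb_bigo]) (use on_bound sgb(1) in auto)

lemma green_bigo: "(\<lambda>n. 2 * jp n * on n - sin (th n) * hf n b) \<in> O(\<lambda>n. ln (real n) * real n powr (- 3 / 4))"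
proof -
  have "(\<lambda>n. 2 * jp n * on n - sin (th n) * hf n b) \<in> O(\<lambda>n. hf n b * sgk n)"
    by (rule bigoI[of _ "b ^ 3 * lb"]) (use on_green sgk_nonneg in \<open>simp add: abs_mult mult_ac\<close>)
  also have "(\<lambda>n. hf n b * sgk n) \<in> O(\<lambda>n. real n powr (- 1 / 4) * (ln (real n) * real n powr (- 1 / 2)))"
    by (intro landau_o.big.mult hf_b_bigo sgk_bigo)
  also have "(\<lambda>n. real n powr (- 1 / 4) * (ln (real n) * real n powr (- 1 / 2))) \<in> O(\<lambda>n. ln (real n) * real n powr (- 3 / 4))" by real_asymp
  finally show ?thesis .
qed

lemma sin_th_bigo: "(\<lambda>n. sin (th n)) \<in> O(\<lambda>n. 1)" and cos_th_bigo: "(\<lambda>n. cos (th n)) \<in> O(\<lambda>n. 1)"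
  by (rule bigoI[of _ 1], simp)+

text \<open>Heuristically O(2n+1) = sin(\<theta>) h_n(b) / (2 jp), jp = k \<rho>, h_n(b) = \<rho>
  cos \<theta>, k \<rho>^2 = 2/pi and \<rho>^4 = 2/(pi^2 n). To avoid dividing by jp or \<rho>, the
  identity g multiplies the Green relation by \<rho> h_n(b)^2 and collects five errors, each O(log n
  / n^(3/2)).\<close>

lemma second_order_csin:
  "(\<lambda>n. 4 * (hf n b)\<^sup>2 * on n - 2 / pi * (1 / real n) * csin (th n)) \<in> O(\<lambda>n. ln (real n) * real n powr (- 3 / 2))"
proof -
  let ?a = "\<lambda>n. hf n b" and ?c = "\<lambda>n. cos (th n)" and ?s = "\<lambda>n. sin (th n)"
  let ?d = "\<lambda>n. hf n b - rho n * cos (th n)" and ?G = "\<lambda>n. 2 * jp n * on n - sin (th n) * hf n b"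
  let ?j = "\<lambda>n. jp n - kk n * rho n" and ?t = "\<lambda>n. kk n * (rho n)\<^sup>2 - 2 / pi" and ?e = "\<lambda>n. (rho n) ^ 4 - 2 / pi\<^sup>2 / real n"
  let ?T = "\<lambda>n. ln (real n) * real n powr (- 3 / 2)"
  let ?p = "\<lambda>n. real n powr (- 1 / 4)" and ?l = "\<lambda>n. ln (real n) * real n powr (- 1 / 2)"
  have 1: "(\<lambda>n. ?e n * (?c n * ?c n * ?c n * ?s n)) \<in> O(?T)"
  proof -
    have "(\<lambda>n. ?e n * (?c n * ?c n * ?c n * ?s n)) \<in> O(\<lambda>n. real n powr (- 2) * (1 * 1 * 1 * 1))"
      by (intro landau_o.big.mult rho_fourth_asymp sin_th_bigo cos_th_bigo)
    also have "(\<lambda>n. real n powr (- 2) * (1 * 1 * 1 * 1)) \<in> O(?T)" by real_asymp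
    finally show ?thesis .
  qed
  have 2: "(\<lambda>n. rho n * ?s n * ?d n * (?a n * ?a n + ?a n * (rho n * ?c n) + rho n * ?c n * (rho n * ?c n))) \<in> O(?T)"
  proof -
    have rc: "(\<lambda>n. rho n * ?c n) \<in> O(?p)" using landau_o.big.mult[OF rho_bigo cos_th_bigo] by simp
    have "(\<lambda>n. rho n * ?s n * ?d n * (?a n * ?a n + ?a n * (rho n * ?c n) + rho n * ?c n * (rho n * ?c n))) \<in> O(\<lambda>n. ?p n * 1 * real n powr (- 3 / 4) * (?p n * ?p n))"
      by (intro landau_o.big.mult sum_in_bigo rho_bigo sin_th_bigo wkb_bigo hf_b_bigo rc)
    also have "(\<lambda>n. ?p n * 1 * real n powr (- 3 / 4) * (?p n * ?p n)) \<in> O(?T)" by real_asymp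
    finally show ?thesis .
  qed
  have 3: "(\<lambda>n. rho n * (?a n * ?a n) * ?G n) \<in> O(?T)"
  proof -
    have "(\<lambda>n. rho n * (?a n * ?a n) * ?G n) \<in> O(\<lambda>n. ?p n * (?p n * ?p n) * (ln (real n) * real n powr (- 3 / 4)))"
      by (intro landau_o.big.mult rho_bigo hf_b_bigo green_bigo)
    also have "(\<lambda>n. ?p n * (?p n * ?p n) * (ln (real n) * real n powr (- 3 / 4))) \<in> O(?T)" by real_asymp
    finally show ?thesis .
  qed
  have 4: "(\<lambda>n. rho n * (?a n * ?a n) * on n * ?j n) \<in> O(?T)"
  proof -
    have "(\<lambda>n. rho n * (?a n * ?a n) * on n * ?j n) \<in> O(\<lambda>n. ?p n * (?p n * ?p n) * ?l n * ?p n)"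
      by (intro landau_o.big.mult rho_bigo hf_b_bigo on_bigo jp_bigo)
    also have "(\<lambda>n. ?p n * (?p n * ?p n) * ?l n * ?p n) \<in> O(?T)" by real_asymp
    finally show ?thesis .
  qed
  have 5: "(\<lambda>n. ?t n * (?a n * ?a n) * on n) \<in> O(?T)"
  proof -
    have "(\<lambda>n. ?t n * (?a n * ?a n) * on n) \<in> O(\<lambda>n. real n powr (- 1) * (?p n * ?p n) * ?l n)"
      by (intro landau_o.big.mult kk_rho_asymp hf_b_bigo on_bigo)
    also have "(\<lambda>n. real n powr (- 1) * (?p n * ?p n) * ?l n) \<in> O(?T)" by real_asymp
    finally show ?thesis .
  qed
  have g: "(r ^ 4 - q) * (c * c * c * s) + r * s * (a - r * c) * (a * a + a * (r * c) + r * c * (r * c))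
      + r * (a * a) * (2 * y * w - s * a) - 2 * (r * (a * a) * w * (y - k * r)) - 2 * ((k * r\<^sup>2 - p) * (a * a) * w)
    = 2 * p * (a * a) * w - q * (c * c * c * s)" for r q c s a y w k p :: real
    by algebra
  have e: "4 * (hf n b)\<^sup>2 * on n - 2 / pi * (1 / real n) * csin (th n)
    = pi * (?e n * (?c n * ?c n * ?c n * ?s n)
        + rho n * ?s n * ?d n * (?a n * ?a n + ?a n * (rho n * ?c n) + rho n * ?c n * (rho n * ?c n))
        + rho n * (?a n * ?a n) * ?G n - 2 * (rho n * (?a n * ?a n) * on n * ?j n) - 2 * (?t n * (?a n * ?a n) * on n))" for n
  proof -
    have "pi * (?e n * (?c n * ?c n * ?c n * ?s n)
        + rho n * ?s n * ?d n * (?a n * ?a n + ?a n * (rho n * ?c n) + rho n * ?c n * (rho n * ?c n))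
        + rho n * (?a n * ?a n) * ?G n - 2 * (rho n * (?a n * ?a n) * on n * ?j n) - 2 * (?t n * (?a n * ?a n) * on n))
      = pi * (2 * (2 / pi) * (?a n * ?a n) * on n - 2 / pi\<^sup>2 / real n * (?c n * ?c n * ?c n * ?s n))"
      unfolding g ..
    also have "\<dots> = 4 * (hf n b)\<^sup>2 * on n - 2 / pi * (1 / real n) * csin (th n)"
      unfolding csin_def by (simp add: right_diff_distrib power2_eq_square power3_eq_cube)
    finally show ?thesis by simp
  qed
  have "(\<lambda>n. ?e n * (?c n * ?c n * ?c n * ?s n)
        + rho n * ?s n * ?d n * (?a n * ?a n + ?a n * (rho n * ?c n) + rho n * ?c n * (rho n * ?c n))
        + rho n * (?a n * ?a n) * ?G n - 2 * (rho n * (?a n * ?a n) * on n * ?j n) - 2 * (?t n * (?a n * ?a n) * on n)) \<in> O(?T)"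
    by (intro sum_in_bigo cmult_bigo 1 2 3 4 5)
  then show ?thesis unfolding e by (rule cmult_bigo)
qed

text \<open>The phase has sqrt (2n+1) where \<open>kappa\<close> has sqrt (2n). They differ by
  O(n^(-1/2)), and \<open>csin\<close> is Lipschitz.\<close>

lemma second_order_kappa:
  "(\<lambda>n. 4 * (hf n b)\<^sup>2 * on n + kappa b n / real n) \<in> O(\<lambda>n. ln (real n) / real n powr (3 / 2))"
proof -
  let ?y = "\<lambda>n. b * sqrt (2 * real n) - real n * pi / 2"
  let ?T = "\<lambda>n. ln (real n) * real n powr (- 3 / 2)"
  have d: "(\<lambda>n. csin (th n) - csin (?y n)) \<in> O(\<lambda>n. real n powr (- 1 / 2))"
  proof -
    have "(\<lambda>n. csin (th n) - csin (?y n)) \<in> O(\<lambda>n. sqrt (2 * real n + 1) - sqrt (2 * real n))"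
    proof (rule bigoI[of _ b], rule always_eventually, rule allI)
      fix n
      have "\<bar>csin (th n) - csin (?y n)\<bar> \<le> \<bar>b * (sqrt (2 * real n + 1) - sqrt (2 * real n))\<bar>"
        using csin_lipschitz[of "th n" "?y n"] unfolding th_def kk_def by (simp add: algebra_simps)
      then show "norm (csin (th n) - csin (?y n)) \<le> b * norm (sqrt (2 * real n + 1) - sqrt (2 * real n))"
        using b_pos by (simp add: abs_mult)
    qed
    also have "(\<lambda>n. sqrt (2 * real n + 1) - sqrt (2 * real n)) \<in> O(\<lambda>n. real n powr (- 1 / 2))" by real_asymp
    finally show ?thesis .
  qed
  have "(\<lambda>n. 1 / real n * (csin (th n) - csin (?y n))) \<in> O(\<lambda>n. 1 / real n * real n powr (- 1 / 2))"
    by (intro landau_o.big.mult d) simp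
  also have "(\<lambda>n. 1 / real n * real n powr (- 1 / 2)) \<in> O(?T)" by real_asymp
  finally have "(\<lambda>n. 2 / pi * (1 / real n * (csin (th n) - csin (?y n)))) \<in> O(?T)" by (rule cmult_bigo)
  from sum_in_bigo(1)[OF second_order_csin this]
  have "(\<lambda>n. 4 * (hf n b)\<^sup>2 * on n + kappa b n / real n) \<in> O(?T)"
    unfolding kappa_csin by (simp add: algebra_simps)
  also have "?T \<in> O(\<lambda>n. ln (real n) / real n powr (3 / 2))" by real_asymp
  finally show ?thesis .
qed

section \<open>Eigenvalue asymptotics and the half-plane of simple eigenvalues\<close>

lemma eigenvalue_at_iff: "eigenvalue_at (osc_op b s) n z \<longleftrightarrow> \<bar>Re z - (2 * real n + 1)\<bar> \<le> 1 \<and> chr s n z = 0"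
  unfolding eigenvalue_at_def using eigenvalue_iff[OF strip_Om, of z n s] by blast

text \<open>One step of the fixed point iteration from the centre, where psi is h_n(b)^2 O(2n+1).
  The error is a Lipschitz constant times the distance of z from the centre; 96 = 4 * 3 * 8.\<close>

lemma first_order_weak:
  assumes z: "z \<in> Om n" and D: "chr s n z = 0" and s: "weak_at s n"
  shows "cmod (z - (of_nat (2 * n + 1) - 4 * s\<^sup>2 * of_real ((hf n b)\<^sup>2 * on n))) \<le> 96 * (cmod s) ^ 4 * (sgb n) ^ 4"
proof -
  let ?z0 = "of_nat (2 * n + 1) :: complex"
  let ?w = "?z0 - z"
  have p0: "psi n ?z0 = of_real ((hf n b)\<^sup>2 * on n)"
    unfolding psi_def cO_centre by simp
  have w: "?w = 4 * s\<^sup>2 * psi n z" using D unfolding chr_psi by simp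
  have w7: "cmod ?w \<le> 1 / 7" by (rule zero_near_centre[OF z D s])
  have "cmod ?w = 4 * (cmod s)\<^sup>2 * cmod (psi n z)" unfolding w by (simp add: norm_mult norm_power)
  also have "\<dots> \<le> 4 * (cmod s)\<^sup>2 * ((sgb n)\<^sup>2 * (1 + cmod ?w))"
    by (intro mult_left_mono psi_bound z) auto
  also have "\<dots> \<le> 4 * (cmod s)\<^sup>2 * ((sgb n)\<^sup>2 * 2)"
    using w7 by (intro mult_left_mono) auto
  finally have w1: "cmod ?w \<le> 8 * (cmod s)\<^sup>2 * (sgb n)\<^sup>2" by simp
  have "cmod (psi n z - psi n ?z0) \<le> (sgb n)\<^sup>2 * (2 + cmod ?w + cmod (?z0 - ?z0)) * cmod (z - ?z0)"
    by (rule psi_lipschitz[OF z centre_Om])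
  also have "\<dots> \<le> (sgb n)\<^sup>2 * 3 * (8 * (cmod s)\<^sup>2 * (sgb n)\<^sup>2)"
    using w7 w1 by (intro mult_mono mult_left_mono) (auto simp: norm_minus_commute)
  finally have d: "cmod (psi n z - psi n ?z0) \<le> (sgb n)\<^sup>2 * 3 * (8 * (cmod s)\<^sup>2 * (sgb n)\<^sup>2)" .
  have e: "z - (?z0 - 4 * s\<^sup>2 * psi n ?z0) = - (4 * s\<^sup>2 * (psi n z - psi n ?z0))"
    using w by (simp add: algebra_simps)
  have "cmod (z - (?z0 - 4 * s\<^sup>2 * psi n ?z0)) = 4 * (cmod s)\<^sup>2 * cmod (psi n z - psi n ?z0)"
    unfolding e norm_minus_cancel by (simp add: norm_mult norm_power)
  also have "\<dots> \<le> 4 * (cmod s)\<^sup>2 * ((sgb n)\<^sup>2 * 3 * (8 * (cmod s)\<^sup>2 * (sgb n)\<^sup>2))"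
    by (intro mult_left_mono d) auto
  also have "\<dots> = 96 * (cmod s) ^ 4 * (sgb n) ^ 4"
    by (simp add: power2_eq_square power4_eq_xxxx)
  finally show ?thesis unfolding p0 .
qed

text \<open>For large n, \<open>first_order_weak\<close> and \<open>second_order_kappa\<close>
  combine. For each of the finitely many other n, \<open>chr_im_bound\<close> bounds the eigenvalues
  of the strip, and these bounds are absorbed into C, which may depend on s.\<close>

lemma eigenvalue_asymp:
  "\<exists>C. \<forall>n\<ge>2. \<forall>z. eigenvalue_at (osc_op b s) n z \<longrightarrow>
    cmod (z - (of_nat (2 * n + 1) + s\<^sup>2 * of_real (kappa b n / real n))) \<le> C * (ln (real n) / real n powr (3 / 2))"
proof -
  define T where "T n = ln (real n) / real n powr (3 / 2)" for n
  define E where "E n z = cmod (z - (of_nat (2 * n + 1) + s\<^sup>2 * of_real (kappa b n / real n)))" for n z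
  let ?k = "\<lambda>n. 4 * (hf n b)\<^sup>2 * on n + kappa b n / real n"
  \<comment> \<open>Positivity begins at n = 2, where ln n > 0; it permits the division by
    \<open>T n\<close> in the definition of \<open>C\<close>.\<close>
  have T0: "T n > 0" if "n \<ge> 2" for n unfolding T_def using that by simp
  have "(\<lambda>n. (sgb n) ^ 4) \<in> O(\<lambda>n. (ln (real n) * real n powr (- 1 / 2)) ^ 4)"
    by (intro landau_o.big_power sgb_bigo)
  also have "(\<lambda>n. (ln (real n) * real n powr (- 1 / 2)) ^ 4) \<in> O(T)"
    unfolding T_def[abs_def] by real_asymp
  finally have b1: "(\<lambda>n. 96 * (cmod s) ^ 4 * (sgb n) ^ 4) \<in> O(T)" by (rule cmult_bigo)
  have "(\<lambda>n. \<bar>?k n\<bar>) \<in> O(T)" using second_order_kappa unfolding T_def[abs_def] by simp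
  then have b2: "(\<lambda>n. (cmod s)\<^sup>2 * \<bar>?k n\<bar>) \<in> O(T)" by (rule cmult_bigo)
  obtain c where c: "c > 0" "\<forall>\<^sub>F n in sequentially. norm (96 * (cmod s) ^ 4 * (sgb n) ^ 4 + (cmod s)\<^sup>2 * \<bar>?k n\<bar>) \<le> c * norm (T n)"
    using landau_o.bigE[OF sum_in_bigo(1)[OF b1 b2]] by blast
  from eventually_conj[OF c(2) eventually_weak[of s]] obtain n1 where
    n1: "\<And>n. n \<ge> n1 \<Longrightarrow> norm (96 * (cmod s) ^ 4 * (sgb n) ^ 4 + (cmod s)\<^sup>2 * \<bar>?k n\<bar>) \<le> c * norm (T n) \<and> weak_at s n"
    unfolding eventually_sequentially by blast
  have large: "E n z \<le> c * T n" if n: "n \<ge> n1" "n \<ge> 2" and z: "eigenvalue_at (osc_op b s) n z" for n z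
  proof -
    have zo: "z \<in> Om n" "chr s n z = 0" using z strip_Om unfolding eigenvalue_at_iff by auto
    have "E n z \<le> cmod (z - (of_nat (2 * n + 1) - 4 * s\<^sup>2 * of_real ((hf n b)\<^sup>2 * on n))) + cmod (s\<^sup>2 * of_real (?k n))"
    proof -
      have "z - (of_nat (2 * n + 1) + s\<^sup>2 * of_real (kappa b n / real n))
        = (z - (of_nat (2 * n + 1) - 4 * s\<^sup>2 * of_real ((hf n b)\<^sup>2 * on n))) - s\<^sup>2 * of_real (?k n)"
        by (simp add: algebra_simps)
      then show ?thesis unfolding E_def by (simp only: norm_triangle_ineq4)
    qed
    also have "\<dots> \<le> 96 * (cmod s) ^ 4 * (sgb n) ^ 4 + (cmod s)\<^sup>2 * \<bar>?k n\<bar>"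
      using first_order_weak[OF zo] n1[OF n(1)] by (intro add_mono) (simp_all only: norm_mult norm_power norm_of_real)
    also have "\<dots> \<le> c * T n" using n1[OF n(1)] T0[OF n(2)] by (simp add: abs_le_iff)
    finally show ?thesis .
  qed
  have small: "\<exists>B. \<forall>z. eigenvalue_at (osc_op b s) n z \<longrightarrow> E n z \<le> B" for n
  proof -
    obtain Y where Y: "\<And>z. z \<in> Om n \<Longrightarrow> \<bar>Im z\<bar> \<ge> Y \<Longrightarrow> chr s n z \<noteq> 0" using chr_im_bound[of n s] by blast
    have "E n z \<le> (2 * real n + 2) + Y + cmod (of_nat (2 * n + 1) + s\<^sup>2 * of_real (kappa b n / real n))" if "eigenvalue_at (osc_op b s) n z" for z
    proof -
      have st: "\<bar>Re z - (2 * real n + 1)\<bar> \<le> 1" and D: "chr s n z = 0" using that unfolding eigenvalue_at_iff by auto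
      have "\<bar>Im z\<bar> < Y" using Y[OF strip_Om[OF st]] D by force
      moreover have "\<bar>Re z\<bar> \<le> 2 * real n + 2" using st by linarith
      ultimately have "cmod z \<le> (2 * real n + 2) + Y" using cmod_le[of z] by linarith
      then show ?thesis unfolding E_def using norm_triangle_ineq4[of z "of_nat (2 * n + 1) + s\<^sup>2 * of_real (kappa b n / real n)"] by linarith
    qed
    then show ?thesis by blast
  qed
  then obtain B where B: "\<And>n z. eigenvalue_at (osc_op b s) n z \<Longrightarrow> E n z \<le> B n" by metis
  define C where "C = c + (\<Sum>n\<in>{2..<n1}. \<bar>B n\<bar> / T n)"
  have S0: "(\<Sum>n\<in>{2..<n1}. \<bar>B n\<bar> / T n) \<ge> 0" using T0 by (intro sum_nonneg divide_nonneg_pos) auto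
  have "E n z \<le> C * T n" if n: "n \<ge> 2" and z: "eigenvalue_at (osc_op b s) n z" for n z
  proof (cases "n \<ge> n1")
    case True
    have "c * T n \<le> C * T n" unfolding C_def using S0 T0[OF n] by (intro mult_right_mono) auto
    then show ?thesis using large[OF True n z] by linarith
  next
    case False
    have "\<bar>B n\<bar> / T n \<le> (\<Sum>n\<in>{2..<n1}. \<bar>B n\<bar> / T n)"
      using False n T0 by (intro member_le_sum divide_nonneg_pos) auto
    then have "\<bar>B n\<bar> / T n \<le> C" unfolding C_def using c(1) by linarith
    then have "\<bar>B n\<bar> \<le> C * T n" using T0[OF n] by (simp add: pos_divide_le_eq)
    then show ?thesis using B[OF z] by linarith
  qed
  then show ?thesis unfolding E_def T_def by blast
qed

text \<open>Keeps log (e |s|) above a positive constant for |s| > 3/8.\<close>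

lemma exp_1_gt: "exp 1 > (8 / 3 :: real)"
proof -
  have "1 + 1 / 4 + (1 / 4)\<^sup>2 / 2 \<le> exp (1 / 4 :: real)" by (rule exp_lower_Taylor_quadratic) simp
  then have "(1 + 1 / 4 + (1 / 4)\<^sup>2 / 2) ^ 4 \<le> (exp (1 / 4 :: real)) ^ 4" by (intro power_mono) auto
  also have "\<dots> = exp 1" by (simp flip: exp_of_nat_mult)
  finally show ?thesis by (simp add: power2_eq_square power4_eq_xxxx)
qed

text \<open>Where \<open>ln (n + 2)\<close> is at most a multiple of \<open>ln (exp 1 * cmod s)\<close>, the lower bound on \<open>n\<close> gives the claim directly;
  otherwise \<open>cmod s\<close> is smaller than a power of \<open>n\<close>, and \<open>n\<close> only has to be large.\<close>

lemma Nstar_weak: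
  obtains D where "D > 0" "\<And>s n z. cmod s > 3 / 8 \<Longrightarrow> Re z > Nstar D s \<Longrightarrow> \<bar>Re z - (2 * real n + 1)\<bar> \<le> 1 \<Longrightarrow> weak_at s n"
proof -
  \<comment> \<open>Makes |s| \<open>sgb n\<close> at most 1/6, and 4/36 is below the 1/8 of
    \<open>weak_at\<close>.\<close>
  define e where "e = 1 / (6 * (80 * bnd))"
  have e: "e > 0" unfolding e_def using bnd(1) by simp
  \<comment> \<open>The exponent 1/4 is the reciprocal of the factor 4 in the case distinction
    below; being less than 1/2, it leaves a null sequence.\<close>
  have "(\<lambda>n. (real n + 2) powr (1 / 4) * ln (real n + 2) / sqrt (real n + 1)) \<longlonglongrightarrow> 0" by real_asymp
  then have "eventually (\<lambda>n. (real n + 2) powr (1 / 4) * ln (real n + 2) / sqrt (real n + 1) < e) sequentially"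
    using e by (rule order_tendstoD(2))
  then obtain m where m: "\<And>n. n \<ge> m \<Longrightarrow> (real n + 2) powr (1 / 4) * ln (real n + 2) / sqrt (real n + 1) < e"
    unfolding eventually_sequentially by blast
  define L0 where "L0 = ln (exp 1 * (3 / 8) :: real)"
  have L0: "L0 > 0" unfolding L0_def using exp_1_gt by simp
  \<comment> \<open>The first entry serves the case ln (n + 2) \<le> 4 L; the second forces n \<ge>
    m in the other case.\<close>
  define D where "D = max (6 / e) (sqrt (2 * (real m + 1)) / (3 / 8 * L0))"
  have D: "D > 0" unfolding D_def using e by (simp add: less_max_iff_disj)
  have "weak_at s n" if s: "cmod s > 3 / 8" and z: "Re z > Nstar D s" "\<bar>Re z - (2 * real n + 1)\<bar> \<le> 1" for s n z
  proof -
    define L where "L = ln (exp 1 * cmod s)"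
    have s0: "cmod s > 0" using s by linarith
    have L: "L \<ge> L0" unfolding L_def L0_def using s s0 by (subst ln_le_cancel_iff) auto
    have La: "L = 1 + ln (cmod s)" unfolding L_def using s0 by (simp add: ln_mult)
    have "Re z \<le> 2 * (real n + 1)" using z(2) unfolding abs_le_iff by (simp add: algebra_simps)
    from order.strict_trans2[OF z(1) this] have "(D * cmod s * L)\<^sup>2 < 2 * (real n + 1)" unfolding Nstar_def L_def .
    then have "sqrt ((D * cmod s * L)\<^sup>2) < sqrt (2 * (real n + 1))" by (rule real_sqrt_less_mono)
    moreover have "D * cmod s * L \<ge> 0" using D L L0 by auto
    ultimately have DL: "D * (cmod s * L) < sqrt (2 * (real n + 1))" by (simp add: mult.assoc)
    have q: "sqrt (real n + 1) > 0" by simp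
    have "cmod s * (ln (real n + 2) / sqrt (real n + 1)) \<le> e"
    proof (cases "ln (real n + 2) \<le> 4 * L")
      case True
      have "cmod s * L * (6 / e) \<le> cmod s * L * D" unfolding D_def using s0 L L0 by (intro mult_left_mono) auto
      also have "\<dots> < sqrt (2 * (real n + 1))" using DL by (simp add: mult_ac)
      also have "\<dots> \<le> 3 / 2 * sqrt (real n + 1)"
      proof -
        have "sqrt 2 \<le> 3 / 2" by (rule real_le_lsqrt) (auto simp: power2_eq_square)
        then show ?thesis unfolding real_sqrt_mult by (intro mult_right_mono) auto
      qed
      finally have "cmod s * (4 * L) < e * sqrt (real n + 1)" using e by (simp add: field_simps)
      moreover have "cmod s * ln (real n + 2) \<le> cmod s * (4 * L)" using True by (intro mult_left_mono) auto
      ultimately have "cmod s * ln (real n + 2) \<le> e * sqrt (real n + 1)" by linarith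
      then show ?thesis using q by (simp add: pos_divide_le_eq)
    next
      case False
      have "sqrt (2 * (real m + 1)) \<le> 3 / 8 * L0 * D"
      proof -
        have "sqrt (2 * (real m + 1)) / (3 / 8 * L0) \<le> D" unfolding D_def by simp
        then show ?thesis using L0 by (simp add: pos_divide_le_eq mult_ac)
      qed
      also have "\<dots> \<le> cmod s * L * D" using s L L0 D by (intro mult_right_mono mult_mono) auto
      also have "\<dots> < sqrt (2 * (real n + 1))" using DL by (simp add: mult_ac)
      finally have nm: "n \<ge> m" by simp
      have "4 * ln (cmod s) \<le> ln (real n + 2)" using False unfolding La by simp
      then have "ln (cmod s) \<le> 1 / 4 * ln (real n + 2)" by simp
      then have "exp (ln (cmod s)) \<le> exp (1 / 4 * ln (real n + 2))" by (simp only: exp_le_cancel_iff)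
      moreover have "(real n + 2) powr (1 / 4) = exp (1 / 4 * ln (real n + 2))" by (simp add: powr_def)
      ultimately have "cmod s \<le> (real n + 2) powr (1 / 4)" using s0 by (simp only: exp_ln)
      then have "cmod s * (ln (real n + 2) / sqrt (real n + 1)) \<le> (real n + 2) powr (1 / 4) * (ln (real n + 2) / sqrt (real n + 1))"
        by (intro mult_right_mono) auto
      then show ?thesis using m[OF nm] by simp
    qed
    then have "80 * bnd * (cmod s * (ln (real n + 2) / sqrt (real n + 1))) \<le> 80 * bnd * e"
      using bnd(1) by (intro mult_left_mono) auto
    then have "cmod s * sgb n \<le> 1 / 6" unfolding sgb_def e_def using bnd(1) by (simp add: mult_ac add.commute)
    then have "(cmod s * sgb n)\<^sup>2 \<le> (1 / 6)\<^sup>2" using sgb(1)[of n] by (intro power_mono) auto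
    then have "4 * (cmod s * sgb n)\<^sup>2 \<le> 4 * (1 / 6)\<^sup>2" by (rule mult_left_mono) simp
    also have "\<dots> \<le> (1 / 8 :: real)" by (simp add: power2_eq_square)
    finally show ?thesis unfolding weak_at_def power_mult_distrib mult.assoc .
  qed
  with D show ?thesis by (rule that)
qed

end

theorem theorem4p5:
  fixes b :: real
  assumes "b > 0"
  shows "\<exists>D>0. \<forall>s :: complex.
    discrete_spectrum (osc_op b s) \<and>
    (\<forall>z. eigenvalue (osc_op b s) z \<and> Re z > Nstar D s \<longrightarrow> simple_eigenvalue (osc_op b s) z) \<and>
    (\<exists>n0. \<forall>n\<ge>n0. \<exists>!z. eigenvalue_at (osc_op b s) n z) \<and>
    (\<exists>C :: real. \<forall>n\<ge>2. \<forall>z. eigenvalue_at (osc_op b s) n z \<and> Re z > Nstar D s \<longrightarrow>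
       cmod (z - (of_nat (2 * n + 1) + s\<^sup>2 * of_real (kappa b n / real n)))
         \<le> C * (ln (real n) / real n powr (3 / 2)))"
proof -
  interpret positive_point_interaction b by unfold_locales (rule assms)
  obtain D where D: "D > 0" "\<And>s n z. cmod s > 3 / 8 \<Longrightarrow> Re z > Nstar D s \<Longrightarrow> \<bar>Re z - (2 * real n + 1)\<bar> \<le> 1 \<Longrightarrow> weak_at s n"
    using Nstar_weak by blast
  show ?thesis
  proof (rule exI[of _ D], intro conjI allI D(1))
    fix s
    show "discrete_spectrum (osc_op b s)" by (rule osc_discrete_spectrum)
    show "eigenvalue (osc_op b s) z \<and> Re z > Nstar D s \<longrightarrow> simple_eigenvalue (osc_op b s) z" for z
    proof
      assume "eigenvalue (osc_op b s) z \<and> Re z > Nstar D s"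
      then have ev: "eigenvalue (osc_op b s) z" and N: "Re z > Nstar D s" by auto
      show "simple_eigenvalue (osc_op b s) z"
      proof (cases "cmod s \<le> 3 / 8")
        case True
        then show ?thesis by (rule small_coupling_simple[OF _ ev])
      next
        case False
        \<comment> \<open>\<open>Nstar\<close> is a square, so z lies in the right half-plane and
          hence in one of the numbered strips.\<close>
        have "Re z > 0" using N unfolding Nstar_def by (rule order.strict_trans1[rotated]) simp
        then obtain n where n: "z \<in> Om n" "\<bar>Re z - (2 * real n + 1)\<bar> \<le> 1" using Om_cover[of z] by blast
        have "weak_at s n" using D(2)[OF _ N n(2)] False by simp
        then have "order_at_most s n z 1" using order_1_weak[OF n(1)] ev eigenvalue_iff[OF n(1)] by blast
        then show ?thesis by (rule simple_eigenvalueI[OF n(1) ev])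
      qed
    qed
    show "\<exists>n0. \<forall>n\<ge>n0. \<exists>!z. eigenvalue_at (osc_op b s) n z"
      using eventually_weak[of s] unfolding eventually_sequentially eigenvalue_at_iff using unique_zero_weak by blast
    show "\<exists>C :: real. \<forall>n\<ge>2. \<forall>z. eigenvalue_at (osc_op b s) n z \<and> Re z > Nstar D s \<longrightarrow>
       cmod (z - (of_nat (2 * n + 1) + s\<^sup>2 * of_real (kappa b n / real n))) \<le> C * (ln (real n) / real n powr (3 / 2))"
      using eigenvalue_asymp[of s] by blast
  qed
qed

end
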